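(* Let $q\in(2,\frac{12}5]$ and $p\in(\frac{10}3,6)$, and let $a\in(0,\widetilde a_0)$ satisfy $$a<\Big(\frac{3}{4C_p^p}\Big)^{\frac1{2p\gamma_p+p-6}}\Big(\frac{4}{4\gamma_p-1}\Big)^{\frac{p\gamma_p-1}{2p\gamma_p+p-6}}\Bigg(\frac{1-\gamma_p}{C_{12/5}^{12/5}}\Bigg)^{\frac{p\gamma_p-2}{2p\gamma_p+p-6}}.$$ For $\mu>0$ with $a<\overline a_0(\mu)$, let $(\widehat\lambda_\mu,\widehat u_\mu)\in\mathbb R^+\times\mathcal H_r$ be the mountain pass type solution of $$-\Delta u+\lambda u+(|x|^{-1}\ast|u|^2)u=|u|^{p-2}u+\mu|u|^{q-2}u\ \text{ in }\mathbb R^3,\qquad \int_{\mathbb R^3}|u|^2dx=a^2 .$$ Then, in the sense of subsequences, $\widehat u_\mu\to\widehat u_0$ in $\mathcal H_r$ and $\widehat\lambda_\mu\to\widehat\lambda_0$ in $\mathbb R$ as $\mu\to0$, where $(\widehat\lambda_0,\widehat u_0)\in\mathbb R^+\times\mathcal H_r$ is a solution of $$-\Delta u+\lambda u+(|x|^{-1}\ast|u|^2)u=|u|^{p-2}u\ \text{ in }\mathbb R^3,\qquad \int_{\mathbb R^3}|u|^2dx=a^2 .$$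
   Context: $\mathbb R^+=(0,\infty)$; $\mathcal H=H^1(\mathbb R^3,\mathbb C)$; $\mathcal H_r$ its radial subspace; $|\cdot|_t$ the $L^t(\mathbb R^3)$ norm; $S_a=\{u\in\mathcal H:|u|_2=a\}$. $\gamma_t=\frac{3(t-2)}{2t}$ and, for $2<t<6$, $C_t$ is the sharp constant in $|u|_t\le C_t|u|_2^{1-\gamma_t}|\nabla u|_2^{\gamma_t}$, $u\in\mathcal H$. For $\mu>0$ define $$a_0=\Big(\frac1{2K}\Big)^{\frac{p\gamma_p-q\gamma_q}{\mathcal B}},\qquad \mathcal B=(q-q\gamma_q)(p\gamma_p-2)+(p-p\gamma_p)(2-q\gamma_q),$$ $$K=\Big(\frac{\mu C_q^q}{q}\Big)^{\frac{p\gamma_p-2}{p\gamma_p-q\gamma_q}}\Big[\frac{p(2-q\gamma_q)}{(p\gamma_p-2)C_p^p}\Big]^{\frac{q\gamma_q-2}{p\gamma_p-q\gamma_q}}+\Big(\frac p{C_p^p}\Big)^{\frac{q\gamma_q-2}{p\gamma_p-q\gamma_q}}\Big[\frac{\mu(2-q\gamma_q)C_q^q}{q(p\gamma_p-2)}\Big]^{\frac{p\gamma_p-2}{p\gamma_p-q\gamma_q}},$$ $$\overline a_0(\mu)=\min\Big\{a_0,\ \Big[\frac{p(2-q\gamma_q)}{2C_p^p(p\gamma_p-q\gamma_q)}\Big]^{\frac{2-q\gamma_q}{\mathcal B}}\Big[\frac{q(p\gamma_p-2)}{2\mu C_q^q(p\gamma_p-q\gamma_q)}\Big]^{\frac{p\gamma_p-2}{\mathcal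 B}}\Big\}.$$ The constant $\widetilde a_0>0$ is the threshold for the problem with $\mu=0$: it is such that the only weak solution $v\in\mathcal H$ of $-\Delta v+\lambda v+(|x|^{-1}\ast|v|^2)v=|v|^{p-2}v$ with $\lambda\le0$ and $|v|_2\le\widetilde a_0$ is $v=0$, and such that for every $a\in(0,\widetilde a_0)$ the problem with $\mu=0$ has a normalized solution in $\mathbb R^+\times\mathcal H_r$. For $\mu>0$ let $$\mathcal J_\mu(u)=\frac12\int|\nabla u|^2+\frac14\iint\frac{|u(x)|^2|u(y)|^2}{|x-y|}dxdy-\frac1p\int|u|^p-\frac{\mu}{q}\int|u|^q,$$ $(s\star u)(x)=e^{3s/2}u(e^sx)$, $\psi_u(s)=\mathcal J_\mu(s\star u)$, and $\mathcal P_{\mu,-,r}=\{u\in S_a\cap\mathcal H_r:\psi_u'(0)=0,\ \psi_u''(0)<0\}$. The mountain pass type solution $(\widehat\lambda_\mu,\widehat u_\mu)$ is a solution with $\widehat u_\mu>0$, $\widehat\lambda_\mu>0$ and $\mathcal J_\mu(\widehat u_\mu)=c_{a,\mu}:=\inf_{\mathcal P_{\mu,-,r}}\mathcal J_\mu$ (which equals the mountain pass level of $\mathcal J_\mu$ on $S_a\cap\mathcal H_r$). "In the sense of subsequences" means that every sequence $\mu_n\to0^+$ has a subsequence along which the convergences hold. *)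

theory Defs
  imports "HOL-Analysis.Analysis"
begin

type_synonym R3 = "real ^ 3"

section \<open>The Sobolev space and its radial subspace\<close>

definition pderiv_R3 :: "3 \<Rightarrow> (R3 \<Rightarrow> real) \<Rightarrow> R3 \<Rightarrow> real" where
  "pderiv_R3 i \<phi> x = frechet_derivative \<phi> (at x) (axis i 1)"

primrec C_k :: "nat \<Rightarrow> (R3 \<Rightarrow> real) \<Rightarrow> bool" where
  "C_k 0 \<phi> \<longleftrightarrow> continuous_on UNIV \<phi>"
| "C_k (Suc k) \<phi> \<longleftrightarrow> (\<forall>x. \<phi> differentiable (at x)) \<and> (\<forall>i. C_k k (pderiv_R3 i \<phi>))"

definition test_function :: "(R3 \<Rightarrow> real) \<Rightarrow> bool" where
  "test_function \<phi> \<longleftrightarrow> (\<forall>k. C_k k \<phi>) \<and> compact (closure {x. \<phi> x \<noteq> 0})"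

definition Lnorm :: "real \<Rightarrow> (R3 \<Rightarrow> 'a::real_normed_vector) \<Rightarrow> real" where
  "Lnorm t f = (\<integral>x. norm (f x) powr t \<partial>lborel) powr (1 / t)"

definition L2_fun :: "(R3 \<Rightarrow> 'a::euclidean_space) \<Rightarrow> bool" where
  "L2_fun f \<longleftrightarrow> f \<in> borel_measurable lborel \<and> integrable lborel (\<lambda>x. (norm (f x))\<^sup>2)"

definition is_weak_gradient :: "(R3 \<Rightarrow> complex) \<Rightarrow> (R3 \<Rightarrow> complex ^ 3) \<Rightarrow> bool" where
  "is_weak_gradient u g \<longleftrightarrow> L2_fun g \<and>
     (\<forall>\<phi>. test_function \<phi> \<longrightarrow> (\<forall>i.
        (\<integral>x. u x * complex_of_real (pderiv_R3 i \<phi> x) \<partial>lborel)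
        = - (\<integral>x. g x $ i * complex_of_real (\<phi> x) \<partial>lborel)))"

(* Elements are Borel representatives, not classes modulo null sets; every notion below is
   invariant under changing a representative on a null set. *)
definition H1 :: "(R3 \<Rightarrow> complex) set" where
  "H1 = {u. L2_fun u \<and> (\<exists>g. is_weak_gradient u g)}"

(* Weak gradients are unique up to null sets, so the choice is immaterial under integrals. *)
definition wgrad :: "(R3 \<Rightarrow> complex) \<Rightarrow> R3 \<Rightarrow> complex ^ 3" where
  "wgrad u = (SOME g. is_weak_gradient u g)"

definition H1_norm :: "(R3 \<Rightarrow> complex) \<Rightarrow> real" where
  "H1_norm u = sqrt ((\<integral>x. (norm (wgrad u x))\<^sup>2 \<partial>lborel) + (\<integral>x. (norm (u x))\<^sup>2 \<partial>lborel))"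

definition H1_rad :: "(R3 \<Rightarrow> complex) set" where
  "H1_rad = {u \<in> H1. \<forall>R. orthogonal_transformation R \<longrightarrow> (AE x in lborel. u (R x) = u x)}"

section \<open>Constants\<close>

definition gam :: "real \<Rightarrow> real" where
  "gam t = 3 * (t - 2) / (2 * t)"

definition C_GN :: "real \<Rightarrow> real" where
  "C_GN t = Inf {C. \<forall>u\<in>H1.
     Lnorm t u \<le> C * Lnorm 2 u powr (1 - gam t) * Lnorm 2 (wgrad u) powr gam t}"

definition B_const :: "real \<Rightarrow> real \<Rightarrow> real" where
  "B_const p q = (q - q * gam q) * (p * gam p - 2) + (p - p * gam p) * (2 - q * gam q)"

definition K_const :: "real \<Rightarrow> real \<Rightarrow> real \<Rightarrow> real" where
  "K_const p q \<mu> =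
     (\<mu> * C_GN q powr q / q) powr ((p * gam p - 2) / (p * gam p - q * gam q))
       * (p * (2 - q * gam q) / ((p * gam p - 2) * C_GN p powr p))
           powr ((q * gam q - 2) / (p * gam p - q * gam q))
   + (p / C_GN p powr p) powr ((q * gam q - 2) / (p * gam p - q * gam q))
       * (\<mu> * (2 - q * gam q) * C_GN q powr q / (q * (p * gam p - 2)))
           powr ((p * gam p - 2) / (p * gam p - q * gam q))"

definition a0 :: "real \<Rightarrow> real \<Rightarrow> real \<Rightarrow> real" where
  "a0 p q \<mu> = (1 / (2 * K_const p q \<mu>)) powr ((p * gam p - q * gam q) / B_const p q)"

definition a0_bar :: "real \<Rightarrow> real \<Rightarrow> real \<Rightarrow> real" where
  "a0_bar p q \<mu> = min (a0 p q \<mu>)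
     ((p * (2 - q * gam q) / (2 * C_GN p powr p * (p * gam p - q * gam q)))
         powr ((2 - q * gam q) / B_const p q)
      * (q * (p * gam p - 2) / (2 * \<mu> * C_GN q powr q * (p * gam p - q * gam q)))
         powr ((p * gam p - 2) / B_const p q))"

section \<open>The equations\<close>

(* The convolution of 1/|x| with |u|^2. *)
definition coulomb :: "(R3 \<Rightarrow> complex) \<Rightarrow> R3 \<Rightarrow> real" where
  "coulomb u x = (\<integral>y. (norm (u y))\<^sup>2 / norm (x - y) \<partial>lborel)"

(* u in H^1 solves  - Laplace u + lambda u + (1/|x| * |u|^2) u = f(u)  weakly, tested against H^1. *)
definition weak_solution :: "(complex \<Rightarrow> complex) \<Rightarrow> real \<Rightarrow> (R3 \<Rightarrow> complex) \<Rightarrow> bool" where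
  "weak_solution f lam u \<longleftrightarrow> u \<in> H1 \<and> (\<forall>\<phi>\<in>H1.
     (\<integral>x. (\<Sum>i\<in>UNIV. wgrad u x $ i * cnj (wgrad \<phi> x $ i)) \<partial>lborel)
     + complex_of_real lam * (\<integral>x. u x * cnj (\<phi> x) \<partial>lborel)
     + (\<integral>x. complex_of_real (coulomb u x) * u x * cnj (\<phi> x) \<partial>lborel)
     = (\<integral>x. f (u x) * cnj (\<phi> x) \<partial>lborel))"

definition pow_nl :: "real \<Rightarrow> complex \<Rightarrow> complex" where
  "pow_nl t z = complex_of_real (norm z powr (t - 2)) * z"

definition comb_nl :: "real \<Rightarrow> real \<Rightarrow> real \<Rightarrow> complex \<Rightarrow> complex" where
  "comb_nl p q \<mu> z = pow_nl p z + complex_of_real \<mu> * pow_nl q z"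

definition normalized_solution ::
  "(complex \<Rightarrow> complex) \<Rightarrow> real \<Rightarrow> real \<Rightarrow> (R3 \<Rightarrow> complex) \<Rightarrow> bool" where
  "normalized_solution f a lam u \<longleftrightarrow>
     weak_solution f lam u \<and> (\<integral>x. (norm (u x))\<^sup>2 \<partial>lborel) = a\<^sup>2"

(* t is an admissible value of the threshold for the problem with mu = 0. *)
definition limit_threshold :: "real \<Rightarrow> real \<Rightarrow> bool" where
  "limit_threshold p t \<longleftrightarrow> 0 < t
     \<and> (\<forall>lam v. lam \<le> 0 \<longrightarrow> weak_solution (pow_nl p) lam v \<longrightarrow> Lnorm 2 v \<le> t \<longrightarrow>
            (AE x in lborel. v x = 0))
     \<and> (\<forall>a. 0 < a \<and> a < t \<longrightarrow> (\<exists>lam>0. \<exists>v\<in>H1_rad. normalized_solution (pow_nl p) a lam v))"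

section \<open>The energy and mountain pass type solutions\<close>

definition energy :: "real \<Rightarrow> real \<Rightarrow> real \<Rightarrow> (R3 \<Rightarrow> complex) \<Rightarrow> real" where
  "energy p q \<mu> u =
     1 / 2 * (\<integral>x. (norm (wgrad u x))\<^sup>2 \<partial>lborel)
     + 1 / 4 * (\<integral>x. (\<integral>y. (norm (u x))\<^sup>2 * (norm (u y))\<^sup>2 / norm (x - y) \<partial>lborel) \<partial>lborel)
     - 1 / p * (\<integral>x. norm (u x) powr p \<partial>lborel)
     - \<mu> / q * (\<integral>x. norm (u x) powr q \<partial>lborel)"

definition dilate :: "real \<Rightarrow> (R3 \<Rightarrow> complex) \<Rightarrow> R3 \<Rightarrow> complex" where
  "dilate s u x = complex_of_real (exp (3 * s / 2)) * u (exp s *\<^sub>R x)"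

definition fiber :: "real \<Rightarrow> real \<Rightarrow> real \<Rightarrow> (R3 \<Rightarrow> complex) \<Rightarrow> real \<Rightarrow> real" where
  "fiber p q \<mu> u s = energy p q \<mu> (dilate s u)"

definition L2_sphere :: "real \<Rightarrow> (R3 \<Rightarrow> complex) set" where
  "L2_sphere a = {u \<in> H1. Lnorm 2 u = a}"

definition P_minus_rad :: "real \<Rightarrow> real \<Rightarrow> real \<Rightarrow> real \<Rightarrow> (R3 \<Rightarrow> complex) set" where
  "P_minus_rad p q \<mu> a = {u \<in> L2_sphere a \<inter> H1_rad.
     deriv (fiber p q \<mu> u) 0 = 0 \<and> deriv (deriv (fiber p q \<mu> u)) 0 < 0}"

definition mp_level :: "real \<Rightarrow> real \<Rightarrow> real \<Rightarrow> real \<Rightarrow> real" where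
  "mp_level p q \<mu> a = (INF u\<in>P_minus_rad p q \<mu> a. energy p q \<mu> u)"

definition mp_solution ::
  "real \<Rightarrow> real \<Rightarrow> real \<Rightarrow> real \<Rightarrow> real \<Rightarrow> (R3 \<Rightarrow> complex) \<Rightarrow> bool" where
  "mp_solution p q \<mu> a lam u \<longleftrightarrow>
     0 < lam \<and> u \<in> H1_rad \<and> normalized_solution (comb_nl p q \<mu>) a lam u
     \<and> (AE x in lborel. u x \<in> \<real> \<and> 0 < Re (u x))
     \<and> energy p q \<mu> u = mp_level p q \<mu> a"

end

(* The solutions satisfy a Pohozaev identity, which places them on the constraint P_minus, where the
   energy dominates the Dirichlet integral up to a term of order mu. Dilating one fixed radial
   function of mass a^2 (a solution of the limit problem) onto P_minus bounds the mountain pass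
   levels from above, and the Gagliardo-Nirenberg inequality bounds them away from 0, uniformly for
   small mu. Hence the Dirichlet integrals of the solutions are bounded above and away from 0, and
   the multipliers are bounded.

   Bounded radial sequences are relatively compact in L^t for 2 < t < 6. Testing the difference of
   two of the equations with the difference of the solutions then shows that the gradients are
   Cauchy in L^2, so the limit solves the equation with mu = 0 and a multiplier lam0 >= 0. If lam0
   were 0, the threshold property would force the limit to vanish, against the lower bound for the
   Dirichlet integrals; and if lam0 > 0 the same test also yields convergence in L^2. *)

theory Submission
  imports Defs "HOL-Complex_Analysis.Great_Picard" "HOL-Library.Diagonal_Subsequence"
begin

section \<open>Changes of variables\<close>

text \<open>The obstacle throughout is that only the weak formulation is at hand: elements of
  \<open>H1\<close> are Borel functions with a weak gradient picked by choice, and no regularity of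
  solutions is used. One device serves in place of density arguments: convolution with
  \<open>eta_j\<close>. Consecutive scales differ by a divergence, so
  \<open>moll j u - moll (Suc j) u\<close> is the weak gradient convolved with kernels whose L^1
  norm decays like 2^(-j) while their L^2 norm grows only like 2^(j/2). Interpolating the two bounds
  gives a geometric series in j exactly for exponents below 6. From this come the
  Gagliardo-Nirenberg inequality, the almost everywhere convergence of mollifications and, since
  mollified radial functions are equicontinuous and decay uniformly, the compactness in L^t.

  At the exponent 2 compactness fails, because mass can escape to infinity. Until the limit
  multiplier is known to be positive, every L^2 pairing therefore has to be handled through a factor
  that vanishes at infinity: a fixed test function or the limit Coulomb potential.\<close>

lemma nn_integral_affine:
  fixes f :: "'a::euclidean_space \<Rightarrow> ennreal"
  assumes [measurable]: "f \<in> borel_measurable borel" and c: "c \<noteq> 0"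
  shows "(\<integral>\<^sup>+x. f x \<partial>lborel) = ennreal (\<bar>c\<bar> ^ DIM('a)) * (\<integral>\<^sup>+x. f (t + c *\<^sub>R x) \<partial>lborel)"
  by (subst lborel_affine[OF c, of t])
     (simp add: nn_integral_density nn_integral_distr nn_integral_cmult)

lemma integrable_affine:
  fixes f :: "'a::euclidean_space \<Rightarrow> 'b :: {banach, second_countable_topology}"
  assumes f: "integrable lborel f" and c: "c \<noteq> 0"
  shows "integrable lborel (\<lambda>x. f (t + c *\<^sub>R x))"
proof -
  have [measurable]: "f \<in> borel_measurable borel" using f by auto
  have "(\<integral>\<^sup>+x. norm (f x) \<partial>lborel)
      = ennreal (\<bar>c\<bar> ^ DIM('a)) * (\<integral>\<^sup>+x. norm (f (t + c *\<^sub>R x)) \<partial>lborel)"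
    by (rule nn_integral_affine[OF _ c]) simp
  moreover have "(\<integral>\<^sup>+x. norm (f x) \<partial>lborel) < \<infinity>" using f by (simp add: integrable_iff_bounded)
  moreover have "ennreal (\<bar>c\<bar> ^ DIM('a)) \<noteq> 0" using c by simp
  ultimately have "(\<integral>\<^sup>+x. norm (f (t + c *\<^sub>R x)) \<partial>lborel) < \<infinity>"
    by (metis ennreal_mult_eq_top_iff infinity_ennreal_def top.not_eq_extremum)
  then show ?thesis by (simp add: integrable_iff_bounded)
qed

lemma integrable_affine_iff:
  fixes f :: "'a::euclidean_space \<Rightarrow> 'b :: {banach, second_countable_topology}"
  assumes c: "c \<noteq> 0"
  shows "integrable lborel (\<lambda>x. f (t + c *\<^sub>R x)) \<longleftrightarrow> integrable lborel f"
  using integrable_affine[of f c t] integrable_affine[of "\<lambda>x. f (t + c *\<^sub>R x)" "1/c" "-(1/c) *\<^sub>R t"] c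
  by (auto simp add: scaleR_add_right scaleR_diff_right)

lemma integral_affine:
  fixes f :: "'a::euclidean_space \<Rightarrow> 'b :: {banach, second_countable_topology}"
  assumes c: "c \<noteq> 0"
  shows "(\<integral>x. f (t + c *\<^sub>R x) \<partial>lborel) = (\<integral>x. f x \<partial>lborel) /\<^sub>R \<bar>c\<bar> ^ DIM('a)"
proof cases
  assume f[measurable]: "integrable lborel f"
  have "(\<integral>x. f x \<partial>lborel) = \<bar>c\<bar> ^ DIM('a) *\<^sub>R (\<integral>x. f (t + c *\<^sub>R x) \<partial>lborel)"
    using c f f[THEN borel_measurable_integrable] integrable_affine[OF f c, of t]
    by (subst lborel_affine[OF c, of t])
       (simp add: integral_density integral_distr)
  then show ?thesis using c by simp
next
  assume "\<not> integrable lborel f" with c show ?thesis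
    by (simp add: integrable_affine_iff not_integrable_integral_eq)
qed

lemma AE_affine:
  fixes P :: "'a::euclidean_space \<Rightarrow> bool"
  assumes P: "AE x in lborel. P x" and c: "c \<noteq> 0"
  shows "AE x in lborel. P (t + c *\<^sub>R x)"
proof -
  obtain N where N: "{x \<in> space lborel. \<not> P x} \<subseteq> N" "emeasure lborel N = 0" "N \<in> sets lborel"
    by (rule AE_E[OF P])
  have [measurable]: "N \<in> sets borel" using N by simp
  define M where "M = {x. t + c *\<^sub>R x \<in> N}"
  have [measurable]: "M \<in> sets borel" unfolding M_def by measurable
  have "(\<integral>\<^sup>+x. indicator N x \<partial>lborel)
      = ennreal (\<bar>c\<bar> ^ DIM('a)) * (\<integral>\<^sup>+x. indicator N (t + c *\<^sub>R x) \<partial>lborel)"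
    by (rule nn_integral_affine[OF _ c]) simp
  also have "(\<integral>\<^sup>+x. indicator N (t + c *\<^sub>R x) \<partial>lborel) = (\<integral>\<^sup>+x. indicator M x \<partial>(lborel::'a measure))"
    by (intro nn_integral_cong) (auto simp: M_def indicator_def)
  finally have "emeasure lborel M = 0" using N c by simp
  then have "M \<in> null_sets lborel" by (simp add: null_sets_def)
  then show ?thesis
    by (rule AE_I') (use N in \<open>auto simp: M_def\<close>)
qed

text \<open>Boxes determine Lebesgue measure, and the preimage of a box is its image under the
  inverse rotation, to which the invariance of Lebesgue measure under orthogonal maps
  applies.\<close>

lemma distr_orthogonal:
  fixes R :: "R3 \<Rightarrow> R3"
  assumes R: "orthogonal_transformation R"
  shows "distr lborel borel R = lborel"
proof (rule lborel_eqI[symmetric])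
  have cont: "continuous_on UNIV R"
    using R by (simp add: linear_continuous_on linear_linear orthogonal_transformation_linear)
  then have meas[measurable]: "R \<in> borel_measurable borel" by (rule borel_measurable_continuous_onI)
  fix l u :: "R3" assume le: "\<And>b. b \<in> Basis \<Longrightarrow> l \<bullet> b \<le> u \<bullet> b"
  define R' where "R' = inv R"
  have R': "orthogonal_transformation R'" unfolding R'_def using R by (rule orthogonal_transformation_inv)
  have im: "R -` box l u = R' ` box l u"
    using R unfolding R'_def by (simp add: bij_vimage_eq_inv_image orthogonal_transformation_bij)
  have bl: "box l u \<in> lmeasurable" by simp
  have ml: "R' ` box l u \<in> lmeasurable" using measurable_orthogonal_image[OF R' bl] .
  have mb: "R -` box l u \<in> sets borel" using meas by (metis borel_open measurable_sets_borel open_box)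
  have "emeasure (distr lborel borel R) (box l u) = emeasure lborel (R -` box l u)"
    by (subst emeasure_distr) auto
  also have "\<dots> = emeasure lebesgue (R' ` box l u)" using mb im by (simp)
  also have "\<dots> = measure lebesgue (R' ` box l u)" using ml
    by (simp add: emeasure_eq_measure2 fmeasurableD2)
  also have "\<dots> = measure lebesgue (box l u)" using measure_orthogonal_image[OF R' bl] by simp
  also have "\<dots> = ennreal (\<Prod>b\<in>Basis. (u - l) \<bullet> b)"
    using le by (simp add: measure_lborel_box_eq)
  finally show "emeasure (distr lborel borel R) (box l u) = (\<Prod>b\<in>Basis. (u - l) \<bullet> b)" .
qed simp

lemma integral_orthogonal:
  fixes f :: "R3 \<Rightarrow> 'b :: {banach, second_countable_topology}"
    and R :: "R3 \<Rightarrow> R3"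
  assumes R: "orthogonal_transformation R" and [measurable]: "f \<in> borel_measurable borel"
  shows "(\<integral>x. f (R x) \<partial>lborel) = (\<integral>x. f x \<partial>lborel)"
proof -
  have cont: "continuous_on UNIV R"
    using R by (simp add: linear_continuous_on linear_linear orthogonal_transformation_linear)
  then have meas[measurable]: "R \<in> borel_measurable borel" by (rule borel_measurable_continuous_onI)
  have "(\<integral>x. f x \<partial>lborel) = (\<integral>x. f x \<partial>distr lborel borel R)" by (simp add: distr_orthogonal[OF R])
  also have "\<dots> = (\<integral>x. f (R x) \<partial>lborel)" by (rule integral_distr) auto
  finally show ?thesis by simp
qed

lemma AE_orthogonal:
  fixes R :: "R3 \<Rightarrow> R3"
  assumes R: "orthogonal_transformation R" and P: "AE x in lborel. P x"
  shows "AE x in lborel. P (R x)"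
proof -
  have cont: "continuous_on UNIV R"
    using R by (simp add: linear_continuous_on linear_linear orthogonal_transformation_linear)
  then have meas[measurable]: "R \<in> borel_measurable borel" by (rule borel_measurable_continuous_onI)
  have "AE x in distr lborel borel R. P x" unfolding distr_orthogonal[OF R] by (rule P)
  then show ?thesis using AE_distrD[of R lborel borel P] by simp
qed

section \<open>Square integrable functions\<close>

definition mass :: "(R3 \<Rightarrow> 'a::real_normed_vector) \<Rightarrow> real" where
  "mass f = (\<integral>x. (norm (f x))\<^sup>2 \<partial>lborel)"

lemma mass_nonneg [simp]: "0 \<le> mass f"
  unfolding mass_def by (rule integral_nonneg_AE) simp

lemma L2_funI:
  "f \<in> borel_measurable borel \<Longrightarrow> integrable lborel (\<lambda>x. (norm (f x))\<^sup>2) \<Longrightarrow> L2_fun f"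
  by (simp add: L2_fun_def)

lemma L2_measurable: "L2_fun f \<Longrightarrow> f \<in> borel_measurable borel"
  by (simp add: L2_fun_def)

lemma L2_integrable: "L2_fun f \<Longrightarrow> integrable lborel (\<lambda>x. (norm (f x))\<^sup>2)"
  by (simp add: L2_fun_def)

lemma L2_bound:
  fixes f :: "R3 \<Rightarrow> 'a::euclidean_space" and g :: "R3 \<Rightarrow> real"
  assumes "f \<in> borel_measurable borel" "integrable lborel g" "\<And>x. (norm (f x))\<^sup>2 \<le> g x"
  shows "L2_fun f" "mass f \<le> (\<integral>x. g x \<partial>lborel)"
proof -
  note [measurable] = assms(1)
  have i: "integrable lborel (\<lambda>x. (norm (f x))\<^sup>2)"
    by (rule Bochner_Integration.integrable_bound[OF assms(2)])
       (measurable, use assms(3) in \<open>auto intro!: AE_I2 intro: order_trans[OF _ abs_ge_self]\<close>)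
  then show "L2_fun f" using assms(1) by (simp add: L2_fun_def)
  show "mass f \<le> (\<integral>x. g x \<partial>lborel)"
    unfolding mass_def using i assms by (intro integral_mono) auto
qed

lemma sq_sum_le: "(norm (a + b :: 'a::real_normed_vector))\<^sup>2 \<le> 2 * (norm a)\<^sup>2 + 2 * (norm b)\<^sup>2"
proof -
  have "(norm (a + b))\<^sup>2 \<le> (norm a + norm b)\<^sup>2" by (simp add: norm_triangle_ineq power_mono)
  also have "\<dots> \<le> 2 * (norm a)\<^sup>2 + 2 * (norm b)\<^sup>2"
    using sum_squares_ge_zero[of "norm a - norm b" 0] by (simp add: power2_eq_square algebra_simps)
  finally show ?thesis .
qed

lemma L2_add:
  fixes f g :: "R3 \<Rightarrow> 'a::euclidean_space"
  assumes "L2_fun f" "L2_fun g" shows "L2_fun (\<lambda>x. f x + g x)"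
    and mass_add_le: "mass (\<lambda>x. f x + g x) \<le> 2 * mass f + 2 * mass g"
proof -
  note [measurable] = L2_measurable[OF assms(1)] L2_measurable[OF assms(2)]
  have i: "integrable lborel (\<lambda>x. 2 * (norm (f x))\<^sup>2 + 2 * (norm (g x))\<^sup>2)"
    using assms by (auto simp: L2_fun_def)
  show "L2_fun (\<lambda>x. f x + g x)"
    by (rule L2_bound(1)[OF _ i]) (auto intro: sq_sum_le)
  have "mass (\<lambda>x. f x + g x) \<le> (\<integral>x. 2 * (norm (f x))\<^sup>2 + 2 * (norm (g x))\<^sup>2 \<partial>lborel)"
    by (rule L2_bound(2)[OF _ i]) (auto intro: sq_sum_le)
  also have "\<dots> = 2 * mass f + 2 * mass g" using assms by (simp add: mass_def L2_fun_def)
  finally show "mass (\<lambda>x. f x + g x) \<le> 2 * mass f + 2 * mass g" .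
qed

lemma L2_minus: "L2_fun f \<Longrightarrow> L2_fun (\<lambda>x. - f x)" 
  by (auto simp: L2_fun_def)

lemma mass_minus: "mass (\<lambda>x. - f x) = mass f" by (simp add: mass_def)

lemma L2_diff:
  fixes f g :: "R3 \<Rightarrow> 'a::euclidean_space"
  assumes "L2_fun f" "L2_fun g" shows "L2_fun (\<lambda>x. f x - g x)"
    and mass_diff_le: "mass (\<lambda>x. f x - g x) \<le> 2 * mass f + 2 * mass g"
  using L2_add[OF assms(1) L2_minus[OF assms(2)]] mass_add_le[OF assms(1) L2_minus[OF assms(2)]]
  by (simp_all add: mass_minus)

lemma L2_scaleR:
  fixes f :: "R3 \<Rightarrow> 'a::euclidean_space"
  assumes "L2_fun f" shows "L2_fun (\<lambda>x. c *\<^sub>R f x)" and mass_scaleR: "mass (\<lambda>x. c *\<^sub>R f x) = c\<^sup>2 * mass f"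
  using assms by (auto simp: L2_fun_def mass_def power_mult_distrib)

lemma L2_zero: "L2_fun (\<lambda>x. 0)" by (simp add: L2_fun_def)

lemma L2_sum:
  fixes f :: "'i \<Rightarrow> R3 \<Rightarrow> 'a::euclidean_space"
  assumes "\<And>i. i \<in> I \<Longrightarrow> L2_fun (f i)" shows "L2_fun (\<lambda>x. \<Sum>i\<in>I. f i x)"
  using assms by (induction I rule: infinite_finite_induct) (auto simp: L2_zero intro!: L2_add)

lemma Cauchy_Schwarz_L2:
  fixes f :: "R3 \<Rightarrow> 'a::euclidean_space" and g :: "R3 \<Rightarrow> 'b::euclidean_space"
  assumes "L2_fun f" "L2_fun g"
  shows "integrable lborel (\<lambda>x. norm (f x) * norm (g x))"
    and "(\<integral>x. norm (f x) * norm (g x) \<partial>lborel) \<le> sqrt (mass f) * sqrt (mass g)"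
proof -
  note [measurable] = L2_measurable[OF assms(1)] L2_measurable[OF assms(2)]
  have i: "integrable lborel (\<lambda>x. (norm (f x))\<^sup>2 + (norm (g x))\<^sup>2)"
    using assms by (auto simp: L2_fun_def)
  have *: "norm (f x) * norm (g x) \<le> (norm (f x))\<^sup>2 + (norm (g x))\<^sup>2" for x
    using sum_squares_bound[of "norm (f x)" "norm (g x)"] mult_nonneg_nonneg[OF norm_ge_zero norm_ge_zero, of "f x" "g x"]
    by linarith
  show int: "integrable lborel (\<lambda>x. norm (f x) * norm (g x))"
    by (rule Bochner_Integration.integrable_bound[OF i]) (use * in auto)
  have "(\<integral>\<^sup>+x. ennreal (norm (f x)) * ennreal (norm (g x)) \<partial>lborel)\<^sup>2
      \<le> (\<integral>\<^sup>+x. (ennreal (norm (f x)))\<^sup>2 \<partial>lborel) * (\<integral>\<^sup>+x. (ennreal (norm (g x)))\<^sup>2 \<partial>lborel)"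
    by (rule Cauchy_Schwarz_nn_integral) auto
  also have "\<dots> = ennreal (mass f) * ennreal (mass g)"
    using assms by (simp add: mass_def L2_fun_def nn_integral_eq_integral[symmetric] ennreal_power)
  also have "(\<integral>\<^sup>+x. ennreal (norm (f x)) * ennreal (norm (g x)) \<partial>lborel)
      = ennreal (\<integral>x. norm (f x) * norm (g x) \<partial>lborel)"
    using int by (simp add: nn_integral_eq_integral[symmetric] ennreal_mult)
  finally have "(\<integral>x. norm (f x) * norm (g x) \<partial>lborel)\<^sup>2 \<le> mass f * mass g"
    by (simp add: ennreal_power ennreal_mult[symmetric])
  then show "(\<integral>x. norm (f x) * norm (g x) \<partial>lborel) \<le> sqrt (mass f) * sqrt (mass g)"
    by (metis real_le_rsqrt real_sqrt_mult)
qed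

text \<open>The form in which Cauchy-Schwarz is applied below: integrability of a bilinear
  expression and its bound both come from one pointwise estimate.\<close>

lemma L2_dominated_product:
  fixes f :: "R3 \<Rightarrow> 'a::euclidean_space" and g :: "R3 \<Rightarrow> 'b::euclidean_space"
    and h :: "R3 \<Rightarrow> 'c::{banach,second_countable_topology}"
  assumes "L2_fun f" "L2_fun g" "h \<in> borel_measurable borel"
    and h: "\<And>x. norm (h x) \<le> C * (norm (f x) * norm (g x))" and C: "0 \<le> C"
  shows "integrable lborel h" "norm (\<integral>x. h x \<partial>lborel) \<le> C * (sqrt (mass f) * sqrt (mass g))"
    and "(\<integral>x. norm (h x) \<partial>lborel) \<le> C * (sqrt (mass f) * sqrt (mass g))"
proof -
  have i: "integrable lborel (\<lambda>x. C * (norm (f x) * norm (g x)))"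
    using Cauchy_Schwarz_L2(1)[OF assms(1,2)] by auto
  show ih: "integrable lborel h"
    by (rule Bochner_Integration.integrable_bound[OF i])
      (use assms in \<open>auto intro!: AE_I2 intro: order_trans[OF _ abs_ge_self]\<close>)
  have "norm (\<integral>x. h x \<partial>lborel) \<le> (\<integral>x. norm (h x) \<partial>lborel)" by simp
  moreover have "(\<integral>x. norm (h x) \<partial>lborel) \<le> (\<integral>x. C * (norm (f x) * norm (g x)) \<partial>lborel)"
    using ih i h by (intro integral_mono) auto
  moreover have "\<dots> \<le> C * (sqrt (mass f) * sqrt (mass g))"
    using Cauchy_Schwarz_L2(2)[OF assms(1,2)] C by (simp add: mult_left_mono)
  ultimately show "norm (\<integral>x. h x \<partial>lborel) \<le> C * (sqrt (mass f) * sqrt (mass g))"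
     "(\<integral>x. norm (h x) \<partial>lborel) \<le> C * (sqrt (mass f) * sqrt (mass g))" by linarith+
qed

lemma l2_triangle:
  fixes f g :: "R3 \<Rightarrow> 'a::euclidean_space"
  assumes "L2_fun f" "L2_fun g"
  shows "sqrt (mass (\<lambda>x. f x + g x)) \<le> sqrt (mass f) + sqrt (mass g)"
proof -
  note [measurable] = L2_measurable[OF assms(1)] L2_measurable[OF assms(2)]
  have "mass (\<lambda>x. f x + g x) \<le> (\<integral>x. (norm (f x))\<^sup>2 + (norm (g x))\<^sup>2 + 2 * (norm (f x) * norm (g x)) \<partial>lborel)"
    unfolding mass_def
  proof (rule integral_mono)
    show "integrable lborel (\<lambda>x. (norm (f x + g x))\<^sup>2)" using L2_add[OF assms] by (simp add: L2_fun_def)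
    show "integrable lborel (\<lambda>x. (norm (f x))\<^sup>2 + (norm (g x))\<^sup>2 + 2 * (norm (f x) * norm (g x)))"
      using assms Cauchy_Schwarz_L2(1)[OF assms] by (auto simp: L2_fun_def)
    show "(norm (f x + g x))\<^sup>2 \<le> (norm (f x))\<^sup>2 + (norm (g x))\<^sup>2 + 2 * (norm (f x) * norm (g x))" for x
      using power_mono[OF norm_triangle_ineq[of "f x" "g x"], of 2] by (simp add: power2_eq_square algebra_simps)
  qed
  also have "\<dots> = mass f + mass g + 2 * (\<integral>x. norm (f x) * norm (g x) \<partial>lborel)"
    using assms Cauchy_Schwarz_L2(1)[OF assms] by (simp add: L2_fun_def mass_def)
  also have "\<dots> \<le> mass f + mass g + 2 * (sqrt (mass f) * sqrt (mass g))"
    using Cauchy_Schwarz_L2(2)[OF assms] by simp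
  also have "\<dots> = (sqrt (mass f) + sqrt (mass g))\<^sup>2"
    by (simp add: power2_eq_square algebra_simps)
  finally show ?thesis by (rule real_le_lsqrt[rotated -1]) auto
qed

lemma mass_affine:
  fixes f :: "R3 \<Rightarrow> 'a::euclidean_space"
  assumes "c \<noteq> 0"
  shows "mass (\<lambda>x. f (t + c *\<^sub>R x)) = mass f / \<bar>c\<bar>^3"
  using integral_affine[OF assms, of "\<lambda>x. (norm (f x))\<^sup>2" t]
  by (simp add: mass_def divide_inverse mult.commute)

lemma L2_affine:
  fixes f :: "R3 \<Rightarrow> 'a::euclidean_space"
  assumes "c \<noteq> 0" "L2_fun f"
  shows "L2_fun (\<lambda>x. f (t + c *\<^sub>R x))"
  using integrable_affine[of "\<lambda>x. (norm (f x))\<^sup>2" c t] assms by (auto simp: L2_fun_def)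

lemma mass_cong_AE:
  assumes "AE x in lborel. f x = g x" "f \<in> borel_measurable borel" "g \<in> borel_measurable borel"
  shows "mass f = mass g"
  unfolding mass_def using assms by (intro integral_cong_AE) auto

lemma mass_eq_0:
  fixes f :: "R3 \<Rightarrow> 'a::euclidean_space"
  assumes "L2_fun f" "mass f = 0" shows "AE x in lborel. f x = 0"
  using assms integral_nonneg_eq_0_iff_AE[of lborel "\<lambda>x. (norm (f x))\<^sup>2"]
  by (simp add: mass_def L2_fun_def)

lemma L2_integrable_on_bounded:
  fixes f :: "R3 \<Rightarrow> 'a::euclidean_space"
  assumes "L2_fun f" "A \<in> sets borel" "emeasure lborel A < \<infinity>"
  shows "integrable lborel (\<lambda>x. indicator A x *\<^sub>R f x)"
proof -
  have "L2_fun (\<lambda>x. indicator A x :: real)"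
  proof (rule L2_funI)
    have "integrable lborel (\<lambda>x. indicator A x :: real)" using assms by simp
    moreover have "(\<lambda>x. (norm (indicator A x :: real))\<^sup>2) = (\<lambda>x::R3. indicator A x :: real)"
      by (auto simp: indicator_def)
    ultimately show "integrable lborel (\<lambda>x. (norm (indicator A x :: real))\<^sup>2)" by simp
  qed (use assms in auto)
  then show ?thesis
  proof (rule L2_dominated_product(1)[OF _ assms(1), where C=1])
    show "(\<lambda>x. indicator A x *\<^sub>R f x) \<in> borel_measurable borel"
      using assms L2_measurable[OF assms(1)] by auto
  qed auto
qed

section \<open>Test functions\<close>

lemma pderiv_R3I: "(f has_derivative D) (at x) \<Longrightarrow> pderiv_R3 i f x = D (axis i 1)"
  unfolding pderiv_R3_def using frechet_derivative_at by metis

lemma C_k_scale: "C_k k f \<Longrightarrow> C_k k (\<lambda>x. c * f x)"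
proof (induction k arbitrary: f)
  case (Suc k)
  then have d: "f differentiable (at x)" for x by simp
  have "pderiv_R3 i (\<lambda>x. c * f x) = (\<lambda>x. c * pderiv_R3 i f x)" for i
  proof
    fix x
    have "((\<lambda>x. c * f x) has_derivative (\<lambda>h. c * frechet_derivative f (at x) h)) (at x)"
      using frechet_derivative_works[THEN iffD1, OF d[of x]] by (rule has_derivative_mult_right)
    then show "pderiv_R3 i (\<lambda>x. c * f x) x = c * pderiv_R3 i f x"
      by (simp only: pderiv_R3I) (simp add: pderiv_R3_def)
  qed
  with Suc d show ?case by (auto intro: differentiable_mult)
qed (auto intro: continuous_intros)

lemma pderiv_affine:
  assumes d: "f differentiable (at (t + m *\<^sub>R x))"
  shows "pderiv_R3 i (\<lambda>y. f (t + m *\<^sub>R y)) x = m * pderiv_R3 i f (t + m *\<^sub>R x)"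
    and "(\<lambda>y. f (t + m *\<^sub>R y)) differentiable (at x)"
proof -
  let ?D = "frechet_derivative f (at (t + m *\<^sub>R x))"
  have D: "(f has_derivative ?D) (at (t + m *\<^sub>R x))"
    using frechet_derivative_works[THEN iffD1, OF d] .
  have "((\<lambda>y. t + m *\<^sub>R y) has_derivative (\<lambda>h. m *\<^sub>R h)) (at x)"
    by (auto intro!: derivative_eq_intros)
  from has_derivative_compose[OF this D]
  have c: "((\<lambda>y. f (t + m *\<^sub>R y)) has_derivative (\<lambda>h. ?D (m *\<^sub>R h))) (at x)" .
  have "?D (m *\<^sub>R axis i 1) = m *\<^sub>R ?D (axis i 1)"
    using has_derivative_linear[OF D] by (rule linear_cmul)
  then show "pderiv_R3 i (\<lambda>y. f (t + m *\<^sub>R y)) x = m * pderiv_R3 i f (t + m *\<^sub>R x)"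
    by (simp only: pderiv_R3I[OF c]) (simp add: pderiv_R3_def)
  show "(\<lambda>y. f (t + m *\<^sub>R y)) differentiable (at x)" using c by (auto simp: differentiable_def)
qed

lemma C_k_affine: "C_k k f \<Longrightarrow> C_k k (\<lambda>x. f (t + m *\<^sub>R x))"
proof (induction k arbitrary: f)
  case 0
  then have "continuous_on UNIV f" by simp
  then have "continuous_on UNIV (\<lambda>x. f (t + m *\<^sub>R x))"
    by (rule continuous_on_compose2) (auto intro!: continuous_intros)
  then show ?case by simp
next
  case (Suc k)
  then have d: "f differentiable (at x)" for x by simp
  have "pderiv_R3 i (\<lambda>x. f (t + m *\<^sub>R x)) = (\<lambda>x. m * pderiv_R3 i f (t + m *\<^sub>R x))" for i
    using pderiv_affine(1)[OF d] by auto
  with Suc pderiv_affine(2)[OF d] show ?case by (auto intro!: C_k_scale)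
qed

text \<open>Vanishing outside some ball is the form of compact support that can be checked under
  affine substitutions and used in estimates.\<close>

lemma test_function_alt:
  "test_function \<phi> \<longleftrightarrow> (\<forall>k. C_k k \<phi>) \<and> (\<exists>\<rho>. \<forall>x. \<rho> < norm x \<longrightarrow> \<phi> x = 0)"
proof -
  have "compact (closure {x. \<phi> x \<noteq> 0}) \<longleftrightarrow> bounded {x. \<phi> x \<noteq> 0}"
    by (auto simp: compact_closure)
  also have "\<dots> \<longleftrightarrow> (\<exists>\<rho>. \<forall>x. \<rho> < norm x \<longrightarrow> \<phi> x = 0)"
    unfolding bounded_iff by (metis (mono_tags, lifting) mem_Collect_eq not_le)
  finally show ?thesis by (simp add: test_function_def)
qed

lemma test_function_scale: "test_function f \<Longrightarrow> test_function (\<lambda>x. c * f x)"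
  unfolding test_function_alt by (metis C_k_scale mult_zero_right)

lemma test_function_affine:
  assumes "test_function f" "m \<noteq> 0" shows "test_function (\<lambda>x. f (t + m *\<^sub>R x))"
proof -
  obtain \<rho> where r: "\<And>x. \<rho> < norm x \<Longrightarrow> f x = 0" using assms by (auto simp: test_function_alt)
  have "f (t + m *\<^sub>R x) = 0" if "(norm t + \<rho>) / \<bar>m\<bar> < norm x" for x
  proof (rule r)
    have "norm t + \<rho> < \<bar>m\<bar> * norm x" using that assms by (simp add: field_simps)
    also have "\<dots> = norm (m *\<^sub>R x)" by simp
    also have "\<dots> \<le> norm t + norm (t + m *\<^sub>R x)" 
      using norm_triangle_ineq4[of "t + m *\<^sub>R x" t] by simp
    finally show "\<rho> < norm (t + m *\<^sub>R x)" by simp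
  qed
  then show ?thesis using assms by (auto simp: test_function_alt intro: C_k_affine)
qed

lemma test_function_reflect: "test_function f \<Longrightarrow> test_function (\<lambda>y. f (x - y))"
  using test_function_affine[of f "-1" x] by simp

lemma test_function_continuous: "test_function f \<Longrightarrow> continuous_on UNIV f"
  unfolding test_function_def by (metis C_k.simps(1))

lemma test_function_differentiable: "test_function f \<Longrightarrow> f differentiable (at x)"
  unfolding test_function_def by (metis C_k.simps(2))

lemma pderiv_continuous: "test_function f \<Longrightarrow> continuous_on UNIV (pderiv_R3 i f)"
  unfolding test_function_def by (metis C_k.simps)

lemma pderiv_reflect:
  assumes "test_function f"
  shows "pderiv_R3 i (\<lambda>y. f (x - y)) y = - pderiv_R3 i f (x - y)"
  using pderiv_affine(1)[of f x "-1" y i] test_function_differentiable[OF assms] by simp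

lemma pderiv_compact_support:
  assumes "test_function f" obtains \<rho> where "\<And>x. \<rho> < norm x \<Longrightarrow> pderiv_R3 i f x = 0"
proof -
  obtain \<rho> where r: "\<And>x. \<rho> < norm x \<Longrightarrow> f x = 0" using assms by (auto simp: test_function_alt)
  have "pderiv_R3 i f x = 0" if "\<rho> < norm x" for x
  proof -
    have "open {x::R3. \<rho> < norm x}" by (intro open_Collect_less continuous_intros)
    with that have "(f has_derivative (\<lambda>h. 0)) (at x)"
      using has_derivative_transform_within_open[of "\<lambda>x. 0" "\<lambda>h. 0" x UNIV "{x::R3. \<rho> < norm x}" f] r by auto
    then show ?thesis by (simp add: pderiv_R3I)
  qed
  with that show ?thesis by blast
qed

subsection \<open>Smooth functions of one variable\<close>

text \<open>One-variable counterpart of \<open>C_k\<close>. The derivative is existentially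
  quantified, so closure under sums, products and inverses is an induction that only has to exhibit
  a derivative.\<close>

primrec Dk :: "nat \<Rightarrow> (real \<Rightarrow> real) \<Rightarrow> bool" where
  "Dk 0 f \<longleftrightarrow> continuous_on UNIV f"
| "Dk (Suc n) f \<longleftrightarrow> (\<exists>f'. (\<forall>x. (f has_real_derivative f' x) (at x)) \<and> Dk n f')"

lemma Dk_const: "Dk n (\<lambda>x. c)"
  by (induction n arbitrary: c) (auto intro!: exI[of _ "\<lambda>x. 0"])

lemma Dk_cont: "Dk n f \<Longrightarrow> continuous_on UNIV f"
  by (cases n) (auto intro!: continuous_at_imp_continuous_on intro: DERIV_isCont)

lemma Dk_Suc: "Dk (Suc n) f \<Longrightarrow> Dk n f"
proof (induction n arbitrary: f)
  case 0 then show ?case using Dk_cont[OF 0] by simp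
next
  case (Suc n)
  then obtain f' where "\<forall>x. (f has_real_derivative f' x) (at x)" "Dk (Suc n) f'" by auto
  then show ?case using Suc.IH by auto
qed

lemma Dk_add: "Dk n f \<Longrightarrow> Dk n g \<Longrightarrow> Dk n (\<lambda>x. f x + g x)"
proof (induction n arbitrary: f g)
  case (Suc n)
  then obtain f' g' where "\<forall>x. (f has_real_derivative f' x) (at x)" "Dk n f'"
    "\<forall>x. (g has_real_derivative g' x) (at x)" "Dk n g'" by auto
  then show ?case using Suc.IH[of f' g'] 
    by (auto intro!: exI[of _ "\<lambda>x. f' x + g' x"] derivative_eq_intros)
qed (auto intro: continuous_intros)

lemma Dk_mult: "Dk n f \<Longrightarrow> Dk n g \<Longrightarrow> Dk n (\<lambda>x. f x * g x)"
proof (induction n arbitrary: f g)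
  case (Suc n)
  then obtain f' g' where d: "\<forall>x. (f has_real_derivative f' x) (at x)" "Dk n f'"
    "\<forall>x. (g has_real_derivative g' x) (at x)" "Dk n g'" by auto
  have "Dk n (\<lambda>x. f' x * g x + f x * g' x)"
    using Dk_Suc[OF Suc.prems(1)] Dk_Suc[OF Suc.prems(2)] d by (intro Dk_add Suc.IH)
  then show ?case using d
    by (auto intro!: exI[of _ "\<lambda>x. f' x * g x + f x * g' x"] derivative_eq_intros)
qed (auto intro: continuous_intros)

lemma Dk_affine: "Dk n f \<Longrightarrow> Dk n (\<lambda>x. f (c + m * x))"
proof (induction n arbitrary: f)
  case 0 then show ?case 
    by (auto intro!: continuous_on_compose2[of UNIV f] continuous_intros)
next
  case (Suc n)
  then obtain f' where d: "\<And>x. (f has_real_derivative f' x) (at x)" "Dk n f'" by auto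
  have "((\<lambda>x. f (c + m * x)) has_real_derivative f' (c + m * x) * m) (at x)" for x
    by (rule DERIV_chain2[OF d(1)]) (auto intro!: derivative_eq_intros)
  then show ?case using Dk_mult[OF Suc.IH[OF d(2)] Dk_const[of n m]]
    by (auto intro!: exI[of _ "\<lambda>x. f' (c + m * x) * m"])
qed

text \<open>The derivative is written through \<open>inverse (f x)\<close> itself, which is of order
  \<open>n\<close> by the induction hypothesis.\<close>

lemma Dk_inverse: "Dk n f \<Longrightarrow> (\<And>x. f x \<noteq> 0) \<Longrightarrow> Dk n (\<lambda>x. inverse (f x))"
proof (induction n arbitrary: f)
  case (Suc n)
  then obtain f' where d: "\<And>x. (f has_real_derivative f' x) (at x)" "Dk n f'" by auto
  have i: "Dk n (\<lambda>x. inverse (f x))" using Dk_Suc[OF Suc.prems(1)] Suc.prems(2) by (rule Suc.IH)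
  have "\<forall>x. ((\<lambda>x. inverse (f x)) has_real_derivative (- 1 * f' x) * (inverse (f x) * inverse (f x))) (at x)"
    using Suc.prems d(1) by (auto intro!: derivative_eq_intros)
  moreover have "Dk n (\<lambda>x. (- 1 * f' x) * (inverse (f x) * inverse (f x)))"
    using d i by (intro Dk_mult Dk_const)
  ultimately show ?case unfolding Dk.simps by (intro exI[of _ "\<lambda>x. (- 1 * f' x) * (inverse (f x) * inverse (f x))"] conjI)
qed (auto intro: continuous_intros)

text \<open>For \<open>k = 0\<close> this is the classical smooth function that is flat at 0. The
  power \<open>k\<close> is carried along because the family is then closed under differentiation up
  to linear combinations.\<close>

definition flat :: "nat \<Rightarrow> real \<Rightarrow> real" where
  "flat k t = (if t \<le> 0 then 0 else exp (- (1 / t)) / t ^ k)"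

lemma flat_tendsto: "(flat k \<longlongrightarrow> 0) (at_right 0)"
proof -
  have "((\<lambda>x::real. x ^ k / exp x) \<longlongrightarrow> 0) at_top" by (rule tendsto_power_div_exp_0)
  moreover have "filterlim (\<lambda>t::real. inverse t) at_top (at_right 0)"
    by (rule filterlim_inverse_at_top_right)
  ultimately have "((\<lambda>t::real. inverse t ^ k / exp (inverse t)) \<longlongrightarrow> 0) (at_right 0)"
    by (rule filterlim_compose)
  moreover have "\<forall>\<^sub>F t in at_right 0. inverse t ^ k / exp (inverse t) = flat k t"
    unfolding eventually_at_right_field
    by (auto simp: flat_def exp_minus field_simps intro!: exI[of _ 1])
  ultimately show ?thesis by (rule Lim_transform_eventually)
qed

lemma flat_deriv: "(flat k has_real_derivative flat (k + 2) t - real k * flat (k + 1) t) (at t)"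
proof -
  consider "t < 0" | "t = 0" | "t > 0" by linarith
  then show ?thesis
  proof cases
    case 1
    have "(flat k has_real_derivative 0) (at t)"
      by (rule has_field_derivative_transform_within_open[of "\<lambda>x. 0" _ _ "{..<0}"]) (use 1 in \<open>auto simp: flat_def\<close>)
    then show ?thesis using 1 by (simp add: flat_def)
  next
    case 2
    \<comment> \<open>At 0 the difference quotient of \<open>flat k\<close> is
      \<open>flat (Suc k)\<close>, with the quotient at \<open>y = 0\<close> being 0 by convention;
      the derivative there is thus the limit 0.\<close>
    have q: "(\<lambda>y. (flat k y - flat k 0) / (y - 0)) = flat (Suc k)"
      by (auto simp: flat_def fun_eq_iff)
    have "(flat (Suc k) \<longlongrightarrow> 0) (at_left 0)"
    proof (rule Lim_transform_eventually[OF tendsto_const[of 0]])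
      show "\<forall>\<^sub>F x in at_left 0. 0 = flat (Suc k) x"
        unfolding eventually_at_left_field by (auto simp: flat_def intro!: exI[of _ "-1"])
    qed
    then have "(flat (Suc k) \<longlongrightarrow> 0) (at 0)" using flat_tendsto filterlim_split_at by blast
    then have "(flat k has_real_derivative 0) (at 0)"
      unfolding has_field_derivative_iff q .
    then show ?thesis using 2 by (simp add: flat_def)
  next
    case 3
    have "((\<lambda>t. exp (- (1 / t))) has_real_derivative exp (- (1 / t)) * (1 / t\<^sup>2)) (at t)"
      using 3 by (auto intro!: derivative_eq_intros simp: power2_eq_square)
    from DERIV_divide[OF this DERIV_pow[of k]]
    have "((\<lambda>t. exp (- (1 / t)) / t ^ k) has_real_derivative
        (exp (- (1 / t)) * (1 / t\<^sup>2) * t ^ k - exp (- (1 / t)) * (real k * t ^ (k - Suc 0))) / (t ^ k * t ^ k)) (at t)"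
      using 3 by simp
    moreover have "(exp (- (1 / t)) * (1 / t\<^sup>2) * t ^ k - exp (- (1 / t)) * (real k * t ^ (k - Suc 0))) / (t ^ k * t ^ k)
        = flat (k + 2) t - real k * flat (k + 1) t"
      using 3 by (cases k) (auto simp: flat_def field_simps power2_eq_square)
    ultimately have "((\<lambda>t. exp (- (1 / t)) / t ^ k) has_real_derivative flat (k + 2) t - real k * flat (k + 1) t) (at t)"
      by simp
    then show ?thesis
      by (rule has_field_derivative_transform_within_open[of _ _ _ "{0<..}"]) (use 3 in \<open>auto simp: flat_def\<close>)
  qed
qed

lemma Dk_flat: "Dk n (flat k)"
proof (induction n arbitrary: k)
  case 0 show ?case using flat_deriv by (auto intro!: continuous_at_imp_continuous_on DERIV_isCont)
next
  case (Suc n)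
  have "Dk n (\<lambda>t. flat (k + 2) t + (- real k) * flat (k + 1) t)"
    by (intro Dk_add Dk_mult Suc Dk_const)
  then show ?case using flat_deriv[of k] by (auto intro!: exI[of _ "\<lambda>t. flat (k + 2) t - real k * flat (k + 1) t"])
qed

text \<open>The quotient A / (A + B) of the flat functions at 1 + t and 1 - t rises from 0 to 1 on
  [-1, 1]. Its derivative \<theta> is the bump from which the mollifier is built; \<open>S\<close>
  is kept as the primitive through which differences of rescaled bumps become derivatives of
  compactly supported functions.\<close>

lemma smooth_step:
  obtains S \<theta> :: "real \<Rightarrow> real"
  where "\<And>n. Dk n S" "\<And>n. Dk n \<theta>" "\<And>t. (S has_real_derivative \<theta> t) (at t)"
    "\<And>t. t \<le> -1 \<Longrightarrow> S t = 0" "\<And>t. t \<ge> 1 \<Longrightarrow> S t = 1" "\<And>t. 0 \<le> \<theta> t" "\<exists>t. \<theta> t > 0"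
    "\<And>t. \<bar>t\<bar> > 1 \<Longrightarrow> \<theta> t = 0"
proof -
  define A where "A t = flat 0 (1 + 1 * t)" for t
  define B where "B t = flat 0 (1 + (-1) * t)" for t
  define A' where "A' t = flat 2 (1 + 1 * t)" for t
  define B' where "B' t = flat 2 (1 + (-1) * t)" for t
  define S where "S t = A t * inverse (A t + B t)" for t
  define \<theta> where "\<theta> t = (A' t * B t + A t * B' t) * (inverse (A t + B t) * inverse (A t + B t))" for t
  have pos: "A t + B t > 0" for t 
    by (auto simp: A_def B_def flat_def add_pos_nonneg add_nonneg_pos)
  have nz: "A t + B t \<noteq> 0" for t using pos[of t] by simp
  have DA: "Dk n A" "Dk n B" "Dk n A'" "Dk n B'" for n
    using Dk_affine[OF Dk_flat, of n _ 1 1] Dk_affine[OF Dk_flat, of n _ 1 "-1"] by (auto simp: A_def[abs_def] B_def[abs_def] A'_def[abs_def] B'_def[abs_def])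
  have Di: "Dk n (\<lambda>t. inverse (A t + B t))" for n
    using DA nz by (intro Dk_inverse Dk_add) auto
  have DS: "Dk n S" for n unfolding S_def[abs_def] using DA Di by (intro Dk_mult) auto
  have D\<theta>: "Dk n \<theta>" for n unfolding \<theta>_def[abs_def] using DA Di by (intro Dk_mult Dk_add) auto
  have dA: "(A has_real_derivative A' t) (at t)" for t
    unfolding A_def[abs_def] A'_def
    using DERIV_chain2[where f="flat 0" and g="\<lambda>t. 1 + 1 * t" and x=t and s=UNIV and Db=1, OF flat_deriv DERIV_add[OF DERIV_const DERIV_cmult[OF DERIV_ident], THEN DERIV_cong]]
    by (simp add: numeral_2_eq_2)
  have dB: "(B has_real_derivative - B' t) (at t)" for t
    unfolding B_def[abs_def] B'_def
    using DERIV_chain2[where f="flat 0" and g="\<lambda>t. 1 + (-1) * t" and x=t and s=UNIV and Db="-1", OF flat_deriv DERIV_add[OF DERIV_const DERIV_cmult[OF DERIV_ident], THEN DERIV_cong]]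
    by (simp add: numeral_2_eq_2)
  have dS: "(S has_real_derivative \<theta> t) (at t)" for t
    unfolding S_def[abs_def] \<theta>_def using nz[of t]
    by (auto intro!: derivative_eq_intros dA dB simp: field_simps)
  have S0: "t \<le> -1 \<Longrightarrow> S t = 0" for t by (simp add: S_def A_def flat_def)
  have S1: "t \<ge> 1 \<Longrightarrow> S t = 1" for t using nz[of t] by (simp add: S_def B_def flat_def)
  have nn: "0 \<le> \<theta> t" for t
    unfolding \<theta>_def A_def B_def A'_def B'_def flat_def by (auto intro!: mult_nonneg_nonneg add_nonneg_nonneg)
  have "\<exists>t. \<theta> t > 0"
  proof -
    obtain z where "S 1 - S (-1) = (1 - (-1)) * \<theta> z"
      using MVT2[of "-1" 1 S \<theta>] dS by auto
    then have "\<theta> z > 0" using S0[of "-1"] S1[of 1] by simp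
    then show ?thesis by blast
  qed
  moreover have "\<theta> t = 0" if "\<bar>t\<bar> > 1" for t
    using that by (auto simp: \<theta>_def A_def B_def A'_def B'_def flat_def)
  ultimately show thesis using that[OF DS D\<theta> dS S0 S1 nn] by auto
qed

subsection \<open>Tensor products and the kernels\<close>

text \<open>A partial derivative changes a single factor, so smoothness of such products reduces to
  one variable.\<close>

definition tensor :: "(3 \<Rightarrow> real \<Rightarrow> real) \<Rightarrow> R3 \<Rightarrow> real" where
  "tensor \<alpha> x = (\<Prod>i\<in>UNIV. \<alpha> i (x $ i))"

lemma pderiv_tensor:
  assumes d: "\<And>i t. (\<alpha> i has_real_derivative \<alpha>' i t) (at t)"
  shows "pderiv_R3 i (tensor \<alpha>) x = tensor (\<alpha>(i := \<alpha>' i)) x" "tensor \<alpha> differentiable (at x)"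
proof -
  have dj: "((\<lambda>x. \<alpha> j (x $ j)) has_derivative (\<lambda>h. \<alpha>' j (x $ j) * h $ j)) (at x)" for j
    using has_derivative_compose[of "\<lambda>x. x $ j" "\<lambda>h. h $ j" x UNIV "\<alpha> j" "\<lambda>h. \<alpha>' j (x $ j) * h"]
      d[of j "x $ j"] bounded_linear.has_derivative[OF bounded_linear_vec_nth has_derivative_ident]
    by (auto simp: has_field_derivative_def)
  have D: "(tensor \<alpha> has_derivative (\<lambda>h. \<Sum>j\<in>UNIV. \<alpha>' j (x $ j) * h $ j * (\<Prod>k\<in>UNIV - {j}. \<alpha> k (x $ k)))) (at x)"
    unfolding tensor_def[abs_def] using has_derivative_prod[of UNIV "\<lambda>j x. \<alpha> j (x $ j)" "\<lambda>j h. \<alpha>' j (x $ j) * h $ j" x UNIV] dj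
    by simp
  then show "tensor \<alpha> differentiable (at x)" by (auto simp: differentiable_def)
  have "pderiv_R3 i (tensor \<alpha>) x = (\<Sum>j\<in>UNIV. \<alpha>' j (x $ j) * axis i 1 $ j * (\<Prod>k\<in>UNIV - {j}. \<alpha> k (x $ k)))"
    by (rule pderiv_R3I[OF D])
  also have "\<dots> = (\<Sum>j\<in>UNIV. if j = i then \<alpha>' i (x $ i) * (\<Prod>k\<in>UNIV - {i}. \<alpha> k (x $ k)) else 0)"
    by (rule sum.cong) (auto simp: axis_def)
  also have "\<dots> = \<alpha>' i (x $ i) * (\<Prod>k\<in>UNIV - {i}. \<alpha> k (x $ k))" by simp
  also have "\<dots> = tensor (\<alpha>(i := \<alpha>' i)) x"
    unfolding tensor_def by (subst prod.remove[of UNIV i]) auto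
  finally show "pderiv_R3 i (tensor \<alpha>) x = tensor (\<alpha>(i := \<alpha>' i)) x" .
qed

lemma C_k_tensor: "(\<And>i n. Dk n (\<alpha> i)) \<Longrightarrow> C_k k (tensor \<alpha>)"
proof (induction k arbitrary: \<alpha>)
  case 0
  have "continuous_on UNIV (\<lambda>x. \<alpha> i (x $ i))" for i
    using continuous_on_compose2[OF Dk_cont[OF 0[of 0 i]], of UNIV "\<lambda>x. x $ i"]
    using continuous_on_component[OF continuous_on_id, of UNIV i] by simp
  then show ?case unfolding C_k.simps tensor_def[abs_def] by (intro continuous_on_prod) auto
next
  case (Suc k)
  \<comment> \<open>\<open>Dk (Suc n)\<close> yields a derivative for each \<open>n\<close>
    separately; uniqueness of derivatives makes these one function that is smooth of every
    order.\<close>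
  have ex: "\<exists>f'. (\<forall>x. (\<alpha> i has_real_derivative f' x) (at x)) \<and> (\<forall>n. Dk n f')" for i
  proof -
    have 1: "\<exists>f'. (\<forall>x. (\<alpha> i has_real_derivative f' x) (at x)) \<and> Dk n f'" for n
      using Suc.prems[of "Suc n" i] by simp
    then obtain f' where f': "\<forall>x. (\<alpha> i has_real_derivative f' x) (at x)" by blast
    have "Dk n f'" for n
    proof -
      obtain g where "\<forall>x. (\<alpha> i has_real_derivative g x) (at x)" "Dk n g" using 1 by blast
      moreover then have "g = f'" using f' DERIV_unique by blast
      ultimately show ?thesis by simp
    qed
    with f' show ?thesis by blast
  qed
  then obtain \<alpha>' where a: "\<And>i x. (\<alpha> i has_real_derivative \<alpha>' i x) (at x)" "\<And>i n. Dk n (\<alpha>' i)" by metis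
  have "C_k k (pderiv_R3 i (tensor \<alpha>))" for i
  proof -
    have "pderiv_R3 i (tensor \<alpha>) = tensor (\<alpha>(i := \<alpha>' i))" using pderiv_tensor(1)[OF a(1)] by auto
    then show ?thesis using Suc a by (auto intro!: Suc.IH)
  qed
  then show ?case using pderiv_tensor(2)[OF a(1)] by simp
qed

lemma test_function_tensor:
  assumes "\<And>i n. Dk n (\<alpha> i)" "\<And>i t. 1 < \<bar>t\<bar> \<Longrightarrow> \<alpha> i t = 0"
  shows "test_function (tensor \<alpha>)"
proof -
  \<comment> \<open>The support lies in the cube [-1, 1]^3, and the l1 bound on the norm places this
    cube in the ball of radius 3.\<close>
  have "tensor \<alpha> x = 0" if "3 < norm x" for x
  proof -
    have "norm x \<le> (\<Sum>i\<in>UNIV. \<bar>x $ i\<bar>)" by (rule norm_le_l1_cart)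
    then have "1 < \<bar>x $ 1\<bar> \<or> 1 < \<bar>x $ 2\<bar> \<or> 1 < \<bar>x $ 3\<bar>" using that unfolding sum_3 by linarith
    then have "\<exists>i. 1 < \<bar>x $ i\<bar>" by blast
    then show ?thesis unfolding tensor_def using assms(2) by (intro prod_zero) auto
  qed
  then show ?thesis using C_k_tensor[OF assms(1)] by (auto simp: test_function_alt)
qed

lemma test_function_integrable:
  assumes "test_function f"
  shows "integrable lborel f" "f \<in> borel_measurable borel" "L2_fun f" "integrable lborel (\<lambda>x. \<bar>f x\<bar>)"
    "bounded (range f)"
proof -
  have c: "continuous_on UNIV f" using assms by (rule test_function_continuous)
  then show m[measurable]: "f \<in> borel_measurable borel" by (rule borel_measurable_continuous_onI)
  obtain \<rho> where r: "\<And>x. \<rho> < norm x \<Longrightarrow> f x = 0" using assms by (auto simp: test_function_alt)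
  have "compact (f ` cball 0 \<rho>)" using c by (intro compact_continuous_image) (auto intro: continuous_on_subset)
  then obtain M where M: "\<And>x. x \<in> cball 0 \<rho> \<Longrightarrow> norm (f x) \<le> M"
    using compact_imp_bounded bounded_iff by (metis imageI)
  then have bd: "\<bar>f x\<bar> \<le> \<bar>M\<bar> * indicator (cball 0 \<rho>) x" for x
    using r[of x] by (cases "norm x \<le> \<rho>") (auto intro: order_trans[OF _ abs_ge_self] simp: not_le)
  have i: "integrable lborel (\<lambda>x::R3. \<bar>M\<bar> * indicator (cball 0 \<rho>) x :: real)" 
    by (intro integrable_mult_right integrable_real_indicator) (use emeasure_lborel_cball_finite[of "0::R3" \<rho>] in simp_all)
  show "integrable lborel f" "integrable lborel (\<lambda>x. \<bar>f x\<bar>)" 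
    by (rule Bochner_Integration.integrable_bound[OF i], use bd in auto)+
  have i2: "integrable lborel (\<lambda>x::R3. \<bar>M\<bar>^2 * indicator (cball 0 \<rho>) x :: real)" 
    by (intro integrable_mult_right integrable_real_indicator) (use emeasure_lborel_cball_finite[of "0::R3" \<rho>] in simp_all)
  show "L2_fun f"
  proof (rule L2_bound[OF m i2])
    fix x show "(norm (f x))\<^sup>2 \<le> \<bar>M\<bar>\<^sup>2 * indicator (cball 0 \<rho>) x"
      using power_mono[OF bd[of x], of 2] r[of x] by (cases "norm x \<le> \<rho>") (simp_all add: power_mult_distrib)
  qed
  show "bounded (range f)"
    using bd by (auto simp: bounded_iff intro!: exI[of _ "\<bar>M\<bar>"]) (metis abs_ge_zero indicator_simps mult.right_neutral mult_zero_right order_trans order_refl)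
qed

text \<open>The two dyadic scales of the mollifier differ by a divergence, so consecutive mollifications of a
  function are controlled by its weak gradient alone; summing over the scales gives the
  Gagliardo--Nirenberg and local compactness estimates without any density theorem.\<close>

lemma kernel_exists:
  "\<exists>(\<eta> :: R3 \<Rightarrow> real) \<Psi>. test_function \<eta> \<and> (\<forall>i. test_function (\<Psi> i)) \<and> (\<forall>x. 0 \<le> \<eta> x)
     \<and> (\<integral>x. \<eta> x \<partial>lborel) = 1 \<and> (\<forall>x. \<eta> x - 8 * \<eta> (2 *\<^sub>R x) = (\<Sum>i\<in>UNIV. pderiv_R3 i (\<Psi> i) x))"
proof -
  obtain S \<theta> :: "real \<Rightarrow> real" where S: "\<And>n. Dk n S" "\<And>n. Dk n \<theta>" "\<And>t. (S has_real_derivative \<theta> t) (at t)"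
    "\<And>t. t \<le> -1 \<Longrightarrow> S t = 0" "\<And>t. t \<ge> 1 \<Longrightarrow> S t = 1" "\<And>t. 0 \<le> \<theta> t" "\<exists>t. \<theta> t > 0"
    "\<And>t. \<bar>t\<bar> > 1 \<Longrightarrow> \<theta> t = 0" using smooth_step by blast
  define \<theta>2 where "\<theta>2 t = 2 * \<theta> (0 + 2 * t)" for t
  \<comment> \<open>A primitive of \<open>\<theta> - \<theta>2\<close>; it has compact support
    because the step and its rescaling agree outside [-1, 1].\<close>
  define \<Theta> where "\<Theta> t = S t + (-1) * S (0 + 2 * t)" for t
  have D: "Dk n \<theta>2" "Dk n \<Theta>" for n
    unfolding \<theta>2_def[abs_def] \<Theta>_def[abs_def] using S by (intro Dk_add Dk_mult Dk_const Dk_affine; simp)+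
  have d\<Theta>: "(\<Theta> has_real_derivative \<theta> t - \<theta>2 t) (at t)" for t
    unfolding \<Theta>_def[abs_def] \<theta>2_def
    using DERIV_chain2[where f=S and g="\<lambda>t. 0 + 2 * t" and x=t and s=UNIV and Db=2, OF S(3)] S(3)[of t]
    by (auto intro!: derivative_eq_intros)
  have s: "\<theta>2 t = 0" "\<Theta> t = 0" if "1 < \<bar>t\<bar>" for t
    using that S(4)[of t] S(4)[of "2*t"] S(5)[of t] S(5)[of "2*t"] S(8)[of "2 * t"] by (auto simp: \<theta>2_def \<Theta>_def abs_if split: if_splits)
  define \<eta> where "\<eta> = tensor (\<lambda>i. \<theta>)"
  \<comment> \<open>The product of three \<theta> is turned into the product of three \<theta>2 one
    factor at a time. The j-th potential has \<Theta> in the slot being changed, \<theta>2 in the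
    slots already changed and \<theta> in the others, so that the divergences telescope.\<close>
  define \<alpha> where "\<alpha> j = (\<lambda>i::3. if i = j then \<Theta> else if (j = 2 \<and> i = 1) \<or> (j = 3 \<and> i \<noteq> 3) then \<theta>2 else \<theta>)" for j
  have t\<eta>: "test_function \<eta>" unfolding \<eta>_def using S by (intro test_function_tensor) auto
  have t\<Psi>: "test_function (tensor (\<alpha> j))" for j 
    by (intro test_function_tensor) (auto simp: \<alpha>_def D S s)
  have dp: "pderiv_R3 j (tensor (\<alpha> j)) x = tensor ((\<alpha> j)(j := \<lambda>t. \<theta> t - \<theta>2 t)) x" for j x
  proof -
    have ex: "\<exists>f'. \<forall>t. (\<alpha> j i has_real_derivative f' t) (at t)" for i
    proof -
      have "Dk (Suc 0) (\<alpha> j i)" by (auto simp: \<alpha>_def D S simp del: Dk.simps)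
      then show ?thesis by auto
    qed
    then obtain \<alpha>' where a': "\<And>i t. (\<alpha> j i has_real_derivative \<alpha>' i t) (at t)" by metis
    have "\<alpha>' j t = \<theta> t - \<theta>2 t" for t using a'[of j t] d\<Theta>[of t] DERIV_unique by (auto simp: \<alpha>_def)
    then have "\<alpha>' j = (\<lambda>t. \<theta> t - \<theta>2 t)" by auto
    then show ?thesis using pderiv_tensor(1)[OF a', where i=j and x=x] by simp
  qed
  have tele: "\<eta> x - 8 * \<eta> (2 *\<^sub>R x) = (\<Sum>j\<in>UNIV. pderiv_R3 j (tensor (\<alpha> j)) x)" for x
  proof -
    have t3: "tensor \<beta> x = \<beta> 1 (x $ 1) * \<beta> 2 (x $ 2) * \<beta> 3 (x $ 3)" for \<beta> x
      unfolding tensor_def UNIV_3 by simp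
    have ne: "(1::3) \<noteq> 2" "(1::3) \<noteq> 3" "(2::3) \<noteq> 3" "(2::3) \<noteq> 1" "(3::3) \<noteq> 1" "(3::3) \<noteq> 2" by auto
    define a1 a2 a3 where "a1 = \<theta> (x $ 1)" "a2 = \<theta> (x $ 2)" "a3 = \<theta> (x $ 3)"
    define b1 b2 b3 where "b1 = \<theta>2 (x $ 1)" "b2 = \<theta>2 (x $ 2)" "b3 = \<theta>2 (x $ 3)"
    have b: "2 * \<theta> ((2 *\<^sub>R x) $ i) = \<theta>2 (x $ i)" for i by (simp add: \<theta>2_def)
    have "8 * \<eta> (2 *\<^sub>R x) = b1 * b2 * b3"
      unfolding \<eta>_def t3 b1_b2_b3_def b[symmetric] by simp
    moreover have "\<eta> x = a1 * a2 * a3" unfolding \<eta>_def t3 a1_a2_a3_def by simp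
    moreover have "(\<Sum>j\<in>UNIV. pderiv_R3 j (tensor (\<alpha> j)) x)
        = (a1 - b1) * a2 * a3 + b1 * (a2 - b2) * a3 + b1 * b2 * (a3 - b3)"
      unfolding dp unfolding sum_3 t3 fun_upd_apply \<alpha>_def a1_a2_a3_def b1_b2_b3_def using ne by simp
    ultimately show ?thesis by (simp add: algebra_simps)
  qed
  have nn: "0 \<le> \<eta> x" for x unfolding \<eta>_def tensor_def using S by (intro prod_nonneg) auto
  define c where "c = (\<integral>x. \<eta> x \<partial>lborel)"
  have "c \<ge> 0" unfolding c_def using nn by (intro integral_nonneg_AE) auto
  moreover have "c \<noteq> 0"
  proof
    assume "c = 0"
    then have ae: "AE x in lborel. \<eta> x = 0" 
      using integral_nonneg_eq_0_iff_AE[OF test_function_integrable(1)[OF t\<eta>]] nn by (auto simp: c_def)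
    obtain t where t: "\<theta> t > 0" using S by blast
    define U where "U = {x. \<eta> x > 0}"
    have "\<eta> (\<chi> i. t) > 0" using t unfolding \<eta>_def tensor_def by (intro prod_pos) auto
    then have "U \<noteq> {}" by (auto simp: U_def)
    moreover have "open U" unfolding U_def using test_function_continuous[OF t\<eta>]
      by (intro open_Collect_less) (auto)
    ultimately have "\<not> negligible U" by (metis open_not_negligible)
    then have "U \<notin> null_sets lborel" by (auto simp: negligible_iff_null_sets intro: null_sets_completionI)
    moreover have "U \<in> null_sets lborel"
    proof -
      have "AE x in lborel. x \<notin> U" using ae by eventually_elim (auto simp: U_def)
      then show ?thesis using \<open>open U\<close> by (subst AE_iff_null_sets) auto
    qed
    ultimately show False by auto
  qed
  ultimately have c: "c > 0" by simp
  have psc: "pderiv_R3 i (\<lambda>x. (1/c) * tensor (\<alpha> i) x) x = (1/c) * pderiv_R3 i (tensor (\<alpha> i)) x" for i x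
  proof -
    have "((\<lambda>x. (1/c) * tensor (\<alpha> i) x) has_derivative (\<lambda>h. (1/c) * frechet_derivative (tensor (\<alpha> i)) (at x) h)) (at x)"
      using frechet_derivative_works[THEN iffD1, OF test_function_differentiable[OF t\<Psi>]] by (rule has_derivative_mult_right)
    then show ?thesis by (simp only: pderiv_R3I) (simp add: pderiv_R3_def)
  qed
  show ?thesis
  proof (intro exI conjI allI)
    show "test_function (\<lambda>x. (1/c) * \<eta> x)" by (rule test_function_scale[OF t\<eta>])
    show "test_function (\<lambda>x. (1/c) * tensor (\<alpha> i) x)" for i by (rule test_function_scale[OF t\<Psi>])
    show "0 \<le> (1/c) * \<eta> x" for x using nn c by simp
    show "(\<integral>x. (1/c) * \<eta> x \<partial>lborel) = 1" using c by (simp add: c_def[symmetric])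
    show "1/c * \<eta> x - 8 * (1/c * \<eta> (2 *\<^sub>R x)) = (\<Sum>i\<in>UNIV. pderiv_R3 i (\<lambda>x. (1/c) * tensor (\<alpha> i) x) x)" for x
      unfolding psc sum_distrib_left[symmetric] tele[symmetric] by (simp add: algebra_simps)
  qed
qed

section \<open>Convolution\<close>

definition conv :: "(R3 \<Rightarrow> real) \<Rightarrow> (R3 \<Rightarrow> 'a::euclidean_space) \<Rightarrow> R3 \<Rightarrow> 'a" where
  "conv k f x = (\<integral>y. k (x - y) *\<^sub>R f y \<partial>lborel)"

lemma conv_measurable [measurable]:
  assumes [measurable]: "k \<in> borel_measurable borel" "f \<in> borel_measurable borel"
  shows "conv k f \<in> borel_measurable borel"
  unfolding conv_def by (rule sigma_finite_measure.borel_measurable_lebesgue_integral) (auto simp: lborel.sigma_finite_measure_axioms)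

lemma L2_reflect: "L2_fun k \<Longrightarrow> L2_fun (\<lambda>y. k (x - y))"
  using L2_affine[of "-1" k x] by simp

lemma mass_reflect: "mass (\<lambda>y. k (x - y)) = mass (k :: R3 \<Rightarrow> 'a::euclidean_space)"
  using mass_affine[of "-1" k x] by simp

lemma conv_sup:
  assumes "L2_fun k" "L2_fun f"
  shows "norm (conv k f x) \<le> sqrt (mass k) * sqrt (mass f)" "integrable lborel (\<lambda>y. k (x - y) *\<^sub>R f y)"
proof -
  note [measurable] = L2_measurable[OF assms(1)] L2_measurable[OF assms(2)]
  have "(\<lambda>y. k (x - y) *\<^sub>R f y) \<in> borel_measurable borel" by measurable
  from L2_dominated_product(1,2)[OF L2_reflect[OF assms(1), of x] assms(2) this, of 1]
  show "norm (conv k f x) \<le> sqrt (mass k) * sqrt (mass f)" "integrable lborel (\<lambda>y. k (x - y) *\<^sub>R f y)"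
    unfolding conv_def mass_reflect by auto
qed

text \<open>Young's inequality for a kernel in L^1: Cauchy-Schwarz after splitting |k| into two
  square roots, then Tonelli.\<close>

lemma conv_L2:
  assumes "L2_fun k" "integrable lborel k" "L2_fun f"
  shows "L2_fun (conv k f)" "mass (conv k f) \<le> (\<integral>x. \<bar>k x\<bar> \<partial>lborel)\<^sup>2 * mass f"
proof -
  note [measurable] = L2_measurable[OF assms(1)] L2_measurable[OF assms(3)]
  define K where "K = (\<integral>x. \<bar>k x\<bar> \<partial>lborel)"
  have K0: "0 \<le> K" unfolding K_def by (intro integral_nonneg_AE) auto
  have K1: "(\<integral>\<^sup>+y. ennreal \<bar>k y\<bar> \<partial>lborel) = ennreal K"
    unfolding K_def using assms(2) by (intro nn_integral_eq_integral) auto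
  have K2: "(\<integral>\<^sup>+y. ennreal \<bar>k (x - y)\<bar> \<partial>lborel) = ennreal K" for x
    using nn_integral_affine[of "\<lambda>y. ennreal \<bar>k y\<bar>" "-1" x] K1 by simp
  have K3: "(\<integral>\<^sup>+x. ennreal \<bar>k (x - y)\<bar> \<partial>lborel) = ennreal K" for y
    using nn_integral_affine[of "\<lambda>y. ennreal \<bar>k y\<bar>" "1" "-y"] K1 by simp
  have pt: "ennreal ((norm (conv k f x))\<^sup>2) \<le> ennreal K * (\<integral>\<^sup>+y. ennreal (\<bar>k (x - y)\<bar> * (norm (f y))\<^sup>2) \<partial>lborel)" for x
  proof -
    have "ennreal (norm (conv k f x)) \<le> (\<integral>\<^sup>+y. ennreal (norm (k (x - y) *\<^sub>R f y)) \<partial>lborel)"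
      unfolding conv_def by (rule integral_norm_bound_ennreal[OF conv_sup(2)[OF assms(1,3)]])
    also have "\<dots> = (\<integral>\<^sup>+y. ennreal (sqrt \<bar>k (x - y)\<bar>) * ennreal (sqrt \<bar>k (x - y)\<bar> * norm (f y)) \<partial>lborel)"
      by (intro nn_integral_cong) (simp add: ennreal_mult[symmetric] mult.assoc[symmetric])
    finally have "(ennreal (norm (conv k f x)))\<^sup>2 \<le> (\<integral>\<^sup>+y. ennreal (sqrt \<bar>k (x - y)\<bar>) * ennreal (sqrt \<bar>k (x - y)\<bar> * norm (f y)) \<partial>lborel)\<^sup>2"
      by (rule power_mono) simp
    then have "ennreal ((norm (conv k f x))\<^sup>2) \<le> (\<integral>\<^sup>+y. ennreal (sqrt \<bar>k (x - y)\<bar>) * ennreal (sqrt \<bar>k (x - y)\<bar> * norm (f y)) \<partial>lborel)\<^sup>2"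
      by (simp add: ennreal_power)
    also have "\<dots> \<le> (\<integral>\<^sup>+y. (ennreal (sqrt \<bar>k (x - y)\<bar>))\<^sup>2 \<partial>lborel) * (\<integral>\<^sup>+y. (ennreal (sqrt \<bar>k (x - y)\<bar> * norm (f y)))\<^sup>2 \<partial>lborel)"
      by (rule Cauchy_Schwarz_nn_integral) auto
    also have "\<dots> = ennreal K * (\<integral>\<^sup>+y. ennreal (\<bar>k (x - y)\<bar> * (norm (f y))\<^sup>2) \<partial>lborel)"
      by (simp add: ennreal_power power_mult_distrib K2)
    finally show ?thesis .
  qed
  have "(\<integral>\<^sup>+x. ennreal ((norm (conv k f x))\<^sup>2) \<partial>lborel)
      \<le> (\<integral>\<^sup>+x. ennreal K * (\<integral>\<^sup>+y. ennreal (\<bar>k (x - y)\<bar> * (norm (f y))\<^sup>2) \<partial>lborel) \<partial>lborel)"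
    by (intro nn_integral_mono) (rule pt)
  also have "\<dots> = ennreal K * (\<integral>\<^sup>+x. (\<integral>\<^sup>+y. ennreal (\<bar>k (x - y)\<bar> * (norm (f y))\<^sup>2) \<partial>lborel) \<partial>lborel)"
    by (rule nn_integral_cmult) measurable
  also have "(\<integral>\<^sup>+x. (\<integral>\<^sup>+y. ennreal (\<bar>k (x - y)\<bar> * (norm (f y))\<^sup>2) \<partial>lborel) \<partial>lborel)
      = (\<integral>\<^sup>+y. (\<integral>\<^sup>+x. ennreal (\<bar>k (x - y)\<bar> * (norm (f y))\<^sup>2) \<partial>lborel) \<partial>lborel)"
    by (rule lborel_pair.Fubini') measurable
  also have "\<dots> = (\<integral>\<^sup>+y. ennreal ((norm (f y))\<^sup>2) * ennreal K \<partial>lborel)"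
    by (intro nn_integral_cong) (simp add: ennreal_mult nn_integral_multc K3 mult.commute)
  also have "\<dots> = ennreal (mass f) * ennreal K"
    using L2_integrable[OF assms(3)] by (simp add: nn_integral_multc mass_def nn_integral_eq_integral)
  also have "ennreal K * (ennreal (mass f) * ennreal K) = ennreal (K\<^sup>2 * mass f)"
    using K0 by (simp add: ennreal_mult[symmetric] power2_eq_square ac_simps)
  finally have b: "(\<integral>\<^sup>+x. ennreal ((norm (conv k f x))\<^sup>2) \<partial>lborel) \<le> ennreal (K\<^sup>2 * mass f)" .
  then have i: "integrable lborel (\<lambda>x. (norm (conv k f x))\<^sup>2)"
    by (intro integrableI_bounded) (auto intro: le_less_trans)
  then show "L2_fun (conv k f)" by (intro L2_funI) auto
  have "ennreal (mass (conv k f)) \<le> ennreal (K\<^sup>2 * mass f)"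
    using b i by (simp add: mass_def nn_integral_eq_integral)
  then show "mass (conv k f) \<le> (\<integral>x. \<bar>k x\<bar> \<partial>lborel)\<^sup>2 * mass f"
    unfolding K_def[symmetric] using K0 by simp
qed

lemma conv_diff_left:
  assumes "L2_fun k" "L2_fun l" "L2_fun f"
  shows "conv (\<lambda>z. k z - l z) f x = conv k f x - conv l f x"
  unfolding conv_def using conv_sup(2)[OF assms(1,3)] conv_sup(2)[OF assms(2,3)]
  by (simp add: scaleR_diff_left)

lemma conv_diff_right:
  assumes "L2_fun k" "L2_fun f" "L2_fun g"
  shows "conv k (\<lambda>y. f y - g y) x = conv k f x - conv k g x"
  unfolding conv_def using conv_sup(2)[OF assms(1,2)] conv_sup(2)[OF assms(1,3)]
  by (simp add: scaleR_diff_right)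

lemma is_weak_gradient_L2: "is_weak_gradient u g \<Longrightarrow> L2_fun g"
  by (simp add: is_weak_gradient_def)

lemma L2_component:
  fixes g :: "R3 \<Rightarrow> complex ^ 3"
  assumes "L2_fun g" shows "L2_fun (\<lambda>x. g x $ i)" "mass (\<lambda>x. g x $ i) \<le> mass g"
proof -
  have m: "(\<lambda>x. g x $ i) \<in> borel_measurable borel"
    by (rule measurable_compose[OF L2_measurable[OF assms]], rule borel_measurable_continuous_onI)
      (rule continuous_on_component[OF continuous_on_id])
  have "(norm (g x $ i))\<^sup>2 \<le> (norm (g x))\<^sup>2" for x
    by (simp add: Finite_Cartesian_Product.norm_nth_le power_mono)
  from L2_bound[OF m L2_integrable[OF assms] this]
  show "L2_fun (\<lambda>x. g x $ i)" "mass (\<lambda>x. g x $ i) \<le> mass g" by (auto simp: mass_def)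
qed

text \<open>The weak gradient is tested against the reflected kernel; the sign from reflecting
  cancels the sign from integrating by parts.\<close>

lemma conv_weak_gradient:
  assumes "is_weak_gradient u g" "test_function \<Psi>"
  shows "conv (pderiv_R3 i \<Psi>) u x = conv \<Psi> (\<lambda>y. g y $ i) x"
proof -
  have "(\<integral>y. u y * complex_of_real (pderiv_R3 i (\<lambda>y. \<Psi> (x - y)) y) \<partial>lborel)
        = - (\<integral>y. g y $ i * complex_of_real (\<Psi> (x - y)) \<partial>lborel)"
    using assms test_function_reflect[OF assms(2), of x] unfolding is_weak_gradient_def by blast
  then show ?thesis
    by (simp add: pderiv_reflect[OF assms(2)] conv_def scaleR_conv_of_real mult.commute)
qed

section \<open>Mollification at dyadic scales\<close>

text \<open>One choice is fixed once and for all, so that every constant depending on the kernels is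
  the same for all functions.\<close>

definition kernels :: "(R3 \<Rightarrow> real) \<times> (3 \<Rightarrow> R3 \<Rightarrow> real)" where
  "kernels = (SOME (\<eta>, \<Psi>). test_function \<eta> \<and> (\<forall>i. test_function (\<Psi> i)) \<and> (\<forall>x. 0 \<le> \<eta> x)
     \<and> (\<integral>x. \<eta> x \<partial>lborel) = 1 \<and> (\<forall>x. \<eta> x - 8 * \<eta> (2 *\<^sub>R x) = (\<Sum>i\<in>UNIV. pderiv_R3 i (\<Psi> i) x)))"

abbreviation eta :: "R3 \<Rightarrow> real" where "eta \<equiv> fst kernels"
abbreviation Psi :: "3 \<Rightarrow> R3 \<Rightarrow> real" where "Psi \<equiv> snd kernels"

lemma
  shows test_eta: "test_function eta" and test_Psi: "test_function (Psi i)"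
    and eta_nonneg: "0 \<le> eta x" and integral_eta: "(\<integral>x. eta x \<partial>lborel) = 1"
    and eta_Psi: "eta x - 8 * eta (2 *\<^sub>R x) = (\<Sum>i\<in>UNIV. pderiv_R3 i (Psi i) x)"
proof -
  have "case kernels of (\<eta>, \<Psi>) \<Rightarrow> test_function \<eta> \<and> (\<forall>i. test_function (\<Psi> i)) \<and> (\<forall>x. 0 \<le> \<eta> x)
     \<and> (\<integral>x. \<eta> x \<partial>lborel) = 1 \<and> (\<forall>x. \<eta> x - 8 * \<eta> (2 *\<^sub>R x) = (\<Sum>i\<in>UNIV. pderiv_R3 i (\<Psi> i) x))"
    unfolding kernels_def by (rule someI_ex) (use kernel_exists in auto)
  then show "test_function eta" "test_function (Psi i)" "0 \<le> eta x" "(\<integral>x. eta x \<partial>lborel) = 1"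
    "eta x - 8 * eta (2 *\<^sub>R x) = (\<Sum>i\<in>UNIV. pderiv_R3 i (Psi i) x)"
    by (simp_all add: case_prod_beta)
qed

definition eta_j :: "nat \<Rightarrow> R3 \<Rightarrow> real" where "eta_j j y = 8 ^ j * eta (2 ^ j *\<^sub>R y)"
text \<open>The factor is 4^j rather than 8^j because differentiation contributes the remaining 2^j:
  the divergence of \<open>Psi_j j\<close> is \<open>eta_j j - eta_j (Suc j)\<close>.\<close>

definition Psi_j :: "nat \<Rightarrow> 3 \<Rightarrow> R3 \<Rightarrow> real" where "Psi_j j i y = 4 ^ j * Psi i (2 ^ j *\<^sub>R y)"

lemma test_eta_j: "test_function (eta_j j)"
  unfolding eta_j_def[abs_def] using test_function_scale[OF test_function_affine[OF test_eta, where m="2 ^ j" and t=0]] by simp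

lemma test_Psi_j: "test_function (Psi_j j i)"
  unfolding Psi_j_def[abs_def] using test_function_scale[OF test_function_affine[OF test_Psi, where m="2 ^ j" and t=0]] by simp

lemma pow28: "(2 ^ j) ^ 3 = (8 ^ j :: real)" 
proof -
  have "(2 ^ j) ^ 3 = ((2 ^ 3) ^ j :: real)" by (metis mult.commute power_mult)
  then show ?thesis by simp
qed

lemma integral_eta_j: "(\<integral>x. eta_j j x \<partial>lborel) = 1"
  using integral_affine[of "2 ^ j" eta 0] by (simp add: eta_j_def[abs_def] integral_eta pow28)

lemma integral_abs_eta_j: "(\<integral>x. \<bar>eta_j j x\<bar> \<partial>lborel) = 1"
  using integral_eta_j[of j] eta_nonneg by (simp add: eta_j_def)

text \<open>This decay of the L^1 norm, against the growth of the squared L^2 norm in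
  \<open>mass_Psi_j\<close>, decides which exponents can be reached.\<close>

lemma integral_Psi_j: "(\<integral>x. \<bar>Psi_j j i x\<bar> \<partial>lborel) = (\<integral>x. \<bar>Psi i x\<bar> \<partial>lborel) / 2 ^ j"
proof -
  have "(\<integral>x. \<bar>Psi_j j i x\<bar> \<partial>lborel) = 4 ^ j * (\<integral>x. \<bar>Psi i (0 + 2 ^ j *\<^sub>R x)\<bar> \<partial>lborel)"
    by (simp add: Psi_j_def[abs_def] abs_mult)
  also have "\<dots> = 4 ^ j * ((\<integral>x. \<bar>Psi i x\<bar> \<partial>lborel) / 8 ^ j)"
    by (subst integral_affine[of "2 ^ j" "\<lambda>x. \<bar>Psi i x\<bar>" 0]) (simp_all add: pow28 divide_inverse)
  also have "\<dots> = (\<integral>x. \<bar>Psi i x\<bar> \<partial>lborel) / 2 ^ j"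
    using power_mult_distrib[of "2::real" 4 j] by (simp add: field_simps)
  finally show ?thesis .
qed

lemma mass_Psi_j: "mass (Psi_j j i) = 2 ^ j * mass (Psi i)"
proof -
  have "mass (Psi_j j i) = (4 ^ j)\<^sup>2 * mass (\<lambda>x. Psi i (0 + 2 ^ j *\<^sub>R x))"
    using mass_scaleR[OF L2_affine[OF _ test_function_integrable(3)[OF test_Psi], where c="2 ^ j" and t=0], where c="4 ^ j"]
    by (simp add: Psi_j_def[abs_def])
  also have "\<dots> = (4 ^ j)\<^sup>2 * (mass (Psi i) / 8 ^ j)"
    by (subst mass_affine[of "2 ^ j" "Psi i" 0]) (simp_all add: pow28)
  also have "\<dots> = 2 ^ j * mass (Psi i)"
    using power_mult_distrib[of "2::real" 8 j] power_mult_distrib[of "4::real" 4 j]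
    by (simp add: field_simps power2_eq_square)
  finally show ?thesis .
qed

lemma eta_j_Psi_j: "eta_j j x - eta_j (Suc j) x = (\<Sum>i\<in>UNIV. pderiv_R3 i (Psi_j j i) x)"
proof -
  have "pderiv_R3 i (Psi_j j i) x = 8 ^ j * pderiv_R3 i (Psi i) (2 ^ j *\<^sub>R x)" for i
  proof -
    have d: "Psi i differentiable at (0 + 2 ^ j *\<^sub>R x)" by (rule test_function_differentiable[OF test_Psi])
    have "((\<lambda>x. 4 ^ j * Psi i (0 + 2 ^ j *\<^sub>R x)) has_derivative
       (\<lambda>h. 4 ^ j * frechet_derivative (\<lambda>x. Psi i (0 + 2 ^ j *\<^sub>R x)) (at x) h)) (at x)"
      using frechet_derivative_works[THEN iffD1, OF pderiv_affine(2)[OF d]] by (rule has_derivative_mult_right)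
    from pderiv_R3I[OF this, of i]
    have "pderiv_R3 i (Psi_j j i) x = 4 ^ j * pderiv_R3 i (\<lambda>x. Psi i (0 + 2 ^ j *\<^sub>R x)) x"
      by (simp add: Psi_j_def[abs_def] pderiv_R3_def)
    also have "\<dots> = 4 ^ j * (2 ^ j * pderiv_R3 i (Psi i) (0 + 2 ^ j *\<^sub>R x))"
      by (subst pderiv_affine(1)[OF d]) simp
    finally show ?thesis using power_mult_distrib[of "2::real" 4 j] by simp
  qed
  then have "(\<Sum>i\<in>UNIV. pderiv_R3 i (Psi_j j i) x) = 8 ^ j * (\<Sum>i\<in>UNIV. pderiv_R3 i (Psi i) (2 ^ j *\<^sub>R x))"
    by (simp add: sum_distrib_left)
  also have "\<dots> = eta_j j x - eta_j (Suc j) x"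
    unfolding eta_Psi[symmetric] eta_j_def by (simp add: algebra_simps)
  finally show ?thesis by simp
qed

definition moll :: "nat \<Rightarrow> (R3 \<Rightarrow> 'a::euclidean_space) \<Rightarrow> R3 \<Rightarrow> 'a" where
  "moll j u = conv (eta_j j) u"

lemma moll_L2:
  assumes "L2_fun u" shows "L2_fun (moll j u)" "mass (moll j u) \<le> mass u"
  using conv_L2[OF test_function_integrable(3,1)[OF test_eta_j[of j]] assms] 
  by (auto simp: moll_def integral_abs_eta_j)

lemma pderiv_L2: "test_function f \<Longrightarrow> L2_fun (pderiv_R3 i f)"
proof -
  assume f: "test_function f"
  obtain \<rho> where r: "\<And>x. \<rho> < norm x \<Longrightarrow> pderiv_R3 i f x = 0" using pderiv_compact_support[OF f] by blast
  have c: "continuous_on UNIV (pderiv_R3 i f)" by (rule pderiv_continuous[OF f])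
  have "compact (pderiv_R3 i f ` cball 0 \<rho>)" using c by (intro compact_continuous_image) (auto intro: continuous_on_subset)
  then obtain M where M: "\<And>x. x \<in> cball 0 \<rho> \<Longrightarrow> norm (pderiv_R3 i f x) \<le> M"
    using compact_imp_bounded bounded_iff by (metis imageI)
  have i2: "integrable lborel (\<lambda>x::R3. M^2 * indicator (cball 0 \<rho>) x :: real)" 
    by (intro integrable_mult_right integrable_real_indicator) (use emeasure_lborel_cball_finite[of "0::R3" \<rho>] in simp_all)
  show ?thesis
  proof (rule L2_bound(1)[OF _ i2])
    show "pderiv_R3 i f \<in> borel_measurable borel" using c by (rule borel_measurable_continuous_onI)
    show "(norm (pderiv_R3 i f x))\<^sup>2 \<le> M\<^sup>2 * indicator (cball 0 \<rho>) x" for x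
      using r[of x] power_mono[OF M[of x], of 2] by (cases "norm x \<le> \<rho>") auto
  qed
qed

lemma moll_diff:
  assumes g: "is_weak_gradient u g" and u: "L2_fun u"
  shows "moll j u x - moll (Suc j) u x = (\<Sum>i\<in>UNIV. conv (Psi_j j i) (\<lambda>y. g y $ i) x)"
proof -
  note e = test_function_integrable(3)[OF test_eta_j]
  have "moll j u x - moll (Suc j) u x = conv (\<lambda>z. eta_j j z - eta_j (Suc j) z) u x"
    unfolding moll_def by (rule conv_diff_left[symmetric, OF e e u])
  also have "\<dots> = (\<integral>y. (\<Sum>i\<in>UNIV. pderiv_R3 i (Psi_j j i) (x - y) *\<^sub>R u y) \<partial>lborel)"
    by (simp add: conv_def eta_j_Psi_j scaleR_sum_left)
  also have "\<dots> = (\<Sum>i\<in>UNIV. conv (pderiv_R3 i (Psi_j j i)) u x)"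
    unfolding conv_def by (rule Bochner_Integration.integral_sum) (rule conv_sup(2)[OF pderiv_L2[OF test_Psi_j] u])
  also have "\<dots> = (\<Sum>i\<in>UNIV. conv (Psi_j j i) (\<lambda>y. g y $ i) x)"
    by (simp add: conv_weak_gradient[OF g test_Psi_j])
  finally show ?thesis .
qed

text \<open>Cauchy-Schwarz against \<open>Psi_j\<close> gives the supremum bound, growing like
  2^(j/2); Young's inequality gives the L^2 bound, decaying like 2^(-j).\<close>

lemma moll_diff_bounds:
  obtains C where "C > 0"
    "\<And>u g j x. is_weak_gradient u g \<Longrightarrow> L2_fun u \<Longrightarrow>
       norm (moll j u x - moll (Suc j) u x) \<le> C * sqrt (2 ^ j) * sqrt (mass g)"
    "\<And>u g j. is_weak_gradient u g \<Longrightarrow> L2_fun u \<Longrightarrow>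
       sqrt (mass (\<lambda>x. moll j u x - moll (Suc j) u x)) \<le> C / 2 ^ j * sqrt (mass g)"
proof -
  define C1 where "C1 = (\<Sum>i\<in>UNIV. sqrt (mass (Psi i)))"
  define C2 where "C2 = (\<Sum>i\<in>UNIV. (\<integral>x. \<bar>Psi i x\<bar> \<partial>lborel))"
  have p: "C1 \<ge> 0" "C2 \<ge> 0" unfolding C1_def C2_def by (auto intro!: sum_nonneg)
  show ?thesis
  proof (rule that[of "C1 + C2 + 1"])
    show "C1 + C2 + 1 > 0" using p by simp
  next
    fix u g j x assume g: "is_weak_gradient u g" and u: "L2_fun u"
    have "norm (moll j u x - moll (Suc j) u x) \<le> (\<Sum>i\<in>UNIV. norm (conv (Psi_j j i) (\<lambda>y. g y $ i) x))"
      unfolding moll_diff[OF g u] by (rule norm_sum)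
    also have "\<dots> \<le> (\<Sum>i\<in>UNIV. sqrt (mass (Psi i)) * (sqrt (2 ^ j) * sqrt (mass g)))"
    proof (rule sum_mono)
      fix i
      have "norm (conv (Psi_j j i) (\<lambda>y. g y $ i) x) \<le> sqrt (mass (Psi_j j i)) * sqrt (mass (\<lambda>y. g y $ i))"
        by (intro conv_sup test_function_integrable(3)[OF test_Psi_j] L2_component is_weak_gradient_L2[OF g])
      also have "\<dots> \<le> sqrt (mass (Psi_j j i)) * sqrt (mass g)"
        using L2_component(2)[OF is_weak_gradient_L2[OF g]] by (intro mult_left_mono) auto
      finally show "norm (conv (Psi_j j i) (\<lambda>y. g y $ i) x) \<le> sqrt (mass (Psi i)) * (sqrt (2 ^ j) * sqrt (mass g))"
        by (simp add: mass_Psi_j real_sqrt_mult mult_ac)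
    qed
    also have "\<dots> = C1 * sqrt (2 ^ j) * sqrt (mass g)" by (simp add: C1_def sum_distrib_right mult.assoc)
    also have "\<dots> \<le> (C1 + C2 + 1) * sqrt (2 ^ j) * sqrt (mass g)"
      using p by (intro mult_right_mono) auto
    finally show "norm (moll j u x - moll (Suc j) u x) \<le> (C1 + C2 + 1) * sqrt (2 ^ j) * sqrt (mass g)" .
  next
    fix u g j assume g: "is_weak_gradient u g" and u: "L2_fun u"
    let ?c = "\<lambda>i. conv (Psi_j j i) (\<lambda>y. g y $ i)"
    note gi = L2_component[OF is_weak_gradient_L2[OF g]]
    note P = test_function_integrable[OF test_Psi_j[of j]]
    have c: "L2_fun (?c i)" for i by (rule conv_L2(1)[OF P(3) P(1) gi(1)])
    have l2: "sqrt (mass (\<lambda>x. \<Sum>i\<in>I. ?c i x)) \<le> (\<Sum>i\<in>I. sqrt (mass (?c i)))" if "finite I" for I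
      using that
    proof (induction I)
      case empty show ?case by (simp add: mass_def)
    next
      case (insert i I)
      then show ?case using l2_triangle[OF c[of i] L2_sum[of I ?c, OF c]] by simp
    qed
    have "sqrt (mass (\<lambda>x. moll j u x - moll (Suc j) u x)) \<le> (\<Sum>i\<in>UNIV. sqrt (mass (?c i)))"
      unfolding moll_diff[OF g u] by (rule l2) simp
    also have "\<dots> \<le> (\<Sum>i\<in>UNIV. (\<integral>x. \<bar>Psi i x\<bar> \<partial>lborel) * (sqrt (mass g) / 2 ^ j))"
    proof (rule sum_mono)
      fix i
      have "mass (?c i) \<le> (\<integral>x. \<bar>Psi_j j i x\<bar> \<partial>lborel)\<^sup>2 * mass g"
        using conv_L2(2)[OF P(3) P(1) gi(1)] gi(2) by (rule order_trans[OF _ mult_left_mono]) auto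
      then have "sqrt (mass (?c i)) \<le> sqrt ((\<integral>x. \<bar>Psi_j j i x\<bar> \<partial>lborel)\<^sup>2 * mass g)" by simp
      also have "\<dots> = (\<integral>x. \<bar>Psi_j j i x\<bar> \<partial>lborel) * sqrt (mass g)"
        by (simp add: real_sqrt_mult)
      finally show "sqrt (mass (?c i)) \<le> (\<integral>x. \<bar>Psi i x\<bar> \<partial>lborel) * (sqrt (mass g) / 2 ^ j)"
        by (simp add: integral_Psi_j)
    qed
    also have "\<dots> = C2 / 2 ^ j * sqrt (mass g)" by (simp add: C2_def sum_distrib_right sum_divide_distrib)
    also have "\<dots> \<le> (C1 + C2 + 1) / 2 ^ j * sqrt (mass g)"
      using p by (intro mult_right_mono divide_right_mono) auto
    finally show "sqrt (mass (\<lambda>x. moll j u x - moll (Suc j) u x)) \<le> (C1 + C2 + 1) / 2 ^ j * sqrt (mass g)" .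
  qed
qed

section \<open>Convergence of mollifications\<close>

text \<open>Plays the role of completeness of L^p: limits are first found almost everywhere, and
  this transfers integrability and norm bounds to them.\<close>

lemma fatou_bound:
  fixes h :: "nat \<Rightarrow> 'a \<Rightarrow> real"
  assumes lim: "AE x in M. (\<lambda>n. h n x) \<longlonglongrightarrow> l x"
    and int: "\<And>n. integrable M (h n)" and nn: "\<And>n x. 0 \<le> h n x"
    and B: "\<And>n. (\<integral>x. h n x \<partial>M) \<le> B" and l: "l \<in> borel_measurable M"
  shows "integrable M l" "(\<integral>x. l x \<partial>M) \<le> B"
proof -
  have [measurable]: "h n \<in> borel_measurable M" for n using int by auto
  note [measurable] = l
  have "0 \<le> (\<integral>x. h 0 x \<partial>M)" by (rule integral_nonneg_AE) (simp add: nn)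
  with B[of 0] have B0: "0 \<le> B" by linarith
  have l0: "AE x in M. 0 \<le> l x"
    using lim by eventually_elim (rule LIMSEQ_le_const, auto simp: nn)
  have "(\<integral>\<^sup>+x. ennreal (l x) \<partial>M) = (\<integral>\<^sup>+x. liminf (\<lambda>n. ennreal (h n x)) \<partial>M)"
  proof (rule nn_integral_cong_AE)
    show "AE x in M. ennreal (l x) = liminf (\<lambda>n. ennreal (h n x))"
      using lim by eventually_elim (intro lim_imp_Liminf[symmetric] tendsto_ennrealI; simp)
  qed
  also have "\<dots> \<le> liminf (\<lambda>n. \<integral>\<^sup>+x. ennreal (h n x) \<partial>M)"
    by (rule nn_integral_liminf) auto
  also have "\<dots> \<le> liminf (\<lambda>n. ennreal B)"
    using int nn B by (intro Liminf_mono) (auto simp: nn_integral_eq_integral ennreal_leI)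
  also have "\<dots> = ennreal B" by (simp add: Liminf_const)
  finally have b: "(\<integral>\<^sup>+x. ennreal (l x) \<partial>M) \<le> ennreal B" .
  show i: "integrable M l"
  proof (rule integrableI_bounded)
    have "(\<integral>\<^sup>+x. ennreal (norm (l x)) \<partial>M) = (\<integral>\<^sup>+x. ennreal (l x) \<partial>M)"
      using l0 by (intro nn_integral_cong_AE) (auto elim!: eventually_mono)
    then show "(\<integral>\<^sup>+x. ennreal (norm (l x)) \<partial>M) < \<infinity>" using b by (simp add: le_less_trans)
  qed simp
  have "ennreal (\<integral>x. l x \<partial>M) \<le> ennreal B" using b i l0 by (simp add: nn_integral_eq_integral)
  then show "(\<integral>x. l x \<partial>M) \<le> B" using B0 by simp
qed

text \<open>Boxes form an intersection-stable generator, so vanishing integrals spread to all Borel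
  sets. Cutting off to a fixed box first makes the function integrable, and the cut sends boxes to
  boxes.\<close>

lemma AE_zero_if_box_integrals_zero:
  fixes f :: "'n::euclidean_space \<Rightarrow> 'a::euclidean_space"
  assumes int: "\<And>a b. set_integrable lborel (box a b) f"
    and z: "\<And>a b. set_lebesgue_integral lborel (box a b) f = 0"
    and [measurable]: "f \<in> borel_measurable borel"
  shows "AE x in lborel. f x = 0"
proof -
  have *: "AE x in lborel. x \<in> box c d \<longrightarrow> f x = 0" for c d :: 'n
  proof -
    define h where "h x = indicator (box c d) x *\<^sub>R f x" for x
    have ih: "integrable lborel h" using int[of c d] by (simp add: set_integrable_def h_def[abs_def])
    have [measurable]: "h \<in> borel_measurable borel" using ih by auto
    define G where "G = range (\<lambda>(a, b). box a b :: 'n set)"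
    have st: "Int_stable G" by (auto simp: Int_stable_def G_def box_Int_box)
    have gen: "sets borel = sigma_sets UNIV G"
      by (simp add: borel_eq_box G_def)
    have si: "set_integrable lborel A h" if "A \<in> sets borel" for A
      unfolding set_integrable_def using that integrable_mult_indicator[OF _ ih, of A] by simp
    have zero: "set_lebesgue_integral lborel A h = 0" if "A \<in> sets borel" for A
    proof -
      have "A \<in> sigma_sets UNIV G" using that by (simp add: gen)
      have sub: "G \<subseteq> Pow UNIV" by simp
      from st sub \<open>A \<in> sigma_sets UNIV G\<close> show ?thesis
      proof (induction rule: sigma_sets_induct_disjoint)
        case (basic A)
        then obtain a b where A: "A = box a b" by (auto simp: G_def)
        obtain c' d' where eq: "box a b \<inter> box c d = box c' d'" by (simp add: box_Int_box)
        have ind: "indicator (box a b) x *\<^sub>R indicator (box c d) x *\<^sub>R f x = indicator (box c' d') x *\<^sub>R f x" for x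
          unfolding eq[symmetric] by (simp add: indicator_def)
        have "set_lebesgue_integral lborel A h = set_lebesgue_integral lborel (box c' d') f"
          unfolding set_lebesgue_integral_def A h_def ind by (rule refl)
        then show ?case using z by simp
      next
        case empty show ?case by (simp add: set_lebesgue_integral_def)
      next
        case (compl A)
        then have A: "A \<in> sets borel" by (simp add: gen)
        have "set_lebesgue_integral lborel (A \<union> (UNIV - A)) h
            = set_lebesgue_integral lborel A h + set_lebesgue_integral lborel (UNIV - A) h"
          using A by (intro set_integral_Un si) auto
        moreover have "set_lebesgue_integral lborel (A \<union> (UNIV - A)) h = set_lebesgue_integral lborel (box c d) f"
          by (simp add: set_lebesgue_integral_def h_def)
        ultimately show ?case using compl z by simp
      next
        case (union A)
        then have A: "A i \<in> sets borel" for i using gen by auto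
        have "set_lebesgue_integral lborel (\<Union>i. A i) h = (\<Sum>i. set_lebesgue_integral lborel (A i) h)"
        proof (rule lebesgue_integral_countable_add)
          show "A i \<inter> A j = {}" if "i \<noteq> j" for i j using union(1) that by (auto simp: disjoint_family_on_def)
          show "set_integrable lborel (\<Union>i. A i) h" using A by (intro si) auto
        qed (use A in auto)
        then show ?case using union by simp
      qed
    qed
    have "AE x in lborel. h x = 0"
      by (rule sigma_finite_measure.density_unique_banach[OF lborel.sigma_finite_measure_axioms ih]) (auto simp: zero)
    then show ?thesis by eventually_elim (auto simp: h_def indicator_def split: if_splits)
  qed
  have "AE x in lborel. \<forall>n::nat. x \<in> box (- (real n *\<^sub>R One)) (real n *\<^sub>R One) \<longrightarrow> f x = 0"
    unfolding AE_all_countable using * by blast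
  then show ?thesis
  proof eventually_elim
    case (elim x)
    have "x \<in> (\<Union>n::nat. box (- (real n *\<^sub>R One)) (real n *\<^sub>R One))" by (subst UN_box_eq_UNIV) simp
    with elim show ?case by auto
  qed
qed

lemma L2_set_integrable_box:
  fixes f :: "R3 \<Rightarrow> 'a::euclidean_space"
  assumes "L2_fun f" shows "set_integrable lborel (box a b) f"
  unfolding set_integrable_def using L2_integrable_on_bounded[OF assms, of "box a b"]
  using emeasure_lborel_box_finite[of a b] by simp

text \<open>The translation is moved onto the indicator, whose values converge off the null boundary
  of the box; dominated convergence then applies.\<close>

lemma translated_box_integral_tendsto:
  fixes f :: "R3 \<Rightarrow> 'a::euclidean_space"
  assumes f: "L2_fun f"
  shows "(\<lambda>j. \<integral>x. indicator (box a b) x *\<^sub>R f (x - (1 / 2 ^ j) *\<^sub>R z) \<partial>lborel)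
     \<longlonglongrightarrow> (\<integral>x. indicator (box a b) x *\<^sub>R f x \<partial>lborel)"
proof -
  note [measurable] = L2_measurable[OF f]
  define e where "e j = (1 / 2 ^ j) *\<^sub>R z" for j :: nat
  have e0: "e \<longlonglongrightarrow> 0"
  proof -
    have "(\<lambda>j::nat. (1 / 2) ^ j) \<longlonglongrightarrow> (0::real)" by (rule LIMSEQ_power_zero) simp
    from tendsto_scaleR[OF this tendsto_const[of z]] show ?thesis by (simp add: e_def[abs_def] power_one_over)
  qed
  have ne: "norm (e j) \<le> norm z" for j
    using mult_right_mono[of "1 / 2 ^ j" 1 "norm z"] by (simp add: e_def divide_le_eq)
  have sh: "(\<integral>x. indicator (box a b) x *\<^sub>R f (x - e j) \<partial>lborel)
     = (\<integral>y. indicator (box a b) (y + e j) *\<^sub>R f y \<partial>lborel)" for j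
    using integral_affine[of 1 "\<lambda>x. indicator (box a b) x *\<^sub>R f (x - e j)" "e j"] by (simp add: add.commute)
  obtain \<rho> where \<rho>: "box a b \<subseteq> cball 0 \<rho>" using bounded_box[of a b] unfolding bounded_iff subset_eq by auto
  define w where "w x = indicator (cball 0 (\<rho> + norm z)) x *\<^sub>R f x" for x
  have iw: "integrable lborel w" unfolding w_def[abs_def]
    by (rule L2_integrable_on_bounded[OF f]) (use emeasure_lborel_cball_finite[of "0::R3" "\<rho> + norm z"] in auto)
  have "(\<lambda>j. \<integral>y. indicator (box a b) (y + e j) *\<^sub>R f y \<partial>lborel) \<longlonglongrightarrow> (\<integral>y. indicator (box a b) y *\<^sub>R f y \<partial>lborel)"
  proof (rule integral_dominated_convergence)
    show "integrable lborel (\<lambda>x. norm (w x))" using iw by simp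
    have "cbox a b - box a b \<in> null_sets lborel"
      using emeasure_lborel_cbox_eq[of a b] emeasure_lborel_box_eq[of a b] box_subset_cbox[of a b]
      by (auto simp: null_sets_def emeasure_Diff emeasure_lborel_box_finite)
    then have "AE y in lborel. y \<notin> cbox a b - box a b" by (rule AE_not_in)
    then show "AE y in lborel. (\<lambda>j. indicator (box a b) (y + e j) *\<^sub>R f y) \<longlonglongrightarrow> indicator (box a b) y *\<^sub>R f y"
    proof eventually_elim
      case (elim y)
      have t: "(\<lambda>j. y + e j) \<longlonglongrightarrow> y" using tendsto_add[OF tendsto_const e0, of y] by simp
      have "\<forall>\<^sub>F j in sequentially. (y + e j \<in> box a b) = (y \<in> box a b)"
      proof (cases "y \<in> box a b")
        case True
        then have "\<forall>\<^sub>F j in sequentially. y + e j \<in> box a b"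
          using topological_tendstoD[OF t open_box] by blast
        then show ?thesis using True by (auto elim!: eventually_mono)
      next
        case False
        with elim have "y \<in> - cbox a b" by auto
        then have "\<forall>\<^sub>F j in sequentially. y + e j \<in> - cbox a b"
          using topological_tendstoD[OF t, of "- cbox a b"] closed_cbox by (auto simp: open_Compl)
        then show ?thesis using False box_subset_cbox[of a b] by (auto elim!: eventually_mono)
      qed
      then have "\<forall>\<^sub>F j in sequentially. indicator (box a b) y *\<^sub>R f y = indicator (box a b) (y + e j) *\<^sub>R f y"
        by eventually_elim (simp add: indicator_def)
      then show ?case by (rule Lim_transform_eventually[OF tendsto_const])
    qed
    show "AE y in lborel. norm (indicator (box a b) (y + e j) *\<^sub>R f y) \<le> norm (w y)" for j
    proof (rule AE_I2)
      fix y
      show "norm (indicator (box a b) (y + e j) *\<^sub>R f y) \<le> norm (w y)"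
      proof (cases "y + e j \<in> box a b")
        case True
        then have "norm (y + e j) \<le> \<rho>" using \<rho> by auto
        then have "norm y \<le> \<rho> + norm z" using norm_triangle_ineq4[of "y + e j" "e j"] ne[of j] by simp
        then show ?thesis by (simp add: w_def True)
      qed simp
    qed
  qed measurable
  then show ?thesis unfolding sh[unfolded e_def] e_def .
qed

text \<open>The substitution z = 2^j (x - y) fixes the weight and moves the scale into the argument,
  so that limits in j can be taken under the integral.\<close>

lemma moll_alt:
  fixes f :: "R3 \<Rightarrow> 'a::euclidean_space"
  shows "moll j f x = (\<integral>z. eta z *\<^sub>R f (x - (1 / 2 ^ j) *\<^sub>R z) \<partial>lborel)"
proof -
  have "(\<integral>z. eta z *\<^sub>R f (x - (1 / 2 ^ j) *\<^sub>R z) \<partial>lborel)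
     = (\<integral>z. (1 / 8 ^ j) *\<^sub>R (eta_j j (x - (x + (- (1 / 2 ^ j)) *\<^sub>R z)) *\<^sub>R f (x + (- (1 / 2 ^ j)) *\<^sub>R z)) \<partial>lborel)"
    by (simp add: eta_j_def)
  also have "\<dots> = (1 / 8 ^ j) *\<^sub>R (\<integral>z. (eta_j j (x - (x + (- (1 / 2 ^ j)) *\<^sub>R z)) *\<^sub>R f (x + (- (1 / 2 ^ j)) *\<^sub>R z)) \<partial>lborel)"
    by (rule integral_scaleR_right) 
  also have "\<dots> = moll j f x"
    by (subst integral_affine[of "- (1 / 2 ^ j)" "\<lambda>y. eta_j j (x - y) *\<^sub>R f y" x])
       (simp_all add: moll_def conv_def power_divide pow28)
  finally show ?thesis by simp
qed

text \<open>A weak convergence statement tested on boxes: Fubini reduces it to translated integrals,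
  averaged with a weight of integral 1.\<close>

lemma moll_box_tendsto:
  fixes f :: "R3 \<Rightarrow> 'a::euclidean_space"
  assumes f: "L2_fun f"
  shows "(\<lambda>j. set_lebesgue_integral lborel (box a b) (moll j f)) \<longlonglongrightarrow> set_lebesgue_integral lborel (box a b) f"
proof -
  note [measurable] = L2_measurable[OF f] test_function_integrable(2)[OF test_eta]
  define Q where "Q x = (indicator (box a b) x :: real)" for x :: R3
  have [measurable]: "Q \<in> borel_measurable borel" unfolding Q_def[abs_def] by simp
  have Qsq: "(Q x)\<^sup>2 = Q x" for x by (simp add: Q_def indicator_def)
  have Q: "L2_fun Q"
  proof (rule L2_funI)
    have "(\<lambda>x. (norm (Q x))\<^sup>2) = Q" by (simp add: Qsq)
    then show "integrable lborel (\<lambda>x. (norm (Q x))\<^sup>2)"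
      using emeasure_lborel_box_finite[of a b] by (simp add: Q_def[abs_def])
  qed simp
  define A where "A = sqrt (mass Q) * sqrt (mass f)"
  have sf: "L2_fun (\<lambda>x. f (x - e))" and msf: "mass (\<lambda>x. f (x - e)) = mass f" for e
    using L2_affine[OF _ f, of 1 "-e"] mass_affine[of 1 f "-e"] by simp_all
  have inner: "integrable lborel (\<lambda>x. Q x *\<^sub>R f (x - e))" 
      "norm (\<integral>x. Q x *\<^sub>R f (x - e) \<partial>lborel) \<le> A" "(\<integral>x. norm (Q x *\<^sub>R f (x - e)) \<partial>lborel) \<le> A" for e
    using L2_dominated_product[OF Q sf, of "\<lambda>x. Q x *\<^sub>R f (x - e)" 1 e] by (auto simp: A_def msf)
  have main: "set_lebesgue_integral lborel (box a b) (moll j f)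
     = (\<integral>z. eta z *\<^sub>R (\<integral>x. Q x *\<^sub>R f (x - (1 / 2 ^ j) *\<^sub>R z) \<partial>lborel) \<partial>lborel)" for j
  proof -
    let ?F = "\<lambda>z x. eta z *\<^sub>R Q x *\<^sub>R f (x - (1 / 2 ^ j) *\<^sub>R z)"
    have iF: "integrable (lborel \<Otimes>\<^sub>M lborel) (case_prod ?F)"
    proof (rule lborel_pair.Fubini_integrable)
      show "case_prod ?F \<in> borel_measurable (lborel \<Otimes>\<^sub>M lborel)" by measurable
      show "AE z in lborel. integrable lborel (\<lambda>x. case (z, x) of (z, x) \<Rightarrow> ?F z x)"
        using integrable_scaleR_right[OF inner(1)] by (simp del: scaleR_scaleR)
      show "integrable lborel (\<lambda>z. \<integral>x. norm (case (z, x) of (z, x) \<Rightarrow> ?F z x) \<partial>lborel)"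
      proof (rule Bochner_Integration.integrable_bound)
        show "integrable lborel (\<lambda>z. eta z * A)" using test_function_integrable(1)[OF test_eta] by simp
        show "AE z in lborel. norm (\<integral>x. norm (case (z, x) of (z, x) \<Rightarrow> ?F z x) \<partial>lborel) \<le> norm (eta z * A)"
        proof (rule AE_I2)
          fix z
          have "(\<integral>x. norm (?F z x) \<partial>lborel) = eta z * (\<integral>x. norm (Q x *\<^sub>R f (x - (1 / 2 ^ j) *\<^sub>R z)) \<partial>lborel)"
            using eta_nonneg[of z] by (simp add: abs_mult mult.assoc)
          also have "\<dots> \<le> eta z * A" using inner(3) eta_nonneg[of z] by (intro mult_left_mono) auto
          finally have "(\<integral>x. norm (?F z x) \<partial>lborel) \<le> eta z * A" .
          moreover have "0 \<le> (\<integral>x. norm (?F z x) \<partial>lborel)" by (rule integral_nonneg_AE) simp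
          ultimately show "norm (\<integral>x. norm (case (z, x) of (z, x) \<Rightarrow> ?F z x) \<partial>lborel) \<le> norm (eta z * A)"
            by simp
        qed
      qed measurable
    qed
    have "set_lebesgue_integral lborel (box a b) (moll j f) = (\<integral>x. (\<integral>z. ?F z x \<partial>lborel) \<partial>lborel)"
      unfolding set_lebesgue_integral_def moll_alt Q_def
      by (intro Bochner_Integration.integral_cong refl) (simp add: mult.commute flip: integral_scaleR_right)
    also have "\<dots> = (\<integral>z. (\<integral>x. ?F z x \<partial>lborel) \<partial>lborel)" by (rule lborel_pair.Fubini_integral[OF iF])
    also have "\<dots> = (\<integral>z. eta z *\<^sub>R (\<integral>x. Q x *\<^sub>R f (x - (1 / 2 ^ j) *\<^sub>R z) \<partial>lborel) \<partial>lborel)"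
      by (simp only: integral_scaleR_right)
    finally show ?thesis .
  qed
  have "(\<lambda>j. \<integral>z. eta z *\<^sub>R (\<integral>x. Q x *\<^sub>R f (x - (1 / 2 ^ j) *\<^sub>R z) \<partial>lborel) \<partial>lborel)
     \<longlonglongrightarrow> (\<integral>z. eta z *\<^sub>R (\<integral>x. Q x *\<^sub>R f x \<partial>lborel) \<partial>lborel)"
  proof (rule integral_dominated_convergence)
    show "integrable lborel (\<lambda>z. eta z * A)" using test_function_integrable(1)[OF test_eta] by simp
    show "AE z in lborel. (\<lambda>j. eta z *\<^sub>R (\<integral>x. Q x *\<^sub>R f (x - (1 / 2 ^ j) *\<^sub>R z) \<partial>lborel)) \<longlonglongrightarrow> eta z *\<^sub>R (\<integral>x. Q x *\<^sub>R f x \<partial>lborel)"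
      using translated_box_integral_tendsto[OF f, of a b] by (intro AE_I2 tendsto_intros) (simp add: Q_def)
    show "AE z in lborel. norm (eta z *\<^sub>R (\<integral>x. Q x *\<^sub>R f (x - (1 / 2 ^ j) *\<^sub>R z) \<partial>lborel)) \<le> eta z * A" for j
      using inner(2) eta_nonneg by (auto intro!: AE_I2 mult_left_mono)
  qed measurable
  also have "(\<integral>z. eta z *\<^sub>R (\<integral>x. Q x *\<^sub>R f x \<partial>lborel) \<partial>lborel) = (\<integral>x. Q x *\<^sub>R f x \<partial>lborel)"
    using test_function_integrable(1)[OF test_eta] by (simp add: integral_eta)
  finally show ?thesis unfolding main by (simp add: set_lebesgue_integral_def Q_def)
qed

lemma AE_zero_if_moll_zero:
  fixes f :: "R3 \<Rightarrow> 'a::euclidean_space"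
  assumes f: "L2_fun f" and z: "\<And>j x. moll j f x = 0"
  shows "AE x in lborel. f x = 0"
proof (rule AE_zero_if_box_integrals_zero)
  show "set_integrable lborel (box a b) f" for a b by (rule L2_set_integrable_box[OF f])
  show "set_lebesgue_integral lborel (box a b) f = 0" for a b
    using moll_box_tendsto[OF f, of a b] by (simp add: z set_lebesgue_integral_def LIMSEQ_const_iff)
  show "f \<in> borel_measurable borel" using f by (rule L2_measurable)
qed

text \<open>All weak gradients of \<open>u\<close> have the same mollifications, namely convolutions
  of \<open>u\<close> with derivatives of the kernel, and a square integrable function whose
  mollifications vanish is null.\<close>

lemma weak_gradient_unique:
  assumes g: "is_weak_gradient u g" and h: "is_weak_gradient u h"
  shows "AE x in lborel. g x = h x"
proof -
  have "AE x in lborel. g x $ i - h x $ i = 0" for i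
  proof (rule AE_zero_if_moll_zero)
    note L = L2_component(1)[OF is_weak_gradient_L2[OF g], of i] L2_component(1)[OF is_weak_gradient_L2[OF h], of i]
    show "L2_fun (\<lambda>x. g x $ i - h x $ i)" by (rule L2_diff[OF L])
    fix j x
    have "moll j (\<lambda>x. g x $ i - h x $ i) x = moll j (\<lambda>x. g x $ i) x - moll j (\<lambda>x. h x $ i) x"
      unfolding moll_def by (rule conv_diff_right[OF test_function_integrable(3)[OF test_eta_j] L])
    then show "moll j (\<lambda>x. g x $ i - h x $ i) x = 0"
      unfolding moll_def conv_weak_gradient[OF g test_eta_j, symmetric] conv_weak_gradient[OF h test_eta_j, symmetric]
      by simp
  qed
  then have "AE x in lborel. \<forall>i. g x $ i - h x $ i = 0" by (simp add: AE_all_countable)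
  then show ?thesis by eventually_elim (simp add: vec_eq_iff)
qed

lemma wgrad_weak_gradient: "u \<in> H1 \<Longrightarrow> is_weak_gradient u (wgrad u)"
  unfolding wgrad_def H1_def using someI_ex[of "is_weak_gradient u"] by auto

lemma wgrad_unique:
  assumes "is_weak_gradient u g" shows "AE x in lborel. wgrad u x = g x"
proof -
  have "is_weak_gradient u (wgrad u)" unfolding wgrad_def using assms someI[of "is_weak_gradient u"] by blast
  then show ?thesis using assms by (rule weak_gradient_unique)
qed

section \<open>The Gagliardo--Nirenberg inequality\<close>

text \<open>The t-th power of the L^t norm, kept as a plain integral so that pointwise bounds and
  Fatou's lemma apply directly.\<close>

definition pw :: "real \<Rightarrow> (R3 \<Rightarrow> 'a::real_normed_vector) \<Rightarrow> real" where
  "pw t u = (\<integral>x. norm (u x) powr t \<partial>lborel)"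

lemma pw_nonneg [simp]: "0 \<le> pw t u"
  unfolding pw_def by (rule integral_nonneg_AE) simp

lemma powr_split_square:
  fixes a t :: real
  assumes "0 \<le> a" shows "a powr t = a powr (t - 2) * a\<^sup>2"
proof (cases "a = 0")
  case False
  then have "a > 0" using assms by simp
  then show ?thesis using powr_add[of a "t - 2" 2] by (simp add: powr_numeral)
qed simp

lemma pw_2: "pw 2 f = mass f"
  unfolding pw_def mass_def by (intro Bochner_Integration.integral_cong refl) (simp add: powr_numeral)

text \<open>Interpolation between L^2 and the supremum norm.\<close>

lemma pw_le_sup_mass:
  fixes f :: "R3 \<Rightarrow> 'a::euclidean_space"
  assumes f: "L2_fun f" and S: "\<And>x. norm (f x) \<le> S" and t: "2 \<le> t"
  shows "integrable lborel (\<lambda>x. norm (f x) powr t)" "pw t f \<le> S powr (t - 2) * mass f"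
proof -
  note [measurable] = L2_measurable[OF f]
  have le: "norm (f x) powr t \<le> S powr (t - 2) * (norm (f x))\<^sup>2" for x
    using powr_mono2[OF _ _ S[of x], of "t - 2"] t by (subst powr_split_square) (auto intro!: mult_right_mono)
  have i: "integrable lborel (\<lambda>x. S powr (t - 2) * (norm (f x))\<^sup>2)" using L2_integrable[OF f] by simp
  show j: "integrable lborel (\<lambda>x. norm (f x) powr t)"
    by (rule Bochner_Integration.integrable_bound[OF i]) (use le in \<open>auto intro!: AE_I2\<close>)
  have "pw t f \<le> (\<integral>x. S powr (t - 2) * (norm (f x))\<^sup>2 \<partial>lborel)"
    unfolding pw_def by (rule integral_mono[OF j i le])
  then show "pw t f \<le> S powr (t - 2) * mass f" by (simp add: mass_def)
qed

text \<open>Stands in for the triangle inequality in L^t: as the weights sum to at most 1, the sum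
  is at most the largest quotient a_i / w_i. With geometric weights the loss is absorbed by the
  decay of the terms.\<close>

lemma sum_powr_weights:
  fixes a w :: "'i \<Rightarrow> real"
  assumes I: "finite I" and a: "\<And>i. i \<in> I \<Longrightarrow> 0 \<le> a i" and w: "\<And>i. i \<in> I \<Longrightarrow> 0 < w i"
    and W: "(\<Sum>i\<in>I. w i) \<le> 1" and t: "0 < t"
  shows "(\<Sum>i\<in>I. a i) powr t \<le> (\<Sum>i\<in>I. (a i / w i) powr t)"
proof (cases "I = {}")
  case False
  define M where "M = Max ((\<lambda>i. a i / w i) ` I)"
  have "M \<in> (\<lambda>i. a i / w i) ` I" unfolding M_def using I False by (intro Max_in) auto
  then obtain i0 where i0: "i0 \<in> I" "M = a i0 / w i0" by auto
  have M0: "0 \<le> M" using i0 a w by (auto intro!: divide_nonneg_pos)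
  have le: "a i \<le> M * w i" if "i \<in> I" for i
  proof -
    have "a i / w i \<le> M" unfolding M_def using I that by (intro Max_ge) auto
    then show ?thesis using w[OF that] by (simp add: divide_le_eq)
  qed
  have "(\<Sum>i\<in>I. a i) \<le> M * (\<Sum>i\<in>I. w i)" unfolding sum_distrib_left by (intro sum_mono le)
  also have "\<dots> \<le> M" using W M0 by (simp add: mult_left_le)
  finally have "(\<Sum>i\<in>I. a i) powr t \<le> M powr t" using a t by (intro powr_mono2) (auto intro!: sum_nonneg)
  also have "\<dots> \<le> (\<Sum>i\<in>I. (a i / w i) powr t)" unfolding i0(2) using i0(1) I by (intro member_le_sum) auto
  finally show ?thesis .
qed simp

lemma powr_add_le:
  fixes a b :: real assumes "0 \<le> a" "0 \<le> b" "0 < t"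
  shows "(a + b) powr t \<le> 2 powr t * (a powr t + b powr t)"
proof -
  have "(a + b) powr t \<le> (2 * max a b) powr t" using assms by (intro powr_mono2) auto
  also have "\<dots> = 2 powr t * (max a b) powr t" using assms by (simp add: powr_mult)
  also have "(max a b) powr t \<le> a powr t + b powr t" by (simp add: max_def)
  finally show ?thesis by simp
qed

lemma pw_integrable_add:
  fixes f g :: "R3 \<Rightarrow> 'a::euclidean_space"
  assumes f: "integrable lborel (\<lambda>x. norm (f x) powr t)" and g: "integrable lborel (\<lambda>x. norm (g x) powr t)"
    and [measurable]: "f \<in> borel_measurable borel" "g \<in> borel_measurable borel" and t: "0 < t"
  shows "integrable lborel (\<lambda>x. norm (f x + g x) powr t)"
    "pw t (\<lambda>x. f x + g x) \<le> 2 powr t * (pw t f + pw t g)"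
proof -
  have le: "norm (f x + g x) powr t \<le> 2 powr t * (norm (f x) powr t + norm (g x) powr t)" for x
  proof -
    have "norm (f x + g x) powr t \<le> (norm (f x) + norm (g x)) powr t"
      using t by (intro powr_mono2 norm_triangle_ineq) auto
    also have "\<dots> \<le> 2 powr t * (norm (f x) powr t + norm (g x) powr t)" using t by (intro powr_add_le) auto
    finally show ?thesis .
  qed
  have i: "integrable lborel (\<lambda>x. 2 powr t * (norm (f x) powr t + norm (g x) powr t))" using f g by auto
  show j: "integrable lborel (\<lambda>x. norm (f x + g x) powr t)"
    by (rule Bochner_Integration.integrable_bound[OF i]) (use le in \<open>auto intro!: AE_I2 intro: order_trans[OF _ abs_ge_self]\<close>)
  have "pw t (\<lambda>x. f x + g x) \<le> (\<integral>x. 2 powr t * (norm (f x) powr t + norm (g x) powr t) \<partial>lborel)"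
    unfolding pw_def by (rule integral_mono[OF j i le])
  then show "pw t (\<lambda>x. f x + g x) \<le> 2 powr t * (pw t f + pw t g)" using f g by (simp add: pw_def)
qed

lemma pw_minus: "pw t (\<lambda>x. - f x) = pw t f" by (simp add: pw_def)

lemma pw_diff_commute: "pw t (\<lambda>x. f x - g x) = pw t (\<lambda>x. g x - f x)"
  by (simp add: pw_def norm_minus_commute)

lemma pw_integrable_diff:
  fixes f g :: "R3 \<Rightarrow> 'a::euclidean_space"
  assumes f: "integrable lborel (\<lambda>x. norm (f x) powr t)" and g: "integrable lborel (\<lambda>x. norm (g x) powr t)"
    and "f \<in> borel_measurable borel" "g \<in> borel_measurable borel" and t: "0 < t"
  shows "integrable lborel (\<lambda>x. norm (f x - g x) powr t)"
    "pw t (\<lambda>x. f x - g x) \<le> 2 powr t * (pw t f + pw t g)"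
  using pw_integrable_add[of f t "\<lambda>x. - g x"] assms by (auto simp: pw_minus)

text \<open>Per scale, the supremum bound contributes (t - 2) / 2 to the exponent of 2 and the L^2
  bound contributes -2, together -(6 - t) / 2. This is where the critical exponent 6 enters.\<close>

lemma moll_step_pw:
  fixes C G t :: real
  assumes "0 < C" "0 \<le> G" "2 \<le> t"
  shows "(C * sqrt (2 ^ i) * sqrt G) powr (t - 2) * (C / 2 ^ i * sqrt G)\<^sup>2
    = C powr t * 2 powr (- ((6 - t) / 2) * real i) * G powr (t / 2)"
proof (cases "G = 0")
  case False
  then have G: "G > 0" using assms by simp
  have s2: "sqrt (2 ^ i) = 2 powr (real i / 2)" by (simp add: powr_half_sqrt[symmetric] powr_powr powr_realpow[symmetric])
  have sG: "sqrt G = G powr (1/2)" using G by (simp add: powr_half_sqrt)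
  have p2: "(2::real) ^ i = 2 powr (real i)" by (simp add: powr_realpow)
  have "(C * sqrt (2 ^ i) * sqrt G) powr (t - 2) * (C / 2 ^ i * sqrt G)\<^sup>2
     = (C powr (t - 2) * C\<^sup>2) * (2 powr (real i / 2 * (t - 2)) * (1 / 2 powr (real i))\<^sup>2) * (G powr (1/2 * (t - 2)) * G)"
  proof -
    have "(C * sqrt (2 ^ i) * sqrt G) powr (t - 2) = C powr (t - 2) * 2 powr (real i / 2 * (t - 2)) * G powr (1/2 * (t - 2))"
      using assms unfolding s2 sG powr_mult powr_powr by simp
    moreover have "(C / 2 ^ i * sqrt G)\<^sup>2 = C\<^sup>2 * (1 / 2 powr (real i))\<^sup>2 * G"
      using G unfolding p2 by (simp add: power_mult_distrib power_divide)
    ultimately show ?thesis by (simp only: mult_ac)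
  qed
  also have "C powr (t - 2) * C\<^sup>2 = C powr t" using powr_split_square[of C t] assms by simp
  also have "G powr (1/2 * (t - 2)) * G = G powr (1/2 * (t - 2) + 1)" using G by (simp only: powr_add powr_one)
  also have "1/2 * (t - 2) + 1 = t / 2" by (simp add: diff_divide_distrib)
  also have "(1 / 2 powr (real i))\<^sup>2 = (2::real) powr (- 2 * real i)"
    by (simp add: power_divide powr_minus divide_inverse power_inverse powr_power mult.commute)
  also have "(2::real) powr (real i / 2 * (t - 2)) * 2 powr (- 2 * real i) = 2 powr (- ((6 - t) / 2) * real i)"
    unfolding powr_add[symmetric] by (rule arg_cong[where f="\<lambda>s. 2 powr s"]) (simp add: field_simps)
  finally show ?thesis .
qed (use assms in simp)

lemma moll_partial:
  assumes t: "2 \<le> t" "t < 6"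
  obtains C where "C > 0"
    "\<And>u g j N. is_weak_gradient u g \<Longrightarrow> L2_fun u \<Longrightarrow> j \<le> N \<Longrightarrow>
       integrable lborel (\<lambda>x. norm (moll j u x - moll N u x) powr t) \<and>
       pw t (\<lambda>x. moll j u x - moll N u x) \<le> C * 2 powr (- ((6 - t) / 2) * real j) * (mass g) powr (t / 2)"
proof -
  obtain C0 where C0: "C0 > 0"
    "\<And>u g j x. is_weak_gradient u g \<Longrightarrow> L2_fun u \<Longrightarrow>
       norm (moll j u x - moll (Suc j) u x) \<le> C0 * sqrt (2 ^ j) * sqrt (mass g)"
    "\<And>u g j. is_weak_gradient u g \<Longrightarrow> L2_fun u \<Longrightarrow>
       sqrt (mass (\<lambda>x. moll j u x - moll (Suc j) u x)) \<le> C0 / 2 ^ j * sqrt (mass g)"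
    using moll_diff_bounds by blast
  define \<beta> where "\<beta> = (6 - t) / 2"
  \<comment> \<open>The weights decay like \<rho>^k with \<rho>^t = \<sigma> = 2^(-\<beta>/2).
    Dividing by them costs \<sigma>^(-k), half of the decay \<sigma>^(2k) of the k-th term, and a
    geometric series in \<sigma> remains.\<close>
  define \<rho> where "\<rho> = (2::real) powr (- (\<beta> / (2 * t)))"
  define \<sigma> where "\<sigma> = (2::real) powr (- (\<beta> / 2))"
  have b: "\<beta> > 0" using t by (simp add: \<beta>_def)
  have \<rho>: "0 < \<rho>" "\<rho> < 1" unfolding \<rho>_def using b t by (auto simp: powr_less_one)
  have \<sigma>: "0 < \<sigma>" "\<sigma> < 1" unfolding \<sigma>_def using b t by (auto simp: powr_less_one)
  have \<rho>t: "\<rho> powr t = \<sigma>" unfolding \<rho>_def \<sigma>_def powr_powr using t by (simp add: field_simps)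
  define C where "C = (1 - \<rho>) powr (- t) * C0 powr t * (1 / (1 - \<sigma>))"
  show ?thesis
  proof (rule that[of C])
    show "C > 0" using \<rho> \<sigma> C0 by (simp add: C_def)
  next
    fix u g and j N :: nat assume g: "is_weak_gradient u g" and u: "L2_fun u" and jN: "j \<le> N"
    define G where "G = mass g"
    define d where "d k x = moll (j + k) u x - moll (Suc (j + k)) u x" for k x
    define w where "w k = (1 - \<rho>) * \<rho> ^ k" for k
    define n where "n = N - j"
    have w0: "w k > 0" for k using \<rho> by (simp add: w_def)
    have mu: "L2_fun (moll i u)" for i by (rule moll_L2(1)[OF u])
    have [measurable]: "moll i u \<in> borel_measurable borel" for i by (rule L2_measurable[OF mu])
    have [measurable]: "d k \<in> borel_measurable borel" for k unfolding d_def[abs_def] by measurable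
    have dL: "L2_fun (d k)" for k unfolding d_def[abs_def] by (rule L2_diff(1)[OF mu mu])
    have sup: "norm (d k x) \<le> C0 * sqrt (2 ^ (j + k)) * sqrt G" for k x
      unfolding d_def G_def by (rule C0(2)[OF g u])
    have ml: "mass (d k) \<le> (C0 / 2 ^ (j + k) * sqrt G)\<^sup>2" for k
      using C0(3)[OF g u, of "j + k"] by (simp add: d_def[abs_def] G_def sqrt_le_D)
    have di: "integrable lborel (\<lambda>x. norm (d k x) powr t)" for k by (rule pw_le_sup_mass(1)[OF dL sup t(1)])
    have dp: "pw t (d k) \<le> C0 powr t * 2 powr (- \<beta> * real (j + k)) * G powr (t / 2)" for k
    proof -
      have "pw t (d k) \<le> (C0 * sqrt (2 ^ (j + k)) * sqrt G) powr (t - 2) * mass (d k)"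
        by (rule pw_le_sup_mass(2)[OF dL sup t(1)])
      also have "\<dots> \<le> (C0 * sqrt (2 ^ (j + k)) * sqrt G) powr (t - 2) * (C0 / 2 ^ (j + k) * sqrt G)\<^sup>2"
        by (intro mult_left_mono ml) simp
      also have "\<dots> = C0 powr t * 2 powr (- \<beta> * real (j + k)) * G powr (t / 2)"
        unfolding \<beta>_def using C0(1) t by (intro moll_step_pw) (auto simp: G_def)
      finally show ?thesis .
    qed
    have W: "(\<Sum>k<n. w k) \<le> 1"
    proof -
      have "(\<Sum>k<n. w k) = 1 - \<rho> ^ n" unfolding w_def sum_distrib_left[symmetric]
        using \<rho> by (subst one_diff_power_eq) simp
      then show ?thesis using \<rho> by simp
    qed
    have tele: "moll j u x - moll N u x = (\<Sum>k<n. d k x)" for x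
    proof -
      have "(\<Sum>k<m. d k x) = moll j u x - moll (j + m) u x" for m
        by (induction m) (auto simp: d_def)
      then show ?thesis using jN by (simp add: n_def)
    qed
    have pt: "norm (moll j u x - moll N u x) powr t \<le> (\<Sum>k<n. w k powr (- t) * norm (d k x) powr t)" for x
    proof -
      have "norm (moll j u x - moll N u x) powr t \<le> (\<Sum>k<n. norm (d k x)) powr t"
        unfolding tele using t by (intro powr_mono2 norm_sum) auto
      also have "\<dots> \<le> (\<Sum>k<n. (norm (d k x) / w k) powr t)"
        using w0 W t by (intro sum_powr_weights) auto
      also have "\<dots> = (\<Sum>k<n. w k powr (- t) * norm (d k x) powr t)"
        using w0 by (intro sum.cong refl) (simp add: powr_divide powr_minus_divide less_imp_le)
      finally show ?thesis .
    qed
    have i: "integrable lborel (\<lambda>x. \<Sum>k<n. w k powr (- t) * norm (d k x) powr t)" using di by auto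
    have j: "integrable lborel (\<lambda>x. norm (moll j u x - moll N u x) powr t)"
      by (rule Bochner_Integration.integrable_bound[OF i]) (use pt in \<open>auto intro!: AE_I2 intro: order_trans[OF _ abs_ge_self]\<close>)
    have "pw t (\<lambda>x. moll j u x - moll N u x) \<le> (\<integral>x. (\<Sum>k<n. w k powr (- t) * norm (d k x) powr t) \<partial>lborel)"
      unfolding pw_def by (rule integral_mono[OF j i pt])
    also have "\<dots> = (\<Sum>k<n. w k powr (- t) * pw t (d k))" using di by (simp add: pw_def)
    also have "\<dots> \<le> (\<Sum>k<n. ((1 - \<rho>) powr (- t) * C0 powr t * 2 powr (- \<beta> * real j) * G powr (t / 2)) * \<sigma> ^ k)"
    proof (rule sum_mono)
      fix k
      have e1: "w k powr (- t) = (1 - \<rho>) powr (- t) * (\<sigma> powr (- real k))"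
      proof -
        have "(\<rho> ^ k) powr (- t) = \<rho> powr (real k * (- t))" using \<rho> by (simp add: powr_realpow[symmetric] powr_powr)
        also have "\<dots> = (\<rho> powr t) powr (- real k)" by (simp add: powr_powr mult.commute)
        finally show ?thesis using \<rho> by (simp add: w_def powr_mult \<rho>t)
      qed
      have e2: "(2::real) powr (- \<beta> * real (j + k)) = 2 powr (- \<beta> * real j) * \<sigma> powr (2 * real k)"
        unfolding \<sigma>_def powr_powr powr_add[symmetric] by (simp add: field_simps)
      have "w k powr (- t) * pw t (d k) \<le> w k powr (- t) * (C0 powr t * 2 powr (- \<beta> * real (j + k)) * G powr (t / 2))"
        by (intro mult_left_mono dp) simp
      also have "\<dots> = (1 - \<rho>) powr (- t) * C0 powr t * 2 powr (- \<beta> * real j) * G powr (t / 2) * (\<sigma> powr (- real k) * \<sigma> powr (2 * real k))"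
        unfolding e1 e2 by (simp add: mult_ac)
      also have "\<sigma> powr (- real k) * \<sigma> powr (2 * real k) = \<sigma> ^ k"
        unfolding powr_add[symmetric] using \<sigma> by (simp add: powr_realpow)
      finally show "w k powr (- t) * pw t (d k) \<le> ((1 - \<rho>) powr (- t) * C0 powr t * 2 powr (- \<beta> * real j) * G powr (t / 2)) * \<sigma> ^ k" .
    qed
    also have "\<dots> = ((1 - \<rho>) powr (- t) * C0 powr t * 2 powr (- \<beta> * real j) * G powr (t / 2)) * (\<Sum>k<n. \<sigma> ^ k)"
      by (simp add: sum_distrib_left)
    also have "\<dots> \<le> ((1 - \<rho>) powr (- t) * C0 powr t * 2 powr (- \<beta> * real j) * G powr (t / 2)) * (1 / (1 - \<sigma>))"
    proof (rule mult_left_mono)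
      have "(\<Sum>k<n. \<sigma> ^ k) \<le> (\<Sum>k. \<sigma> ^ k)" using \<sigma> by (intro sum_le_suminf summable_geometric) auto
      then show "(\<Sum>k<n. \<sigma> ^ k) \<le> 1 / (1 - \<sigma>)" using \<sigma> by (simp add: suminf_geometric)
    qed simp
    also have "\<dots> = C * 2 powr (- \<beta> * real j) * G powr (t / 2)" by (simp add: C_def)
    finally show "integrable lborel (\<lambda>x. norm (moll j u x - moll N u x) powr t) \<and>
       pw t (\<lambda>x. moll j u x - moll N u x) \<le> C * 2 powr (- ((6 - t) / 2) * real j) * (mass g) powr (t / 2)"
      using j by (simp add: \<beta>_def G_def)
  qed
qed

text \<open>The geometric decay is split in two by s = sqrt \<theta>. One half makes the sum of the
  rescaled integrals finite, so the rescaled increments are bounded at almost every point; the other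
  half then makes the increments summable there.\<close>

lemma fast_cauchy_AE_convergent:
  fixes f :: "nat \<Rightarrow> R3 \<Rightarrow> 'a::euclidean_space"
  assumes m[measurable]: "\<And>n. f n \<in> borel_measurable borel"
    and i: "\<And>n. integrable lborel (\<lambda>x. norm (f (Suc n) x - f n x) powr t)"
    and b: "\<And>n. pw t (\<lambda>x. f (Suc n) x - f n x) \<le> B * \<theta> ^ n"
    and t: "0 < t" and \<theta>: "0 < \<theta>" "\<theta> < 1"
  shows "AE x in lborel. convergent (\<lambda>n. f n x)"
proof -
  define s where "s = sqrt \<theta>"
  have s: "0 < s" "s < 1" "s * s = \<theta>" using \<theta> by (auto simp: s_def)
  have B0: "0 \<le> B" using order_trans[OF pw_nonneg b[of 0]] by simp
  define h where "h n x = (1 / s ^ n) * norm (f (Suc n) x - f n x) powr t" for n x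
  have [measurable]: "h n \<in> borel_measurable borel" for n unfolding h_def[abs_def] by measurable
  have "(\<integral>\<^sup>+x. (\<Sum>n. ennreal (h n x)) \<partial>lborel) = (\<Sum>n. \<integral>\<^sup>+x. ennreal (h n x) \<partial>lborel)"
    by (rule nn_integral_suminf) simp
  also have "\<dots> \<le> (\<Sum>n. ennreal (B * s ^ n))"
  proof (intro suminf_le)
    fix n
    have "(\<integral>\<^sup>+x. ennreal (h n x) \<partial>lborel) = ennreal ((1 / s ^ n) * pw t (\<lambda>x. f (Suc n) x - f n x))"
      unfolding pw_def integral_mult_right_zero[symmetric] h_def
      using i s by (intro nn_integral_eq_integral) (auto intro!: integrable_mult_right)
    also have "\<dots> \<le> ennreal (B * s ^ n)"
    proof (rule ennreal_leI)
      have "(1 / s ^ n) * pw t (\<lambda>x. f (Suc n) x - f n x) \<le> (1 / s ^ n) * (B * \<theta> ^ n)"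
        using s by (intro mult_left_mono b) auto
      also have "\<dots> = B * s ^ n" using s by (simp add: s(3)[symmetric] power_mult_distrib)
      finally show "(1 / s ^ n) * pw t (\<lambda>x. f (Suc n) x - f n x) \<le> B * s ^ n" .
    qed
    finally show "(\<integral>\<^sup>+x. ennreal (h n x) \<partial>lborel) \<le> ennreal (B * s ^ n)" .
  qed auto
  also have "\<dots> = ennreal (\<Sum>n. B * s ^ n)"
    using s B0 by (intro suminf_ennreal2 summable_mult summable_geometric) auto
  finally have "(\<integral>\<^sup>+x. (\<Sum>n. ennreal (h n x)) \<partial>lborel) \<noteq> \<infinity>" by (auto simp: top_unique)
  then have "AE x in lborel. (\<Sum>n. ennreal (h n x)) \<noteq> \<infinity>" by (intro nn_integral_PInf_AE) auto
  then show ?thesis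
  proof eventually_elim
    case (elim x)
    have h0: "0 \<le> h n x" for n using s by (simp add: h_def)
    have sm: "summable (\<lambda>n. h n x)" using elim h0 by (intro summable_suminf_not_top) auto
    then have "(\<lambda>n. h n x) \<longlonglongrightarrow> 0" by (rule summable_LIMSEQ_zero)
    then obtain M where M: "\<And>n. h n x \<le> M" using convergent_imp_Bseq[of "\<lambda>n. h n x"]
      by (auto simp: convergent_def Bseq_def) (metis abs_le_D1)
    have M0: "0 \<le> M" using h0[of 0] M[of 0] by simp
    have "norm (f (Suc n) x - f n x) \<le> M powr (1/t) * (s powr (1/t)) ^ n" for n
    proof -
      have "norm (f (Suc n) x - f n x) powr t \<le> M * s ^ n" using M[of n] s by (simp add: h_def divide_le_eq)
      then have "(norm (f (Suc n) x - f n x) powr t) powr (1/t) \<le> (M * s ^ n) powr (1/t)"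
        using t by (intro powr_mono2) auto
      also have "\<dots> = M powr (1/t) * (s powr (1/t)) ^ n"
        using M0 s by (simp add: powr_mult powr_power powr_realpow[symmetric] powr_powr mult.commute)
      finally show ?thesis using t by (simp add: powr_powr)
    qed
    moreover have "s powr (1/t) < 1" using powr_less_mono2[of "1/t" s 1] s t by simp
    ultimately have "summable (\<lambda>n. f (Suc n) x - f n x)"
      by (intro summable_comparison_test'[OF summable_mult[OF summable_geometric]]) auto
    then have "convergent (\<lambda>n. \<Sum>k<n. f (Suc k) x - f k x)" by (simp add: summable_iff_convergent)
    then have "convergent (\<lambda>n. f n x - f 0 x)" by (subst (asm) sum_lessThan_telescope)
    then show ?case by (simp add: convergent_diff_const_right_iff)
  qed
qed

text \<open>The increments decay geometrically in L^2, so an almost everywhere limit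
  \<open>v\<close> exists. It is identified with \<open>u\<close> by comparing integrals over boxes,
  where both are limits of the same sequence.\<close>

lemma moll_AE_tendsto:
  assumes g: "is_weak_gradient u g" and u: "L2_fun u"
  shows "AE x in lborel. (\<lambda>j. moll j u x) \<longlonglongrightarrow> u x"
proof -
  obtain C where C: "C > 0"
    "\<And>u g j N. is_weak_gradient u g \<Longrightarrow> L2_fun u \<Longrightarrow> j \<le> N \<Longrightarrow>
       integrable lborel (\<lambda>x. norm (moll j u x - moll N u x) powr 2) \<and>
       pw 2 (\<lambda>x. moll j u x - moll N u x) \<le> C * 2 powr (- ((6 - 2) / 2) * real j) * (mass g) powr (2 / 2)"
    using moll_partial[of 2] by auto
  have e: "(2::real) powr (- ((6 - 2) / 2) * real j) = (1/4) ^ j" for j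
  proof -
    have "(2::real) powr (- ((6 - 2) / 2) * real j) = (2 powr (-2)) powr (real j)" by (simp add: powr_powr)
    also have "(2::real) powr (-2) = 1/4" by (simp add: powr_minus)
    finally show ?thesis by (simp add: powr_realpow)
  qed
  define B where "B = C * (mass g) powr 1"
  have P: "integrable lborel (\<lambda>x. (norm (moll j u x - moll N u x))\<^sup>2)" 
    "mass (\<lambda>x. moll j u x - moll N u x) \<le> B * (1/4) ^ j" if "j \<le> N" for j N
    using C(2)[OF g u that] unfolding pw_2 e by (auto simp: powr_numeral B_def mult_ac)
  have mu: "L2_fun (moll i u)" for i by (rule moll_L2(1)[OF u])
  note [measurable] = L2_measurable[OF mu] L2_measurable[OF u]
  have conv: "AE x in lborel. convergent (\<lambda>n. moll n u x)"
  proof (rule fast_cauchy_AE_convergent[where t=2 and \<theta>="1/4" and B=B])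
    show "integrable lborel (\<lambda>x. norm (moll (Suc n) u x - moll n u x) powr 2)" for n
      using P(1)[of n "Suc n"] by (simp add: powr_numeral norm_minus_commute)
    show "pw 2 (\<lambda>x. moll (Suc n) u x - moll n u x) \<le> B * (1 / 4) ^ n" for n
      unfolding pw_2[symmetric] pw_diff_commute[of _ "moll (Suc n) u"] using P(2)[of n "Suc n"] by (simp add: pw_2)
  qed auto
  define v where "v x = lim (\<lambda>n. moll n u x)" for x
  have [measurable]: "v \<in> borel_measurable borel" unfolding v_def[abs_def] by measurable
  have lv: "AE x in lborel. (\<lambda>j. moll j u x) \<longlonglongrightarrow> v x"
    using conv by eventually_elim (simp add: v_def convergent_LIMSEQ_iff)
  have F: "integrable lborel (\<lambda>x. (norm (moll j u x - v x))\<^sup>2)" "mass (\<lambda>x. moll j u x - v x) \<le> B * (1/4) ^ j" for j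
  proof -
    have l: "AE x in lborel. (\<lambda>n. (norm (moll j u x - moll (j + n) u x))\<^sup>2) \<longlonglongrightarrow> (norm (moll j u x - v x))\<^sup>2"
      using lv
    proof eventually_elim
      case (elim x)
      have "(\<lambda>n. moll (j + n) u x) \<longlonglongrightarrow> v x"
        using LIMSEQ_ignore_initial_segment[OF elim, of j] by (simp add: add.commute)
      then show ?case by (intro tendsto_intros)
    qed
    show "integrable lborel (\<lambda>x. (norm (moll j u x - v x))\<^sup>2)"
      by (rule fatou_bound(1)[OF l P(1), where B="B * (1/4) ^ j"]) (use P(2) in \<open>auto simp: mass_def\<close>)
    show "mass (\<lambda>x. moll j u x - v x) \<le> B * (1/4) ^ j"
      unfolding mass_def by (rule fatou_bound(2)[OF l P(1)]) (use P(2) in \<open>auto simp: mass_def\<close>)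
  qed
  have L: "L2_fun (\<lambda>x. moll j u x - v x)" for j by (rule L2_funI) (auto simp: F)
  have vL: "L2_fun v" using L2_diff(1)[OF mu[of 0] L[of 0]] by simp
  have vu: "set_lebesgue_integral lborel (box a b) v = set_lebesgue_integral lborel (box a b) u" for a b
  proof (rule LIMSEQ_unique[OF _ moll_box_tendsto[OF u]])
    define Q where "Q x = (indicator (box a b) x :: real)" for x :: R3
    have [measurable]: "Q \<in> borel_measurable borel" unfolding Q_def[abs_def] by simp
    have Qsq: "(Q x)\<^sup>2 = Q x" for x by (simp add: Q_def indicator_def)
    have Q: "L2_fun Q"
    proof (rule L2_funI)
      have "(\<lambda>x. (norm (Q x))\<^sup>2) = Q" by (simp add: Qsq)
      then show "integrable lborel (\<lambda>x. (norm (Q x))\<^sup>2)"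
        using emeasure_lborel_box_finite[of a b] by (simp add: Q_def[abs_def])
    qed simp
    have "(\<lambda>j. sqrt (mass Q) * sqrt (B * (1/4) ^ j)) \<longlonglongrightarrow> sqrt (mass Q) * sqrt (B * 0)"
      by (intro tendsto_intros LIMSEQ_power_zero) simp
    then have z: "(\<lambda>j. sqrt (mass Q) * sqrt (B * (1/4) ^ j)) \<longlonglongrightarrow> 0" by simp
    have "(\<lambda>j. set_lebesgue_integral lborel (box a b) (moll j u) - set_lebesgue_integral lborel (box a b) v) \<longlonglongrightarrow> 0"
    proof (rule Lim_null_comparison[OF always_eventually[OF allI] z])
      fix j
      have "set_lebesgue_integral lborel (box a b) (moll j u) - set_lebesgue_integral lborel (box a b) v
          = (\<integral>x. Q x *\<^sub>R (moll j u x - v x) \<partial>lborel)"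
        using set_integral_diff(2)[OF L2_set_integrable_box[OF mu, of a b j] L2_set_integrable_box[OF vL, of a b]]
        by (simp add: set_lebesgue_integral_def Q_def)
      also have "norm \<dots> \<le> 1 * (sqrt (mass Q) * sqrt (mass (\<lambda>x. moll j u x - v x)))"
        by (rule L2_dominated_product(2)[OF Q L]) auto
      also have "\<dots> \<le> sqrt (mass Q) * sqrt (B * (1/4) ^ j)" using F(2) by (auto intro!: mult_left_mono)
      finally show "norm (set_lebesgue_integral lborel (box a b) (moll j u) - set_lebesgue_integral lborel (box a b) v)
         \<le> sqrt (mass Q) * sqrt (B * (1/4) ^ j)" .
    qed
    then show "(\<lambda>j. set_lebesgue_integral lborel (box a b) (moll j u)) \<longlonglongrightarrow> set_lebesgue_integral lborel (box a b) v"
      by (rule LIM_zero_cancel)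
  qed
  have "AE x in lborel. v x - u x = 0"
  proof (rule AE_zero_if_box_integrals_zero)
    show "set_integrable lborel (box a b) (\<lambda>x. v x - u x)" for a b
      by (rule L2_set_integrable_box[OF L2_diff(1)[OF vL u]])
    show "set_lebesgue_integral lborel (box a b) (\<lambda>x. v x - u x) = 0" for a b
      using set_integral_diff(2)[OF L2_set_integrable_box[OF vL, of a b] L2_set_integrable_box[OF u, of a b]] vu
      by simp
  qed measurable
  with lv show ?thesis by eventually_elim simp
qed

text \<open>The finer scale in \<open>moll_partial\<close> goes to infinity by Fatou's lemma. The
  rate in \<open>j\<close> depends on \<open>u\<close> only through its gradient, which later gives
  compactness.\<close>

lemma moll_error:
  assumes t: "2 \<le> t" "t < 6"
  obtains C where "C > 0"
    "\<And>u g j. is_weak_gradient u g \<Longrightarrow> L2_fun u \<Longrightarrow>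
       integrable lborel (\<lambda>x. norm (moll j u x - u x) powr t) \<and>
       pw t (\<lambda>x. moll j u x - u x) \<le> C * 2 powr (- ((6 - t) / 2) * real j) * (mass g) powr (t / 2)"
proof -
  obtain C where C: "C > 0"
    "\<And>u g j N. is_weak_gradient u g \<Longrightarrow> L2_fun u \<Longrightarrow> j \<le> N \<Longrightarrow>
       integrable lborel (\<lambda>x. norm (moll j u x - moll N u x) powr t) \<and>
       pw t (\<lambda>x. moll j u x - moll N u x) \<le> C * 2 powr (- ((6 - t) / 2) * real j) * (mass g) powr (t / 2)"
    using moll_partial[OF t] by auto
  show ?thesis
  proof (rule that[OF C(1)])
    fix u g j assume g: "is_weak_gradient u g" and u: "L2_fun u"
    note P = C(2)[OF g u, of j "j + n" for n]
    have [measurable]: "u \<in> borel_measurable borel" "moll i u \<in> borel_measurable borel" for i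
      using L2_measurable[OF u] L2_measurable[OF moll_L2(1)[OF u]] by auto
    have l: "AE x in lborel. (\<lambda>n. norm (moll j u x - moll (j + n) u x) powr t) \<longlonglongrightarrow> norm (moll j u x - u x) powr t"
      using moll_AE_tendsto[OF g u]
    proof eventually_elim
      case (elim x)
      have "(\<lambda>n. moll (j + n) u x) \<longlonglongrightarrow> u x"
        using LIMSEQ_ignore_initial_segment[OF elim, of j] by (simp add: add.commute)
      then show ?case using t by (intro tendsto_powr' tendsto_intros) auto
    qed
    have "integrable lborel (\<lambda>x. norm (moll j u x - u x) powr t)"
      by (rule fatou_bound(1)[OF l, where B="C * 2 powr (- ((6 - t) / 2) * real j) * (mass g) powr (t / 2)"])
        (use P in \<open>auto simp: pw_def\<close>)
    moreover have "pw t (\<lambda>x. moll j u x - u x) \<le> C * 2 powr (- ((6 - t) / 2) * real j) * (mass g) powr (t / 2)"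
      unfolding pw_def by (rule fatou_bound(2)[OF l]) (use P in \<open>auto simp: pw_def\<close>)
    ultimately show "integrable lborel (\<lambda>x. norm (moll j u x - u x) powr t) \<and>
       pw t (\<lambda>x. moll j u x - u x) \<le> C * 2 powr (- ((6 - t) / 2) * real j) * (mass g) powr (t / 2)" ..
  qed
qed

text \<open>Write \<open>u\<close> as its mollification at scale 0, bounded in terms of the mass,
  minus the mollification error, bounded in terms of the gradient.\<close>

lemma GN_inhomogeneous:
  assumes t: "2 \<le> t" "t < 6"
  obtains C where "C > 0"
    "\<And>u g. is_weak_gradient u g \<Longrightarrow> L2_fun u \<Longrightarrow>
       integrable lborel (\<lambda>x. norm (u x) powr t) \<and> pw t u \<le> C * (mass u + mass g) powr (t / 2)"
proof -
  obtain C where C: "C > 0"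
    "\<And>u g j. is_weak_gradient u g \<Longrightarrow> L2_fun u \<Longrightarrow>
       integrable lborel (\<lambda>x. norm (moll j u x - u x) powr t) \<and>
       pw t (\<lambda>x. moll j u x - u x) \<le> C * 2 powr (- ((6 - t) / 2) * real j) * (mass g) powr (t / 2)"
    using moll_error[OF t] by auto
  define M where "M = (sqrt (mass (eta_j 0))) powr (t - 2)"
  show ?thesis
  proof (rule that[of "2 powr t * (M + C)"])
    show "2 powr t * (M + C) > 0" using C by (simp add: M_def add_nonneg_pos)
  next
    fix u g assume g: "is_weak_gradient u g" and u: "L2_fun u"
    have [measurable]: "u \<in> borel_measurable borel" "moll 0 u \<in> borel_measurable borel"
      using L2_measurable[OF u] L2_measurable[OF moll_L2(1)[OF u]] by auto
    have s: "norm (moll 0 u x) \<le> sqrt (mass (eta_j 0)) * sqrt (mass u)" for x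
      unfolding moll_def by (rule conv_sup(1)[OF test_function_integrable(3)[OF test_eta_j] u])
    note m = pw_le_sup_mass[OF moll_L2(1)[OF u] s t(1)]
    note e = C(2)[OF g u, of 0]
    have S: "sqrt (mass u) powr (t - 2) * mass u = mass u powr (t / 2)"
    proof (cases "mass u = 0")
      case False
      then have p: "mass u > 0" using mass_nonneg[of u] by linarith
      have "sqrt (mass u) powr (t - 2) * mass u = mass u powr (1/2 * (t - 2) + 1)"
        using p unfolding powr_add by (simp add: powr_half_sqrt[symmetric] powr_powr)
      also have "1/2 * (t - 2) + 1 = t / 2" by (simp add: diff_divide_distrib)
      finally show ?thesis .
    qed simp
    have "integrable lborel (\<lambda>x. norm (moll 0 u x - (moll 0 u x - u x)) powr t)"
      by (rule pw_integrable_diff(1)[OF m(1)]) (use e t in auto)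
    then have i: "integrable lborel (\<lambda>x. norm (u x) powr t)" by simp
    have "pw t (\<lambda>x. moll 0 u x - (moll 0 u x - u x)) \<le> 2 powr t * (pw t (moll 0 u) + pw t (\<lambda>x. moll 0 u x - u x))"
      by (rule pw_integrable_diff(2)[OF m(1)]) (use e t in auto)
    also have "\<dots> \<le> 2 powr t * (M * mass u powr (t / 2) + C * mass g powr (t / 2))"
    proof (intro mult_left_mono add_mono)
      have "pw t (moll 0 u) \<le> (sqrt (mass (eta_j 0)) * sqrt (mass u)) powr (t - 2) * mass u"
        by (rule order_trans[OF m(2) mult_left_mono[OF moll_L2(2)[OF u]]]) simp
      then show "pw t (moll 0 u) \<le> M * mass u powr (t / 2)"
        by (simp add: M_def powr_mult S[symmetric] mult.assoc)
      show "pw t (\<lambda>x. moll 0 u x - u x) \<le> C * mass g powr (t / 2)" using e by simp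
    qed simp
    also have "\<dots> \<le> 2 powr t * (M * (mass u + mass g) powr (t / 2) + C * (mass u + mass g) powr (t / 2))"
      using t C(1) by (intro mult_left_mono add_mono powr_mono2) (auto simp: M_def)
    also have "\<dots> = 2 powr t * (M + C) * (mass u + mass g) powr (t / 2)" by (simp add: algebra_simps)
    finally show "integrable lborel (\<lambda>x. norm (u x) powr t) \<and> pw t u \<le> 2 powr t * (M + C) * (mass u + mass g) powr (t / 2)"
      using i by simp
  qed
qed

section \<open>The space $H^1$ and dilations\<close>

abbreviation kin :: "(R3 \<Rightarrow> complex) \<Rightarrow> real" where "kin u \<equiv> mass (wgrad u)"

lemma H1_I: "L2_fun u \<Longrightarrow> is_weak_gradient u g \<Longrightarrow> u \<in> H1" by (auto simp: H1_def)
lemma H1_L2: "u \<in> H1 \<Longrightarrow> L2_fun u" by (simp add: H1_def)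
lemma H1_measurable: "u \<in> H1 \<Longrightarrow> u \<in> borel_measurable borel" by (simp add: H1_L2 L2_measurable)
lemma wgrad_L2: "u \<in> H1 \<Longrightarrow> L2_fun (wgrad u)" by (rule is_weak_gradient_L2[OF wgrad_weak_gradient])

lemma kin_eq:
  assumes "is_weak_gradient u g" shows "kin u = mass g"
proof (rule mass_cong_AE)
  show "AE x in lborel. wgrad u x = g x" by (rule wgrad_unique[OF assms])
  have "is_weak_gradient u (wgrad u)" unfolding wgrad_def using assms someI[of "is_weak_gradient u"] by blast
  then show "wgrad u \<in> borel_measurable borel" by (intro L2_measurable is_weak_gradient_L2)
  show "g \<in> borel_measurable borel" using assms by (intro L2_measurable is_weak_gradient_L2)
qed

lemma weak_gradient_pairings:
  fixes u :: "R3 \<Rightarrow> complex" and g :: "R3 \<Rightarrow> complex ^ 3"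
  assumes u: "L2_fun u" and g: "L2_fun g" and \<phi>: "test_function \<phi>"
  shows "integrable lborel (\<lambda>x. u x * complex_of_real (pderiv_R3 i \<phi> x))"
    and "integrable lborel (\<lambda>x. g x $ i * complex_of_real (\<phi> x))"
proof -
  note P = pderiv_L2[OF \<phi>, of i] and F = test_function_integrable(3)[OF \<phi>] and G = L2_component(1)[OF g, of i]
  note [measurable] = L2_measurable[OF P] L2_measurable[OF F] L2_measurable[OF u] L2_measurable[OF G]
  show "integrable lborel (\<lambda>x. u x * complex_of_real (pderiv_R3 i \<phi> x))"
    by (rule L2_dominated_product(1)[OF u P, where C=1]) (auto simp: norm_mult)
  show "integrable lborel (\<lambda>x. g x $ i * complex_of_real (\<phi> x))"
    by (rule L2_dominated_product(1)[OF G F, where C=1]) (auto simp: norm_mult)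
qed

lemma is_weak_gradient_diff:
  assumes "is_weak_gradient u g" "is_weak_gradient v h" "L2_fun u" "L2_fun v"
  shows "is_weak_gradient (\<lambda>x. u x - v x) (\<lambda>x. g x - h x)"
  unfolding is_weak_gradient_def
proof (intro conjI allI impI)
  note L = is_weak_gradient_L2[OF assms(1)] is_weak_gradient_L2[OF assms(2)]
  show "L2_fun (\<lambda>x. g x - h x)" by (rule L2_diff(1)[OF L])
  fix \<phi> i assume \<phi>: "test_function \<phi>"
  note I = weak_gradient_pairings[OF assms(3) L(1) \<phi>, of i] weak_gradient_pairings[OF assms(4) L(2) \<phi>, of i]
  show "(\<integral>x. (u x - v x) * complex_of_real (pderiv_R3 i \<phi> x) \<partial>lborel)
     = - (\<integral>x. (g x - h x) $ i * complex_of_real (\<phi> x) \<partial>lborel)"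
    using assms(1,2) \<phi> I by (simp add: left_diff_distrib is_weak_gradient_def)
qed

lemma H1_diff:
  assumes "u \<in> H1" "v \<in> H1"
  shows "(\<lambda>x. u x - v x) \<in> H1"
    and "is_weak_gradient (\<lambda>x. u x - v x) (\<lambda>x. wgrad u x - wgrad v x)"
    and "AE x in lborel. wgrad (\<lambda>x. u x - v x) x = wgrad u x - wgrad v x"
    and "kin (\<lambda>x. u x - v x) = mass (\<lambda>x. wgrad u x - wgrad v x)"
proof -
  show w: "is_weak_gradient (\<lambda>x. u x - v x) (\<lambda>x. wgrad u x - wgrad v x)"
    by (intro is_weak_gradient_diff wgrad_weak_gradient assms H1_L2)
  show "(\<lambda>x. u x - v x) \<in> H1" by (rule H1_I[OF L2_diff(1)[OF H1_L2 H1_L2] w]) fact+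
  show "AE x in lborel. wgrad (\<lambda>x. u x - v x) x = wgrad u x - wgrad v x" by (rule wgrad_unique[OF w])
  show "kin (\<lambda>x. u x - v x) = mass (\<lambda>x. wgrad u x - wgrad v x)" by (rule kin_eq[OF w])
qed

lemma H1_norm_eq: "H1_norm u = sqrt (kin u + mass u)"
  by (simp add: H1_norm_def mass_def)

lemma exp_cubed: "exp s ^ 3 = exp (3 * s)" for s :: real
  by (simp add: exp_of_nat_mult[symmetric])

lemma dilate_alt: "dilate s u = (\<lambda>x. exp (3 * s / 2) *\<^sub>R u (0 + exp s *\<^sub>R x))"
  by (simp add: dilate_def fun_eq_iff scaleR_conv_of_real)

lemma norm_dilate: "norm (dilate s u x) = exp (3 * s / 2) * norm (u (exp s *\<^sub>R x))"
  by (simp add: dilate_def norm_mult)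

lemma dilate_0: "dilate 0 u = u" by (rule ext) (simp add: dilate_def)

lemma L2_dilate: "L2_fun u \<Longrightarrow> L2_fun (dilate s u)"
  unfolding dilate_alt by (intro L2_scaleR(1) L2_affine) auto

lemma mass_dilate:
  assumes "L2_fun u" shows "mass (dilate s u) = mass u"
proof -
  have "mass (dilate s u) = (exp (3 * s / 2))\<^sup>2 * (mass u / \<bar>exp s\<bar> ^ 3)"
    unfolding dilate_alt by (simp only: mass_scaleR[OF L2_affine[OF _ assms]] exp_not_eq_zero mass_affine not_False_eq_True)
  then show ?thesis by (simp add: exp_cubed flip: exp_double)
qed

lemma pw_affine: "c \<noteq> 0 \<Longrightarrow> pw t (\<lambda>x. f (y + c *\<^sub>R x)) = pw t f / \<bar>c\<bar> ^ 3"
  using integral_affine[of c "\<lambda>x. norm (f x) powr t" y] by (simp add: pw_def divide_inverse mult.commute)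

lemma pw_dilate: "pw t (dilate s u) = exp (3 * s * (t - 2) / 2) * pw t u"
proof -
  have "pw t (dilate s u) = exp (3 * s / 2) powr t * pw t (\<lambda>x. u (0 + exp s *\<^sub>R x))"
    unfolding pw_def norm_dilate by (simp add: powr_mult)
  also have "\<dots> = exp (3 * s / 2) powr t * (pw t u / exp (3 * s))"
    by (subst pw_affine) (simp_all add: exp_cubed)
  also have "exp (3 * s / 2) powr t = exp (3 * s * (t - 2) / 2) * exp (3 * s)"
    unfolding exp_add[symmetric] by (simp add: powr_def field_simps)
  finally show ?thesis by simp
qed

text \<open>Change of variables, after transporting the test function by the inverse
  dilation.\<close>

lemma is_weak_gradient_dilate:
  assumes g: "is_weak_gradient u g"
  shows "is_weak_gradient (dilate s u) (\<lambda>x. (exp s * exp (3 * s / 2)) *\<^sub>R g (0 + exp s *\<^sub>R x))"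
  unfolding is_weak_gradient_def
proof (intro conjI allI impI)
  show "L2_fun (\<lambda>x. (exp s * exp (3 * s / 2)) *\<^sub>R g (0 + exp s *\<^sub>R x))"
    by (intro L2_scaleR(1) L2_affine is_weak_gradient_L2[OF g]) simp
  fix \<phi> i assume \<phi>: "test_function \<phi>"
  define \<phi>' where "\<phi>' y = \<phi> (0 + exp (- s) *\<^sub>R y)" for y
  have \<phi>': "test_function \<phi>'" unfolding \<phi>'_def[abs_def] by (rule test_function_affine[OF \<phi>]) simp
  have pd: "pderiv_R3 i \<phi>' (exp s *\<^sub>R x) = exp (- s) * pderiv_R3 i \<phi> x" for x
    unfolding \<phi>'_def[abs_def] by (subst pderiv_affine(1)[OF test_function_differentiable[OF \<phi>]]) (simp flip: exp_add)
  have p: "pderiv_R3 i \<phi> x = exp s * pderiv_R3 i \<phi>' (exp s *\<^sub>R x)" for x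
    unfolding pd by (simp add: mult.assoc[symmetric] exp_add[symmetric])
  have ph: "\<phi>' (exp s *\<^sub>R x) = \<phi> x" for x by (simp add: \<phi>'_def flip: exp_add)
  have eq: "(\<integral>x. u x * complex_of_real (pderiv_R3 i \<phi>' x) \<partial>lborel) = - (\<integral>x. g x $ i * complex_of_real (\<phi>' x) \<partial>lborel)"
    using g \<phi>' by (simp add: is_weak_gradient_def)
  have "(\<integral>x. dilate s u x * complex_of_real (pderiv_R3 i \<phi> x) \<partial>lborel)
     = (\<integral>x. (exp (3 * s / 2) * exp s) *\<^sub>R (u (0 + exp s *\<^sub>R x) * complex_of_real (pderiv_R3 i \<phi>' (0 + exp s *\<^sub>R x))) \<partial>lborel)"
    unfolding dilate_alt p by (intro Bochner_Integration.integral_cong refl) (simp add: scaleR_conv_of_real mult_ac)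
  also have "\<dots> = (exp (3 * s / 2) * exp s) *\<^sub>R ((\<integral>x. u x * complex_of_real (pderiv_R3 i \<phi>' x) \<partial>lborel) /\<^sub>R \<bar>exp s\<bar> ^ 3)"
    unfolding integral_scaleR_right
    by (subst integral_affine[of "exp s" "\<lambda>x. u x * complex_of_real (pderiv_R3 i \<phi>' x)" 0]) simp_all
  also have "\<dots> = - ((exp (3 * s / 2) * exp s) *\<^sub>R ((\<integral>x. g x $ i * complex_of_real (\<phi>' x) \<partial>lborel) /\<^sub>R \<bar>exp s\<bar> ^ 3))"
    unfolding eq by simp
  also have "(exp (3 * s / 2) * exp s) *\<^sub>R ((\<integral>x. g x $ i * complex_of_real (\<phi>' x) \<partial>lborel) /\<^sub>R \<bar>exp s\<bar> ^ 3)
     = (\<integral>x. (exp (3 * s / 2) * exp s) *\<^sub>R (g (0 + exp s *\<^sub>R x) $ i * complex_of_real (\<phi>' (0 + exp s *\<^sub>R x))) \<partial>lborel)"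
    unfolding integral_scaleR_right
    by (subst integral_affine[of "exp s" "\<lambda>x. g x $ i * complex_of_real (\<phi>' x)" 0]) simp_all
  also have "\<dots> = (\<integral>x. ((exp s * exp (3 * s / 2)) *\<^sub>R g (0 + exp s *\<^sub>R x)) $ i * complex_of_real (\<phi> x) \<partial>lborel)"
    by (intro Bochner_Integration.integral_cong refl)
      (simp only: vector_scaleR_component add_0_left ph mult_scaleR_left mult.commute[of "exp s"])
  finally show "(\<integral>x. dilate s u x * complex_of_real (pderiv_R3 i \<phi> x) \<partial>lborel)
     = - (\<integral>x. ((exp s * exp (3 * s / 2)) *\<^sub>R g (0 + exp s *\<^sub>R x)) $ i * complex_of_real (\<phi> x) \<partial>lborel)" .
qed

lemma H1_dilate: "u \<in> H1 \<Longrightarrow> dilate s u \<in> H1"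
  by (rule H1_I[OF L2_dilate is_weak_gradient_dilate[OF wgrad_weak_gradient]]) (auto simp: H1_L2)

lemma kin_dilate:
  assumes u: "u \<in> H1" shows "kin (dilate s u) = exp (2 * s) * kin u"
proof -
  have "kin (dilate s u) = (exp s * exp (3 * s / 2))\<^sup>2 * (kin u / \<bar>exp s\<bar> ^ 3)"
    unfolding kin_eq[OF is_weak_gradient_dilate[OF wgrad_weak_gradient[OF u]]]
    by (simp only: mass_scaleR[OF L2_affine[OF _ wgrad_L2[OF u]]] exp_not_eq_zero mass_affine not_False_eq_True)
  then show ?thesis by (simp add: exp_cubed power_mult_distrib flip: exp_double)
qed

lemma H1_rad_dilate:
  assumes "u \<in> H1_rad" shows "dilate s u \<in> H1_rad"
  unfolding H1_rad_def
proof (intro CollectI conjI allI impI)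
  show "dilate s u \<in> H1" using assms by (auto simp: H1_rad_def intro: H1_dilate)
  fix R :: "R3 \<Rightarrow> R3" assume R: "orthogonal_transformation R"
  have "AE x in lborel. u (R x) = u x" using assms R by (auto simp: H1_rad_def)
  then have "AE x in lborel. u (R (0 + exp s *\<^sub>R x)) = u (0 + exp s *\<^sub>R x)"
    by (rule AE_affine) simp
  then show "AE x in lborel. dilate s u (R x) = dilate s u x"
    by eventually_elim (simp add: dilate_def linear_cmul[OF orthogonal_transformation_linear[OF R]])
qed

lemma H1_pw_integrable:
  assumes "u \<in> H1" "2 \<le> t" "t < 6" shows "integrable lborel (\<lambda>x. norm (u x) powr t)"
proof -
  obtain C where C: "C > 0" "\<And>u g. is_weak_gradient u g \<Longrightarrow> L2_fun u \<Longrightarrow>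
       integrable lborel (\<lambda>x. norm (u x) powr t) \<and> pw t u \<le> C * (mass u + mass g) powr (t / 2)"
    by (rule GN_inhomogeneous[OF assms(2,3)]) blast
  show ?thesis using C(2)[OF wgrad_weak_gradient[OF assms(1)] H1_L2[OF assms(1)]] by simp
qed

text \<open>Dilations keep the mass and rescale the other two quantities. The homogeneous form
  follows from the inhomogeneous one at the dilation for which mass and Dirichlet integral
  agree.\<close>

lemma GN:
  assumes t: "2 < t" "t < 6"
  obtains C where "C > 0"
    "\<And>u. u \<in> H1 \<Longrightarrow> pw t u \<le> C * mass u powr ((6 - t) / 4) * kin u powr (3 * (t - 2) / 4)"
proof -
  obtain C where C: "C > 0" "\<And>u g. is_weak_gradient u g \<Longrightarrow> L2_fun u \<Longrightarrow>
       integrable lborel (\<lambda>x. norm (u x) powr t) \<and> pw t u \<le> C * (mass u + mass g) powr (t / 2)"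
    by (rule GN_inhomogeneous[OF less_imp_le[OF t(1)] t(2)]) blast
  show ?thesis
  proof (rule that[of "C * 2 powr (t / 2)"])
    show "C * 2 powr (t / 2) > 0" using C by simp
  next
    fix u assume u: "u \<in> H1"
    define M where "M = mass u"
    define k where "k = kin u"
    have M0: "M \<ge> 0" "k \<ge> 0" by (auto simp: M_def k_def)
    have *: "exp (3 * s * (t - 2) / 2) * pw t u \<le> C * (M + exp (2 * s) * k) powr (t / 2)" for s
      using C(2)[OF wgrad_weak_gradient[OF H1_dilate[OF u, of s]] H1_L2[OF H1_dilate[OF u, of s]]]
      by (simp add: pw_dilate mass_dilate[OF H1_L2[OF u]] kin_dilate[OF u] M_def k_def)
    consider "M = 0" | "k = 0" | "M > 0" "k > 0" using M0 by linarith
    then have "pw t u \<le> C * 2 powr (t / 2) * M powr ((6 - t) / 4) * k powr (3 * (t - 2) / 4)"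
    proof cases
      case 1
      then have "AE x in lborel. u x = 0" using mass_eq_0[OF H1_L2[OF u]] by (simp add: M_def)
      then have "AE x in lborel. norm (u x) powr t = 0" by eventually_elim simp
      then have "pw t u = 0" unfolding pw_def using H1_measurable[OF u] by (subst integral_cong_AE[where g="\<lambda>x. 0"]) auto
      then show ?thesis using C by simp
    next
      case 2
      have "pw t u \<le> 0"
      proof (rule ccontr)
        assume "\<not> pw t u \<le> 0"
        then have p: "pw t u > 0" by simp
        define A where "A = C * M powr (t / 2)"
        \<comment> \<open>Chosen so that exp (3 s (t - 2) / 2) is at least 1 + A /
          \<open>pw t u\<close>; multiplied by \<open>pw t u\<close> this exceeds the bound
          A.\<close>
        define s where "s = 2 * (A / pw t u) / (3 * (t - 2))"
        have "1 + 3 * s * (t - 2) / 2 \<le> exp (3 * s * (t - 2) / 2)" by (rule exp_ge_add_one_self)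
        moreover have "3 * (2 * X / (3 * (t - 2))) * (t - 2) / 2 = X" for X using t by (simp add: field_simps)
        then have "3 * s * (t - 2) / 2 = A / pw t u" unfolding s_def .
        ultimately have "(1 + A / pw t u) * pw t u \<le> exp (3 * s * (t - 2) / 2) * pw t u" using p by (intro mult_right_mono) auto
        also have "\<dots> \<le> A" using *[of s] 2 by (simp add: A_def)
        also have "(1 + A / pw t u) * pw t u = pw t u + A" using p by (simp add: distrib_right)
        finally show False using p by simp
      qed
      then show ?thesis using 2 t by simp
    next
      case 3
      define s where "s = ln (M / k) / 2"
      have e: "exp (2 * s) = M / k" using 3 by (simp add: s_def)
      have e2: "exp (3 * s * (t - 2) / 2) = (M / k) powr (3 * (t - 2) / 4)"
        using 3 by (simp add: s_def powr_def field_simps)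
      have "(M / k) powr (3 * (t - 2) / 4) * pw t u \<le> C * (M + M) powr (t / 2)"
        using *[of s] 3 by (simp add: e e2)
      also have "(M + M) powr (t / 2) = 2 powr (t / 2) * M powr (t / 2)"
        using 3 by (simp add: powr_mult[symmetric])
      also have "M powr (t / 2) = M powr ((6 - t) / 4) * M powr (3 * (t - 2) / 4)"
        unfolding powr_add[symmetric] by (rule arg_cong[where f="\<lambda>s. M powr s"]) (simp add: field_simps)
      finally have "M powr (3 * (t - 2) / 4) * (pw t u) 
          \<le> M powr (3 * (t - 2) / 4) * (C * 2 powr (t / 2) * M powr ((6 - t) / 4) * k powr (3 * (t - 2) / 4))"
        using 3 by (simp add: powr_divide field_simps)
      then show ?thesis using 3 by simp
    qed
    then show "pw t u \<le> C * 2 powr (t / 2) * mass u powr ((6 - t) / 4) * kin u powr (3 * (t - 2) / 4)"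
      by (simp add: M_def k_def)
  qed
qed

lemma Lnorm_pw: "Lnorm t u = (pw t u) powr (1 / t)" by (simp add: Lnorm_def pw_def)

lemma Lnorm_2: "Lnorm 2 u = sqrt (mass u)" by (simp add: Lnorm_pw pw_2 powr_half_sqrt)

lemma pw_eq_0:
  assumes "integrable lborel (\<lambda>x. norm (u x) powr t)" "pw t u = 0"
  shows "AE x in lborel. u x = 0"
  using assms integral_nonneg_eq_0_iff_AE[of lborel "\<lambda>x. norm (u x) powr t"]
  by (simp add: pw_def)

text \<open>As a real infimum, \<open>C_GN\<close> is meaningful only once some admissible constant
  exists, which \<open>GN\<close> supplies. A single nonzero function then bounds all admissible
  constants from below by its own quotient. Positivity matters because these constants are divided
  by in \<open>a0_bar\<close>.\<close>

lemma C_GN_pos: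
  assumes t: "2 < t" "t < 6" and v: "v \<in> H1" "mass v > 0"
  shows "C_GN t > 0"
proof -
  obtain C where C: "C > 0"
    "\<And>u. u \<in> H1 \<Longrightarrow> pw t u \<le> C * mass u powr ((6 - t) / 4) * kin u powr (3 * (t - 2) / 4)"
    using GN[OF t] by blast
  define S where "S = {C. \<forall>u\<in>H1. Lnorm t u \<le> C * Lnorm 2 u powr (1 - gam t) * Lnorm 2 (wgrad u) powr gam t}"
  have "C powr (1 / t) \<in> S"
    unfolding S_def
  proof (intro CollectI ballI)
    fix u assume u: "u \<in> H1"
    have "Lnorm t u \<le> (C * mass u powr ((6 - t) / 4) * kin u powr (3 * (t - 2) / 4)) powr (1 / t)"
      unfolding Lnorm_pw using C(2)[OF u] t by (intro powr_mono2) auto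
    also have "\<dots> = C powr (1 / t) * mass u powr ((6 - t) / 4 * (1 / t)) * kin u powr (3 * (t - 2) / 4 * (1 / t))"
      unfolding powr_mult powr_powr ..
    also have "(6 - t) / 4 * (1 / t) = 1 / 2 * (1 - gam t)" using t by (simp add: gam_def field_simps)
    also have "3 * (t - 2) / 4 * (1 / t) = 1 / 2 * gam t" using t by (simp add: gam_def field_simps)
    also have "mass u powr (1 / 2 * (1 - gam t)) = Lnorm 2 u powr (1 - gam t)"
      unfolding powr_powr[symmetric] by (simp add: Lnorm_2 powr_half_sqrt)
    also have "kin u powr (1 / 2 * gam t) = Lnorm 2 (wgrad u) powr gam t"
      unfolding powr_powr[symmetric] by (simp add: Lnorm_2 powr_half_sqrt)
    finally show "Lnorm t u \<le> C powr (1 / t) * Lnorm 2 u powr (1 - gam t) * Lnorm 2 (wgrad u) powr gam t" .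
  qed
  then have ne: "S \<noteq> {}" by blast
  have "pw t v \<noteq> 0"
  proof
    assume "pw t v = 0"
    then have "AE x in lborel. v x = 0" using pw_eq_0[OF H1_pw_integrable[OF v(1) less_imp_le[OF t(1)] t(2)]] by blast
    then have "mass v = 0" using mass_cong_AE[of v "\<lambda>x. 0"] H1_measurable[OF v(1)] by (simp add: mass_def)
    then show False using v by simp
  qed
  then have Lp: "Lnorm t v > 0" unfolding Lnorm_pw using pw_nonneg[of t v] by (simp add: less_le)
  define D where "D = Lnorm 2 v powr (1 - gam t) * Lnorm 2 (wgrad v) powr gam t"
  have lb: "Lnorm t v \<le> c * D" if "c \<in> S" for c using that v(1) unfolding S_def D_def by (auto simp: mult.assoc)
  have "D > 0"
  proof -
    have "D \<noteq> 0" using lb Lp ne by fastforce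
    moreover have "D \<ge> 0" by (simp add: D_def)
    ultimately show ?thesis by simp
  qed
  then have "Lnorm t v / D \<le> Inf S"
    by (intro cInf_greatest ne) (simp add: divide_le_eq lb)
  moreover have "Lnorm t v / D > 0" using Lp \<open>D > 0\<close> by simp
  ultimately show ?thesis unfolding C_GN_def S_def by simp
qed

section \<open>The Newton potential\<close>

text \<open>Signed densities are allowed, so that differences of Coulomb potentials are again
  potentials.\<close>

definition newton :: "(R3 \<Rightarrow> real) \<Rightarrow> R3 \<Rightarrow> real" where
  "newton g x = (\<integral>y. g y / norm (x - y) \<partial>lborel)"

text \<open>A class with bounded potentials: the kernel 1 / |z| is square integrable near its pole
  and bounded away from it.\<close>

definition L12 :: "(R3 \<Rightarrow> real) \<Rightarrow> bool" where
  "L12 g \<longleftrightarrow> integrable lborel g \<and> L2_fun g"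

lemma L12_measurable: "L12 g \<Longrightarrow> g \<in> borel_measurable borel"
  by (simp add: L12_def L2_measurable)

lemma L12_integrable: "L12 g \<Longrightarrow> integrable lborel g" by (simp add: L12_def)

lemma L12_add: "L12 f \<Longrightarrow> L12 g \<Longrightarrow> L12 (\<lambda>x. f x + g x)"
  by (auto simp: L12_def intro: L2_add(1))
lemma L12_diff: "L12 f \<Longrightarrow> L12 g \<Longrightarrow> L12 (\<lambda>x. f x - g x)"
  by (auto simp: L12_def intro: L2_diff(1))
lemma L12_cmult: "L12 f \<Longrightarrow> L12 (\<lambda>x. c * f x)"
  using L2_scaleR(1)[of f c] by (auto simp: L12_def)

lemma L12_bound:
  assumes g: "L12 g" and [measurable]: "f \<in> borel_measurable borel" and le: "\<And>x. \<bar>f x\<bar> \<le> g x"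
  shows "L12 f"
  unfolding L12_def
proof
  show "integrable lborel f"
    by (rule Bochner_Integration.integrable_bound[OF L12_integrable[OF g]])
      (use le in \<open>auto intro!: AE_I2 intro: order_trans[OF _ abs_ge_self]\<close>)
  have "integrable lborel (\<lambda>x. (norm (g x))\<^sup>2)" using g by (auto simp: L12_def L2_fun_def)
  then show "L2_fun f"
    by (rule L2_bound(1)[rotated]) (use le in \<open>auto intro!: power_mono simp: abs_le_square_iff[symmetric] intro: order_trans[OF _ abs_ge_self]\<close>)
qed

text \<open>Squared L^2 norm of the kernel 1 / |z| on the unit ball; on a ball of radius \<rho> it
  scales to \<open>\<rho> * K2\<close>.\<close>

definition K2 :: real where "K2 = (\<integral>z. indicator (ball 0 1) z / (norm (z::R3))\<^sup>2 \<partial>lborel)"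

text \<open>Dyadic shells: where |z| is at least 2^(-k-1) the integrand is at most 4^(k+1), and the
  ball of radius 2^(-k) has volume of order 8^(-k), so the sum is geometric.\<close>

lemma inverse_square_integrable:
  "integrable lborel (\<lambda>z::R3. indicator (ball 0 1) z / (norm z)\<^sup>2 :: real)"
proof (rule integrableI_bounded)
  show "(\<lambda>z::R3. indicator (ball 0 1) z / (norm z)\<^sup>2 :: real) \<in> borel_measurable lborel"
    by (intro borel_measurable_divide borel_measurable_indicator borel_measurable_power borel_measurable_norm) auto
  define V where "V = unit_ball_vol (real DIM(R3))"
  have V0: "0 \<le> V" unfolding V_def by (rule unit_ball_vol_nonneg) simp
  have pt: "ennreal (norm (indicator (ball 0 1) z / (norm z)\<^sup>2 :: real)) \<le> (\<Sum>k. ennreal (4 ^ Suc k) * indicator (ball 0 (1 / 2 ^ k)) z)"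
    for z :: R3
  proof (cases "z = 0 \<or> 1 \<le> norm z")
    case True then show ?thesis by (auto simp: not_less)
  next
    case False
    then have z: "0 < norm z" "norm z < 1" by auto
    define P where "P k = (1 / 2 ^ k \<le> norm z)" for k :: nat
    obtain n :: nat where "(1/2) ^ n < norm z" using real_arch_pow_inv[OF z(1), of "1/2"] by auto
    then have "P n" by (simp add: P_def power_one_over less_imp_le)
    moreover have "\<not> P 0" using z by (simp add: P_def)
    ultimately obtain k where k: "\<not> P k" "P (Suc k)" using ex_least_nat_less[of P n] by auto
    have a: "norm z < 1 / 2 ^ k" "1 / 2 ^ Suc k \<le> norm z" using k by (auto simp: P_def)
    have "(1 / 2 ^ Suc k)\<^sup>2 \<le> (norm z)\<^sup>2" using a by (intro power_mono) auto
    moreover have "(1 / 2 ^ Suc k)\<^sup>2 = 1 / (4::real) ^ Suc k"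
    proof -
      have "((2::real) ^ Suc k)\<^sup>2 = (2\<^sup>2) ^ Suc k" by (simp only: power_mult[symmetric] mult.commute)
      then show ?thesis by (simp add: power_divide)
    qed
    ultimately have "1 / (norm z)\<^sup>2 \<le> 4 ^ Suc k" using z by (simp add: field_simps)
    then have "ennreal (norm (indicator (ball 0 1) z / (norm z)\<^sup>2 :: real)) \<le> ennreal (4 ^ Suc k) * indicator (ball 0 (1 / 2 ^ k)) z"
      using z a by (simp add: ennreal_leI)
    also have "\<dots> \<le> (\<Sum>k. ennreal (4 ^ Suc k) * indicator (ball 0 (1 / 2 ^ k)) z)"
    proof -
      define F where "F k = ennreal (4 ^ Suc k) * indicator (ball 0 (1 / 2 ^ k)) z" for k :: nat
      have "(\<Sum>i\<in>{k}. F i) \<le> (\<Sum>i. F i)" by (rule sum_le_suminf) auto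
      then have "F k \<le> (\<Sum>i. F i)" by simp
      then show ?thesis unfolding F_def .
    qed
    finally show ?thesis .
  qed
  have "(\<integral>\<^sup>+z. ennreal (norm (indicator (ball 0 1) z / (norm (z::R3))\<^sup>2 :: real)) \<partial>lborel)
      \<le> (\<integral>\<^sup>+z. (\<Sum>k. ennreal (4 ^ Suc k) * indicator (ball 0 (1 / 2 ^ k)) (z::R3)) \<partial>lborel)"
    by (intro nn_integral_mono pt)
  also have "\<dots> = (\<Sum>k. \<integral>\<^sup>+z. ennreal (4 ^ Suc k) * indicator (ball 0 (1 / 2 ^ k)) (z::R3) \<partial>lborel)"
    by (intro nn_integral_suminf borel_measurable_times_ennreal borel_measurable_indicator) auto
  also have "\<dots> = (\<Sum>k. ennreal (4 * V * (1/2) ^ k))"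
  proof (intro suminf_cong)
    fix k
    have "(\<integral>\<^sup>+z. ennreal (4 ^ Suc k) * indicator (ball 0 (1 / 2 ^ k)) (z::R3) \<partial>lborel)
        = ennreal (4 ^ Suc k) * emeasure lborel (ball (0::R3) (1 / 2 ^ k))"
      by (rule nn_integral_cmult_indicator) simp
    also have "\<dots> = ennreal (4 ^ Suc k * (V * (1 / 2 ^ k) ^ 3))"
      using V0 by (subst emeasure_ball) (auto simp: V_def ennreal_mult[symmetric])
    also have "4 ^ Suc k * (V * (1 / 2 ^ k) ^ 3) = 4 * V * (1/2) ^ k"
    proof -
      have "(4::real) ^ k * (1 / 2 ^ k) ^ 3 = (1/2) ^ k"
        using power_mult_distrib[of "2::real" 4 k] by (simp add: power_divide pow28 power_one_over field_simps)
      then show ?thesis by simp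
    qed
    finally show "(\<integral>\<^sup>+z. ennreal (4 ^ Suc k) * indicator (ball 0 (1 / 2 ^ k)) (z::R3) \<partial>lborel) = ennreal (4 * V * (1/2) ^ k)" .
  qed
  also have "\<dots> = ennreal (\<Sum>k. 4 * V * (1/2) ^ k)"
    using V0 by (intro suminf_ennreal2 summable_mult summable_geometric) auto
  also have "\<dots> < \<infinity>" by simp
  finally show "(\<integral>\<^sup>+z. ennreal (norm (indicator (ball 0 1) z / (norm (z::R3))\<^sup>2 :: real)) \<partial>lborel) < \<infinity>" .
qed

lemma K2_nonneg: "0 \<le> K2" unfolding K2_def by (rule integral_nonneg_AE) simp

lemma inverse_square_ball:
  assumes \<rho>: "\<rho> > 0"
  shows "L2_fun (\<lambda>y. indicator (ball x \<rho>) y / norm (x - y))" 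
    "mass (\<lambda>y. indicator (ball x \<rho>) y / norm (x - y)) = \<rho> * K2"
proof -
  let ?F = "\<lambda>z::R3. indicator (ball 0 1) z / (norm z)\<^sup>2 :: real"
  have e: "(norm (indicator (ball x \<rho>) y / norm (x - y) :: real))\<^sup>2 = (1 / \<rho>\<^sup>2) * ?F ((1/\<rho>) *\<^sub>R x + (- (1 / \<rho>)) *\<^sub>R y)" for y
  proof -
    have "(1/\<rho>) *\<^sub>R x + (- (1 / \<rho>)) *\<^sub>R y = (1/\<rho>) *\<^sub>R (x - y)" by (simp add: scaleR_diff_right)
    then have n: "norm ((1/\<rho>) *\<^sub>R x + (- (1 / \<rho>)) *\<^sub>R y) = norm (x - y) / \<rho>" using \<rho> by simp
    have "((1/\<rho>) *\<^sub>R x + (- (1 / \<rho>)) *\<^sub>R y \<in> ball 0 1) = (y \<in> ball x \<rho>)"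
      unfolding mem_ball_0 n using \<rho> by (simp add: dist_norm)
    then show ?thesis unfolding n using \<rho> by (auto simp: indicator_def power_divide)
  qed
  have i: "integrable lborel (\<lambda>y. ?F ((1/\<rho>) *\<^sub>R x + (- (1 / \<rho>)) *\<^sub>R y))"
    using \<rho> by (intro integrable_affine inverse_square_integrable) auto
  show "L2_fun (\<lambda>y. indicator (ball x \<rho>) y / norm (x - y))"
  proof (rule L2_funI)
    show "integrable lborel (\<lambda>y. (norm (indicator (ball x \<rho>) y / norm (x - y) :: real))\<^sup>2)" 
      unfolding e using i by (intro integrable_mult_right) 
    show "(\<lambda>y. indicator (ball x \<rho>) y / norm (x - y) :: real) \<in> borel_measurable borel"
      by (intro borel_measurable_divide borel_measurable_indicator borel_measurable_norm) auto
  qed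
  have "mass (\<lambda>y. indicator (ball x \<rho>) y / norm (x - y)) = (1 / \<rho>\<^sup>2) * (\<integral>y. ?F ((1/\<rho>) *\<^sub>R x + (- (1 / \<rho>)) *\<^sub>R y) \<partial>lborel)"
    unfolding mass_def e by (rule integral_mult_right_zero)
  also have "(\<integral>y. ?F ((1/\<rho>) *\<^sub>R x + (- (1 / \<rho>)) *\<^sub>R y) \<partial>lborel) = K2 /\<^sub>R \<bar>- (1 / \<rho>)\<bar> ^ DIM(R3)"
    unfolding K2_def using \<rho> by (intro integral_affine) auto
  also have "(1 / \<rho>\<^sup>2) * (K2 /\<^sub>R \<bar>- (1 / \<rho>)\<bar> ^ DIM(R3)) = \<rho> * K2"
    using \<rho> by (simp add: power_divide power2_eq_square power3_eq_cube)
  finally show "mass (\<lambda>y. indicator (ball x \<rho>) y / norm (x - y)) = \<rho> * K2" .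
qed

text \<open>Split at distance \<rho> from \<open>x\<close>: Cauchy-Schwarz inside, kernel at most 1
  / \<rho> outside. The radius stays free for later optimisation, and the L^2 norm is kept local for
  the sake of decay at infinity.\<close>

lemma newton_bound:
  assumes g: "L12 g" and \<rho>: "\<rho> > 0"
  shows "integrable lborel (\<lambda>y. g y / norm (x - y))"
    and "(\<integral>y. \<bar>g y\<bar> / norm (x - y) \<partial>lborel)
      \<le> sqrt (\<rho> * K2) * sqrt (mass (\<lambda>y. indicator (ball x \<rho>) y * g y)) + (\<integral>y. \<bar>g y\<bar> \<partial>lborel) / \<rho>"
proof -
  note [measurable] = L12_measurable[OF g]
  let ?k = "\<lambda>y. indicator (ball x \<rho>) y / norm (x - y) :: real"
  let ?h = "\<lambda>y. indicator (ball x \<rho>) y * g y"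
  have hL: "L2_fun ?h"
  proof (rule L2_bound(1))
    show "integrable lborel (\<lambda>x. (norm (g x))\<^sup>2)" using g by (auto simp: L12_def L2_fun_def)
  qed (auto simp: indicator_def)
  note P = Cauchy_Schwarz_L2[OF inverse_square_ball(1)[OF \<rho>, of x] hL]
  have le: "\<bar>g y\<bar> / norm (x - y) \<le> norm (?k y) * norm (?h y) + \<bar>g y\<bar> / \<rho>" for y
  proof (cases "y \<in> ball x \<rho>")
    case False
    then have "\<rho> \<le> norm (x - y)" by (simp add: dist_norm)
    then have "\<bar>g y\<bar> / norm (x - y) \<le> \<bar>g y\<bar> / \<rho>" using \<rho> by (intro divide_left_mono mult_pos_pos) auto
    then show ?thesis using False by simp
  qed (use \<rho> in simp)
  have ig: "integrable lborel (\<lambda>y. \<bar>g y\<bar>)" using L12_integrable[OF g] by simp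
  have i: "integrable lborel (\<lambda>y. norm (?k y) * norm (?h y) + \<bar>g y\<bar> / \<rho>)" using P(1) ig by simp
  have i2: "integrable lborel (\<lambda>y. \<bar>g y\<bar> / norm (x - y))"
    by (rule Bochner_Integration.integrable_bound[OF i]) (use le in \<open>auto intro!: AE_I2 intro: order_trans[OF _ abs_ge_self]\<close>)
  show "integrable lborel (\<lambda>y. g y / norm (x - y))"
    by (rule Bochner_Integration.integrable_bound[OF i2]) auto
  have "(\<integral>y. \<bar>g y\<bar> / norm (x - y) \<partial>lborel) \<le> (\<integral>y. norm (?k y) * norm (?h y) + \<bar>g y\<bar> / \<rho> \<partial>lborel)"
    by (rule integral_mono[OF i2 i le])
  also have "\<dots> = (\<integral>y. norm (?k y) * norm (?h y) \<partial>lborel) + (\<integral>y. \<bar>g y\<bar> \<partial>lborel) / \<rho>"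
    using P(1) ig by (subst Bochner_Integration.integral_add) auto
  also have "\<dots> \<le> sqrt (\<rho> * K2) * sqrt (mass ?h) + (\<integral>y. \<bar>g y\<bar> \<partial>lborel) / \<rho>"
    using P(2) inverse_square_ball(2)[OF \<rho>, of x] by simp
  finally show "(\<integral>y. \<bar>g y\<bar> / norm (x - y) \<partial>lborel)
      \<le> sqrt (\<rho> * K2) * sqrt (mass ?h) + (\<integral>y. \<bar>g y\<bar> \<partial>lborel) / \<rho>" .
qed

lemma mass_indicator_le:
  fixes g :: "R3 \<Rightarrow> real"
  assumes g: "L2_fun g" and [measurable]: "A \<in> sets borel" "B \<in> sets borel" and AB: "A \<subseteq> B"
  shows "mass (\<lambda>y. indicator A y * g y) \<le> mass (\<lambda>y. indicator B y * g y)"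
proof -
  note [measurable] = L2_measurable[OF g]
  have L: "integrable lborel (\<lambda>y. (norm (indicator B y * g y))\<^sup>2)"
    by (rule Bochner_Integration.integrable_bound[OF L2_integrable[OF g]]) (auto simp: indicator_def)
  show ?thesis
    unfolding mass_def[of "\<lambda>y. indicator B y * g y"]
    by (rule L2_bound(2)[OF _ L]) (use AB in \<open>auto simp: indicator_def\<close>)
qed

lemma newton_abs_le: "\<bar>newton g x\<bar> \<le> newton (\<lambda>y. \<bar>g y\<bar>) x"
  using integral_norm_bound[of lborel "\<lambda>y. g y / norm (x - y)"] by (simp add: newton_def)

lemma newton_sup:
  assumes g: "L12 g" and \<rho>: "\<rho> > 0"
  shows "newton (\<lambda>y. \<bar>g y\<bar>) x \<le> sqrt (\<rho> * K2) * sqrt (mass g) + (\<integral>y. \<bar>g y\<bar> \<partial>lborel) / \<rho>"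
proof -
  have "mass (\<lambda>y. indicator (ball x \<rho>) y * g y) \<le> mass g"
    using mass_indicator_le[of g "ball x \<rho>" UNIV] g by (simp add: L12_def)
  then have "sqrt (\<rho> * K2) * sqrt (mass (\<lambda>y. indicator (ball x \<rho>) y * g y)) \<le> sqrt (\<rho> * K2) * sqrt (mass g)"
    using \<rho> K2_nonneg by (intro mult_left_mono) auto
  then show ?thesis using newton_bound(2)[OF g \<rho>, of x] by (simp add: newton_def)
qed

lemma newton_bounded:
  assumes g: "L12 g" obtains M where "M > 0" "\<And>x. \<bar>newton g x\<bar> \<le> M" "\<And>x. newton (\<lambda>y. \<bar>g y\<bar>) x \<le> M"
proof -
  let ?B = "sqrt (1 * K2) * sqrt (mass g) + (\<integral>y. \<bar>g y\<bar> \<partial>lborel) / 1"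
  have "newton (\<lambda>y. \<bar>g y\<bar>) x \<le> \<bar>?B\<bar> + 1" for x using newton_sup[OF g, of 1 x] by linarith
  with that[of "\<bar>?B\<bar> + 1"] newton_abs_le[of g] show ?thesis by (meson abs_ge_zero add_nonneg_pos order_trans zero_less_one)
qed

lemma newton_measurable [measurable]:
  assumes [measurable]: "g \<in> borel_measurable borel"
  shows "newton g \<in> borel_measurable borel"
  unfolding newton_def by (rule sigma_finite_measure.borel_measurable_lebesgue_integral) (auto simp: lborel.sigma_finite_measure_axioms)

lemma newton_nonneg: "(\<And>y. 0 \<le> g y) \<Longrightarrow> 0 \<le> newton g x"
  unfolding newton_def by (intro integral_nonneg_AE) auto

lemma newton_add: "L12 f \<Longrightarrow> L12 g \<Longrightarrow> newton (\<lambda>y. f y + g y) x = newton f x + newton g x"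
  using newton_bound(1)[of f 1 x] newton_bound(1)[of g 1 x] by (simp add: newton_def add_divide_distrib)

lemma newton_diff: "L12 f \<Longrightarrow> L12 g \<Longrightarrow> newton (\<lambda>y. f y - g y) x = newton f x - newton g x"
  using newton_bound(1)[of f 1 x] newton_bound(1)[of g 1 x] by (simp add: newton_def diff_divide_distrib)

lemma newton_cmult: "newton (\<lambda>y. c * f y) x = c * newton f x"
  by (simp add: newton_def flip: times_divide_eq_right)

text \<open>First \<rho> is taken large for the far part. With \<rho> fixed, the near part sees
  \<open>g\<close> only on \<open>ball x \<rho>\<close>, which for distant \<open>x\<close> lies in
  the L^2 tail of \<open>g\<close>.\<close>

lemma newton_vanishes:
  assumes g: "L12 g" and e: "e > 0"
  obtains R where "R > 0" "\<And>x. R \<le> norm x \<Longrightarrow> newton (\<lambda>y. \<bar>g y\<bar>) x \<le> e"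
proof -
  note [measurable] = L12_measurable[OF g]
  have g2: "integrable lborel (\<lambda>y. (g y)\<^sup>2)" using g by (auto simp: L12_def L2_fun_def)
  define I where "I = (\<integral>y. \<bar>g y\<bar> \<partial>lborel)"
  have I0: "0 \<le> I" unfolding I_def by (intro integral_nonneg_AE) auto
  define \<rho> where "\<rho> = 2 * I / e + 1"
  have \<rho>: "\<rho> > 0" using I0 e by (simp add: \<rho>_def add_nonneg_pos)
  have I\<rho>: "I / \<rho> \<le> e / 2"
  proof -
    have "I = e / 2 * (2 * I / e)" using e by simp
    also have "\<dots> \<le> e / 2 * \<rho>" using e by (intro mult_left_mono) (auto simp: \<rho>_def)
    finally show ?thesis using \<rho> by (simp add: pos_divide_le_eq)
  qed
  define T where "T n = mass (\<lambda>y. indicator {y. real n < norm y} y * g y)" for n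
  have T0: "T \<longlonglongrightarrow> (\<integral>x. 0 \<partial>(lborel::R3 measure))"
    unfolding T_def mass_def
  proof (rule integral_dominated_convergence[OF _ _ g2])
    show "AE x in lborel. (\<lambda>n. (norm (indicator {y. real n < norm y} x * g x))\<^sup>2) \<longlonglongrightarrow> 0"
    proof (rule AE_I2, rule Lim_transform_eventually[OF tendsto_const])
      fix x :: R3
      have "\<forall>\<^sub>F n in sequentially. norm x \<le> real n" by (rule eventually_sequentiallyI[of "nat \<lceil>norm x\<rceil>"]) linarith
      then show "\<forall>\<^sub>F n in sequentially. 0 = (norm (indicator {y. real n < norm y} x * g x))\<^sup>2"
        by eventually_elim simp
    qed
  qed (auto simp: indicator_def)
  then have "(\<lambda>n. sqrt (\<rho> * K2) * sqrt (T n)) \<longlonglongrightarrow> sqrt (\<rho> * K2) * sqrt 0" by (intro tendsto_intros) simp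
  then have "\<forall>\<^sub>F n in sequentially. sqrt (\<rho> * K2) * sqrt (T n) < e / 2"
    using e by (intro order_tendstoD(2)[where y="sqrt (\<rho> * K2) * sqrt 0"]) auto
  then obtain n where n: "sqrt (\<rho> * K2) * sqrt (T n) < e / 2" by (auto simp: eventually_sequentially)
  show ?thesis
  proof (rule that[of "real n + \<rho>"])
    show "real n + \<rho> > 0" using \<rho> by simp
    fix x :: R3 assume x: "real n + \<rho> \<le> norm x"
    have sub: "ball x \<rho> \<subseteq> {y. real n < norm y}"
    proof
      fix y assume "y \<in> ball x \<rho>"
      then have "norm (x - y) < \<rho>" by (simp add: dist_norm)
      then show "y \<in> {y. real n < norm y}" using x norm_triangle_ineq2[of x y] by simp
    qed
    have "mass (\<lambda>y. indicator (ball x \<rho>) y * g y) \<le> T n"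
      unfolding T_def using g sub by (intro mass_indicator_le) (auto simp: L12_def)
    then have "sqrt (\<rho> * K2) * sqrt (mass (\<lambda>y. indicator (ball x \<rho>) y * g y)) \<le> sqrt (\<rho> * K2) * sqrt (T n)"
      using \<rho> K2_nonneg by (intro mult_left_mono) auto
    then show "newton (\<lambda>y. \<bar>g y\<bar>) x \<le> e"
      using newton_bound(2)[OF g \<rho>, of x] n I\<rho> unfolding newton_def I_def abs_abs by linarith
  qed
qed

text \<open>Fubini, with the bounded potential of |g| providing the integrable majorant; the last
  identity is the symmetry of the kernel.\<close>

lemma newton_pairing:
  assumes f: "L12 f" and g: "L12 g"
  shows "integrable (lborel \<Otimes>\<^sub>M lborel) (\<lambda>(x, y). f x * g y / norm (x - y))"
    and "(\<integral>x. f x * newton g x \<partial>lborel) = (\<integral>z. (case z of (x, y) \<Rightarrow> f x * g y / norm (x - y)) \<partial>(lborel \<Otimes>\<^sub>M lborel))"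
    and "(\<integral>x. f x * newton g x \<partial>lborel) = (\<integral>x. g x * newton f x \<partial>lborel)"
proof -
  note [measurable] = L12_measurable[OF f] L12_measurable[OF g]
  obtain M where M: "M > 0" "\<And>x. \<bar>newton g x\<bar> \<le> M" "\<And>x. newton (\<lambda>y. \<bar>g y\<bar>) x \<le> M" using newton_bounded[OF g] by blast
  show i: "integrable (lborel \<Otimes>\<^sub>M lborel) (\<lambda>(x, y). f x * g y / norm (x - y))"
  proof (rule lborel_pair.Fubini_integrable)
    show "(\<lambda>(x, y). f x * g y / norm (x - y)) \<in> borel_measurable (lborel \<Otimes>\<^sub>M lborel)" by measurable
    show "AE x in lborel. integrable lborel (\<lambda>y. case (x, y) of (x, y) \<Rightarrow> f x * g y / norm (x - y))"
      using newton_bound(1)[OF g, of 1] by (simp flip: times_divide_eq_right)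
    show "integrable lborel (\<lambda>x. \<integral>y. norm (case (x, y) of (x, y) \<Rightarrow> f x * g y / norm (x - y)) \<partial>lborel)"
    proof (rule Bochner_Integration.integrable_bound)
      show "integrable lborel (\<lambda>x. M * f x)" using L12_integrable[OF f] by simp
      show "AE x in lborel. norm (\<integral>y. norm (case (x, y) of (x, y) \<Rightarrow> f x * g y / norm (x - y)) \<partial>lborel) \<le> norm (M * f x)"
      proof (rule AE_I2)
        fix x
        have "(\<integral>y. norm (f x * g y / norm (x - y)) \<partial>lborel) = \<bar>f x\<bar> * newton (\<lambda>y. \<bar>g y\<bar>) x"
          by (simp add: newton_def abs_mult flip: times_divide_eq_right)
        moreover have "\<bar>f x\<bar> * newton (\<lambda>y. \<bar>g y\<bar>) x \<le> \<bar>f x\<bar> * M" by (intro mult_left_mono M) auto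
        moreover have "0 \<le> \<bar>f x\<bar> * newton (\<lambda>y. \<bar>g y\<bar>) x" by (intro mult_nonneg_nonneg newton_nonneg) auto
        ultimately show "norm (\<integral>y. norm (case (x, y) of (x, y) \<Rightarrow> f x * g y / norm (x - y)) \<partial>lborel) \<le> norm (M * f x)"
          using M(1) by (simp add: abs_mult mult.commute)
      qed
    qed measurable
  qed
  have a: "f x * newton g x = (\<integral>y. f x * g y / norm (x - y) \<partial>lborel)" for x
    by (simp add: newton_def flip: times_divide_eq_right)
  show "(\<integral>x. f x * newton g x \<partial>lborel) = (\<integral>z. (case z of (x, y) \<Rightarrow> f x * g y / norm (x - y)) \<partial>(lborel \<Otimes>\<^sub>M lborel))"
    unfolding a using lborel_pair.integral_fst'[OF i] by simp
  have b: "g y * newton f y = (\<integral>x. f x * g y / norm (x - y) \<partial>lborel)" for y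
    unfolding newton_def integral_mult_right_zero[symmetric]
    by (intro Bochner_Integration.integral_cong refl) (simp add: norm_minus_commute)
  show "(\<integral>x. f x * newton g x \<partial>lborel) = (\<integral>x. g x * newton f x \<partial>lborel)"
    unfolding a b by (rule lborel_pair.Fubini_integral[symmetric]) (rule i)
qed

lemma newton_mult_integrable:
  assumes f: "integrable lborel f" and g: "L12 g"
  shows "integrable lborel (\<lambda>x. f x * newton g x)"
proof -
  note [measurable] = borel_measurable_integrable[OF f] L12_measurable[OF g]
  obtain M where M: "M > 0" "\<And>x. \<bar>newton g x\<bar> \<le> M" "\<And>x. newton (\<lambda>y. \<bar>g y\<bar>) x \<le> M" using newton_bounded[OF g] by blast
  have i: "integrable lborel (\<lambda>x. M * f x)" using f by simp
  show ?thesis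
    by (rule Bochner_Integration.integrable_bound[OF i])
      (use M in \<open>auto intro!: AE_I2 mult_right_mono simp: abs_mult mult.commute[of _ "newton g _"]\<close>)
qed

section \<open>The Coulomb energy\<close>

abbreviation dens :: "(R3 \<Rightarrow> complex) \<Rightarrow> R3 \<Rightarrow> real" where "dens u \<equiv> (\<lambda>x. (norm (u x))\<^sup>2)"

definition hart :: "(R3 \<Rightarrow> complex) \<Rightarrow> real" where "hart u = (\<integral>x. dens u x * coulomb u x \<partial>lborel)"

lemma coulomb_newton: "coulomb u = newton (dens u)"
  by (simp add: fun_eq_iff coulomb_def newton_def)

lemma norm_powr_4: "norm z powr 4 = ((norm z)\<^sup>2)\<^sup>2"
  by (cases "z = 0") (simp_all flip: power_mult)

lemma dens_mass:
  shows "mass (dens u) = pw 4 u"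
  unfolding mass_def pw_def norm_powr_4 by simp

lemma L12_dens_iff:
  "u \<in> borel_measurable borel \<Longrightarrow> L2_fun u \<Longrightarrow> integrable lborel (\<lambda>x. norm (u x) powr 4) \<Longrightarrow> L12 (dens u)"
  unfolding L12_def norm_powr_4 by (auto intro!: L2_funI simp: L2_integrable)

lemma L12_dens: "u \<in> H1 \<Longrightarrow> L12 (dens u)"
  using H1_pw_integrable[of u 4] by (intro L12_dens_iff) (auto simp: H1_measurable H1_L2)

lemma coulomb_nonneg: "0 \<le> coulomb u x" unfolding coulomb_newton by (rule newton_nonneg) simp

lemma hart_nonneg: "0 \<le> hart u" unfolding hart_def by (intro integral_nonneg_AE) (auto simp: coulomb_nonneg)

lemma hart_eq_energy: "(\<integral>x. (\<integral>y. (norm (u x))\<^sup>2 * (norm (u y))\<^sup>2 / norm (x - y) \<partial>lborel) \<partial>lborel) = hart u"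
  unfolding hart_def coulomb_def by (simp flip: times_divide_eq_right)

lemma coulomb_dilate: "coulomb (dilate s u) x = exp s * coulomb u (exp s *\<^sub>R x)"
proof -
  have "(norm (dilate s u y))\<^sup>2 / norm (x - y)
      = exp (4 * s) * ((norm (u (0 + exp s *\<^sub>R y)))\<^sup>2 / norm (exp s *\<^sub>R x - (0 + exp s *\<^sub>R y)))" for y
  proof -
    have "norm (exp s *\<^sub>R x - (0 + exp s *\<^sub>R y)) = exp s * norm (x - y)"
      unfolding add_0_left scaleR_diff_right[symmetric] norm_scaleR by simp
    moreover have "(exp (3 * s / 2))\<^sup>2 = exp (4 * s) / exp s"
      by (simp add: exp_double[symmetric] exp_diff[symmetric])
    ultimately show ?thesis by (simp add: norm_dilate power_mult_distrib)
  qed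
  then have "coulomb (dilate s u) x = exp (4 * s) * (\<integral>y. (norm (u (0 + exp s *\<^sub>R y)))\<^sup>2 / norm (exp s *\<^sub>R x - (0 + exp s *\<^sub>R y)) \<partial>lborel)"
    unfolding coulomb_def by (simp only: integral_mult_right_zero)
  also have "\<dots> = exp (4 * s) * (coulomb u (exp s *\<^sub>R x) /\<^sub>R \<bar>exp s\<bar> ^ DIM(R3))"
    unfolding coulomb_def by (subst integral_affine[of "exp s" "\<lambda>y. (norm (u y))\<^sup>2 / norm (exp s *\<^sub>R x - y)" 0]) simp_all
  also have "\<dots> = exp s * coulomb u (exp s *\<^sub>R x)"
    by (simp add: exp_cubed divide_inverse[symmetric] exp_diff[symmetric])
  finally show ?thesis .
qed

lemma hart_dilate: "hart (dilate s u) = exp s * hart u"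
proof -
  have "hart (dilate s u) = (\<integral>x. exp (4 * s) * (dens u (0 + exp s *\<^sub>R x) * coulomb u (0 + exp s *\<^sub>R x)) \<partial>lborel)"
    unfolding hart_def
  proof (intro Bochner_Integration.integral_cong refl)
    fix x
    have "(exp (3 * s / 2))\<^sup>2 * exp s = exp (4 * s)"
      by (simp add: exp_double[symmetric] exp_add[symmetric])
    then show "dens (dilate s u) x * coulomb (dilate s u) x = exp (4 * s) * (dens u (0 + exp s *\<^sub>R x) * coulomb u (0 + exp s *\<^sub>R x))"
      unfolding coulomb_dilate norm_dilate power_mult_distrib by (simp add: mult_ac)
  qed
  also have "\<dots> = exp (4 * s) * (hart u /\<^sub>R \<bar>exp s\<bar> ^ DIM(R3))"
    unfolding hart_def integral_mult_right_zero by (subst integral_affine[of "exp s" "\<lambda>x. dens u x * coulomb u x" 0]) simp_all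
  also have "\<dots> = exp s * hart u" by (simp add: exp_cubed divide_inverse[symmetric] exp_diff[symmetric])
  finally show ?thesis .
qed

text \<open>The radius 1 / sqrt (kin u) in \<open>newton_sup\<close> balances the two terms: by
  Gagliardo-Nirenberg at exponent 4 each becomes a multiple of sqrt (kin u). Thus a small Dirichlet
  integral forces a small Coulomb energy at fixed mass.\<close>

lemma hart_le_sqrt_kin:
  obtains C where "C > 0" "\<And>u. u \<in> H1 \<Longrightarrow> mass u = m \<Longrightarrow> hart u \<le> C * sqrt (kin u)"
proof -
  obtain G where G: "G > 0" "\<And>u. u \<in> H1 \<Longrightarrow> pw 4 u \<le> G * mass u powr ((6 - 4) / 4) * kin u powr (3 * (4 - 2) / 4)"
    by (rule GN[of 4]) auto
  define C where "C = \<bar>m\<bar> * (sqrt (K2 * (G * m powr (1/2))) + \<bar>m\<bar>) + 1"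
  show ?thesis
  proof (rule that[of C])
    show "C > 0" unfolding C_def using K2_nonneg G by (intro add_nonneg_pos mult_nonneg_nonneg add_nonneg_nonneg) auto
    fix u assume u: "u \<in> H1" and m: "mass u = m"
    then have m0: "m \<ge> 0" using mass_nonneg[of u] by simp
    have d: "L12 (dens u)" by (rule L12_dens[OF u])
    have I: "(\<integral>x. \<bar>dens u x\<bar> \<partial>lborel) = m" using m by (simp add: mass_def)
    show "hart u \<le> C * sqrt (kin u)"
    proof (cases "kin u = 0")
      case True
      then have "pw 4 u = 0" using G(2)[OF u] pw_nonneg[of 4 u] by simp
      then have "AE x in lborel. u x = 0" using pw_eq_0[OF H1_pw_integrable[OF u, of 4]] by simp
      then have "hart u = 0" unfolding hart_def using H1_measurable[OF u]
        by (subst integral_cong_AE[where g="\<lambda>x. 0"]) (auto elim!: eventually_mono simp: coulomb_newton)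
      then show ?thesis using True by simp
    next
      case False
      then have k: "kin u > 0" using mass_nonneg[of "wgrad u"] by linarith
      define \<rho> where "\<rho> = 1 / sqrt (kin u)"
      have \<rho>: "\<rho> > 0" using k by (simp add: \<rho>_def)
      have p: "pw 4 u \<le> G * m powr (1/2) * (kin u * sqrt (kin u))"
      proof -
        have "kin u powr (3 / 2) = kin u powr 1 * kin u powr (1 / 2)" unfolding powr_add[symmetric] by simp
        then show ?thesis using G(2)[OF u] k m by (simp add: powr_half_sqrt)
      qed
      have c: "coulomb u x \<le> (sqrt (K2 * (G * m powr (1/2))) + m) * sqrt (kin u)" for x
      proof -
        have "coulomb u x \<le> sqrt (\<rho> * K2) * sqrt (pw 4 u) + m / \<rho>"
          using newton_sup[OF d \<rho>, of x] unfolding coulomb_newton dens_mass I by simp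
        also have "sqrt (\<rho> * K2) * sqrt (pw 4 u) \<le> sqrt (\<rho> * K2) * sqrt (G * m powr (1/2) * (kin u * sqrt (kin u)))"
          using p \<rho> K2_nonneg by (intro mult_left_mono) auto
        also have "\<dots> = sqrt (K2 * (G * m powr (1/2))) * sqrt (kin u)"
          unfolding real_sqrt_mult[symmetric] \<rho>_def using k by (simp add: mult_ac)
        finally show ?thesis using k by (simp add: \<rho>_def algebra_simps)
      qed
      have "hart u \<le> (\<integral>x. dens u x * ((sqrt (K2 * (G * m powr (1/2))) + m) * sqrt (kin u)) \<partial>lborel)"
        unfolding hart_def
      proof (rule integral_mono)
        show "integrable lborel (\<lambda>x. dens u x * coulomb u x)"
          unfolding coulomb_newton by (rule newton_mult_integrable[OF L12_integrable[OF d] d])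
        show "integrable lborel (\<lambda>x. dens u x * ((sqrt (K2 * (G * m powr (1/2))) + m) * sqrt (kin u)))"
          using L12_integrable[OF d] by simp
        show "dens u x * coulomb u x \<le> dens u x * ((sqrt (K2 * (G * m powr (1/2))) + m) * sqrt (kin u))" for x
          by (intro mult_left_mono c) simp
      qed
      also have "\<dots> = m * ((sqrt (K2 * (G * m powr (1/2))) + m) * sqrt (kin u))"
        using m by (simp add: mass_def)
      also have "\<dots> \<le> C * sqrt (kin u)" using m0 by (simp add: C_def distrib_right mult.assoc)
      finally show ?thesis .
    qed
  qed
qed

lemma dens_expand: "(norm (v :: complex))\<^sup>2 = (norm u)\<^sup>2 + 2 * Re (u * cnj (v - u)) + (norm (v - u))\<^sup>2"
  unfolding cmod_power2 by (simp add: power2_eq_square algebra_simps)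

lemma Re_pairing_bound: "\<bar>Re (a * cnj b)\<bar> \<le> norm a * norm b"
  using abs_Re_le_cmod[of "a * cnj b"] by (simp add: norm_mult)

lemma L12_Re_pairing:
  assumes "L12 (dens u)" "L12 (dens h)" and [measurable]: "u \<in> borel_measurable borel" "h \<in> borel_measurable borel"
  shows "L12 (\<lambda>x. Re (u x * cnj (h x)))"
proof (rule L12_bound)
  show "L12 (\<lambda>x. dens u x + dens h x)" using assms by (intro L12_add)
  show "\<bar>Re (u x * cnj (h x))\<bar> \<le> dens u x + dens h x" for x
    using Re_pairing_bound[of "u x" "h x"] sum_squares_bound[of "norm (u x)" "norm (h x)"] 
      mult_nonneg_nonneg[OF norm_ge_zero norm_ge_zero, of "u x" "h x"] by linarith
  have [measurable]: "cnj \<in> borel_measurable borel" by (intro borel_measurable_continuous_onI continuous_intros)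
  show "(\<lambda>x. Re (u x * cnj (h x))) \<in> borel_measurable borel" by measurable
qed

text \<open>With f = |v|^2 - |u|^2 the difference of the Coulomb energies is twice the pairing of f
  with the potential of |u|^2, plus the self-pairing of f. The part of f linear in v - u gives the
  first term on the left; its quadratic part contributes nonnegatively, and the self-pairing is
  estimated in absolute value.\<close>

lemma hart_lower_expansion:
  assumes u: "u \<in> H1" and v: "v \<in> H1"
  shows "4 * (\<integral>x. Re (u x * cnj (v x - u x)) * coulomb u x \<partial>lborel)
       - 2 * (\<integral>x. dens (\<lambda>x. v x - u x) x * (coulomb u x + coulomb v x) \<partial>lborel) \<le> hart v - hart u"
proof -
  define h where "h x = v x - u x" for x
  have hH: "h \<in> H1" unfolding h_def[abs_def] by (rule H1_diff(1)[OF v u])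
  note [measurable] = H1_measurable[OF u] H1_measurable[OF v] H1_measurable[OF hH]
  note D = L12_dens[OF u] L12_dens[OF v] L12_dens[OF hH]
  define f where "f x = dens v x - dens u x" for x
  have f: "L12 f" unfolding f_def[abs_def] by (rule L12_diff[OF D(2,1)])
  define r where "r x = Re (u x * cnj (h x))" for x
  have r: "L12 r" unfolding r_def[abs_def] by (rule L12_Re_pairing[OF D(1,3)]) measurable
  define w where "w x = 2 * dens u x + 2 * dens v x" for x
  have w: "L12 w" unfolding w_def[abs_def] by (intro L12_add L12_cmult D)
  have fe: "f x = 2 * r x + dens h x" for x
    using dens_expand[of "v x" "u x"] by (simp add: f_def r_def h_def)
  \<comment> \<open>Each factor f is at most |h| p with p = |u| + |v|. Grouping |h(x)| with p(y) and
    |h(y)| with p(x) before applying 2ab <= a^2 + b^2 leaves products of two densities, one of them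
    quadratic in h.\<close>
  have abf: "\<bar>f x\<bar> * \<bar>f y\<bar> \<le> (dens h x * w y + w x * dens h y) / 2" for x y
  proof -
    define p where "p x = norm (u x) + norm (v x)" for x
    have p0: "0 \<le> p x" for x by (simp add: p_def)
    have fp: "\<bar>f x\<bar> \<le> norm (h x) * p x" for x
    proof -
      have "f x = (norm (v x) - norm (u x)) * p x" by (simp add: f_def p_def power2_eq_square algebra_simps)
      moreover have "\<bar>norm (v x) - norm (u x)\<bar> \<le> norm (h x)" by (simp add: h_def norm_triangle_ineq3)
      ultimately show ?thesis using p0[of x] by (simp add: abs_mult mult_right_mono)
    qed
    have pw: "(p x)\<^sup>2 \<le> w x" for x
      using sum_squares_bound[of "norm (u x)" "norm (v x)"] by (simp add: p_def w_def power2_sum)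
    have "\<bar>f x\<bar> * \<bar>f y\<bar> \<le> (norm (h x) * p x) * (norm (h y) * p y)"
      using p0 by (intro mult_mono fp) auto
    also have "\<dots> = (norm (h x) * p y) * (norm (h y) * p x)" by simp
    also have "\<dots> \<le> ((norm (h x) * p y)\<^sup>2 + (norm (h y) * p x)\<^sup>2) / 2"
      using sum_squares_bound[of "norm (h x) * p y" "norm (h y) * p x"] by simp
    also have "\<dots> \<le> (dens h x * w y + w x * dens h y) / 2"
      using mult_left_mono[OF pw[of y], of "dens h x"] mult_left_mono[OF pw[of x], of "dens h y"]
      by (simp add: power_mult_distrib mult.commute)
    finally show ?thesis .
  qed
  note Pf = newton_pairing[OF f f] and Phw = newton_pairing[OF D(3) w] and Pwh = newton_pairing[OF w D(3)]
  have ff: "\<bar>\<integral>x. f x * newton f x \<partial>lborel\<bar> \<le> (\<integral>x. dens h x * newton w x \<partial>lborel)"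
  proof -
    have "\<bar>\<integral>x. f x * newton f x \<partial>lborel\<bar>
      \<le> (\<integral>z. norm (case z of (x, y) \<Rightarrow> f x * f y / norm (x - y)) \<partial>(lborel \<Otimes>\<^sub>M lborel))"
      unfolding Pf(2) real_norm_def[symmetric] by (rule integral_norm_bound)
    also have "\<dots> \<le> (\<integral>z. ((case z of (x, y) \<Rightarrow> dens h x * w y / norm (x - y)) + (case z of (x, y) \<Rightarrow> w x * dens h y / norm (x - y))) / 2 \<partial>(lborel \<Otimes>\<^sub>M lborel))"
    proof (rule integral_mono)
      show "integrable (lborel \<Otimes>\<^sub>M lborel) (\<lambda>z. norm (case z of (x, y) \<Rightarrow> f x * f y / norm (x - y)))"
        using Pf(1) by (rule integrable_norm)
      show "integrable (lborel \<Otimes>\<^sub>M lborel) (\<lambda>z. ((case z of (x, y) \<Rightarrow> dens h x * w y / norm (x - y)) + (case z of (x, y) \<Rightarrow> w x * dens h y / norm (x - y))) / 2)"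
        using Phw(1) Pwh(1) by (intro integrable_divide Bochner_Integration.integrable_add)
      show "norm (case z of (x, y) \<Rightarrow> f x * f y / norm (x - y))
          \<le> ((case z of (x, y) \<Rightarrow> dens h x * w y / norm (x - y)) + (case z of (x, y) \<Rightarrow> w x * dens h y / norm (x - y))) / 2" for z
      proof (cases z)
        case (Pair x y)
        have "\<bar>f x\<bar> * \<bar>f y\<bar> / norm (x - y) \<le> (dens h x * w y + w x * dens h y) / 2 / norm (x - y)"
          by (intro divide_right_mono abf) simp
        then show ?thesis unfolding Pair by (simp add: abs_mult add_divide_distrib)
      qed
    qed
    also have "\<dots> = ((\<integral>x. dens h x * newton w x \<partial>lborel) + (\<integral>x. w x * newton (dens h) x \<partial>lborel)) / 2"
      unfolding Phw(2) Pwh(2) using Phw(1) Pwh(1) by (subst integral_divide_zero, subst Bochner_Integration.integral_add) auto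
    also have "\<dots> = (\<integral>x. dens h x * newton w x \<partial>lborel)" unfolding Pwh(3) by simp
    finally show ?thesis .
  qed
  have nw: "newton w x = 2 * (coulomb u x + coulomb v x)" for x
    unfolding w_def[abs_def] coulomb_newton by (subst newton_add) (auto intro!: L12_cmult D simp: newton_cmult)
  note I = newton_mult_integrable[OF L12_integrable]
  have cv: "coulomb v x = coulomb u x + newton f x" for x
    unfolding coulomb_newton f_def[abs_def] by (subst newton_diff[OF D(2,1)]) simp
  have "hart v = (\<integral>x. dens u x * newton (dens u) x + dens u x * newton f x + (f x * newton (dens u) x + f x * newton f x) \<partial>lborel)"
    unfolding hart_def cv by (intro Bochner_Integration.integral_cong refl) (simp add: f_def coulomb_newton algebra_simps)
  also have "\<dots> = hart u + (\<integral>x. dens u x * newton f x \<partial>lborel) + ((\<integral>x. f x * newton (dens u) x \<partial>lborel) + (\<integral>x. f x * newton f x \<partial>lborel))"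
    unfolding hart_def coulomb_newton using I[OF D(1) D(1)] I[OF D(1) f] I[OF f D(1)] I[OF f f] by simp
  also have "(\<integral>x. dens u x * newton f x \<partial>lborel) = (\<integral>x. f x * newton (dens u) x \<partial>lborel)"
    by (rule newton_pairing(3)[OF D(1) f])
  finally have hv: "hart v - hart u = 2 * (\<integral>x. f x * newton (dens u) x \<partial>lborel) + (\<integral>x. f x * newton f x \<partial>lborel)" by simp
  have "(\<integral>x. f x * newton (dens u) x \<partial>lborel) = (\<integral>x. 2 * (r x * newton (dens u) x) + dens h x * newton (dens u) x \<partial>lborel)"
    unfolding fe by (simp add: algebra_simps)
  also have "\<dots> = 2 * (\<integral>x. r x * newton (dens u) x \<partial>lborel) + (\<integral>x. dens h x * newton (dens u) x \<partial>lborel)"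
    using I[OF r D(1)] I[OF D(3) D(1)] by simp
  finally have e: "(\<integral>x. f x * newton (dens u) x \<partial>lborel) = 2 * (\<integral>x. r x * newton (dens u) x \<partial>lborel) + (\<integral>x. dens h x * newton (dens u) x \<partial>lborel)" .
  have nn: "0 \<le> (\<integral>x. dens h x * newton (dens u) x \<partial>lborel)"
    by (intro integral_nonneg_AE) (auto intro!: AE_I2 mult_nonneg_nonneg newton_nonneg)
  have "(\<integral>x. dens h x * newton w x \<partial>lborel) = 2 * (\<integral>x. dens h x * (coulomb u x + coulomb v x) \<partial>lborel)"
  proof -
    have "dens h x * newton w x = 2 * (dens h x * (coulomb u x + coulomb v x))" for x by (simp add: nw)
    then show ?thesis by (simp only: integral_mult_right_zero)
  qed
  then show ?thesis using hv e nn ff by (simp add: r_def h_def coulomb_newton)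
qed

section \<open>Local Lipschitz continuity of dilations\<close>

lemma test_function_ftc:
  assumes k: "test_function k"
  shows "k (z + h) - k z = (\<integral>\<tau>. indicator {0..1} \<tau> * (\<Sum>i\<in>UNIV. h $ i * pderiv_R3 i k (z + \<tau> *\<^sub>R h)) \<partial>lborel)"
proof -
  let ?D = "\<lambda>\<tau>. \<Sum>i\<in>UNIV. h $ i * pderiv_R3 i k (z + \<tau> *\<^sub>R h)"
  have d: "((\<lambda>\<tau>. k (z + \<tau> *\<^sub>R h)) has_real_derivative ?D \<tau>) (at \<tau>)" for \<tau>
  proof -
    let ?F = "frechet_derivative k (at (z + \<tau> *\<^sub>R h))"
    have F: "(k has_derivative ?F) (at (z + \<tau> *\<^sub>R h))"
      using frechet_derivative_works[THEN iffD1, OF test_function_differentiable[OF k]] .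
    have "((\<lambda>\<tau>. z + \<tau> *\<^sub>R h) has_derivative (\<lambda>e. e *\<^sub>R h)) (at \<tau>)" by (auto intro!: derivative_eq_intros)
    from has_derivative_compose[OF this F]
    have c: "((\<lambda>\<tau>. k (z + \<tau> *\<^sub>R h)) has_derivative (\<lambda>e. ?F (e *\<^sub>R h))) (at \<tau>)" .
    have lin: "linear ?F" using F by (rule has_derivative_linear)
    have "?F h = ?F (\<Sum>i\<in>UNIV. h $ i *\<^sub>R axis i 1)" by (simp add: basis_expansion scalar_mult_eq_scaleR[symmetric])
    also have "\<dots> = ?D \<tau>" using lin by (simp add: linear_sum linear_cmul pderiv_R3_def)
    finally have "?F (e *\<^sub>R h) = e * ?D \<tau>" for e using lin by (simp add: linear_cmul)
    then show ?thesis unfolding has_field_derivative_def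
      by (intro has_derivative_eq_rhs[OF c]) (simp add: fun_eq_iff mult.commute)
  qed
  have "continuous_on UNIV ?D"
    by (intro continuous_intros continuous_on_compose2[OF pderiv_continuous[OF k]]) auto
  then have "isCont ?D \<tau>" for \<tau> by (simp add: continuous_on_eq_continuous_at)
  then have "(\<integral>\<tau>. ?D \<tau> * indicator {0..1} \<tau> \<partial>lborel) = k (z + 1 *\<^sub>R h) - k (z + 0 *\<^sub>R h)"
    using d by (intro integral_FTC_Icc_real) auto
  then show ?thesis by (simp add: mult.commute)
qed

text \<open>The fundamental theorem of calculus is applied to the kernel along the segment from x to
  x + h; after Fubini the derivative of the kernel becomes the weak gradient of
  \<open>u\<close>.\<close>

lemma conv_translate_diff:
  assumes g: "is_weak_gradient u g" and u: "L2_fun u" and k: "test_function k"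
  shows "conv k u (x + h) - conv k u x
    = (\<integral>\<tau>. indicator {0..1} \<tau> *\<^sub>R (\<Sum>i\<in>UNIV. h $ i *\<^sub>R conv k (\<lambda>y. g y $ i) (x + \<tau> *\<^sub>R h)) \<partial>lborel)"
proof -
  note [measurable] = L2_measurable[OF u] L2_measurable[OF pderiv_L2[OF k]]
  let ?F = "\<lambda>\<tau> y. indicator {0..1} \<tau> *\<^sub>R (\<Sum>i\<in>UNIV. h $ i *\<^sub>R (pderiv_R3 i k (x + \<tau> *\<^sub>R h - y) *\<^sub>R u y))"
  note kL = test_function_integrable(3)[OF k]
  define M where "M = (\<Sum>i\<in>UNIV. \<bar>h $ i\<bar> * (sqrt (mass (pderiv_R3 i k)) * sqrt (mass u)))"
  have int1: "integrable lborel (\<lambda>y. pderiv_R3 i k (z - y) *\<^sub>R u y)" for i z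
    by (rule conv_sup(2)[OF pderiv_L2[OF k] u])
  have int1n: "(\<integral>y. norm (pderiv_R3 i k (z - y) *\<^sub>R u y) \<partial>lborel) \<le> sqrt (mass (pderiv_R3 i k)) * sqrt (mass u)" for i z
    using Cauchy_Schwarz_L2(2)[OF L2_reflect[OF pderiv_L2[OF k], where x=z] u] by (simp add: mass_reflect)
  have iF: "integrable (lborel \<Otimes>\<^sub>M lborel) (case_prod ?F)"
  proof (rule lborel_pair.Fubini_integrable)
    show "case_prod ?F \<in> borel_measurable (lborel \<Otimes>\<^sub>M lborel)" by measurable
    show "AE \<tau> in lborel. integrable lborel (\<lambda>y. case (\<tau>, y) of (\<tau>, y) \<Rightarrow> ?F \<tau> y)"
      unfolding prod.case by (intro AE_I2 integrable_scaleR_right Bochner_Integration.integrable_sum int1)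
    show "integrable lborel (\<lambda>\<tau>. \<integral>y. norm (case (\<tau>, y) of (\<tau>, y) \<Rightarrow> ?F \<tau> y) \<partial>lborel)"
    proof (rule Bochner_Integration.integrable_bound)
      show "integrable lborel (\<lambda>\<tau>. indicator {0..1::real} \<tau> * M)" by simp
      show "AE \<tau> in lborel. norm (\<integral>y. norm (case (\<tau>, y) of (\<tau>, y) \<Rightarrow> ?F \<tau> y) \<partial>lborel) \<le> norm (indicator {0..1::real} \<tau> * M)"
      proof (rule AE_I2)
        fix \<tau> :: real
        have "(\<integral>y. norm (?F \<tau> y) \<partial>lborel) \<le> (\<integral>y. indicator {0..1} \<tau> * (\<Sum>i\<in>UNIV. \<bar>h $ i\<bar> * norm (pderiv_R3 i k (x + \<tau> *\<^sub>R h - y) *\<^sub>R u y)) \<partial>lborel)"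
        proof (rule integral_mono)
          show "integrable lborel (\<lambda>y. norm (?F \<tau> y))"
            by (intro integrable_norm integrable_scaleR_right Bochner_Integration.integrable_sum int1)
          show "integrable lborel (\<lambda>y. indicator {0..1} \<tau> * (\<Sum>i\<in>UNIV. \<bar>h $ i\<bar> * norm (pderiv_R3 i k (x + \<tau> *\<^sub>R h - y) *\<^sub>R u y)))"
            by (intro integrable_mult_right Bochner_Integration.integrable_sum integrable_norm int1)
          fix y
          have "norm (\<Sum>i\<in>UNIV. h $ i *\<^sub>R (pderiv_R3 i k (x + \<tau> *\<^sub>R h - y) *\<^sub>R u y))
              \<le> (\<Sum>i\<in>UNIV. \<bar>h $ i\<bar> * norm (pderiv_R3 i k (x + \<tau> *\<^sub>R h - y) *\<^sub>R u y))"
            by (rule order_trans[OF norm_sum]) (simp add: abs_mult mult_ac)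
          then show "norm (?F \<tau> y) \<le> indicator {0..1} \<tau> * (\<Sum>i\<in>UNIV. \<bar>h $ i\<bar> * norm (pderiv_R3 i k (x + \<tau> *\<^sub>R h - y) *\<^sub>R u y))"
            by (simp only: norm_scaleR) (simp add: mult_left_mono)
        qed
        also have "\<dots> = indicator {0..1} \<tau> * (\<Sum>i\<in>UNIV. \<bar>h $ i\<bar> * (\<integral>y. norm (pderiv_R3 i k (x + \<tau> *\<^sub>R h - y) *\<^sub>R u y) \<partial>lborel))"
          using int1 by (simp only: integral_mult_right_zero Bochner_Integration.integral_sum integrable_mult_right integrable_norm)
        also have "\<dots> \<le> indicator {0..1} \<tau> * M"
          unfolding M_def by (intro mult_left_mono sum_mono int1n) auto
        finally have "(\<integral>y. norm (?F \<tau> y) \<partial>lborel) \<le> indicator {0..1} \<tau> * M" .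
        moreover have "0 \<le> (\<integral>y. norm (?F \<tau> y) \<partial>lborel)" by (rule integral_nonneg_AE) simp
        ultimately show "norm (\<integral>y. norm (case (\<tau>, y) of (\<tau>, y) \<Rightarrow> ?F \<tau> y) \<partial>lborel) \<le> norm (indicator {0..1::real} \<tau> * M)"
          unfolding prod.case by (simp only: real_norm_def abs_of_nonneg)
      qed
    qed measurable
  qed
  have "conv k u (x + h) - conv k u x = (\<integral>y. k (x + h - y) *\<^sub>R u y - k (x - y) *\<^sub>R u y \<partial>lborel)"
    unfolding conv_def using conv_sup(2)[OF kL u] by (subst Bochner_Integration.integral_diff) auto
  also have "\<dots> = (\<integral>y. (\<integral>\<tau>. ?F \<tau> y \<partial>lborel) \<partial>lborel)"
  proof (intro Bochner_Integration.integral_cong refl)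
    fix y
    have "k (x + h - y) *\<^sub>R u y - k (x - y) *\<^sub>R u y = (k ((x - y) + h) - k (x - y)) *\<^sub>R u y"
      by (simp add: scaleR_diff_left algebra_simps)
    also have "\<dots> = (\<integral>\<tau>. (indicator {0..1} \<tau> * (\<Sum>i\<in>UNIV. h $ i * pderiv_R3 i k ((x - y) + \<tau> *\<^sub>R h))) *\<^sub>R u y \<partial>lborel)"
    proof -
      have "continuous_on UNIV (\<lambda>\<tau>. \<Sum>i\<in>UNIV. h $ i * pderiv_R3 i k ((x - y) + \<tau> *\<^sub>R h))"
        by (intro continuous_intros continuous_on_compose2[OF pderiv_continuous[OF k]]) auto
      then have "integrable lborel (\<lambda>\<tau>. indicator {0..1::real} \<tau> *\<^sub>R (\<Sum>i\<in>UNIV. h $ i * pderiv_R3 i k ((x - y) + \<tau> *\<^sub>R h)))"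
        using borel_integrable_atLeastAtMost'[OF continuous_on_subset[OF _ subset_UNIV]] unfolding set_integrable_def by blast
      then show ?thesis unfolding test_function_ftc[OF k] by (subst integral_scaleR_left) auto
    qed
    also have "\<dots> = (\<integral>\<tau>. ?F \<tau> y \<partial>lborel)"
      by (intro Bochner_Integration.integral_cong refl) (simp add: scaleR_sum_left add_diff_eq diff_add_eq flip: scaleR_scaleR)
    finally show "k (x + h - y) *\<^sub>R u y - k (x - y) *\<^sub>R u y = (\<integral>\<tau>. ?F \<tau> y \<partial>lborel)" .
  qed
  also have "\<dots> = (\<integral>\<tau>. (\<integral>y. ?F \<tau> y \<partial>lborel) \<partial>lborel)"
    by (rule lborel_pair.Fubini_integral[OF iF])
  also have "\<dots> = (\<integral>\<tau>. indicator {0..1} \<tau> *\<^sub>R (\<Sum>i\<in>UNIV. h $ i *\<^sub>R conv (pderiv_R3 i k) u (x + \<tau> *\<^sub>R h)) \<partial>lborel)"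
  proof (intro Bochner_Integration.integral_cong refl)
    fix \<tau> :: real
    have "(\<integral>y. (\<Sum>i\<in>UNIV. h $ i *\<^sub>R (pderiv_R3 i k (x + \<tau> *\<^sub>R h - y) *\<^sub>R u y)) \<partial>lborel)
        = (\<Sum>i\<in>UNIV. h $ i *\<^sub>R conv (pderiv_R3 i k) u (x + \<tau> *\<^sub>R h))"
      unfolding conv_def using int1 by (subst Bochner_Integration.integral_sum) (auto intro!: integrable_scaleR_right simp del: scaleR_scaleR)
    then show "(\<integral>y. ?F \<tau> y \<partial>lborel) = indicator {0..1} \<tau> *\<^sub>R (\<Sum>i\<in>UNIV. h $ i *\<^sub>R conv (pderiv_R3 i k) u (x + \<tau> *\<^sub>R h))"
      by (simp only: integral_scaleR_right)
  qed
  finally show ?thesis by (simp add: conv_weak_gradient[OF g k])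
qed

lemma l2_sum_triangle:
  fixes c :: "'i \<Rightarrow> R3 \<Rightarrow> 'a::euclidean_space"
  assumes "finite I" and c: "\<And>i. i \<in> I \<Longrightarrow> L2_fun (c i)"
  shows "sqrt (mass (\<lambda>x. \<Sum>i\<in>I. c i x)) \<le> (\<Sum>i\<in>I. sqrt (mass (c i)))"
  using assms
proof (induction I)
  case empty show ?case by (simp add: mass_def)
next
  case (insert i I)
  then show ?case using l2_triangle[of "c i" "\<lambda>x. \<Sum>i\<in>I. c i x"] L2_sum[of I c] by simp
qed

lemma abs_exp_minus_1_le: "\<bar>exp t - 1\<bar> \<le> \<bar>t\<bar> * exp \<bar>t\<bar>" for t :: real
proof (cases "t \<ge> 0")
  case True
  have "1 - t \<le> exp (- t)" using exp_ge_add_one_self[of "- t"] by simp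
  then have "exp t * (1 - t) \<le> exp t * exp (- t)" by (intro mult_left_mono) auto
  then have "exp t - 1 \<le> t * exp t" by (simp add: exp_minus algebra_simps)
  then show ?thesis using True by simp
next
  case False
  have "1 - exp t \<le> - t" using exp_ge_add_one_self[of t] by linarith
  also have "\<dots> \<le> - t * exp (- t)" using False mult_left_mono[of 1 "exp (-t)" "-t"] by simp
  finally show ?thesis using False by simp
qed

text \<open>Integrability is not asked for, because a non-integrable function has Bochner integral
  0.\<close>

lemma norm_integral_le_nn_integral:
  fixes f :: "'a \<Rightarrow> 'b::{banach,second_countable_topology}"
  shows "ennreal (norm (integral\<^sup>L M f)) \<le> (\<integral>\<^sup>+x. ennreal (norm (f x)) \<partial>M)"
  by (cases "integrable M f") (auto simp: integral_norm_bound_ennreal not_integrable_integral_eq)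

text \<open>On the ball a dilation moves a point by at most R |exp s - 1|, so the increment is an
  average of the mollified gradient over dilates of the point. The 9 comes from three gradient
  components, and exp 5 = exp 2 * exp 3 from the displacement and from undoing the dilations. The
  bound is uniform in \<open>j\<close>.\<close>

lemma moll_local_dilation:
  assumes g: "is_weak_gradient u g" and u: "L2_fun u" and R: "R > 0" and s: "\<bar>s\<bar> \<le> 1"
  shows "mass (\<lambda>x. indicator (cball 0 R) x *\<^sub>R (moll j u (exp s *\<^sub>R x) - moll j u x))
    \<le> 9 * exp 5 * R\<^sup>2 * mass g * s\<^sup>2"
    and "L2_fun (\<lambda>x. indicator (cball 0 R) x *\<^sub>R (moll j u (exp s *\<^sub>R x) - moll j u x))"
proof -
  note gi = L2_component[OF is_weak_gradient_L2[OF g]]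
  define G where "G x = (\<Sum>i\<in>UNIV. norm (moll j (\<lambda>y. g y $ i) x))" for x
  have mi: "L2_fun (\<lambda>x. norm (moll j (\<lambda>y. g y $ i) x))" for i
    using moll_L2(1)[OF gi(1), of j i] L2_measurable[OF moll_L2(1)[OF gi(1)], of j i] by (auto simp: L2_fun_def)
  have mmi: "mass (\<lambda>x. norm (moll j (\<lambda>y. g y $ i) x)) \<le> mass g" for i
    using order_trans[OF moll_L2(2)[OF gi(1)] gi(2)] by (simp add: mass_def)
  have GL: "L2_fun G" unfolding G_def[abs_def] by (rule L2_sum) (rule mi)
  have G0: "0 \<le> G x" for x unfolding G_def by (intro sum_nonneg) auto
  have "sqrt (mass G) \<le> (\<Sum>i\<in>(UNIV::3 set). sqrt (mass (\<lambda>x. norm (moll j (\<lambda>y. g y $ i) x))))"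
    unfolding G_def[abs_def] by (rule l2_sum_triangle) (auto intro: mi)
  also have "\<dots> \<le> (\<Sum>i\<in>(UNIV::3 set). sqrt (mass g))" by (intro sum_mono) (simp add: mmi)
  also have "\<dots> = 3 * sqrt (mass g)" by simp
  finally have "(sqrt (mass G))\<^sup>2 \<le> (3 * sqrt (mass g))\<^sup>2" by (intro power_mono) auto
  then have mG: "mass G \<le> 9 * mass g" by (simp add: power_mult_distrib)
  have vL: "L2_fun (moll j u)" by (rule moll_L2(1)[OF u])
  note [measurable] = L2_measurable[OF vL] L2_measurable[OF GL]
  have B: "indicator (cball 0 R) \<in> borel_measurable (borel :: R3 measure)" by (intro borel_measurable_indicator) auto
  note [measurable] = B
  define E where "E = exp s - 1"
  \<comment> \<open>The intermediate dilation factors stay above exp (-1), so the change of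
    variables that removes one of them costs at most exp 3.\<close>
  have c: "exp (-1) \<le> 1 + \<tau> * E" if "0 \<le> \<tau>" "\<tau> \<le> 1" for \<tau>
  proof -
    have "exp (-1) = (1 - \<tau>) * exp (-1) + \<tau> * exp (-1)" by (simp add: algebra_simps)
    also have "\<dots> \<le> (1 - \<tau>) * 1 + \<tau> * exp s" using that s by (intro add_mono mult_left_mono) auto
    finally show ?thesis by (simp add: E_def algebra_simps)
  qed
  let ?D = "\<lambda>x. indicator (cball 0 R) x *\<^sub>R (moll j u (exp s *\<^sub>R x) - moll j u x)"
  have pt: "ennreal ((norm (?D x))\<^sup>2) \<le> (\<integral>\<^sup>+\<tau>. indicator {0..1} \<tau> * ennreal (E\<^sup>2 * R\<^sup>2 * (G ((1 + \<tau> * E) *\<^sub>R x))\<^sup>2) \<partial>lborel)" for x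
  proof (cases "x \<in> cball 0 R")
    case True
    define h where "h = E *\<^sub>R x"
    have xh: "exp s *\<^sub>R x = x + h" by (simp add: h_def E_def scaleR_diff_left)
    have xt: "x + \<tau> *\<^sub>R h = (1 + \<tau> * E) *\<^sub>R x" for \<tau> by (simp add: h_def scaleR_add_left)
    have "ennreal (norm (?D x)) = ennreal (norm (conv (eta_j j) u (x + h) - conv (eta_j j) u x))"
      using True by (simp add: xh moll_def)
    also have "\<dots> \<le> (\<integral>\<^sup>+\<tau>. ennreal (norm (indicator {0..1} \<tau> *\<^sub>R (\<Sum>i\<in>UNIV. h $ i *\<^sub>R conv (eta_j j) (\<lambda>y. g y $ i) (x + \<tau> *\<^sub>R h)))) \<partial>lborel)"
      unfolding conv_translate_diff[OF g u test_eta_j] by (rule norm_integral_le_nn_integral)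
    also have "\<dots> \<le> (\<integral>\<^sup>+\<tau>. ennreal (indicator {0..1} \<tau>) * ennreal (\<bar>E\<bar> * R * G ((1 + \<tau> * E) *\<^sub>R x)) \<partial>lborel)"
    proof (intro nn_integral_mono)
      fix \<tau> :: real
      have "norm (\<Sum>i\<in>UNIV. h $ i *\<^sub>R conv (eta_j j) (\<lambda>y. g y $ i) (x + \<tau> *\<^sub>R h))
          \<le> (\<Sum>i\<in>UNIV. norm h * norm (moll j (\<lambda>y. g y $ i) ((1 + \<tau> * E) *\<^sub>R x)))"
        unfolding xt by (rule order_trans[OF norm_sum])
          (auto intro!: sum_mono mult_right_mono simp: moll_def Finite_Cartesian_Product.norm_nth_le[of h, unfolded real_norm_def])
      also have "\<dots> = norm h * G ((1 + \<tau> * E) *\<^sub>R x)" by (simp add: G_def sum_distrib_left)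
      also have "\<dots> \<le> \<bar>E\<bar> * R * G ((1 + \<tau> * E) *\<^sub>R x)"
        using True G0 by (intro mult_right_mono) (auto simp: h_def mult_left_mono)
      finally show "ennreal (norm (indicator {0..1} \<tau> *\<^sub>R (\<Sum>i\<in>UNIV. h $ i *\<^sub>R conv (eta_j j) (\<lambda>y. g y $ i) (x + \<tau> *\<^sub>R h))))
          \<le> ennreal (indicator {0..1} \<tau>) * ennreal (\<bar>E\<bar> * R * G ((1 + \<tau> * E) *\<^sub>R x))"
        by (auto simp: indicator_def intro!: ennreal_leI)
    qed
    finally have "(ennreal (norm (?D x)))\<^sup>2 \<le> (\<integral>\<^sup>+\<tau>. ennreal (indicator {0..1} \<tau>) * ennreal (\<bar>E\<bar> * R * G ((1 + \<tau> * E) *\<^sub>R x)) \<partial>lborel)\<^sup>2"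
      by (rule power_mono) simp
    also have "\<dots> = (\<integral>\<^sup>+\<tau>. ennreal (indicator {0..1} \<tau>) * (ennreal (indicator {0..1} \<tau>) * ennreal (\<bar>E\<bar> * R * G ((1 + \<tau> * E) *\<^sub>R x))) \<partial>lborel)\<^sup>2"
      by (intro arg_cong[where f="\<lambda>z. z\<^sup>2"] nn_integral_cong) (auto simp: indicator_def)
    also have "\<dots> \<le> (\<integral>\<^sup>+\<tau>. (ennreal (indicator {0..1::real} \<tau>))\<^sup>2 \<partial>lborel)
        * (\<integral>\<^sup>+\<tau>. (ennreal (indicator {0..1} \<tau>) * ennreal (\<bar>E\<bar> * R * G ((1 + \<tau> * E) *\<^sub>R x)))\<^sup>2 \<partial>lborel)"
      by (rule Cauchy_Schwarz_nn_integral) measurable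
    also have "(\<integral>\<^sup>+\<tau>. (ennreal (indicator {0..1::real} \<tau>))\<^sup>2 \<partial>lborel) = (\<integral>\<^sup>+\<tau>. indicator {0..1::real} \<tau> \<partial>lborel)"
      by (intro nn_integral_cong) (auto simp: indicator_def)
    also have "\<dots> = 1" by simp
    also have "(\<integral>\<^sup>+\<tau>. (ennreal (indicator {0..1} \<tau>) * ennreal (\<bar>E\<bar> * R * G ((1 + \<tau> * E) *\<^sub>R x)))\<^sup>2 \<partial>lborel)
       = (\<integral>\<^sup>+\<tau>. indicator {0..1} \<tau> * ennreal (E\<^sup>2 * R\<^sup>2 * (G ((1 + \<tau> * E) *\<^sub>R x))\<^sup>2) \<partial>lborel)"
      using G0 R by (intro nn_integral_cong) (auto simp: indicator_def ennreal_power power_mult_distrib)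
    finally show ?thesis by (simp add: ennreal_power)
  qed simp
  have "(\<integral>\<^sup>+x. ennreal ((norm (?D x))\<^sup>2) \<partial>lborel)
      \<le> (\<integral>\<^sup>+x. (\<integral>\<^sup>+\<tau>. indicator {0..1} \<tau> * ennreal (E\<^sup>2 * R\<^sup>2 * (G ((1 + \<tau> * E) *\<^sub>R x))\<^sup>2) \<partial>lborel) \<partial>lborel)"
    by (intro nn_integral_mono pt)
  also have "\<dots> = (\<integral>\<^sup>+\<tau>. (\<integral>\<^sup>+x. indicator {0..1} \<tau> * ennreal (E\<^sup>2 * R\<^sup>2 * (G ((1 + \<tau> * E) *\<^sub>R x))\<^sup>2) \<partial>lborel) \<partial>lborel)"
    by (rule lborel_pair.Fubini') measurable
  also have "\<dots> \<le> (\<integral>\<^sup>+\<tau>. indicator {0..1::real} \<tau> * ennreal (E\<^sup>2 * R\<^sup>2 * (exp 3 * mass G)) \<partial>lborel)"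
  proof (intro nn_integral_mono)
    fix \<tau> :: real
    show "(\<integral>\<^sup>+x. indicator {0..1} \<tau> * ennreal (E\<^sup>2 * R\<^sup>2 * (G ((1 + \<tau> * E) *\<^sub>R x))\<^sup>2) \<partial>lborel)
       \<le> indicator {0..1::real} \<tau> * ennreal (E\<^sup>2 * R\<^sup>2 * (exp 3 * mass G))"
    proof (cases "\<tau> \<in> {0..1}")
      case True
      let ?c = "1 + \<tau> * E"
      have c0: "exp (-1) \<le> ?c" using c True by simp
      then have cp: "?c > 0" using exp_gt_zero[of "-1::real"] by linarith
      have L: "L2_fun (\<lambda>x. G (0 + ?c *\<^sub>R x))" using cp by (intro L2_affine GL) auto
      have "(\<integral>\<^sup>+x. indicator {0..1} \<tau> * ennreal (E\<^sup>2 * R\<^sup>2 * (G (?c *\<^sub>R x))\<^sup>2) \<partial>lborel)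
         = (\<integral>\<^sup>+x. ennreal (E\<^sup>2 * R\<^sup>2 * (norm (G (0 + ?c *\<^sub>R x)))\<^sup>2) \<partial>lborel)"
        using True by simp
      also have "\<dots> = ennreal (E\<^sup>2 * R\<^sup>2 * mass (\<lambda>x. G (0 + ?c *\<^sub>R x)))"
        unfolding mass_def integral_mult_right_zero[symmetric] using L2_integrable[OF L]
        by (intro nn_integral_eq_integral) (auto intro!: integrable_mult_right)
      also have "mass (\<lambda>x. G (0 + ?c *\<^sub>R x)) = mass G / ?c ^ 3" using cp by (subst mass_affine) auto
      also have "ennreal (E\<^sup>2 * R\<^sup>2 * (mass G / ?c ^ 3)) \<le> ennreal (E\<^sup>2 * R\<^sup>2 * (exp 3 * mass G))"
      proof (intro ennreal_leI mult_left_mono)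
        have "exp (-1) ^ 3 \<le> ?c ^ 3" using c0 by (intro power_mono) auto
        then have "mass G / ?c ^ 3 \<le> mass G / exp (-1) ^ 3" using cp by (intro divide_left_mono) auto
        also have "mass G / exp (-1) ^ 3 = exp 3 * mass G"
          by (simp add: exp_of_nat_mult[symmetric] exp_minus field_simps)
        finally show "mass G / ?c ^ 3 \<le> exp 3 * mass G" .
      qed auto
      finally show ?thesis using True by simp
    qed simp
  qed
  also have "\<dots> = ennreal (E\<^sup>2 * R\<^sup>2 * (exp 3 * mass G))"
    by (subst nn_integral_multc) auto
  also have "\<dots> \<le> ennreal (9 * exp 5 * R\<^sup>2 * mass g * s\<^sup>2)"
  proof (rule ennreal_leI)
    have "\<bar>E\<bar> \<le> \<bar>s\<bar> * exp 1" unfolding E_def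
      by (rule order_trans[OF abs_exp_minus_1_le]) (use s in \<open>auto intro!: mult_left_mono\<close>)
    then have "E\<^sup>2 \<le> (\<bar>s\<bar> * exp 1)\<^sup>2" by (metis abs_ge_zero power2_abs power_mono)
    then have E2: "E\<^sup>2 \<le> s\<^sup>2 * exp 2" by (simp add: power_mult_distrib flip: exp_double)
    have "E\<^sup>2 * R\<^sup>2 * (exp 3 * mass G) \<le> (s\<^sup>2 * exp 2) * R\<^sup>2 * (exp 3 * (9 * mass g))"
      by (intro mult_mono E2 mG) auto
    also have "\<dots> = 9 * (exp 2 * exp 3) * R\<^sup>2 * mass g * s\<^sup>2" by simp
    also have "exp 2 * exp 3 = exp (5::real)" by (simp flip: exp_add)
    finally show "E\<^sup>2 * R\<^sup>2 * (exp 3 * mass G) \<le> 9 * exp 5 * R\<^sup>2 * mass g * s\<^sup>2" .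
  qed
  finally have b: "(\<integral>\<^sup>+x. ennreal ((norm (?D x))\<^sup>2) \<partial>lborel) \<le> ennreal (9 * exp 5 * R\<^sup>2 * mass g * s\<^sup>2)" .
  have i: "integrable lborel (\<lambda>x. (norm (?D x))\<^sup>2)"
  proof (rule integrableI_bounded)
    show "(\<integral>\<^sup>+x. ennreal (norm ((norm (?D x))\<^sup>2)) \<partial>lborel) < \<infinity>" using b by (auto intro: le_less_trans)
  qed measurable
  then show "L2_fun ?D" by (intro L2_funI) measurable
  have "ennreal (mass ?D) \<le> ennreal (9 * exp 5 * R\<^sup>2 * mass g * s\<^sup>2)"
    unfolding mass_def using b i by (subst nn_integral_eq_integral[symmetric]) (auto simp: mass_def)
  then show "mass ?D \<le> 9 * exp 5 * R\<^sup>2 * mass g * s\<^sup>2" by (subst (asm) ennreal_le_iff) auto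
qed

text \<open>The displacement under a dilation grows with |x|, hence the cutoff. The amplitude factor
  and the change of argument are treated separately, the latter as the limit of its mollified
  version.\<close>

lemma dilate_locally_lipschitz:
  assumes u: "u \<in> H1" and R: "R > 0"
  obtains C where "C > 0"
    "\<And>s. \<bar>s\<bar> \<le> 1 \<Longrightarrow> mass (\<lambda>x. indicator (cball 0 R) x *\<^sub>R (dilate s u x - u x)) \<le> C * s\<^sup>2"
proof -
  define A where "A = 9 * exp 5 * R\<^sup>2 * kin u"
  define B where "B = (3/2 * exp (3/2))\<^sup>2 * (exp 3 * mass u)"
  have uL: "L2_fun u" by (rule H1_L2[OF u])
  note [measurable] = L2_measurable[OF uL] L2_measurable[OF moll_L2(1)[OF uL]]
  have ind: "indicator (cball 0 R) \<in> borel_measurable (borel :: R3 measure)" by (intro borel_measurable_indicator) auto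
  note [measurable] = ind
  have A0: "A \<ge> 0" "B \<ge> 0" by (auto simp: A_def B_def)
  have "mass (\<lambda>x. indicator (cball 0 R) x *\<^sub>R (dilate s u x - u x)) \<le> (2 * B + 2 * A + 1) * s\<^sup>2" if s: "\<bar>s\<bar> \<le> 1" for s
  proof -
    let ?D = "\<lambda>j x. indicator (cball 0 R) x *\<^sub>R (moll j u (exp s *\<^sub>R x) - moll j u x)"
    let ?d = "\<lambda>x. indicator (cball 0 R) x *\<^sub>R (u (exp s *\<^sub>R x) - u x)"
    let ?e = "\<lambda>x. indicator (cball 0 R) x *\<^sub>R ((exp (3 * s / 2) - 1) *\<^sub>R u (exp s *\<^sub>R x))"
    note M = moll_local_dilation[OF wgrad_weak_gradient[OF u] uL R s]
    have c: "AE x in lborel. (\<lambda>j. moll j u x) \<longlonglongrightarrow> u x" by (rule moll_AE_tendsto[OF wgrad_weak_gradient[OF u] uL])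
    have c2: "AE x in lborel. (\<lambda>j. moll j u (exp s *\<^sub>R x)) \<longlonglongrightarrow> u (exp s *\<^sub>R x)"
      using AE_affine[OF c, of "exp s" 0] by simp
    from c2 c have l: "AE x in lborel. (\<lambda>j. (norm (?D j x))\<^sup>2) \<longlonglongrightarrow> (norm (?d x))\<^sup>2"
      by eventually_elim (intro tendsto_intros)
    have dL: "L2_fun ?d"
      by (rule L2_funI) (measurable, rule fatou_bound(1)[OF l L2_integrable[OF M(2)], where B="A * s\<^sup>2"],
        use M(1) in \<open>auto simp: mass_def A_def\<close>)
    have "mass ?d \<le> A * s\<^sup>2"
      unfolding mass_def by (rule fatou_bound(2)[OF l L2_integrable[OF M(2)]]) (use M(1) in \<open>auto simp: mass_def A_def\<close>)
    have cL: "L2_fun (\<lambda>x. (exp (3 * s / 2) - 1) *\<^sub>R u (0 + exp s *\<^sub>R x))" by (intro L2_scaleR(1) L2_affine uL) simp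
    have eb: "(norm (?e x))\<^sup>2 \<le> (norm ((exp (3 * s / 2) - 1) *\<^sub>R u (0 + exp s *\<^sub>R x)))\<^sup>2" for x by (auto simp: indicator_def)
    have eL: "L2_fun ?e" by (rule L2_bound(1)[OF _ L2_integrable[OF cL] eb]) measurable
    have "mass ?e \<le> mass (\<lambda>x. (exp (3 * s / 2) - 1) *\<^sub>R u (0 + exp s *\<^sub>R x))"
      unfolding mass_def[of "\<lambda>x. (exp (3 * s / 2) - 1) *\<^sub>R u (0 + exp s *\<^sub>R x)"]
      by (rule L2_bound(2)[OF _ L2_integrable[OF cL] eb]) measurable
    also have "\<dots> = (exp (3 * s / 2) - 1)\<^sup>2 * (mass u / exp s ^ 3)"
      by (subst mass_scaleR) (auto intro!: L2_affine uL simp: mass_affine[of _ u 0, simplified] L2_affine[of _ u 0, simplified] uL)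
    also have "\<dots> \<le> ((3/2 * exp (3/2))\<^sup>2 * s\<^sup>2) * (exp 3 * mass u)"
    proof (intro mult_mono)
      have "\<bar>exp (3 * s / 2) - 1\<bar> \<le> \<bar>3 * s / 2\<bar> * exp (3/2)"
        by (rule order_trans[OF abs_exp_minus_1_le]) (use s in \<open>auto intro!: mult_left_mono\<close>)
      then have "(exp (3 * s / 2) - 1)\<^sup>2 \<le> (\<bar>3 * s / 2\<bar> * exp (3/2))\<^sup>2" by (metis abs_ge_zero power2_abs power_mono)
      then show "(exp (3 * s / 2) - 1)\<^sup>2 \<le> (3/2 * exp (3/2))\<^sup>2 * s\<^sup>2" by (simp add: power_mult_distrib power_divide mult_ac)
      have "mass u / exp s ^ 3 = exp (- 3 * s) * mass u" by (simp add: exp_of_nat_mult[symmetric] exp_minus field_simps)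
      also have "\<dots> \<le> exp 3 * mass u" using s by (intro mult_right_mono) auto
      finally show "mass u / exp s ^ 3 \<le> exp 3 * mass u" .
    qed auto
    also have "\<dots> = B * s\<^sup>2" by (simp add: B_def)
    finally have "mass ?e \<le> B * s\<^sup>2" .
    have eq: "indicator (cball 0 R) x *\<^sub>R (dilate s u x - u x) = ?e x + ?d x" for x
      by (simp add: dilate_alt algebra_simps)
    have "mass (\<lambda>x. indicator (cball 0 R) x *\<^sub>R (dilate s u x - u x)) \<le> 2 * mass ?e + 2 * mass ?d"
      unfolding eq by (rule mass_add_le[OF eL dL])
    also have "\<dots> \<le> 2 * (B * s\<^sup>2) + 2 * (A * s\<^sup>2) + s\<^sup>2"
      using \<open>mass ?e \<le> B * s\<^sup>2\<close> \<open>mass ?d \<le> A * s\<^sup>2\<close> zero_le_power2[of s] by linarith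
    also have "\<dots> = (2 * B + 2 * A + 1) * s\<^sup>2" by (simp add: distrib_right)
    finally show ?thesis .
  qed
  with that[of "2 * B + 2 * A + 1"] A0 show ?thesis by simp
qed

section \<open>Second order bounds for the nonlinear terms\<close>

text \<open>The tangent inequality at b^2 of the convex function s^(p/2) of the squared modulus,
  obtained from Young's inequality.\<close>

lemma power_young:
  fixes a b p :: real
  assumes "0 \<le> a" "0 \<le> b" "2 < p"
  shows "(b powr p - a powr p) / p \<le> 1/2 * b powr (p - 2) * (b\<^sup>2 - a\<^sup>2)"
proof (cases "a = 0 \<or> b = 0")
  case True
  then show ?thesis
  proof
    assume "a = 0"
    have "b powr p / p \<le> b powr p / 2" using assms by (intro divide_left_mono) auto
    then show ?thesis using \<open>a = 0\<close> assms powr_split_square[of b p] by simp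
  qed (use assms in simp)
next
  case False
  then have ab: "a > 0" "b > 0" using assms by auto
  have "(b powr p) powr (1 - 2 / p) * (a powr p) powr (2 / p) \<le> (1 - 2 / p) * b powr p + (2 / p) * a powr p"
    using ab assms by (intro Youngs_inequality_0) (auto simp: field_simps)
  moreover have "(b powr p) powr (1 - 2 / p) = b powr (p - 2)" 
    unfolding powr_powr using assms by (intro arg_cong[where f="\<lambda>s. b powr s"]) (simp add: field_simps)
  moreover have "(a powr p) powr (2 / p) = a\<^sup>2" 
    unfolding powr_powr using assms ab by (simp add: powr_numeral)
  ultimately have y: "b powr (p - 2) * a\<^sup>2 \<le> (1 - 2 / p) * b powr p + (2 / p) * a powr p" by simp
  have "1/2 * b powr (p - 2) * (b\<^sup>2 - a\<^sup>2) = 1/2 * b powr p - 1/2 * (b powr (p - 2) * a\<^sup>2)"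
    using powr_split_square[of b p] ab by (simp add: algebra_simps diff_divide_distrib)
  moreover have "(b powr p - a powr p) / p = 1/2 * b powr p - 1/2 * ((1 - 2 / p) * b powr p + (2 / p) * a powr p)"
    using assms by (simp add: field_simps)
  ultimately show ?thesis using mult_left_mono[OF y, of "1/2"] by simp
qed

text \<open>By homogeneity the smaller number may be taken as t times the larger with t in [0, 1].
  As r < 4, one has 1 - t^r <= 1 - t^4 <= 4 (1 - t), which also covers small r, where the power is
  not Lipschitz at 0.\<close>

lemma powr_diff_bound:
  fixes a b r :: real
  assumes "0 \<le> a" "0 \<le> b" "0 < r" "r < 4"
  shows "(b powr r - a powr r) * (b\<^sup>2 - a\<^sup>2) \<le> 8 * (a powr r + b powr r) * (b - a)\<^sup>2"
proof -
  have main: "(b powr r - a powr r) * (b\<^sup>2 - a\<^sup>2) \<le> 8 * b powr r * (b - a)\<^sup>2" if ab: "0 \<le> a" "a \<le> b" for a b :: real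
  proof (cases "b = 0")
    case False
    then have b: "b > 0" using ab by simp
    define t where "t = a / b"
    have t: "0 \<le> t" "t \<le> 1" "a = t * b" using ab b by (auto simp: t_def)
    have t4: "t ^ 4 \<le> t powr r"
    proof (cases "t = 0")
      case False
      then have "t powr 4 \<le> t powr r" using t assms by (intro powr_mono') auto
      then show ?thesis using False t by (simp add: powr_numeral)
    qed simp
    have "1 - t ^ 4 = (1 - t) * ((1 + t) * (1 + t\<^sup>2))" by (simp add: algebra_simps power2_eq_square power4_eq_xxxx)
    also have "\<dots> \<le> (1 - t) * ((1 + 1) * (1 + 1))"
      using t by (intro mult_left_mono mult_mono add_mono) (auto simp: power_le_one)
    finally have f: "1 - t powr r \<le> 4 * (1 - t)" using t4 by simp
    have "b powr r - a powr r = b powr r * (1 - t powr r)" using t b by (simp add: powr_mult algebra_simps)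
    also have "\<dots> \<le> b powr r * (4 * (1 - t))" by (intro mult_left_mono f) auto
    finally have 1: "b powr r - a powr r \<le> b powr r * (4 * (1 - t))" .
    have "(b powr r - a powr r) * (b\<^sup>2 - a\<^sup>2) \<le> (b powr r * (4 * (1 - t))) * (b\<^sup>2 - a\<^sup>2)"
      using ab by (intro mult_right_mono 1) (simp add: power_mono)
    also have "\<dots> = (b powr r * (4 * (1 - t))) * ((b - a) * (a + b))"
      by (rule arg_cong[where f="\<lambda>z. (b powr r * (4 * (1 - t))) * z"]) (simp add: power2_eq_square algebra_simps)
    also have "(b powr r * (4 * (1 - t))) * ((b - a) * (a + b)) \<le> (b powr r * (4 * (1 - t))) * ((b - a) * (2 * b))"
      using ab t by (intro mult_left_mono) auto
    also have "\<dots> = 8 * b powr r * (b - a)\<^sup>2" using b by (simp add: t(3) power2_eq_square algebra_simps)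
    finally show ?thesis .
  qed (use ab in simp)
  have nn: "0 \<le> a powr r * (b - a)\<^sup>2" "0 \<le> b powr r * (b - a)\<^sup>2" by auto
  show ?thesis
  proof (cases "a \<le> b")
    case True
    have "8 * (a powr r + b powr r) * (b - a)\<^sup>2 = 8 * (a powr r * (b - a)\<^sup>2) + 8 * b powr r * (b - a)\<^sup>2"
      by (simp add: algebra_simps)
    with main[OF assms(1) True] nn show ?thesis by linarith
  next
    case False
    then have "(a powr r - b powr r) * (a\<^sup>2 - b\<^sup>2) \<le> 8 * a powr r * (a - b)\<^sup>2" by (intro main assms) simp
    moreover have "(a powr r - b powr r) * (a\<^sup>2 - b\<^sup>2) = (b powr r - a powr r) * (b\<^sup>2 - a\<^sup>2)" by (simp add: algebra_simps)
    moreover have "8 * (a powr r + b powr r) * (b - a)\<^sup>2 = 8 * a powr r * (a - b)\<^sup>2 + 8 * (b powr r * (b - a)\<^sup>2)"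
      by (simp add: power2_commute[of a b] algebra_simps)
    ultimately show ?thesis using nn by linarith
  qed
qed

text \<open>The tangent inequality at \<open>w\<close> is combined with the cost of replacing its
  coefficient by the one at \<open>z\<close>; the pairing is half of |w|^2 - |z|^2 - |w - z|^2. The
  constant 5 covers 8 / 2 + 1 / 2.\<close>

lemma power_taylor:
  fixes z w :: complex
  assumes p: "2 < p" "p < 6"
  shows "(norm w powr p - norm z powr p) / p - norm z powr (p - 2) * Re (z * cnj (w - z))
    \<le> 5 * (norm z powr (p - 2) + norm w powr (p - 2)) * (norm (w - z))\<^sup>2"
proof -
  define a where "a = norm z"
  define b where "b = norm w"
  define d where "d = norm (w - z)"
  have ab: "0 \<le> a" "0 \<le> b" "0 \<le> d" by (auto simp: a_def b_def d_def)
  have re: "Re (z * cnj (w - z)) = (b\<^sup>2 - a\<^sup>2 - d\<^sup>2) / 2"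
    using dens_expand[of w z] by (simp add: a_def b_def d_def)
  have bd: "(b - a)\<^sup>2 \<le> d\<^sup>2"
  proof -
    have "\<bar>b - a\<bar> \<le> d" unfolding a_def b_def d_def by (rule norm_triangle_ineq3)
    then show ?thesis by (metis abs_ge_zero power2_abs power_mono)
  qed
  have "(b powr (p - 2) - a powr (p - 2)) * (b\<^sup>2 - a\<^sup>2) \<le> 8 * (a powr (p - 2) + b powr (p - 2)) * (b - a)\<^sup>2"
    using ab p by (intro powr_diff_bound) auto
  also have "\<dots> \<le> 8 * (a powr (p - 2) + b powr (p - 2)) * d\<^sup>2"
    by (intro mult_left_mono bd) auto
  finally have 1: "(b powr (p - 2) - a powr (p - 2)) * (b\<^sup>2 - a\<^sup>2) \<le> 8 * (a powr (p - 2) + b powr (p - 2)) * d\<^sup>2" .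
  define \<alpha> where "\<alpha> = a powr (p - 2)"
  define \<beta> where "\<beta> = b powr (p - 2)"
  have "0 \<le> \<alpha> * d\<^sup>2" "0 \<le> \<beta> * d\<^sup>2" by (auto simp: \<alpha>_def \<beta>_def)
  moreover have "(\<beta> - \<alpha>) * (b\<^sup>2 - a\<^sup>2) \<le> 8 * (\<alpha> * d\<^sup>2) + 8 * (\<beta> * d\<^sup>2)"
    using 1 unfolding \<alpha>_def[symmetric] \<beta>_def[symmetric] by (simp add: distrib_left distrib_right)
  moreover have "(b powr p - a powr p) / p \<le> 1/2 * \<beta> * (b\<^sup>2 - a\<^sup>2)"
    using power_young[OF ab(1,2) p(1)] by (simp add: \<beta>_def)
  moreover have "1/2 * \<beta> * (b\<^sup>2 - a\<^sup>2) - \<alpha> * ((b\<^sup>2 - a\<^sup>2 - d\<^sup>2) / 2) = 1/2 * ((\<beta> - \<alpha>) * (b\<^sup>2 - a\<^sup>2)) + 1/2 * (\<alpha> * d\<^sup>2)"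
    by (simp add: field_simps)
  ultimately have "(b powr p - a powr p) / p - \<alpha> * ((b\<^sup>2 - a\<^sup>2 - d\<^sup>2) / 2) \<le> 5 * (\<alpha> * d\<^sup>2) + 5 * (\<beta> * d\<^sup>2)"
    by linarith
  then show ?thesis
    unfolding re unfolding a_def[symmetric] b_def[symmetric] d_def[symmetric] \<alpha>_def[symmetric] \<beta>_def[symmetric]
    by (simp add: distrib_left distrib_right)
qed

text \<open>A case distinction at y = \<kappa> x; the free parameter shifts weight between the two
  terms.\<close>

lemma powr_mult_square_le:
  fixes x y :: real
  assumes "0 \<le> x" "0 \<le> y" "2 < t" "0 < \<kappa>"
  shows "x powr (t - 2) * y\<^sup>2 \<le> \<kappa>\<^sup>2 * x powr t + \<kappa> powr (2 - t) * y powr t"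
proof (cases "y \<le> \<kappa> * x")
  case True
  then have "y\<^sup>2 \<le> (\<kappa> * x)\<^sup>2" using assms by (intro power_mono)
  then have "x powr (t - 2) * y\<^sup>2 \<le> x powr (t - 2) * (\<kappa>\<^sup>2 * x\<^sup>2)" by (intro mult_left_mono) (auto simp: power_mult_distrib)
  also have "\<dots> = \<kappa>\<^sup>2 * x powr t" using powr_split_square[of x t] assms by simp
  finally show ?thesis by (simp add: add_increasing2)
next
  case False
  then have "x \<le> y / \<kappa>" using assms by (simp add: field_simps)
  then have "x powr (t - 2) \<le> (y / \<kappa>) powr (t - 2)" using assms by (intro powr_mono2) auto
  also have "\<dots> = \<kappa> powr (2 - t) * y powr (t - 2)" 
  proof -
    have "(y / \<kappa>) powr (t - 2) = y powr (t - 2) / \<kappa> powr (t - 2)" by (rule powr_divide)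
    then show ?thesis using powr_minus[of \<kappa> "t - 2"] by (simp add: divide_inverse mult.commute)
  qed
  finally have "x powr (t - 2) * y\<^sup>2 \<le> \<kappa> powr (2 - t) * y powr (t - 2) * y\<^sup>2" by (intro mult_right_mono) auto
  also have "\<dots> = \<kappa> powr (2 - t) * y powr t" using powr_split_square[of y t] assms by simp
  finally show ?thesis by (simp add: add_increasing)
qed

lemma powr_square_integrable:
  fixes f h :: "R3 \<Rightarrow> complex"
  assumes "integrable lborel (\<lambda>x. norm (f x) powr t)" "integrable lborel (\<lambda>x. norm (h x) powr t)"
    and [measurable]: "f \<in> borel_measurable borel" "h \<in> borel_measurable borel" and t: "2 < t"
  shows "integrable lborel (\<lambda>x. norm (f x) powr (t - 2) * (norm (h x))\<^sup>2)"
proof (rule Bochner_Integration.integrable_bound)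
  show "integrable lborel (\<lambda>x. norm (f x) powr t + norm (h x) powr t)" using assms by simp
  have "norm (f x) powr (t - 2) * (norm (h x))\<^sup>2 \<le> norm (f x) powr t + norm (h x) powr t" for x
    using powr_mult_square_le[of "norm (f x)" "norm (h x)" t 1] t by simp
  then show "AE x in lborel. norm (norm (f x) powr (t - 2) * (norm (h x))\<^sup>2) \<le> norm (norm (f x) powr t + norm (h x) powr t)"
    by (auto intro!: AE_I2 intro: order_trans[OF _ abs_ge_self])
qed measurable

lemma H1_cball_integrable:
  assumes "L2_fun h" shows "integrable lborel (\<lambda>x. indicator (cball 0 R) x * (norm (h x))\<^sup>2)"
    "mass (\<lambda>x. indicator (cball 0 R) x *\<^sub>R h x) = (\<integral>x. indicator (cball 0 R) x * (norm (h x))\<^sup>2 \<partial>lborel)"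
proof -
  have [measurable]: "indicator (cball 0 R) \<in> borel_measurable (borel :: R3 measure)" by (intro borel_measurable_indicator) auto
  note [measurable] = L2_measurable[OF assms]
  show "integrable lborel (\<lambda>x. indicator (cball 0 R) x * (norm (h x))\<^sup>2)"
    by (rule Bochner_Integration.integrable_bound[OF L2_integrable[OF assms]]) (auto simp: indicator_def)
  show "mass (\<lambda>x. indicator (cball 0 R) x *\<^sub>R h x) = (\<integral>x. indicator (cball 0 R) x * (norm (h x))\<^sup>2 \<partial>lborel)"
    unfolding mass_def by (intro Bochner_Integration.integral_cong refl) (simp add: indicator_def)
qed

text \<open>The potential is relatively compact as a quadratic form on H^1: where \<open>u\<close>
  is large or its argument far out, its L^t norm is small and a small multiple of the H^1 norm
  suffices; elsewhere it is bounded and lives on a ball. Explicit scaling makes this uniform over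
  |s| <= 1.\<close>

lemma power_potential_bound:
  assumes u: "u \<in> H1" and t: "2 < t" "t < 6" and e: "0 < e"
  obtains C R where "C > 0" "R > 0"
    "\<And>s h. \<bar>s\<bar> \<le> 1 \<Longrightarrow> h \<in> H1 \<Longrightarrow> (\<integral>x. norm (dilate s u x) powr (t - 2) * (norm (h x))\<^sup>2 \<partial>lborel)
       \<le> e * (kin h + mass h) + C * mass (\<lambda>x. indicator (cball 0 R) x *\<^sub>R h x)"
proof -
  obtain G where G: "G > 0" "\<And>u g. is_weak_gradient u g \<Longrightarrow> L2_fun u \<Longrightarrow>
       integrable lborel (\<lambda>x. norm (u x) powr t) \<and> pw t u \<le> G * (mass u + mass g) powr (t / 2)"
    by (rule GN_inhomogeneous[OF less_imp_le[OF t(1)] t(2)]) blast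
  note [measurable] = H1_measurable[OF u]
  have ut: "integrable lborel (\<lambda>x. norm (u x) powr t)" using H1_pw_integrable[OF u] t by auto
  \<comment> \<open>\<open>\<theta>\<close> makes the contribution of \<open>h\<close> small, and then \<open>n\<close> that of the tails of \<open>u\<close>.\<close>
  define \<theta> where "\<theta> = (2 * G / e) powr (1 / (t - 2))"
  have \<theta>: "\<theta> > 0" using G e by (simp add: \<theta>_def)
  have G\<theta>: "G * \<theta> powr (2 - t) = e / 2"
  proof -
    have "\<theta> powr (2 - t) = (2 * G / e) powr (-1)" unfolding \<theta>_def powr_powr
      using t by (intro arg_cong[where f="\<lambda>s. (2 * G / e) powr s"]) (simp add: field_simps)
    then show ?thesis using G e by (simp add: powr_minus divide_simps mult_ac)
  qed
  define A where "A n = {x. real n < norm (u x) \<or> real n < norm x}" for n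
  have [measurable]: "A n \<in> sets borel" for n unfolding A_def by measurable
  define E where "E n = (\<integral>x. indicator (A n) x * norm (u x) powr t \<partial>lborel)" for n
  have "E \<longlonglongrightarrow> (\<integral>x. 0 \<partial>(lborel :: R3 measure))"
    unfolding E_def
  proof (rule integral_dominated_convergence[OF _ _ ut])
    show "AE x in lborel. (\<lambda>n. indicator (A n) x * norm (u x) powr t) \<longlonglongrightarrow> 0"
    proof (rule AE_I2, rule Lim_transform_eventually[OF tendsto_const])
      fix x :: R3
      have "\<forall>\<^sub>F n in sequentially. max (norm (u x)) (norm x) \<le> real n"
        by (rule eventually_sequentiallyI[of "nat \<lceil>max (norm (u x)) (norm x)\<rceil>"]) linarith
      then show "\<forall>\<^sub>F n in sequentially. 0 = indicator (A n) x * norm (u x) powr t"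
        by eventually_elim (simp add: A_def indicator_def)
    qed
  qed (auto simp: indicator_def)
  then have El: "(\<lambda>n. \<theta>\<^sup>2 * (exp (3 * (t - 2) / 2) * E n)) \<longlonglongrightarrow> \<theta>\<^sup>2 * (exp (3 * (t - 2) / 2) * 0)" by (intro tendsto_intros) simp
  have "\<forall>\<^sub>F n in sequentially. \<theta>\<^sup>2 * (exp (3 * (t - 2) / 2) * E n) < e / 2"
    by (rule order_tendstoD(2)[OF El]) (use e in simp)
  then obtain n where n: "\<theta>\<^sup>2 * (exp (3 * (t - 2) / 2) * E n) < e / 2" by (auto simp: eventually_sequentially)
  \<comment> \<open>Where the dilated point lies outside \<open>A n\<close>, its norm and the value
    of \<open>u\<close> are at most n. Undoing a dilation with |s| <= 1 costs at most exp 1 in the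
    radius and exp (3/2) in the amplitude.\<close>
  define R where "R = exp 1 * real n + 1"
  define C where "C = (exp (3/2) * real n) powr (t - 2) + 1"
  show ?thesis
  proof (rule that[of C R])
    show C0: "C > 0" and "R > 0" by (auto simp: C_def R_def add_nonneg_pos)
    fix s :: real and h assume s: "\<bar>s\<bar> \<le> 1" and h: "h \<in> H1"
    note [measurable] = H1_measurable[OF h]
    define v where "v = dilate s u"
    have v: "v \<in> H1" unfolding v_def by (rule H1_dilate[OF u])
    note [measurable] = H1_measurable[OF v]
    have ht: "integrable lborel (\<lambda>x. norm (h x) powr t)" using H1_pw_integrable[OF h] t by auto
    have vt: "integrable lborel (\<lambda>x. norm (v x) powr t)" using H1_pw_integrable[OF v] t by auto
    have iv: "integrable lborel (\<lambda>x. norm (v x) powr (t - 2) * (norm (h x))\<^sup>2)"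
      by (rule powr_square_integrable[OF vt ht _ _ t(1)]) measurable
    define N2 where "N2 = kin h + mass h"
    have ph: "pw t h \<le> G * N2 powr (t / 2)"
      using G(2)[OF wgrad_weak_gradient[OF h] H1_L2[OF h]] by (simp add: N2_def add.commute)
    have nnR: "0 \<le> mass (\<lambda>x. indicator (cball 0 R) x *\<^sub>R h x)" by simp
    show "(\<integral>x. norm (dilate s u x) powr (t - 2) * (norm (h x))\<^sup>2 \<partial>lborel)
       \<le> e * (kin h + mass h) + C * mass (\<lambda>x. indicator (cball 0 R) x *\<^sub>R h x)"
    proof (cases "N2 = 0")
      case True
      then have "mass h = 0" using mass_nonneg[of h] mass_nonneg[of "wgrad h"] unfolding N2_def by linarith
      then have "AE x in lborel. h x = 0" using mass_eq_0[OF H1_L2[OF h]] by simp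
      then have "(\<integral>x. norm (v x) powr (t - 2) * (norm (h x))\<^sup>2 \<partial>lborel) = (\<integral>x. 0 \<partial>(lborel :: R3 measure))"
        by (intro integral_cong_AE) (auto elim!: eventually_mono)
      then show ?thesis using True nnR C0 by (simp add: v_def N2_def)
    next
      case False
      then have N2: "N2 > 0" using mass_nonneg[of h] mass_nonneg[of "wgrad h"] unfolding N2_def by linarith
      \<comment> \<open>The factor sqrt N2 makes both terms of the splitting homogeneous of degree
        two in \<open>h\<close>.\<close>
      define \<kappa> where "\<kappa> = \<theta> * sqrt N2"
      have \<kappa>: "\<kappa> > 0" using \<theta> N2 by (simp add: \<kappa>_def)
      define B where "B = {x. exp s *\<^sub>R x \<in> A n}"
      have [measurable]: "B \<in> sets borel" unfolding B_def by measurable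
      have i2: "integrable lborel (\<lambda>x. indicator B x * norm (v x) powr t)"
        by (rule Bochner_Integration.integrable_bound[OF vt]) (auto simp: indicator_def)
      have EB: "(\<integral>x. indicator B x * norm (v x) powr t \<partial>lborel) \<le> exp (3 * (t - 2) / 2) * E n"
      proof -
        have "(\<integral>x. indicator B x * norm (v x) powr t \<partial>lborel)
           = (\<integral>x. exp (3 * s / 2) powr t * (indicator (A n) (0 + exp s *\<^sub>R x) * norm (u (0 + exp s *\<^sub>R x)) powr t) \<partial>lborel)"
          unfolding v_def norm_dilate by (intro Bochner_Integration.integral_cong refl) (auto simp: B_def indicator_def powr_mult)
        also have "\<dots> = exp (3 * s / 2) powr t * (E n / exp s ^ 3)"
        proof -
          have "(\<integral>x. indicator (A n) (0 + exp s *\<^sub>R x) * norm (u (0 + exp s *\<^sub>R x)) powr t \<partial>lborel) = E n / exp s ^ 3"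
            using integral_affine[of "exp s" "\<lambda>x. indicator (A n) x * norm (u x) powr t" 0]
            unfolding E_def[symmetric] by (simp add: field_simps power3_eq_cube)
          then show ?thesis by (simp only: integral_mult_right_zero)
        qed
        also have "\<dots> = exp (3 * s * (t - 2) / 2) * E n"
        proof -
          have "exp (3 * s / 2) powr t = exp (3 * s * (t - 2) / 2) * exp (3 * s)"
            unfolding exp_add[symmetric] by (simp add: powr_def field_simps)
          then show ?thesis by (simp add: exp_cubed)
        qed
        also have "\<dots> \<le> exp (3 * (t - 2) / 2) * E n"
        proof (intro mult_right_mono)
          have "s * (3 * (t - 2) / 2) \<le> 1 * (3 * (t - 2) / 2)" using s t by (intro mult_right_mono) auto
          then show "exp (3 * s * (t - 2) / 2) \<le> exp (3 * (t - 2) / 2)" by (simp add: mult_ac)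
          show "0 \<le> E n" unfolding E_def by (intro integral_nonneg_AE) auto
        qed
        finally show ?thesis .
      qed
      have pt: "norm (v x) powr (t - 2) * (norm (h x))\<^sup>2
          \<le> \<kappa>\<^sup>2 * (indicator B x * norm (v x) powr t) + \<kappa> powr (2 - t) * norm (h x) powr t
            + C * (indicator (cball 0 R) x * (norm (h x))\<^sup>2)" for x
      proof (cases "x \<in> B")
        case True
        have "norm (v x) powr (t - 2) * (norm (h x))\<^sup>2 \<le> \<kappa>\<^sup>2 * norm (v x) powr t + \<kappa> powr (2 - t) * norm (h x) powr t"
          using \<kappa> t by (intro powr_mult_square_le) auto
        moreover have "0 \<le> C * (indicator (cball 0 R) x * (norm (h x))\<^sup>2)" using C0 by simp
        ultimately show ?thesis using True by simp
      next
        case False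
        then have "norm (u (exp s *\<^sub>R x)) \<le> real n" "norm (exp s *\<^sub>R x) \<le> real n" by (auto simp: B_def A_def)
        then have vn: "norm (v x) \<le> exp (3 / 2) * real n" and sx: "exp s * norm x \<le> real n"
          unfolding v_def norm_dilate using s by (auto intro!: mult_mono)
        have "norm x = exp (- s) * (exp s * norm x)" by (simp add: exp_minus)
        also have "\<dots> \<le> exp 1 * real n" using s sx by (intro mult_mono) auto
        finally have "x \<in> cball 0 R" by (simp add: R_def)
        moreover have "norm (v x) powr (t - 2) \<le> C" unfolding C_def
          using powr_mono2[OF _ _ vn, of "t - 2"] t by simp
        ultimately have "norm (v x) powr (t - 2) * (norm (h x))\<^sup>2 \<le> C * (indicator (cball 0 R) x * (norm (h x))\<^sup>2)"
          by (simp add: mult_right_mono)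
        moreover have "0 \<le> \<kappa> powr (2 - t) * norm (h x) powr t" by simp
        moreover have "\<kappa>\<^sup>2 * (indicator B x * norm (v x) powr t) = 0" using False by simp
        ultimately show ?thesis by linarith
      qed
      have "(\<integral>x. norm (v x) powr (t - 2) * (norm (h x))\<^sup>2 \<partial>lborel)
         \<le> (\<integral>x. \<kappa>\<^sup>2 * (indicator B x * norm (v x) powr t) + \<kappa> powr (2 - t) * norm (h x) powr t
            + C * (indicator (cball 0 R) x * (norm (h x))\<^sup>2) \<partial>lborel)"
        using iv i2 ht H1_cball_integrable(1)[OF H1_L2[OF h], of R]
        by (intro integral_mono pt) auto
      also have "\<dots> = \<kappa>\<^sup>2 * (\<integral>x. indicator B x * norm (v x) powr t \<partial>lborel) + \<kappa> powr (2 - t) * pw t h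
            + C * mass (\<lambda>x. indicator (cball 0 R) x *\<^sub>R h x)"
        using i2 ht H1_cball_integrable[OF H1_L2[OF h], of R] by (simp add: pw_def)
      also have "\<dots> \<le> \<kappa>\<^sup>2 * (exp (3 * (t - 2) / 2) * E n) + \<kappa> powr (2 - t) * (G * N2 powr (t / 2))
            + C * mass (\<lambda>x. indicator (cball 0 R) x *\<^sub>R h x)"
        by (intro add_mono mult_left_mono EB ph) (use C0 in auto)
      also have "\<kappa>\<^sup>2 * (exp (3 * (t - 2) / 2) * E n) = N2 * (\<theta>\<^sup>2 * (exp (3 * (t - 2) / 2) * E n))"
        using N2 by (simp add: \<kappa>_def power_mult_distrib)
      also have "\<dots> \<le> N2 * (e / 2)" using N2 n by (intro mult_left_mono) auto
      also have "\<kappa> powr (2 - t) * (G * N2 powr (t / 2)) = N2 * (G * \<theta> powr (2 - t))"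
      proof -
        have "\<kappa> powr (2 - t) = \<theta> powr (2 - t) * N2 powr ((2 - t) / 2)"
          unfolding \<kappa>_def powr_mult using N2 by (simp add: powr_half_sqrt[symmetric] powr_powr)
        moreover have "N2 powr ((2 - t) / 2) * N2 powr (t / 2) = N2"
          unfolding powr_add[symmetric] using N2 by (simp add: diff_divide_distrib)
        ultimately show ?thesis by (simp add: mult_ac)
      qed
      also have "\<dots> = N2 * (e / 2)" unfolding G\<theta> ..
      finally show ?thesis by (simp add: v_def N2_def algebra_simps)
    qed
  qed
qed

text \<open>The Coulomb potential is bounded and vanishes at infinity, and a dilation with |s| <= 1
  changes its size and its argument by at most a factor exp 1.\<close>

lemma coulomb_potential_bound:
  assumes u: "u \<in> H1" and e: "0 < e"
  obtains C R where "C > 0" "R > 0"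
    "\<And>s h. \<bar>s\<bar> \<le> 1 \<Longrightarrow> h \<in> H1 \<Longrightarrow> (\<integral>x. (norm (h x))\<^sup>2 * coulomb (dilate s u) x \<partial>lborel)
       \<le> e * mass h + C * mass (\<lambda>x. indicator (cball 0 R) x *\<^sub>R h x)"
proof -
  have d: "L12 (dens u)" by (rule L12_dens[OF u])
  obtain M where M: "M > 0" "\<And>x. newton (\<lambda>y. \<bar>dens u y\<bar>) x \<le> M" by (rule newton_bounded[OF d]) blast
  obtain R where R: "R > 0" "\<And>x. R \<le> norm x \<Longrightarrow> newton (\<lambda>y. \<bar>dens u y\<bar>) x \<le> e / exp 1"
    by (rule newton_vanishes[OF d, of "e / exp 1"]) (use e in auto)
  show ?thesis
  proof (rule that[of "exp 1 * M" "exp 1 * R"])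
    show "exp 1 * M > 0" "exp 1 * R > 0" using M R by auto
  next
    fix s :: real and h assume s: "\<bar>s\<bar> \<le> 1" and h: "h \<in> H1"
    have e1: "exp s \<le> exp 1" using s by simp
    have pt: "(norm (h x))\<^sup>2 * coulomb (dilate s u) x \<le> e * (norm (h x))\<^sup>2 + (exp 1 * M) * (indicator (cball 0 (exp 1 * R)) x * (norm (h x))\<^sup>2)" for x
    proof (cases "x \<in> cball 0 (exp 1 * R)")
      case True
      have "coulomb (dilate s u) x \<le> exp 1 * M"
        unfolding coulomb_dilate using e1 M(2)[of "exp s *\<^sub>R x"] coulomb_nonneg[of u] by (intro mult_mono) (auto simp: coulomb_newton)
      then have "(norm (h x))\<^sup>2 * coulomb (dilate s u) x \<le> (norm (h x))\<^sup>2 * (exp 1 * M)" by (intro mult_left_mono) auto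
      then show ?thesis using True e by (simp add: mult_ac add_increasing)
    next
      case False
      have "R = exp (-1) * (exp 1 * R)" by (simp add: exp_minus)
      also have "\<dots> \<le> exp s * norm x" using False s R by (intro mult_mono) auto
      finally have "newton (\<lambda>y. \<bar>dens u y\<bar>) (exp s *\<^sub>R x) \<le> e / exp 1" by (intro R(2)) simp
      then have "coulomb (dilate s u) x \<le> exp 1 * (e / exp 1)"
        unfolding coulomb_dilate using e1 coulomb_nonneg[of u] by (intro mult_mono) (auto simp: coulomb_newton)
      then have "coulomb (dilate s u) x \<le> e" by simp
      then have "(norm (h x))\<^sup>2 * coulomb (dilate s u) x \<le> (norm (h x))\<^sup>2 * e" by (intro mult_left_mono) auto
      then show ?thesis using False by (simp add: mult.commute)
    qed
    have "(\<integral>x. (norm (h x))\<^sup>2 * coulomb (dilate s u) x \<partial>lborel)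
      \<le> (\<integral>x. e * (norm (h x))\<^sup>2 + (exp 1 * M) * (indicator (cball 0 (exp 1 * R)) x * (norm (h x))\<^sup>2) \<partial>lborel)"
    proof (rule integral_mono[OF _ _ pt])
      show "integrable lborel (\<lambda>x. (norm (h x))\<^sup>2 * coulomb (dilate s u) x)"
        unfolding coulomb_newton by (rule newton_mult_integrable[OF L2_integrable[OF H1_L2[OF h]] L12_dens[OF H1_dilate[OF u]]])
    qed (use L2_integrable[OF H1_L2[OF h]] H1_cball_integrable(1)[OF H1_L2[OF h]] in auto)
    also have "\<dots> = e * mass h + exp 1 * M * mass (\<lambda>x. indicator (cball 0 (exp 1 * R)) x *\<^sub>R h x)"
      using L2_integrable[OF H1_L2[OF h]] H1_cball_integrable[OF H1_L2[OF h]] by (simp add: mass_def[of h])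
    finally show "(\<integral>x. (norm (h x))\<^sup>2 * coulomb (dilate s u) x \<partial>lborel)
       \<le> e * mass h + exp 1 * M * mass (\<lambda>x. indicator (cball 0 (exp 1 * R)) x *\<^sub>R h x)" .
  qed
qed

section \<open>The Pohozaev identity\<close>

lemma mass_add_eq:
  fixes f g :: "R3 \<Rightarrow> 'a::euclidean_space"
  assumes "L2_fun f" "L2_fun g"
  shows "integrable lborel (\<lambda>x. f x \<bullet> g x)"
    and "mass (\<lambda>x. f x + g x) = mass f + 2 * (\<integral>x. f x \<bullet> g x \<partial>lborel) + mass g"
proof -
  note [measurable] = L2_measurable[OF assms(1)] L2_measurable[OF assms(2)]
  show i: "integrable lborel (\<lambda>x. f x \<bullet> g x)"
    by (rule L2_dominated_product(1)[OF assms, where C=1]) (auto simp: Cauchy_Schwarz_ineq2)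
  have e: "(norm (f x + g x))\<^sup>2 = (norm (f x))\<^sup>2 + 2 * (f x \<bullet> g x) + (norm (g x))\<^sup>2" for x
    by (simp add: power2_norm_eq_inner inner_add inner_commute)
  show "mass (\<lambda>x. f x + g x) = mass f + 2 * (\<integral>x. f x \<bullet> g x \<partial>lborel) + mass g"
    unfolding mass_def e using i L2_integrable[OF assms(1)] L2_integrable[OF assms(2)] by simp
qed

lemma inner_complex_cnj: "z \<bullet> w = Re (z * cnj w)"
  by (simp add: inner_complex_def)

lemma cnj_measurable [measurable]: "cnj \<in> borel_measurable borel"
  by (intro borel_measurable_continuous_onI continuous_intros)

lemma powr_pairing_integrable:
  fixes u \<phi> :: "R3 \<Rightarrow> complex"
  assumes "integrable lborel (\<lambda>x. norm (u x) powr p)" "integrable lborel (\<lambda>x. norm (\<phi> x) powr p)"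
    and [measurable]: "u \<in> borel_measurable borel" "\<phi> \<in> borel_measurable borel" and p: "2 < p"
  shows "integrable lborel (\<lambda>x. pow_nl p (u x) * cnj (\<phi> x))"
proof (rule Bochner_Integration.integrable_bound)
  show "integrable lborel (\<lambda>x. norm (u x) powr p + norm (\<phi> x) powr p)" using assms by simp
  have "norm (pow_nl p (u x) * cnj (\<phi> x)) \<le> norm (u x) powr p + norm (\<phi> x) powr p" for x
  proof -
    define m where "m = max (norm (u x)) (norm (\<phi> x))"
    have "norm (pow_nl p (u x) * cnj (\<phi> x)) = norm (u x) powr (p - 2) * (norm (u x) * norm (\<phi> x))"
      by (simp add: pow_nl_def norm_mult)
    also have "\<dots> \<le> m powr (p - 2) * (m * m)"
      using p by (intro mult_mono powr_mono2) (auto simp: m_def le_max_iff_disj)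
    also have "\<dots> = m powr p" using powr_split_square[of m p] by (simp add: m_def power2_eq_square max_def)
    also have "\<dots> \<le> norm (u x) powr p + norm (\<phi> x) powr p" by (simp add: m_def max_def)
    finally show ?thesis .
  qed
  then show "AE x in lborel. norm (pow_nl p (u x) * cnj (\<phi> x)) \<le> norm (norm (u x) powr p + norm (\<phi> x) powr p)"
    by (auto intro!: AE_I2 intro: order_trans[OF _ abs_ge_self])
  show "(\<lambda>x. pow_nl p (u x) * cnj (\<phi> x)) \<in> borel_measurable lborel" unfolding pow_nl_def by measurable
qed

lemma gradient_pairing_integrable:
  fixes f g :: "R3 \<Rightarrow> complex ^ 3"
  assumes "L2_fun f" "L2_fun g"
  shows "integrable lborel (\<lambda>x. \<Sum>i\<in>UNIV. f x $ i * cnj (g x $ i))"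
    and "Re (\<integral>x. (\<Sum>i\<in>UNIV. f x $ i * cnj (g x $ i)) \<partial>lborel) = (\<integral>x. f x \<bullet> g x \<partial>lborel)"
    and "norm (\<integral>x. (\<Sum>i\<in>UNIV. f x $ i * cnj (g x $ i)) \<partial>lborel) \<le> 3 * (sqrt (mass f) * sqrt (mass g))"
proof -
  note L = L2_component(1)[OF assms(1)] L2_component(1)[OF assms(2)]
  have i: "integrable lborel (\<lambda>x. f x $ i * cnj (g x $ i))" for i
  proof (rule L2_dominated_product(1)[OF L(1)[of i] L(2)[of i], where C=1])
    note [measurable] = L2_measurable[OF L(1)[of i]] L2_measurable[OF L(2)[of i]]
    show "(\<lambda>x. f x $ i * cnj (g x $ i)) \<in> borel_measurable borel" by measurable
  qed (auto simp: norm_mult)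
  then show I: "integrable lborel (\<lambda>x. \<Sum>i\<in>UNIV. f x $ i * cnj (g x $ i))" by (intro Bochner_Integration.integrable_sum)
  have "Re (\<integral>x. (\<Sum>i\<in>UNIV. f x $ i * cnj (g x $ i)) \<partial>lborel) = (\<integral>x. Re (\<Sum>i\<in>UNIV. f x $ i * cnj (g x $ i)) \<partial>lborel)"
    using integral_Re[OF I] by simp
  also have "\<dots> = (\<integral>x. f x \<bullet> g x \<partial>lborel)"
    by (intro Bochner_Integration.integral_cong refl) (simp add: inner_vec_def inner_complex_cnj)
  finally show "Re (\<integral>x. (\<Sum>i\<in>UNIV. f x $ i * cnj (g x $ i)) \<partial>lborel) = (\<integral>x. f x \<bullet> g x \<partial>lborel)" .
  show "norm (\<integral>x. (\<Sum>i\<in>UNIV. f x $ i * cnj (g x $ i)) \<partial>lborel) \<le> 3 * (sqrt (mass f) * sqrt (mass g))"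
  proof (rule L2_dominated_product(2)[OF assms])
    show "(\<lambda>x. \<Sum>i\<in>UNIV. f x $ i * cnj (g x $ i)) \<in> borel_measurable borel" using I by auto
    fix x
    have "norm (\<Sum>i\<in>UNIV. f x $ i * cnj (g x $ i)) \<le> (\<Sum>i\<in>(UNIV::3 set). norm (f x) * norm (g x))"
      by (rule order_trans[OF norm_sum], rule sum_mono)
        (auto intro!: mult_mono Finite_Cartesian_Product.norm_nth_le simp: norm_mult)
    also have "\<dots> = 3 * (norm (f x) * norm (g x))" by simp
    finally show "norm (\<Sum>i\<in>UNIV. f x $ i * cnj (g x $ i)) \<le> 3 * (norm (f x) * norm (g x))" .
  qed simp
qed

lemma coulomb_pairing_integrable:
  fixes f g :: "R3 \<Rightarrow> complex"
  assumes u: "L12 (dens u)" and "L2_fun f" "L2_fun g"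
  shows "integrable lborel (\<lambda>x. complex_of_real (coulomb u x) * f x * cnj (g x))"
proof -
  note [measurable] = L2_measurable[OF assms(2)] L2_measurable[OF assms(3)] L12_measurable[OF u]
  obtain M where M: "M > 0" "\<And>x. \<bar>newton (dens u) x\<bar> \<le> M" by (rule newton_bounded[OF u]) blast
  show ?thesis
  proof (rule L2_dominated_product(1)[OF assms(2,3), where C=M])
    show "(\<lambda>x. complex_of_real (coulomb u x) * f x * cnj (g x)) \<in> borel_measurable borel"
      unfolding coulomb_newton by measurable
    show "norm (complex_of_real (coulomb u x) * f x * cnj (g x)) \<le> M * (norm (f x) * norm (g x))" for x
      using M(2)[of x] by (simp add: norm_mult coulomb_newton mult.assoc mult_right_mono)
  qed (use M in simp)
qed

lemma comb_nl_integrable: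
  assumes "u \<in> H1" "\<phi> \<in> H1" "2 < p" "p < 6" "2 < q" "q < 6"
  shows "integrable lborel (\<lambda>x. pow_nl p (u x) * cnj (\<phi> x))" "integrable lborel (\<lambda>x. pow_nl q (u x) * cnj (\<phi> x))"
    "(\<integral>x. comb_nl p q \<mu> (u x) * cnj (\<phi> x) \<partial>lborel)
      = (\<integral>x. pow_nl p (u x) * cnj (\<phi> x) \<partial>lborel) + complex_of_real \<mu> * (\<integral>x. pow_nl q (u x) * cnj (\<phi> x) \<partial>lborel)"
proof -
  show i: "integrable lborel (\<lambda>x. pow_nl p (u x) * cnj (\<phi> x))" "integrable lborel (\<lambda>x. pow_nl q (u x) * cnj (\<phi> x))"
    using assms by (intro powr_pairing_integrable H1_pw_integrable H1_measurable; simp)+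
  show "(\<integral>x. comb_nl p q \<mu> (u x) * cnj (\<phi> x) \<partial>lborel)
      = (\<integral>x. pow_nl p (u x) * cnj (\<phi> x) \<partial>lborel) + complex_of_real \<mu> * (\<integral>x. pow_nl q (u x) * cnj (\<phi> x) \<partial>lborel)"
    unfolding comb_nl_def distrib_right mult.assoc using i by simp
qed

lemma Re_pow_nl: "Re (pow_nl p z * cnj w) = norm z powr (p - 2) * Re (z * cnj w)"
  by (simp add: pow_nl_def algebra_simps)

text \<open>Taking real parts gives the pairing that appears as the first variation of the
  energy.\<close>

lemma weak_solution_real:
  assumes sol: "weak_solution (comb_nl p q \<mu>) lam u" and \<phi>: "\<phi> \<in> H1"
    and pq: "2 < p" "p < 6" "2 < q" "q < 6"
  shows "(\<integral>x. wgrad u x \<bullet> wgrad \<phi> x \<partial>lborel) + lam * (\<integral>x. u x \<bullet> \<phi> x \<partial>lborel)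
      + (\<integral>x. Re (u x * cnj (\<phi> x)) * coulomb u x \<partial>lborel)
    = (\<integral>x. norm (u x) powr (p - 2) * Re (u x * cnj (\<phi> x)) \<partial>lborel)
      + \<mu> * (\<integral>x. norm (u x) powr (q - 2) * Re (u x * cnj (\<phi> x)) \<partial>lborel)"
proof -
  have u: "u \<in> H1" using sol by (simp add: weak_solution_def)
  note N = comb_nl_integrable[OF u \<phi> pq]
  note [measurable] = H1_measurable[OF u] H1_measurable[OF \<phi>]
  have c: "integrable lborel (\<lambda>x. complex_of_real (coulomb u x) * u x * cnj (\<phi> x))"
    by (rule coulomb_pairing_integrable[OF L12_dens[OF u] H1_L2[OF u] H1_L2[OF \<phi>]])
  have m: "integrable lborel (\<lambda>x. u x * cnj (\<phi> x))"
    by (rule L2_dominated_product(1)[OF H1_L2[OF u] H1_L2[OF \<phi>], where C=1]) (auto simp: norm_mult)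
  have "Re ((\<integral>x. (\<Sum>i\<in>UNIV. wgrad u x $ i * cnj (wgrad \<phi> x $ i)) \<partial>lborel)
     + complex_of_real lam * (\<integral>x. u x * cnj (\<phi> x) \<partial>lborel)
     + (\<integral>x. complex_of_real (coulomb u x) * u x * cnj (\<phi> x) \<partial>lborel))
     = Re (\<integral>x. comb_nl p q \<mu> (u x) * cnj (\<phi> x) \<partial>lborel)"
    using sol \<phi> by (simp add: weak_solution_def)
  moreover have "Re (\<integral>x. u x * cnj (\<phi> x) \<partial>lborel) = (\<integral>x. u x \<bullet> \<phi> x \<partial>lborel)"
    unfolding inner_complex_cnj using integral_Re[OF m] by simp
  moreover have "Re (\<integral>x. complex_of_real (coulomb u x) * u x * cnj (\<phi> x) \<partial>lborel)
      = (\<integral>x. Re (u x * cnj (\<phi> x)) * coulomb u x \<partial>lborel)"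
    unfolding integral_Re[OF c, symmetric] by (intro Bochner_Integration.integral_cong refl) (simp add: algebra_simps)
  moreover have "Re (\<integral>x. pow_nl p (u x) * cnj (\<phi> x) \<partial>lborel) = (\<integral>x. norm (u x) powr (p - 2) * Re (u x * cnj (\<phi> x)) \<partial>lborel)"
    unfolding integral_Re[OF N(1), symmetric] Re_pow_nl ..
  moreover have "Re (\<integral>x. pow_nl q (u x) * cnj (\<phi> x) \<partial>lborel) = (\<integral>x. norm (u x) powr (q - 2) * Re (u x * cnj (\<phi> x)) \<partial>lborel)"
    unfolding integral_Re[OF N(2), symmetric] Re_pow_nl ..
  ultimately show ?thesis
    unfolding N(3) by (simp add: gradient_pairing_integrable(2)[OF wgrad_L2[OF u] wgrad_L2[OF \<phi>]])
qed

lemma energy_eq: "energy p q \<mu> u = 1/2 * kin u + 1/4 * hart u - 1/p * pw p u - \<mu>/q * pw q u"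
  unfolding energy_def hart_eq_energy by (simp add: mass_def pw_def)

lemma pw_taylor:
  assumes u: "u \<in> H1" and v: "v \<in> H1" and p: "2 < p" "p < 6"
  shows "1/p * pw p v - 1/p * pw p u - (\<integral>x. norm (u x) powr (p - 2) * Re (u x * cnj (v x - u x)) \<partial>lborel)
    \<le> 5 * ((\<integral>x. norm (u x) powr (p - 2) * (norm (v x - u x))\<^sup>2 \<partial>lborel) + (\<integral>x. norm (v x) powr (p - 2) * (norm (v x - u x))\<^sup>2 \<partial>lborel))"
proof -
  have h: "(\<lambda>x. v x - u x) \<in> H1" by (rule H1_diff(1)[OF v u])
  have p2: "2 \<le> p" using p by simp
  note I = H1_pw_integrable[OF u p2 p(2)] H1_pw_integrable[OF v p2 p(2)] H1_pw_integrable[OF h p2 p(2)]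
  note M = H1_measurable[OF u] H1_measurable[OF v] H1_measurable[OF h]
  have i1: "integrable lborel (\<lambda>x. norm (u x) powr (p - 2) * Re (u x * cnj (v x - u x)))"
    using integrable_Re[OF powr_pairing_integrable[OF I(1) I(3) M(1) M(3) p(1)]] unfolding Re_pow_nl .
  have i2: "integrable lborel (\<lambda>x. norm (u x) powr (p - 2) * (norm (v x - u x))\<^sup>2)"
    by (rule powr_square_integrable[OF I(1) I(3) M(1) M(3) p(1)])
  have i3: "integrable lborel (\<lambda>x. norm (v x) powr (p - 2) * (norm (v x - u x))\<^sup>2)"
    by (rule powr_square_integrable[OF I(2) I(3) M(2) M(3) p(1)])
  have "1/p * pw p v - 1/p * pw p u - (\<integral>x. norm (u x) powr (p - 2) * Re (u x * cnj (v x - u x)) \<partial>lborel)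
     = (\<integral>x. 1/p * norm (v x) powr p - 1/p * norm (u x) powr p - norm (u x) powr (p - 2) * Re (u x * cnj (v x - u x)) \<partial>lborel)"
    using I(1,2) i1 by (simp add: pw_def)
  also have "\<dots> \<le> (\<integral>x. 5 * (norm (u x) powr (p - 2) * (norm (v x - u x))\<^sup>2 + norm (v x) powr (p - 2) * (norm (v x - u x))\<^sup>2) \<partial>lborel)"
  proof (rule integral_mono)
    show "integrable lborel (\<lambda>x. 1/p * norm (v x) powr p - 1/p * norm (u x) powr p - norm (u x) powr (p - 2) * Re (u x * cnj (v x - u x)))"
      using I(1,2) i1 by (intro Bochner_Integration.integrable_diff integrable_mult_right)
    show "integrable lborel (\<lambda>x. 5 * (norm (u x) powr (p - 2) * (norm (v x - u x))\<^sup>2 + norm (v x) powr (p - 2) * (norm (v x - u x))\<^sup>2))"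
      using i2 i3 by simp
    show "1/p * norm (v x) powr p - 1/p * norm (u x) powr p - norm (u x) powr (p - 2) * Re (u x * cnj (v x - u x))
       \<le> 5 * (norm (u x) powr (p - 2) * (norm (v x - u x))\<^sup>2 + norm (v x) powr (p - 2) * (norm (v x - u x))\<^sup>2)" for x
      using power_taylor[OF p, of "v x" "u x"] by (simp add: diff_divide_distrib algebra_simps)
  qed
  also have "\<dots> = 5 * ((\<integral>x. norm (u x) powr (p - 2) * (norm (v x - u x))\<^sup>2 \<partial>lborel) + (\<integral>x. norm (v x) powr (p - 2) * (norm (v x - u x))\<^sup>2 \<partial>lborel))"
    using i2 i3 by simp
  finally show ?thesis .
qed

text \<open>Equality of the masses means that the inner product of \<open>u\<close> and
  \<open>h\<close> is - mass h / 2, so the multiplier term of the tested equation turns into the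
  positive quadratic term \<open>1/2 * lam * mass h\<close>.\<close>

lemma energy_taylor:
  assumes sol: "weak_solution (comb_nl p q \<mu>) lam u" and v: "v \<in> H1" and m: "mass v = mass u"
    and pq: "2 < p" "p < 6" "2 < q" "q < 6" and mu: "0 \<le> \<mu>"
  defines "h \<equiv> \<lambda>x. v x - u x"
  shows "1/2 * kin h + 1/2 * lam * mass h
      - 1/2 * (\<integral>x. dens h x * (coulomb u x + coulomb v x) \<partial>lborel)
      - 5 * ((\<integral>x. norm (u x) powr (p - 2) * dens h x \<partial>lborel) + (\<integral>x. norm (v x) powr (p - 2) * dens h x \<partial>lborel))
      - 5 * \<mu> * ((\<integral>x. norm (u x) powr (q - 2) * dens h x \<partial>lborel) + (\<integral>x. norm (v x) powr (q - 2) * dens h x \<partial>lborel))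
    \<le> energy p q \<mu> v - energy p q \<mu> u"
proof -
  have u: "u \<in> H1" using sol by (simp add: weak_solution_def)
  have h: "h \<in> H1" unfolding h_def by (rule H1_diff(1)[OF v u])
  have veq: "v = (\<lambda>x. u x + h x)" by (simp add: h_def)
  have m2: "mass v = mass u + 2 * (\<integral>x. u x \<bullet> h x \<partial>lborel) + mass h"
    unfolding veq by (rule mass_add_eq(2)[OF H1_L2[OF u] H1_L2[OF h]])
  have k2: "kin v = kin u + 2 * (\<integral>x. wgrad u x \<bullet> wgrad h x \<partial>lborel) + kin h"
  proof -
    have "AE x in lborel. wgrad h x = wgrad v x - wgrad u x" unfolding h_def by (rule H1_diff(3)[OF v u])
    then have "AE x in lborel. wgrad v x = wgrad u x + wgrad h x" by eventually_elim simp
    then have "kin v = mass (\<lambda>x. wgrad u x + wgrad h x)"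
      using L2_measurable[OF wgrad_L2[OF u]] L2_measurable[OF wgrad_L2[OF h]] L2_measurable[OF wgrad_L2[OF v]]
      by (intro mass_cong_AE) auto
    then show ?thesis by (simp add: mass_add_eq(2)[OF wgrad_L2[OF u] wgrad_L2[OF h]])
  qed
  note W = weak_solution_real[OF sol h pq]
  note H = hart_lower_expansion[OF u v, folded h_def]
  have h': "v x - u x = h x" for x by (simp add: h_def)
  note P = pw_taylor[OF u v pq(1,2), unfolded h']
  note Q = mult_left_mono[OF pw_taylor[OF u v pq(3,4), unfolded h'] mu]
  have Q': "\<mu> / q * pw q v - \<mu> / q * pw q u - \<mu> * (\<integral>x. norm (u x) powr (q - 2) * Re (u x * cnj (h x)) \<partial>lborel)
    \<le> 5 * \<mu> * ((\<integral>x. norm (u x) powr (q - 2) * dens h x \<partial>lborel) + (\<integral>x. norm (v x) powr (q - 2) * dens h x \<partial>lborel))"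
    using Q by (simp add: algebra_simps)
  have l: "lam * (\<integral>x. u x \<bullet> h x \<partial>lborel) = - (1/2 * lam * mass h)"
  proof -
    have "(\<integral>x. u x \<bullet> h x \<partial>lborel) = - mass h / 2" using m m2 by simp
    then show ?thesis by simp
  qed
  have H': "(\<integral>x. Re (u x * cnj (h x)) * coulomb u x \<partial>lborel) - 1/2 * (\<integral>x. dens h x * (coulomb u x + coulomb v x) \<partial>lborel)
     \<le> 1/4 * hart v - 1/4 * hart u" using H unfolding h' by simp
  show ?thesis unfolding energy_eq using W l k2 H' P Q' by linarith
qed

text \<open>No regularity of the solution is available to differentiate the energy along \<open>s \<mapsto> dilate s u\<close>. Instead the
  energy is expanded at \<open>u\<close>: dilations preserve the mass, so the first order term vanishes up to
  \<open>lam / 2 * mass h\<close>, and the quadratic errors are absorbed by \<open>kin h + lam * mass h\<close> except on a ball,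
  where \<open>h = dilate s u - u\<close> is of size \<open>s\<close>. A function bounded below by \<open>- C * s\<^sup>2\<close> that
  vanishes at \<open>0\<close> has derivative \<open>0\<close> there, which is the Pohozaev identity.\<close>

lemma energy_dilate_lower_bound:
  assumes sol: "weak_solution (comb_nl p q \<mu>) lam u" and lam: "0 < lam" and mu: "0 \<le> \<mu>"
    and pq: "2 < p" "p < 6" "2 < q" "q < 6"
  obtains C where "\<And>s. \<bar>s\<bar> \<le> 1 \<Longrightarrow> - C * s\<^sup>2 \<le> energy p q \<mu> (dilate s u) - energy p q \<mu> u"
proof -
  have u: "u \<in> H1" using sol by (simp add: weak_solution_def)
  \<comment> \<open>With N2 = kin h + mass h, the errors of size e N2 number 1 from the Coulomb
    term, 10 from the p-power and 10 \<mu> from the q-power; together they exactly use up the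
    quadratic form's lower bound min 1 lam / 2 * N2.\<close>
  define e where "e = min 1 lam / 2 / (11 + 10 * \<mu>)"
  have e: "e > 0" using lam mu by (simp add: e_def)
  have ee: "(11 + 10 * \<mu>) * e = min 1 lam / 2" using mu by (simp add: e_def del: divide_divide_eq_left)
  obtain C1 R1 where 1: "C1 > 0" "R1 > 0"
    "\<And>s h. \<bar>s\<bar> \<le> 1 \<Longrightarrow> h \<in> H1 \<Longrightarrow> (\<integral>x. norm (dilate s u x) powr (p - 2) * (norm (h x))\<^sup>2 \<partial>lborel)
       \<le> e * (kin h + mass h) + C1 * mass (\<lambda>x. indicator (cball 0 R1) x *\<^sub>R h x)"
    by (rule power_potential_bound[OF u pq(1,2) e]) blast
  obtain C2 R2 where 2: "C2 > 0" "R2 > 0"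
    "\<And>s h. \<bar>s\<bar> \<le> 1 \<Longrightarrow> h \<in> H1 \<Longrightarrow> (\<integral>x. norm (dilate s u x) powr (q - 2) * (norm (h x))\<^sup>2 \<partial>lborel)
       \<le> e * (kin h + mass h) + C2 * mass (\<lambda>x. indicator (cball 0 R2) x *\<^sub>R h x)"
    by (rule power_potential_bound[OF u pq(3,4) e]) blast
  obtain C3 R3 where 3: "C3 > 0" "R3 > 0"
    "\<And>s h. \<bar>s\<bar> \<le> 1 \<Longrightarrow> h \<in> H1 \<Longrightarrow> (\<integral>x. (norm (h x))\<^sup>2 * coulomb (dilate s u) x \<partial>lborel)
       \<le> e * mass h + C3 * mass (\<lambda>x. indicator (cball 0 R3) x *\<^sub>R h x)"
    by (rule coulomb_potential_bound[OF u e]) blast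
  obtain D1 where D1: "D1 > 0" "\<And>s. \<bar>s\<bar> \<le> 1 \<Longrightarrow> mass (\<lambda>x. indicator (cball 0 R1) x *\<^sub>R (dilate s u x - u x)) \<le> D1 * s\<^sup>2"
    by (rule dilate_locally_lipschitz[OF u 1(2)]) blast
  obtain D2 where D2: "D2 > 0" "\<And>s. \<bar>s\<bar> \<le> 1 \<Longrightarrow> mass (\<lambda>x. indicator (cball 0 R2) x *\<^sub>R (dilate s u x - u x)) \<le> D2 * s\<^sup>2"
    by (rule dilate_locally_lipschitz[OF u 2(2)]) blast
  obtain D3 where D3: "D3 > 0" "\<And>s. \<bar>s\<bar> \<le> 1 \<Longrightarrow> mass (\<lambda>x. indicator (cball 0 R3) x *\<^sub>R (dilate s u x - u x)) \<le> D3 * s\<^sup>2"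
    by (rule dilate_locally_lipschitz[OF u 3(2)]) blast
  define K where "K = C3 * D3 + 10 * (C1 * D1) + 10 * \<mu> * (C2 * D2)"
  show ?thesis
  proof (rule that[of K])
    fix s :: real assume s: "\<bar>s\<bar> \<le> 1"
    define v where "v = dilate s u"
    have v: "v \<in> H1" unfolding v_def by (rule H1_dilate[OF u])
    define h where "h = (\<lambda>x. v x - u x)"
    have h': "v x - u x = h x" for x by (simp add: h_def)
    have h: "h \<in> H1" unfolding h_def by (rule H1_diff(1)[OF v u])
    have m: "mass v = mass u" unfolding v_def by (rule mass_dilate[OF H1_L2[OF u]])
    define N2 where "N2 = kin h + mass h"
    have z: "\<bar>0::real\<bar> \<le> 1" by simp
    note D1' = D1(2)[OF s, folded v_def, unfolded h'] and D2' = D2(2)[OF s, folded v_def, unfolded h'] and D3' = D3(2)[OF s, folded v_def, unfolded h']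
    have p1: "(\<integral>x. norm (u x) powr (p - 2) * dens h x \<partial>lborel) \<le> e * N2 + C1 * (D1 * s\<^sup>2)"
      using 1(3)[OF z h] mult_left_mono[OF D1' less_imp_le[OF 1(1)]] unfolding dilate_0 N2_def by linarith
    have p2: "(\<integral>x. norm (v x) powr (p - 2) * dens h x \<partial>lborel) \<le> e * N2 + C1 * (D1 * s\<^sup>2)"
      using 1(3)[OF s h, folded v_def] mult_left_mono[OF D1' less_imp_le[OF 1(1)]] unfolding N2_def by linarith
    have q1: "(\<integral>x. norm (u x) powr (q - 2) * dens h x \<partial>lborel) \<le> e * N2 + C2 * (D2 * s\<^sup>2)"
      using 2(3)[OF z h] mult_left_mono[OF D2' less_imp_le[OF 2(1)]] unfolding dilate_0 N2_def by linarith
    have q2: "(\<integral>x. norm (v x) powr (q - 2) * dens h x \<partial>lborel) \<le> e * N2 + C2 * (D2 * s\<^sup>2)"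
      using 2(3)[OF s h, folded v_def] mult_left_mono[OF D2' less_imp_le[OF 2(1)]] unfolding N2_def by linarith
    have eN: "e * mass h \<le> e * N2" using e by (simp add: N2_def)
    have c1: "(\<integral>x. dens h x * coulomb u x \<partial>lborel) \<le> e * N2 + C3 * (D3 * s\<^sup>2)"
      using 3(3)[OF z h] mult_left_mono[OF D3' less_imp_le[OF 3(1)]] eN unfolding dilate_0 by linarith
    have c2: "(\<integral>x. dens h x * coulomb v x \<partial>lborel) \<le> e * N2 + C3 * (D3 * s\<^sup>2)"
      using 3(3)[OF s h, folded v_def] mult_left_mono[OF D3' less_imp_le[OF 3(1)]] eN by linarith
    have c: "(\<integral>x. dens h x * (coulomb u x + coulomb v x) \<partial>lborel) = (\<integral>x. dens h x * coulomb u x \<partial>lborel) + (\<integral>x. dens h x * coulomb v x \<partial>lborel)"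
      unfolding distrib_left coulomb_newton
      by (intro Bochner_Integration.integral_add newton_mult_integrable L2_integrable[OF H1_L2[OF h]] L12_dens u v)
    note T = energy_taylor[OF sol v m pq mu, folded h_def, unfolded h']
    have q: "5 * \<mu> * ((\<integral>x. norm (u x) powr (q - 2) * dens h x \<partial>lborel) + (\<integral>x. norm (v x) powr (q - 2) * dens h x \<partial>lborel))
       \<le> 5 * \<mu> * ((e * N2 + C2 * (D2 * s\<^sup>2)) + (e * N2 + C2 * (D2 * s\<^sup>2)))"
      using mu by (intro mult_left_mono add_mono q1 q2) simp
    have lo: "min 1 lam / 2 * N2 \<le> 1/2 * kin h + 1/2 * lam * mass h"
    proof -
      have "min 1 lam * kin h \<le> 1 * kin h" "min 1 lam * mass h \<le> lam * mass h" by (intro mult_right_mono; simp)+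
      then show ?thesis by (simp add: N2_def algebra_simps)
    qed
    have "min 1 lam / 2 * N2 - (e * N2 + C3 * (D3 * s\<^sup>2)) - 5 * ((e * N2 + C1 * (D1 * s\<^sup>2)) + (e * N2 + C1 * (D1 * s\<^sup>2)))
       - 5 * \<mu> * ((e * N2 + C2 * (D2 * s\<^sup>2)) + (e * N2 + C2 * (D2 * s\<^sup>2))) \<le> energy p q \<mu> v - energy p q \<mu> u"
    proof -
      define Qv where "Qv = 5 * \<mu> * ((\<integral>x. norm (u x) powr (q - 2) * dens h x \<partial>lborel) + (\<integral>x. norm (v x) powr (q - 2) * dens h x \<partial>lborel))"
      define Qb where "Qb = 5 * \<mu> * ((e * N2 + C2 * (D2 * s\<^sup>2)) + (e * N2 + C2 * (D2 * s\<^sup>2)))"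
      define cb where "cb = e * N2 + C3 * (D3 * s\<^sup>2)"
      define pb where "pb = e * N2 + C1 * (D1 * s\<^sup>2)"
      define c1 where "c1 = (\<integral>x. dens h x * coulomb u x \<partial>lborel)"
      define c2 where "c2 = (\<integral>x. dens h x * coulomb v x \<partial>lborel)"
      define P1 where "P1 = (\<integral>x. norm (u x) powr (p - 2) * dens h x \<partial>lborel)"
      define P2 where "P2 = (\<integral>x. norm (v x) powr (p - 2) * dens h x \<partial>lborel)"
      define L where "L = 1/2 * kin h + 1/2 * lam * mass h"
      define l where "l = min 1 lam / 2 * N2"
      show ?thesis
        using T lo p1 p2 q c1 c2 unfolding c Qv_def[symmetric] Qb_def[symmetric] cb_def[symmetric] pb_def[symmetric]
          L_def[symmetric] l_def[symmetric] c1_def[symmetric] c2_def[symmetric] P1_def[symmetric] P2_def[symmetric] by argo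
    qed
    also have "min 1 lam / 2 * N2 - (e * N2 + C3 * (D3 * s\<^sup>2)) - 5 * ((e * N2 + C1 * (D1 * s\<^sup>2)) + (e * N2 + C1 * (D1 * s\<^sup>2)))
       - 5 * \<mu> * ((e * N2 + C2 * (D2 * s\<^sup>2)) + (e * N2 + C2 * (D2 * s\<^sup>2))) = - K * s\<^sup>2"
      unfolding ee[symmetric] K_def by (simp add: algebra_simps)
    finally show "- K * s\<^sup>2 \<le> energy p q \<mu> (dilate s u) - energy p q \<mu> u" by (simp add: v_def)
  qed
qed

lemma fiber_eq:
  assumes u: "u \<in> H1"
  shows "fiber p q \<mu> u s = 1/2 * exp (2 * s) * kin u + 1/4 * exp s * hart u
    - 1/p * exp (3 * s * (p - 2) / 2) * pw p u - \<mu>/q * exp (3 * s * (q - 2) / 2) * pw q u"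
  unfolding fiber_def energy_eq kin_dilate[OF u] hart_dilate pw_dilate by simp

text \<open>Closed form of the first derivative of the fiber map, read off from the scaling of each
  term; its value at 0 is the Pohozaev functional.\<close>

definition fiber1 :: "real \<Rightarrow> real \<Rightarrow> real \<Rightarrow> (R3 \<Rightarrow> complex) \<Rightarrow> real \<Rightarrow> real" where
  "fiber1 p q \<mu> u s = exp (2 * s) * kin u + 1/4 * exp s * hart u
    - gam p * exp (3 * s * (p - 2) / 2) * pw p u - \<mu> * gam q * exp (3 * s * (q - 2) / 2) * pw q u"

definition fiber2 :: "real \<Rightarrow> real \<Rightarrow> real \<Rightarrow> (R3 \<Rightarrow> complex) \<Rightarrow> real \<Rightarrow> real" where
  "fiber2 p q \<mu> u s = 2 * exp (2 * s) * kin u + 1/4 * exp s * hart u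
    - gam p * (3 * (p - 2) / 2) * exp (3 * s * (p - 2) / 2) * pw p u
    - \<mu> * gam q * (3 * (q - 2) / 2) * exp (3 * s * (q - 2) / 2) * pw q u"

lemma fiber_deriv:
  assumes u: "u \<in> H1" and "p \<noteq> 0" "q \<noteq> 0"
  shows "(fiber p q \<mu> u has_real_derivative fiber1 p q \<mu> u s) (at s)"
    and "(fiber1 p q \<mu> u has_real_derivative fiber2 p q \<mu> u s) (at s)"
proof -
  show "(fiber p q \<mu> u has_real_derivative fiber1 p q \<mu> u s) (at s)"
    unfolding fiber_eq[OF u, abs_def] fiber1_def gam_def using assms
    by (auto intro!: derivative_eq_intros simp: field_simps)
  show "(fiber1 p q \<mu> u has_real_derivative fiber2 p q \<mu> u s) (at s)"
    unfolding fiber1_def[abs_def] fiber2_def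
    by (auto intro!: derivative_eq_intros simp: field_simps)
qed

lemma deriv_fiber:
  assumes u: "u \<in> H1" and "p \<noteq> 0" "q \<noteq> 0"
  shows "deriv (fiber p q \<mu> u) = fiber1 p q \<mu> u" "deriv (deriv (fiber p q \<mu> u)) = fiber2 p q \<mu> u"
proof -
  show 1: "deriv (fiber p q \<mu> u) = fiber1 p q \<mu> u"
    using DERIV_imp_deriv[OF fiber_deriv(1)[OF assms]] by auto
  show "deriv (deriv (fiber p q \<mu> u)) = fiber2 p q \<mu> u"
    unfolding 1 using DERIV_imp_deriv[OF fiber_deriv(2)[OF assms]] by auto
qed

lemma pohozaev:
  assumes sol: "weak_solution (comb_nl p q \<mu>) lam u" and lam: "0 < lam" and mu: "0 \<le> \<mu>"
    and pq: "2 < p" "p < 6" "2 < q" "q < 6"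
  shows "kin u + 1/4 * hart u - gam p * pw p u - \<mu> * gam q * pw q u = 0"
proof -
  have u: "u \<in> H1" using sol by (simp add: weak_solution_def)
  obtain C where C: "\<And>s. \<bar>s\<bar> \<le> 1 \<Longrightarrow> - C * s\<^sup>2 \<le> energy p q \<mu> (dilate s u) - energy p q \<mu> u"
    by (rule energy_dilate_lower_bound[OF assms]) blast
  have d: "((\<lambda>s. fiber p q \<mu> u s + C * s\<^sup>2) has_real_derivative fiber1 p q \<mu> u 0) (at 0)"
    using pq by (auto intro!: derivative_eq_intros fiber_deriv(1) u)
  have "fiber1 p q \<mu> u 0 = 0"
  proof (rule DERIV_local_min[OF d, of 1])
    show "\<forall>y. \<bar>0 - y\<bar> < 1 \<longrightarrow> fiber p q \<mu> u 0 + C * 0\<^sup>2 \<le> fiber p q \<mu> u y + C * y\<^sup>2"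
    proof (intro allI impI)
      fix y :: real assume "\<bar>0 - y\<bar> < 1"
      then show "fiber p q \<mu> u 0 + C * 0\<^sup>2 \<le> fiber p q \<mu> u y + C * y\<^sup>2"
        using C[of y] by (simp add: fiber_def dilate_0)
    qed
  qed simp
  then show ?thesis by (simp add: fiber1_def)
qed

section \<open>Bounds for the mountain pass level\<close>

lemma gam_mult: "t \<noteq> 0 \<Longrightarrow> t * gam t = 3 * (t - 2) / 2" by (simp add: gam_def)

lemma gam_pos: "2 < t \<Longrightarrow> 0 < gam t" by (simp add: gam_def)

text \<open>The Pohozaev identity eliminates the p-term. The coefficient of the Dirichlet integral
  is positive once \<alpha> > 2, which means p > 10/3.\<close>

lemma energy_fiber1:
  assumes "p \<noteq> 0" "q \<noteq> 0" and p: "2 < p" and q: "0 < q" and z: "fiber1 p q \<mu> u 0 = 0"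
  defines "\<alpha> \<equiv> 3 * (p - 2) / 2"
  shows "energy p q \<mu> u = (1/2 - 1/\<alpha>) * kin u + 1/4 * (1 - 1/\<alpha>) * hart u - \<mu> * (1/q - gam q / \<alpha>) * pw q u"
proof -
  have a: "\<alpha> > 0" "p * gam p = \<alpha>" using p by (simp_all add: \<alpha>_def gam_mult)
  have z': "gam p * pw p u = kin u + 1/4 * hart u - \<mu> * gam q * pw q u" using z by (simp add: fiber1_def)
  have "1/p * pw p u = (gam p * pw p u) / \<alpha>" unfolding a(2)[symmetric] using assms(1) gam_pos[OF p] by simp
  also have "\<dots> = (kin u + 1/4 * hart u - \<mu> * gam q * pw q u) / \<alpha>" unfolding z' ..
  finally have e: "1/p * pw p u = (kin u + 1/4 * hart u - \<mu> * gam q * pw q u) / \<alpha>" .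
  show ?thesis unfolding energy_eq e by (simp add: diff_divide_distrib add_divide_distrib algebra_simps)
qed

text \<open>The Coulomb term is dropped and the q-term is estimated by Gagliardo-Nirenberg. The unit
  \<mu>0 is scaled so that at \<mu> = \<mu>0 the q-term carries the coefficient c, half of that of
  the Dirichlet integral.\<close>

lemma energy_lower_bound:
  assumes p: "10/3 < p" "p < 6" and q: "2 < q" "q \<le> 12/5"
  obtains \<mu>0 c where "\<mu>0 > 0" "c > 0"
    "\<And>\<mu> u. 0 \<le> \<mu> \<Longrightarrow> \<mu> \<le> \<mu>0 \<Longrightarrow> u \<in> H1 \<Longrightarrow> mass u = m \<Longrightarrow> fiber1 p q \<mu> u 0 = 0 \<Longrightarrow>
       2 * c * kin u - \<mu> / \<mu>0 * c * kin u powr (3 * (q - 2) / 4) \<le> energy p q \<mu> u"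
proof -
  define \<alpha> where "\<alpha> = 3 * (p - 2) / 2"
  have a: "\<alpha> > 2" using p by (simp add: \<alpha>_def)
  obtain G where G: "G > 0" "\<And>u. u \<in> H1 \<Longrightarrow> pw q u \<le> G * mass u powr ((6 - q) / 4) * kin u powr (3 * (q - 2) / 4)"
    by (rule GN[of q]) (use q in auto)
  define c where "c = (1/2 - 1/\<alpha>) / 2"
  have c: "c > 0" using a by (simp add: c_def field_simps)
  define D where "D = G * m powr ((6 - q) / 4)"
  define \<mu>0 where "\<mu>0 = c / (D + 1)"
  have D: "D \<ge> 0" using G by (simp add: D_def)
  have \<mu>0: "\<mu>0 > 0" using c D by (simp add: \<mu>0_def)
  show ?thesis
  proof (rule that[OF \<mu>0 c])
    fix \<mu> u assume mu: "0 \<le> \<mu>" "\<mu> \<le> \<mu>0" and u: "u \<in> H1" and m: "mass u = m" and z: "fiber1 p q \<mu> u 0 = 0"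
    have e: "energy p q \<mu> u = (1/2 - 1/\<alpha>) * kin u + 1/4 * (1 - 1/\<alpha>) * hart u - \<mu> * (1/q - gam q / \<alpha>) * pw q u"
      unfolding \<alpha>_def using p q by (intro energy_fiber1 z) auto
    have h: "0 \<le> 1/4 * (1 - 1/\<alpha>) * hart u" using a hart_nonneg[of u] by (intro mult_nonneg_nonneg) auto
    have Q: "\<mu> * (1/q - gam q / \<alpha>) * pw q u \<le> \<mu> / \<mu>0 * c * kin u powr (3 * (q - 2) / 4)"
    proof -
      have "1/q - gam q / \<alpha> \<le> 1"
      proof -
        have "1/q \<le> 1" using q by simp
        moreover have "0 \<le> gam q / \<alpha>" using gam_pos[OF q(1)] a by simp
        ultimately show ?thesis by simp
      qed
      then have "(1/q - gam q / \<alpha>) * pw q u \<le> 1 * pw q u" by (intro mult_right_mono) auto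
      also have "\<dots> \<le> D * kin u powr (3 * (q - 2) / 4)" using G(2)[OF u] m by (simp add: D_def)
      also have "\<dots> \<le> (D + 1) * kin u powr (3 * (q - 2) / 4)" by (intro mult_right_mono) auto
      finally have "\<mu> * ((1/q - gam q / \<alpha>) * pw q u) \<le> \<mu> * ((D + 1) * kin u powr (3 * (q - 2) / 4))"
        using mu by (intro mult_left_mono)
      also have "\<dots> = \<mu> / \<mu>0 * c * kin u powr (3 * (q - 2) / 4)" using c D by (simp add: \<mu>0_def)
      finally show ?thesis by (simp add: mult.assoc)
    qed
    have "(1/2 - 1/\<alpha>) * kin u = 2 * c * kin u" by (simp add: c_def)
    then show "2 * c * kin u - \<mu> / \<mu>0 * c * kin u powr (3 * (q - 2) / 4) \<le> energy p q \<mu> u"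
      unfolding e using h Q by argo
  qed
qed

text \<open>The combination fiber2 - \<beta> fiber1 removes the \<mu>-term altogether, so \<delta>
  does not depend on \<mu>. The Coulomb term keeps its sign because \<beta> < 1, and
  Gagliardo-Nirenberg bounds the p-term by a power of the Dirichlet integral larger than 1.\<close>

lemma P_minus_kin_lower_bound:
  assumes p: "10/3 < p" "p < 6" and q: "2 < q" "q \<le> 12/5"
  obtains \<delta> where "\<delta> > 0"
    "\<And>\<mu> u. 0 \<le> \<mu> \<Longrightarrow> u \<in> H1 \<Longrightarrow> mass u = m \<Longrightarrow> fiber1 p q \<mu> u 0 = 0 \<Longrightarrow> fiber2 p q \<mu> u 0 < 0 \<Longrightarrow> \<delta> \<le> kin u"
proof -
  define \<alpha> where "\<alpha> = 3 * (p - 2) / 2"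
  define \<beta> where "\<beta> = 3 * (q - 2) / 2"
  have a: "\<alpha> > 2" using p by (simp add: \<alpha>_def)
  have b: "0 < \<beta>" "\<beta> < 1" using q by (simp_all add: \<beta>_def)
  obtain G where G: "G > 0" "\<And>u. u \<in> H1 \<Longrightarrow> pw p u \<le> G * mass u powr ((6 - p) / 4) * kin u powr (3 * (p - 2) / 4)"
    by (rule GN[of p]) (use p in auto)
  define D where "D = gam p * (\<alpha> - \<beta>) * (G * m powr ((6 - p) / 4)) + 1"
  have gp: "gam p > 0" using p by (intro gam_pos) simp
  have D: "D > 0" unfolding D_def using gp a b G by (intro add_nonneg_pos mult_nonneg_nonneg) auto
  \<comment> \<open>The positive solution k of (2 - \<beta>) k = D k^(\<alpha>/2).\<close>
  define \<delta> where "\<delta> = ((2 - \<beta>) / D) powr (1 / (\<alpha> / 2 - 1))"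
  show ?thesis
  proof (rule that[of \<delta>])
    show "\<delta> > 0" using b D by (simp add: \<delta>_def)
    fix \<mu> u assume mu: "0 \<le> \<mu>" and u: "u \<in> H1" and m: "mass u = m" and z: "fiber1 p q \<mu> u 0 = 0" and n: "fiber2 p q \<mu> u 0 < 0"
    have "fiber2 p q \<mu> u 0 - \<beta> * fiber1 p q \<mu> u 0
        = (2 - \<beta>) * kin u + 1/4 * (1 - \<beta>) * hart u - gam p * (\<alpha> - \<beta>) * pw p u"
      by (simp add: fiber1_def fiber2_def \<alpha>_def \<beta>_def algebra_simps diff_divide_distrib add_divide_distrib)
    moreover have "0 \<le> 1/4 * (1 - \<beta>) * hart u" using b hart_nonneg[of u] by (intro mult_nonneg_nonneg) auto
    ultimately have "(2 - \<beta>) * kin u < gam p * (\<alpha> - \<beta>) * pw p u" using z n by simp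
    also have "\<dots> \<le> gam p * (\<alpha> - \<beta>) * (G * m powr ((6 - p) / 4) * kin u powr (\<alpha> / 2))"
      using G(2)[OF u] m gp a b by (intro mult_left_mono) (auto simp: \<alpha>_def)
    also have "\<dots> \<le> D * kin u powr (\<alpha> / 2)" by (simp add: D_def algebra_simps)
    finally have lt: "(2 - \<beta>) * kin u < D * kin u powr (\<alpha> / 2)" .
    then have "kin u \<noteq> 0" by auto
    then have k: "kin u > 0" using mass_nonneg[of "wgrad u"] by linarith
    have "kin u powr (\<alpha> / 2) = kin u powr (\<alpha> / 2 - 1) * kin u" using k powr_add[of "kin u" "\<alpha> / 2 - 1" 1] by simp
    with lt have "(2 - \<beta>) * kin u < (D * kin u powr (\<alpha> / 2 - 1)) * kin u" by (simp only: mult.assoc)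
    then have "2 - \<beta> < D * kin u powr (\<alpha> / 2 - 1)" using k by simp
    then have "(2 - \<beta>) / D < kin u powr (\<alpha> / 2 - 1)" using D by (simp add: pos_divide_less_eq mult.commute)
    then have "((2 - \<beta>) / D) powr (1 / (\<alpha> / 2 - 1)) \<le> (kin u powr (\<alpha> / 2 - 1)) powr (1 / (\<alpha> / 2 - 1))"
      using a b D by (intro powr_mono2) auto
    also have "\<dots> = kin u" using a k by (simp add: powr_powr)
    finally show "\<delta> \<le> kin u" by (simp add: \<delta>_def)
  qed
qed

lemma fiber1_dilate: "u \<in> H1 \<Longrightarrow> fiber1 p q \<mu> (dilate s u) 0 = fiber1 p q \<mu> u s"
  and fiber2_dilate: "u \<in> H1 \<Longrightarrow> fiber2 p q \<mu> (dilate s u) 0 = fiber2 p q \<mu> u s"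
  by (simp_all add: fiber1_def fiber2_def kin_dilate hart_dilate pw_dilate)

lemma P_minus_rad_iff:
  assumes "p \<noteq> 0" "q \<noteq> 0" "0 < a"
  shows "u \<in> P_minus_rad p q \<mu> a \<longleftrightarrow> u \<in> H1_rad \<and> mass u = a\<^sup>2 \<and> fiber1 p q \<mu> u 0 = 0 \<and> fiber2 p q \<mu> u 0 < 0"
proof -
  have "Lnorm 2 u = a \<longleftrightarrow> mass u = a\<^sup>2"
    unfolding Lnorm_2 using assms(3) by (metis less_imp_le mass_nonneg real_sqrt_pow2 real_sqrt_unique)
  moreover have "u \<in> H1_rad \<Longrightarrow> u \<in> H1" by (simp add: H1_rad_def)
  ultimately show ?thesis
    unfolding P_minus_rad_def L2_sphere_def using deriv_fiber[OF _ assms(1,2)] by auto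
qed

lemma mult_less_eventually:
  fixes x y z :: real
  assumes "0 \<le> y" "0 < z" "0 < x" "x \<le> z / (y + 1) / 2" shows "x * y < z"
proof -
  have "x * y \<le> z / (y + 1) / 2 * (y + 1)" using assms by (intro mult_mono) auto
  also have "\<dots> = z / 2" using assms by (simp add: field_simps)
  finally show ?thesis using assms by linarith
qed

text \<open>The fiber derivative of \<open>v\<close> is positive at s1 and negative at s2 for all
  small \<mu>. At a zero in between the second derivative is negative, and the energy there is
  bounded through s2 alone.\<close>

lemma P_minus_element:
  assumes p: "10/3 < p" "p < 6" and q: "2 < q" "q \<le> 12/5" and v: "v \<in> H1_rad" "mass v = a\<^sup>2" "0 < a"
  obtains \<mu>1 M where "\<mu>1 > 0"
    "\<And>\<mu>. 0 < \<mu> \<Longrightarrow> \<mu> \<le> \<mu>1 \<Longrightarrow> \<exists>w\<in>P_minus_rad p q \<mu> a. energy p q \<mu> w \<le> M"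
proof -
  define \<alpha> where "\<alpha> = 3 * (p - 2) / 2"
  define \<beta> where "\<beta> = 3 * (q - 2) / 2"
  have al: "\<alpha> > 2" using p by (simp add: \<alpha>_def)
  have b: "0 < \<beta>" "\<beta> < 1" using q by (simp_all add: \<beta>_def)
  have vH: "v \<in> H1" using v by (simp add: H1_rad_def)
  define k where "k = kin v"
  define B where "B = hart v"
  define P where "P = gam p * pw p v"
  define Q where "Q = gam q * pw q v"
  have gp: "gam p > 0" "gam q > 0" using p q by (auto intro!: gam_pos)
  have "pw p v \<noteq> 0"
  proof
    assume "pw p v = 0"
    then have "AE x in lborel. v x = 0" by (rule pw_eq_0[rotated]) (use H1_pw_integrable[OF vH, of p] p in auto)
    then have "mass v = 0" using mass_cong_AE[of v "\<lambda>x. 0"] H1_measurable[OF vH] by (simp add: mass_def)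
    then show False using v by simp
  qed
  then have P0: "P > 0" unfolding P_def using gp pw_nonneg[of p v] by (simp add: less_le)
  obtain G where G: "G > 0" "\<And>u. u \<in> H1 \<Longrightarrow> pw p u \<le> G * mass u powr ((6 - p) / 4) * kin u powr (3 * (p - 2) / 4)"
    by (rule GN[of p]) (use p in auto)
  have "pw p v > 0" using \<open>pw p v \<noteq> 0\<close> pw_nonneg[of p v] by linarith
  then have "k \<noteq> 0" using G(2)[OF vH] p by (auto simp: k_def)
  then have k0: "k > 0" using mass_nonneg[of "wgrad v"] unfolding k_def by linarith
  have B0: "B \<ge> 0" and Q0: "Q \<ge> 0" using hart_nonneg gp by (auto simp: B_def Q_def)
  \<comment> \<open>At s1 the p-term is exactly half of the kinetic term; s2 is so large that the
    p-term dominates the kinetic and Coulomb terms together. Neither depends on \<mu>.\<close>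
  define s1 where "s1 = ln (k / (2 * P)) / (\<alpha> - 2)"
  define s2 where "s2 = max (max 0 s1) (ln ((k + B / 4) / P + 1) / (\<alpha> - 2))"
  have f1: "fiber1 p q \<mu> v s = exp (2 * s) * k + 1/4 * exp s * B - exp (\<alpha> * s) * P - \<mu> * (exp (\<beta> * s) * Q)" for \<mu> s
    unfolding fiber1_def k_def B_def P_def Q_def \<alpha>_def \<beta>_def by (simp add: algebra_simps)
  \<comment> \<open>Expressed through the first derivative, which vanishes at the point found later,
    the second derivative consists of nonpositive terms and one term of order \<mu>.\<close>
  have f2: "fiber2 p q \<mu> v s = \<alpha> * fiber1 p q \<mu> v s - (\<alpha> - 2) * exp (2 * s) * k - (\<alpha> - 1) * (1/4 * exp s * B) + \<mu> * ((\<alpha> - \<beta>) * (exp (\<beta> * s) * Q))" for \<mu> s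
    unfolding f1 unfolding fiber2_def k_def B_def P_def Q_def \<alpha>_def \<beta>_def by (simp add: algebra_simps)
  \<comment> \<open>\<open>\<mu>a\<close> keeps the q-term below half of the kinetic term at s1;
    \<open>\<mu>b\<close> keeps the positive term of the second derivative below the kinetic one on
    all of [s1, s2].\<close>
  define \<mu>a where "\<mu>a = exp (2 * s1) * k / 2 / (exp (\<beta> * s1) * Q + 1) / 2"
  define \<mu>b where "\<mu>b = (\<alpha> - 2) * exp (2 * s1) * k / ((\<alpha> - \<beta>) * (exp (\<beta> * s2) * Q) + 1) / 2"
  define M where "M = 1/2 * exp (2 * s2) * k + 1/4 * exp s2 * B"
  show ?thesis
  proof (rule that[of "min \<mu>a \<mu>b" M])
    show "min \<mu>a \<mu>b > 0" using k0 Q0 al b by (auto simp: \<mu>a_def \<mu>b_def intro!: divide_pos_pos add_nonneg_pos mult_nonneg_nonneg mult_pos_pos)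
    fix \<mu> assume mu: "0 < \<mu>" "\<mu> \<le> min \<mu>a \<mu>b"
    have pos: "fiber1 p q \<mu> v s1 > 0"
    proof -
      have "exp (\<alpha> * s1) = exp (2 * s1) * exp ((\<alpha> - 2) * s1)" by (simp add: exp_add[symmetric] algebra_simps)
      also have "(\<alpha> - 2) * s1 = ln (k / (2 * P))" using al by (simp add: s1_def)
      also have "exp (ln (k / (2 * P))) = k / (2 * P)" using k0 P0 by simp
      finally have "exp (\<alpha> * s1) * P = exp (2 * s1) * k / 2" using P0 by simp
      moreover have "\<mu> * (exp (\<beta> * s1) * Q) < exp (2 * s1) * k / 2"
        by (rule mult_less_eventually) (use mu k0 Q0 in \<open>auto simp: \<mu>a_def\<close>)
      moreover have "0 \<le> 1/4 * exp s1 * B" using B0 by simp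
      ultimately show ?thesis unfolding f1 by linarith
    qed
    have neg: "fiber1 p q \<mu> v s2 < 0"
    proof -
      have s20: "s2 \<ge> 0" by (simp add: s2_def)
      have "exp s2 \<le> exp (2 * s2)" using s20 by simp
      then have "exp (2 * s2) * k + 1/4 * exp s2 * B \<le> exp (2 * s2) * (k + B / 4)"
        using B0 by (simp add: distrib_left mult_right_mono)
      also have "\<dots> < exp (2 * s2) * (((k + B / 4) / P + 1) * P)"
      proof (rule mult_strict_left_mono)
        have "((k + B / 4) / P + 1) * P = (k + B / 4) + P" using P0 by (subst distrib_right) simp
        then show "k + B / 4 < ((k + B / 4) / P + 1) * P" using P0 by linarith
      qed simp
      also have "\<dots> \<le> exp (2 * s2) * (exp ((\<alpha> - 2) * s2) * P)"
      proof -
        have "ln ((k + B / 4) / P + 1) \<le> (\<alpha> - 2) * s2"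
        proof -
          have "ln ((k + B / 4) / P + 1) / (\<alpha> - 2) \<le> s2" by (simp add: s2_def)
          then show ?thesis using al by (simp add: pos_divide_le_eq mult.commute)
        qed
        then have "exp (ln ((k + B / 4) / P + 1)) \<le> exp ((\<alpha> - 2) * s2)" by simp
        moreover have "(k + B / 4) / P + 1 > 0" using k0 B0 P0 by (intro add_nonneg_pos divide_nonneg_pos) auto
        ultimately have "(k + B / 4) / P + 1 \<le> exp ((\<alpha> - 2) * s2)" by simp
        then show ?thesis using P0 by (intro mult_left_mono mult_right_mono) auto
      qed
      also have "\<dots> = exp (\<alpha> * s2) * P" by (simp add: mult.assoc[symmetric] exp_add[symmetric] algebra_simps)
      finally have "exp (2 * s2) * k + 1/4 * exp s2 * B < exp (\<alpha> * s2) * P" .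
      moreover have "0 \<le> \<mu> * (exp (\<beta> * s2) * Q)" using mu Q0 by simp
      ultimately show ?thesis unfolding f1 by linarith
    qed
    have "\<exists>s\<ge>s1. s \<le> s2 \<and> fiber1 p q \<mu> v s = 0"
    proof (rule IVT2)
      show "fiber1 p q \<mu> v s2 \<le> 0" "0 \<le> fiber1 p q \<mu> v s1" using pos neg by auto
      show "s1 \<le> s2" by (simp add: s2_def)
      show "\<forall>x. s1 \<le> x \<and> x \<le> s2 \<longrightarrow> isCont (fiber1 p q \<mu> v) x"
        using DERIV_isCont[OF fiber_deriv(2)[OF vH]] p q by auto
    qed
    then obtain s where s: "s1 \<le> s" "s \<le> s2" "fiber1 p q \<mu> v s = 0" by auto
    have n2: "fiber2 p q \<mu> v s < 0"
    proof -
      have "\<mu> * ((\<alpha> - \<beta>) * (exp (\<beta> * s) * Q)) \<le> \<mu> * ((\<alpha> - \<beta>) * (exp (\<beta> * s2) * Q))"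
        using mu al b Q0 s by (intro mult_left_mono mult_right_mono) auto
      also have "\<dots> < (\<alpha> - 2) * exp (2 * s1) * k"
        by (rule mult_less_eventually) (use mu k0 Q0 al b in \<open>auto simp: \<mu>b_def\<close>)
      also have "\<dots> \<le> (\<alpha> - 2) * exp (2 * s) * k" using al k0 s by (intro mult_right_mono mult_left_mono) auto
      finally have "\<mu> * ((\<alpha> - \<beta>) * (exp (\<beta> * s) * Q)) < (\<alpha> - 2) * exp (2 * s) * k" .
      moreover have "0 \<le> (\<alpha> - 1) * (1/4 * exp s * B)" using al B0 by simp
      ultimately show ?thesis unfolding f2 s(3) by simp
    qed
    have "dilate s v \<in> P_minus_rad p q \<mu> a"
      using p q v s(3) n2 H1_rad_dilate[OF v(1)] mass_dilate[OF H1_L2[OF vH]]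
      by (simp add: P_minus_rad_iff fiber1_dilate[OF vH] fiber2_dilate[OF vH])
    moreover have "energy p q \<mu> (dilate s v) \<le> M"
    proof -
      have "energy p q \<mu> (dilate s v) = 1/2 * exp (2 * s) * k + 1/4 * exp s * B - 1/p * exp (3 * s * (p - 2) / 2) * pw p v
          - \<mu>/q * exp (3 * s * (q - 2) / 2) * pw q v"
        unfolding fiber_def[symmetric] fiber_eq[OF vH] k_def B_def ..
      moreover have "0 \<le> 1/p * exp (3 * s * (p - 2) / 2) * pw p v" "0 \<le> \<mu>/q * exp (3 * s * (q - 2) / 2) * pw q v"
        using p q mu by auto
      moreover have "1/2 * exp (2 * s) * k \<le> 1/2 * exp (2 * s2) * k" "1/4 * exp s * B \<le> 1/4 * exp s2 * B"
        using s k0 B0 by (auto intro!: mult_right_mono)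
      ultimately show ?thesis unfolding M_def by linarith
    qed
    ultimately show "\<exists>w\<in>P_minus_rad p q \<mu> a. energy p q \<mu> w \<le> M" by blast
  qed
qed

lemma powr_less_one_le_affine:
  fixes k e :: real assumes "0 \<le> k" "0 \<le> e" "e \<le> 1" shows "k powr e \<le> 1 + k"
proof (cases "k \<le> 1")
  case True
  then have "k powr e \<le> 1" using assms powr_mono2[of e k 1] by simp
  then show ?thesis using assms by simp
next
  case False
  then have "k powr e \<le> k powr 1" using assms by (intro powr_mono) auto
  then show ?thesis using False by simp
qed

text \<open>A real infimum carries information only for a nonempty set bounded below, so both halves
  are proved together. The member comes from \<open>P_minus_element\<close>; the lower bound
  combines the energy estimate with \<open>kin u >= d\<close> on the constraint.\<close>

lemma mp_level_bounds:
  assumes p: "10/3 < p" "p < 6" and q: "2 < q" "q \<le> 12/5" and v: "v \<in> H1_rad" "mass v = a\<^sup>2" "0 < a"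
  obtains \<mu>1 \<delta> M where "\<mu>1 > 0" "\<delta> > 0"
    "\<And>\<mu>. 0 < \<mu> \<Longrightarrow> \<mu> \<le> \<mu>1 \<Longrightarrow> \<delta> \<le> mp_level p q \<mu> a \<and> mp_level p q \<mu> a \<le> M"
proof -
  obtain \<mu>0 c where 0: "\<mu>0 > 0" "c > 0"
    "\<And>\<mu> u. 0 \<le> \<mu> \<Longrightarrow> \<mu> \<le> \<mu>0 \<Longrightarrow> u \<in> H1 \<Longrightarrow> mass u = a\<^sup>2 \<Longrightarrow> fiber1 p q \<mu> u 0 = 0 \<Longrightarrow>
       2 * c * kin u - \<mu> / \<mu>0 * c * kin u powr (3 * (q - 2) / 4) \<le> energy p q \<mu> u"
    by (rule energy_lower_bound[OF p q]) blast
  obtain d where d: "d > 0"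
    "\<And>\<mu> u. 0 \<le> \<mu> \<Longrightarrow> u \<in> H1 \<Longrightarrow> mass u = a\<^sup>2 \<Longrightarrow> fiber1 p q \<mu> u 0 = 0 \<Longrightarrow> fiber2 p q \<mu> u 0 < 0 \<Longrightarrow> d \<le> kin u"
    by (rule P_minus_kin_lower_bound[OF p q]) blast
  obtain \<mu>1 M where 1: "\<mu>1 > 0" "\<And>\<mu>. 0 < \<mu> \<Longrightarrow> \<mu> \<le> \<mu>1 \<Longrightarrow> \<exists>w\<in>P_minus_rad p q \<mu> a. energy p q \<mu> w \<le> M"
    by (rule P_minus_element[OF p q v]) blast
  \<comment> \<open>With k^e <= 1 + k, the factor d / (1 + d) makes the negative term at most c k
    for every k >= d, which leaves half of the kinetic contribution.\<close>
  define \<mu>2 where "\<mu>2 = min \<mu>1 (min \<mu>0 (\<mu>0 * (d / (1 + d))))"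
  have lb: "c * d \<le> energy p q \<mu> u" if mu: "0 < \<mu>" "\<mu> \<le> \<mu>2" and u: "u \<in> P_minus_rad p q \<mu> a" for \<mu> u
  proof -
    have uH: "u \<in> H1" "mass u = a\<^sup>2" "fiber1 p q \<mu> u 0 = 0" "fiber2 p q \<mu> u 0 < 0"
      using u p q v by (auto simp: P_minus_rad_iff H1_rad_def)
    have kd: "d \<le> kin u" using d(2)[OF _ uH] mu by simp
    have e: "2 * c * kin u - \<mu> / \<mu>0 * c * kin u powr (3 * (q - 2) / 4) \<le> energy p q \<mu> u"
      using 0(3)[OF _ _ uH(1-3)] mu by (simp add: \<mu>2_def)
    have "\<mu> / \<mu>0 \<le> d / (1 + d)" using mu 0(1) by (simp add: \<mu>2_def divide_le_eq mult.commute)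
    then have "\<mu> / \<mu>0 * c * kin u powr (3 * (q - 2) / 4) \<le> d / (1 + d) * c * (1 + kin u)"
      using 0 d q powr_less_one_le_affine[OF mass_nonneg[of "wgrad u"], of "3 * (q - 2) / 4"]
      by (intro mult_mono mult_right_mono) auto
    also have "\<dots> = c * (d / (1 + d) * (1 + kin u))" by simp
    also have "\<dots> \<le> c * kin u"
    proof (intro mult_left_mono)
      have "d / (1 + d) \<le> kin u / (1 + kin u)" using kd d(1) by (simp add: divide_simps algebra_simps)
      then have "d / (1 + d) * (1 + kin u) \<le> kin u / (1 + kin u) * (1 + kin u)" using mass_nonneg[of "wgrad u"] by (intro mult_right_mono) linarith+
      moreover have "1 + kin u \<noteq> 0" using mass_nonneg[of "wgrad u"] by linarith
      ultimately show "d / (1 + d) * (1 + kin u) \<le> kin u" by simp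
    qed (use 0 in simp)
    finally have "c * kin u \<le> energy p q \<mu> u" using e by linarith
    moreover have "c * d \<le> c * kin u" using kd 0 by simp
    ultimately show ?thesis by linarith
  qed
  show ?thesis
  proof (rule that[of \<mu>2 "c * d" M])
    show "\<mu>2 > 0" using 0 1 d by (simp add: \<mu>2_def)
    show "c * d > 0" using 0 d by simp
    fix \<mu> assume mu: "0 < \<mu>" "\<mu> \<le> \<mu>2"
    obtain w where w: "w \<in> P_minus_rad p q \<mu> a" "energy p q \<mu> w \<le> M" using 1(2)[of \<mu>] mu by (auto simp: \<mu>2_def)
    have "c * d \<le> mp_level p q \<mu> a" unfolding mp_level_def using w by (intro cINF_greatest lb[OF mu]) auto
    moreover have "mp_level p q \<mu> a \<le> energy p q \<mu> w" unfolding mp_level_def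
      using lb[OF mu] w by (intro cINF_lower bdd_belowI[of _ "c * d"]) auto
    ultimately show "c * d \<le> mp_level p q \<mu> a \<and> mp_level p q \<mu> a \<le> M" using w by simp
  qed
qed

section \<open>Uniform bounds for the mountain pass solutions\<close>

lemma normalized_mass: "normalized_solution f a lam u \<Longrightarrow> mass u = a\<^sup>2"
  by (simp add: normalized_solution_def mass_def)

lemma weak_solution_H1: "weak_solution f lam u \<Longrightarrow> u \<in> H1" by (simp add: weak_solution_def)

lemma weak_solution_self:
  assumes sol: "weak_solution (comb_nl p q \<mu>) lam u" and pq: "2 < p" "p < 6" "2 < q" "q < 6"
  shows "kin u + lam * mass u + hart u = pw p u + \<mu> * pw q u"
proof -
  have u: "u \<in> H1" using sol by (rule weak_solution_H1)
  have e: "Re (u x * cnj (u x)) = (norm (u x))\<^sup>2" for x unfolding inner_complex_cnj[symmetric] power2_norm_eq_inner ..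
  have pe: "norm (u x) powr (t - 2) * (norm (u x))\<^sup>2 = norm (u x) powr t" for t x
    using powr_split_square[of "norm (u x)" t] by simp
  show ?thesis using weak_solution_real[OF sol u pq]
    unfolding e pe by (simp add: mass_def hart_def pw_def power2_norm_eq_inner)
qed

text \<open>The upper bound on the Dirichlet integral comes from the Pohozaev identity and the level
  from above. The lower bound comes from the level from below, because the energy is at most the
  Dirichlet integral plus a multiple of its square root. Testing the equation with the solution
  bounds the multiplier.\<close>

lemma mp_solution_bounds:
  assumes p: "10/3 < p" "p < 6" and q: "2 < q" "q \<le> 12/5" and v: "v \<in> H1_rad" "mass v = a\<^sup>2" "0 < a"
  obtains \<mu>1 \<kappa> K \<Lambda> where "\<mu>1 > 0" "\<kappa> > 0"
    "\<And>\<mu> lam u. 0 < \<mu> \<Longrightarrow> \<mu> \<le> \<mu>1 \<Longrightarrow> mp_solution p q \<mu> a lam u \<Longrightarrow> \<kappa> \<le> kin u \<and> kin u \<le> K \<and> lam \<le> \<Lambda>"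
proof -
  obtain \<mu>0 c where 0: "\<mu>0 > 0" "c > 0"
    "\<And>\<mu> u. 0 \<le> \<mu> \<Longrightarrow> \<mu> \<le> \<mu>0 \<Longrightarrow> u \<in> H1 \<Longrightarrow> mass u = a\<^sup>2 \<Longrightarrow> fiber1 p q \<mu> u 0 = 0 \<Longrightarrow>
       2 * c * kin u - \<mu> / \<mu>0 * c * kin u powr (3 * (q - 2) / 4) \<le> energy p q \<mu> u"
    by (rule energy_lower_bound[OF p q]) blast
  obtain \<mu>1 \<delta> M where 1: "\<mu>1 > 0" "\<delta> > 0"
    "\<And>\<mu>. 0 < \<mu> \<Longrightarrow> \<mu> \<le> \<mu>1 \<Longrightarrow> \<delta> \<le> mp_level p q \<mu> a \<and> mp_level p q \<mu> a \<le> M"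
    by (rule mp_level_bounds[OF p q v]) blast
  obtain H where H: "H > 0" "\<And>u. u \<in> H1 \<Longrightarrow> mass u = a\<^sup>2 \<Longrightarrow> hart u \<le> H * sqrt (kin u)"
    by (rule hart_le_sqrt_kin[of "a\<^sup>2"]) blast
  obtain G where G: "G > 0" "\<And>u. u \<in> H1 \<Longrightarrow> pw p u \<le> G * mass u powr ((6 - p) / 4) * kin u powr (3 * (p - 2) / 4)"
    by (rule GN[of p]) (use p in auto)
  obtain F where F: "F > 0" "\<And>u. u \<in> H1 \<Longrightarrow> pw q u \<le> F * mass u powr ((6 - q) / 4) * kin u powr (3 * (q - 2) / 4)"
    by (rule GN[of q]) (use q in auto)
  define \<mu>2 where "\<mu>2 = min 1 (min \<mu>0 \<mu>1)"
  \<comment> \<open>With r = sqrt (kin u) the estimate reads \<delta> <= r^2 + H r: either r >= 1,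
    or \<delta> <= (1 + H) r. The extra \<delta> in the denominator covers both cases.\<close>
  define \<kappa> where "\<kappa> = (\<delta> / (1 + H + \<delta>))\<^sup>2"
  define K where "K = (M + c) / c"
  define L where "L = G * (a\<^sup>2) powr ((6 - p) / 4) * K powr (3 * (p - 2) / 4) + F * (a\<^sup>2) powr ((6 - q) / 4) * K powr (3 * (q - 2) / 4)"
  show ?thesis
  proof (rule that[of \<mu>2 \<kappa> K "L / a\<^sup>2"])
    show "\<mu>2 > 0" using 0 1 by (simp add: \<mu>2_def)
    show "\<kappa> > 0" using 1 H by (simp add: \<kappa>_def)
    fix \<mu> lam u assume mu: "0 < \<mu>" "\<mu> \<le> \<mu>2" and sol: "mp_solution p q \<mu> a lam u"
    have s: "0 < lam" "weak_solution (comb_nl p q \<mu>) lam u" "mass u = a\<^sup>2" "energy p q \<mu> u = mp_level p q \<mu> a"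
      using sol normalized_mass by (auto simp: mp_solution_def normalized_solution_def)
    have u: "u \<in> H1" using s(2) by (rule weak_solution_H1)
    have pq: "2 < p" "p < 6" "2 < q" "q < 6" using p q by auto
    have z: "fiber1 p q \<mu> u 0 = 0" using pohozaev[OF s(2) s(1) _ pq] mu by (simp add: fiber1_def)
    have en: "\<delta> \<le> energy p q \<mu> u" "energy p q \<mu> u \<le> M" using 1(3)[of \<mu>] mu s(4) by (auto simp: \<mu>2_def)
    have k0: "0 \<le> kin u" by simp
    have kK: "kin u \<le> K"
    proof -
      have "2 * c * kin u - \<mu> / \<mu>0 * c * kin u powr (3 * (q - 2) / 4) \<le> M"
        using 0(3)[OF _ _ u s(3) z] mu en by (simp add: \<mu>2_def)
      moreover have "\<mu> / \<mu>0 * c * kin u powr (3 * (q - 2) / 4) \<le> 1 * c * (1 + kin u)"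
        using 0 q mu powr_less_one_le_affine[OF k0, of "3 * (q - 2) / 4"]
        by (intro mult_mono mult_right_mono) (auto simp: \<mu>2_def divide_le_eq)
      ultimately have "c * kin u \<le> M + c" by (simp add: algebra_simps)
      then show ?thesis using 0 by (simp add: K_def field_simps)
    qed
    have "\<kappa> \<le> kin u"
    proof -
      have "energy p q \<mu> u \<le> 1/2 * kin u + 1/4 * hart u"
      proof -
        have "0 \<le> 1/p * pw p u" "0 \<le> \<mu>/q * pw q u" using pq mu by auto
        then show ?thesis unfolding energy_eq by linarith
      qed
      then have le: "\<delta> \<le> kin u + H * sqrt (kin u)" using en H(2)[OF u s(3)] hart_nonneg[of u] k0 by linarith
      define r where "r = sqrt (kin u)"
      have r: "0 \<le> r" "kin u = r * r" by (auto simp: r_def)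
      have "\<delta> / (1 + H + \<delta>) \<le> r"
      proof (cases "1 \<le> r")
        case True
        have "\<delta> / (1 + H + \<delta>) \<le> 1" using 1 H by simp
        then show ?thesis using True by linarith
      next
        case False
        then have "r * r \<le> 1 * r" using r by (intro mult_right_mono) auto
        then have "\<delta> \<le> (1 + H) * r" using le r(2) unfolding r_def[symmetric] by (simp add: algebra_simps)
        also have "\<dots> \<le> (1 + H + \<delta>) * r" using r 1 by (intro mult_right_mono) auto
        finally show ?thesis using 1 H by (simp add: divide_le_eq mult.commute)
      qed
      then have "(\<delta> / (1 + H + \<delta>))\<^sup>2 \<le> r\<^sup>2" using 1 H by (intro power_mono) auto
      then show ?thesis by (simp add: \<kappa>_def r(2) power2_eq_square)
    qed
    moreover have "lam \<le> L / a\<^sup>2"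
    proof -
      have "lam * a\<^sup>2 \<le> pw p u + \<mu> * pw q u"
        using weak_solution_self[OF s(2) pq] hart_nonneg[of u] k0 unfolding s(3) by linarith
      also have "\<dots> \<le> pw p u + 1 * pw q u" using mu by (intro add_left_mono mult_right_mono) (auto simp: \<mu>2_def)
      also have "\<dots> \<le> L"
      proof -
        have "kin u powr (3 * (p - 2) / 4) \<le> K powr (3 * (p - 2) / 4)" "kin u powr (3 * (q - 2) / 4) \<le> K powr (3 * (q - 2) / 4)"
          using kK pq by (auto intro!: powr_mono2)
        then have "pw p u \<le> G * (a\<^sup>2) powr ((6 - p) / 4) * K powr (3 * (p - 2) / 4)"
          "pw q u \<le> F * (a\<^sup>2) powr ((6 - q) / 4) * K powr (3 * (q - 2) / 4)"
          using G(1) F(1) by (auto intro!: order_trans[OF G(2)[OF u]] order_trans[OF F(2)[OF u]] mult_left_mono simp: s(3))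
        then show ?thesis by (simp add: L_def)
      qed
      finally show ?thesis using v by (simp add: le_divide_eq)
    qed
    ultimately show "\<kappa> \<le> kin u \<and> kin u \<le> K \<and> lam \<le> L / a\<^sup>2" using kK by simp
  qed
qed

text \<open>Both members of the minimum tend to infinity as \<mu> tends to 0: in \<open>a0\<close>
  because \<open>K_const\<close> vanishes like a positive power of \<mu>, in the other because \<mu>
  stands in a denominator under a positive exponent.\<close>

lemma a_less_a0_bar:
  assumes p: "10/3 < p" "p < 6" and q: "2 < q" "q \<le> 12/5" and C: "C_GN p > 0" "C_GN q > 0" and a: "0 < a"
  shows "\<forall>\<^sub>F \<mu> in at_right 0. a < a0_bar p q \<mu>"
proof -
  define \<alpha> where "\<alpha> = 3 * (p - 2) / 2"
  define \<beta> where "\<beta> = 3 * (q - 2) / 2"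
  have pa: "p * gam p = \<alpha>" "q * gam q = \<beta>" using p q by (simp_all add: gam_mult \<alpha>_def \<beta>_def)
  have al: "\<alpha> > 2" "\<alpha> < p" using p by (simp_all add: \<alpha>_def)
  have b: "0 < \<beta>" "\<beta> < 1" "\<beta> < q" using q by (simp_all add: \<beta>_def)
  define Bc where "Bc = B_const p q"
  have Bc: "Bc > 0" unfolding Bc_def B_const_def pa using al b by (intro add_pos_pos mult_pos_pos) auto
  define e where "e = (\<alpha> - 2) / (\<alpha> - \<beta>)"
  have e: "e > 0" using al b by (simp add: e_def)
  define E where "E = (\<alpha> - \<beta>) / Bc"
  have E: "E > 0" using al b Bc by (simp add: E_def)
  let ?A1 = "\<lambda>\<mu>. \<mu> * C_GN q powr q / q" and ?A2 = "\<lambda>\<mu>. \<mu> * (2 - \<beta>) * C_GN q powr q / (q * (\<alpha> - 2))"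
  define X1 where "X1 = (p * (2 - \<beta>) / ((\<alpha> - 2) * C_GN p powr p)) powr ((\<beta> - 2) / (\<alpha> - \<beta>))"
  define X2 where "X2 = (p / C_GN p powr p) powr ((\<beta> - 2) / (\<alpha> - \<beta>))"
  have X: "X1 > 0" "X2 > 0" using p C al b by (auto simp: X1_def X2_def)
  have K: "K_const p q \<mu> = ?A1 \<mu> powr e * X1 + X2 * ?A2 \<mu> powr e" for \<mu>
    by (simp add: K_const_def pa e_def X1_def X2_def)
  have ev: "\<forall>\<^sub>F \<mu>::real in at_right 0. 0 < \<mu>" by (simp add: eventually_at_right_less)
  have lim: "((\<lambda>\<mu>. K_const p q \<mu>) \<longlongrightarrow> 0 * X1 + X2 * 0) (at_right 0)"
    unfolding K
  proof (intro tendsto_intros)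
    have id: "((\<lambda>\<mu>. \<mu>) \<longlongrightarrow> (0::real)) (at_right 0)" by (rule tendsto_ident_at)
    have "((\<lambda>\<mu>. ?A1 \<mu> powr e) \<longlongrightarrow> (0 * C_GN q powr q / q) powr e) (at_right 0)"
      using q e C by (intro tendsto_powr' tendsto_intros id) (auto intro: eventually_mono[OF ev])
    then show "((\<lambda>\<mu>. ?A1 \<mu> powr e) \<longlongrightarrow> 0) (at_right 0)" by simp
    have "((\<lambda>\<mu>. ?A2 \<mu> powr e) \<longlongrightarrow> (0 * (2 - \<beta>) * C_GN q powr q / (q * (\<alpha> - 2))) powr e) (at_right 0)"
      using q e C al b by (intro tendsto_powr' tendsto_intros id) (auto intro: eventually_mono[OF ev])
    then show "((\<lambda>\<mu>. ?A2 \<mu> powr e) \<longlongrightarrow> 0) (at_right 0)" by simp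
  qed
  define T where "T = a powr (1 / E) + 1"
  have T: "T > 0" by (simp add: T_def add_nonneg_pos)
  have ev1: "\<forall>\<^sub>F \<mu> in at_right 0. K_const p q \<mu> < 1 / (2 * T)"
    using order_tendstoD(2)[OF lim, of "1 / (2 * T)"] T by simp
  define c where "c = (p * (2 - \<beta>) / (2 * C_GN p powr p * (\<alpha> - \<beta>))) powr ((2 - \<beta>) / Bc)"
  define f where "f = (\<alpha> - 2) / Bc"
  have c: "c > 0" using p C al b by (simp add: c_def)
  have f: "f > 0" using al Bc by (simp add: f_def)
  define d where "d = q * (\<alpha> - 2) / (2 * C_GN q powr q * (\<alpha> - \<beta>))"
  have d: "d > 0" using q C al b by (simp add: d_def)
  define T2 where "T2 = (a / c) powr (1 / f) + 1"
  have T2: "T2 > 0" by (simp add: T2_def add_nonneg_pos)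
  have ev2: "\<forall>\<^sub>F \<mu> in at_right 0. \<mu> < d / T2"
    using d T2 by (intro eventually_at_right_less[THEN eventually_mono] order_tendstoD(2)[OF tendsto_ident_at]) auto
  from ev ev1 ev2 show ?thesis
  proof eventually_elim
    case (elim \<mu>)
    have Kp: "K_const p q \<mu> > 0" unfolding K using elim(1) X q C al b
      by (intro add_pos_pos mult_pos_pos) auto
    have "T < 1 / (2 * K_const p q \<mu>)" using elim(2) Kp T by (simp add: field_simps)
    then have "T powr E < (1 / (2 * K_const p q \<mu>)) powr E" using T E by (intro powr_less_mono2) auto
    moreover have "a \<le> T powr E"
    proof -
      have "a = (a powr (1 / E)) powr E" using a E by (simp add: powr_powr)
      also have "\<dots> \<le> T powr E" using E by (intro powr_mono2) (auto simp: T_def)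
      finally show ?thesis .
    qed
    ultimately have 1: "a < a0 p q \<mu>" by (simp add: a0_def pa E_def Bc_def)
    have "T2 < d / \<mu>" using elim T2 by (simp add: field_simps)
    then have "T2 powr f < (d / \<mu>) powr f" using T2 f by (intro powr_less_mono2) auto
    moreover have "a / c \<le> T2 powr f"
    proof -
      have "a / c = ((a / c) powr (1 / f)) powr f" using a c f by (simp add: powr_powr)
      also have "\<dots> \<le> T2 powr f" using f by (intro powr_mono2) (auto simp: T2_def)
      finally show ?thesis .
    qed
    ultimately have "a / c < (d / \<mu>) powr f" by simp
    then have "a < c * (d / \<mu>) powr f" using c by (simp add: field_simps)
    also have "d / \<mu> = q * (\<alpha> - 2) / (2 * \<mu> * C_GN q powr q * (\<alpha> - \<beta>))" by (simp add: d_def)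
    finally show ?case using 1 by (simp add: a0_bar_def pa c_def f_def Bc_def)
  qed
qed

section \<open>Compactness for bounded sequences of radial functions\<close>

text \<open>A decay estimate for radial functions in integrated form, meaningful for functions whose
  symmetry holds only almost everywhere.\<close>

lemma radial_ball_mass:
  assumes u: "u \<in> H1_rad" and r: "r > 0" and x: "2 * r * real N \<le> norm x"
  shows "real N * mass (\<lambda>y. indicator (ball x r) y *\<^sub>R u y) \<le> mass u"
proof -
  have uH: "u \<in> H1" using u by (simp add: H1_rad_def)
  note [measurable] = H1_measurable[OF uH]
  have u2: "integrable lborel (dens u)" by (rule L2_integrable[OF H1_L2[OF uH]])
  have e1: "indicator (ball x r) \<in> borel_measurable (borel :: R3 measure)" for x r by (intro borel_measurable_indicator) auto
  note [measurable] = e1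
  have iu: "integrable lborel (\<lambda>y. indicator (ball z r) y * dens u y)" for z
    by (rule Bochner_Integration.integrable_bound[OF u2]) (auto simp: indicator_def)
  \<comment> \<open>\<open>N\<close> disjoint balls whose centres have norm \<open>norm x\<close>, all carrying the same mass by radiality\<close>
  define Y where "Y i = ((2 * r * real i) *\<^sub>R axis 1 1 + sqrt ((norm x)\<^sup>2 - (2 * r * real i)\<^sup>2) *\<^sub>R axis 2 1 :: R3)" for i :: nat
  \<comment> \<open>The first coordinates of distinct centres are at least 2 r apart, which makes
    the balls of radius r disjoint; the second coordinate restores the common norm.\<close>
  have Y1: "Y i $ 1 = 2 * r * real i" for i by (simp add: Y_def axis_def)
  have nY: "norm (Y i) = norm x" if "i < N" for i
  proof -
    have "2 * r * real i \<le> norm x" using x that r by (auto intro: order_trans[OF mult_left_mono[of "real i" "real N" "2 * r"]])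
    then have "(2 * r * real i)\<^sup>2 \<le> (norm x)\<^sup>2" using r by (intro power_mono) auto
    then have "(norm (Y i))\<^sup>2 = (norm x)\<^sup>2"
      by (simp add: Y_def power2_norm_eq_inner inner_add inner_axis_axis power2_eq_square[symmetric])
    then show ?thesis by simp
  qed
  have rot: "(\<integral>y. indicator (ball (Y i) r) y * dens u y \<partial>lborel) = mass (\<lambda>y. indicator (ball x r) y *\<^sub>R u y)" if i: "i < N" for i
  proof -
    obtain R :: "R3 \<Rightarrow> R3" where R: "orthogonal_transformation R" "R x = Y i"
      using orthogonal_transformation_exists[of x "Y i"] nY[OF i] by metis
    have "(\<integral>y. indicator (ball (Y i) r) y * dens u y \<partial>lborel) = (\<integral>y. indicator (ball (Y i) r) (R y) * dens u (R y) \<partial>lborel)"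
      by (rule integral_orthogonal[OF R(1), symmetric]) measurable
    also have "\<dots> = (\<integral>y. (norm (indicator (ball x r) y *\<^sub>R u y))\<^sup>2 \<partial>lborel)"
    proof (rule integral_cong_AE)
      have cont: "continuous_on UNIV R"
        using R(1) by (simp add: linear_continuous_on linear_linear orthogonal_transformation_linear)
      then have [measurable]: "R \<in> borel_measurable borel" by (rule borel_measurable_continuous_onI)
      show "(\<lambda>y. indicator (ball (Y i) r) (R y) * dens u (R y)) \<in> borel_measurable lborel"
        "(\<lambda>y. (norm (indicator (ball x r) y *\<^sub>R u y))\<^sup>2) \<in> borel_measurable lborel" by measurable
      have "AE y in lborel. u (R y) = u y" using u R(1) by (auto simp: H1_rad_def)
      then show "AE y in lborel. indicator (ball (Y i) r) (R y) * dens u (R y) = (norm (indicator (ball x r) y *\<^sub>R u y))\<^sup>2"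
      proof eventually_elim
        case (elim y)
        have "dist (Y i) (R y) = dist x y"
          unfolding dist_norm R(2)[symmetric] using R(1)
          by (metis linear_diff orthogonal_transformation_linear orthogonal_transformation_norm)
        then show ?case using elim by (simp add: indicator_def)
      qed
    qed
    finally show ?thesis by (simp add: mass_def)
  qed
  have "real N * mass (\<lambda>y. indicator (ball x r) y *\<^sub>R u y) = (\<Sum>i<N. \<integral>y. indicator (ball (Y i) r) y * dens u y \<partial>lborel)"
    using rot by simp
  also have "\<dots> = (\<integral>y. (\<Sum>i<N. indicator (ball (Y i) r) y * dens u y) \<partial>lborel)"
    by (rule Bochner_Integration.integral_sum[symmetric]) (rule iu)
  also have "\<dots> \<le> (\<integral>y. dens u y \<partial>lborel)"
  proof (rule integral_mono)
    show "integrable lborel (\<lambda>y. \<Sum>i<N. indicator (ball (Y i) r) y * dens u y)" by (intro Bochner_Integration.integrable_sum iu)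
    show "integrable lborel (dens u)" by (rule u2)
    fix y
    have "(\<Sum>i<N. indicator (ball (Y i) r) y :: real) \<le> 1"
    proof (cases "\<exists>i<N. y \<in> ball (Y i) r")
      case True
      then obtain i where i: "i < N" "y \<in> ball (Y i) r" by blast
      have "y \<notin> ball (Y k) r" if "k \<noteq> i" for k
      proof
        assume k: "y \<in> ball (Y k) r"
        have "2 * r * 1 \<le> 2 * r * \<bar>real i - real k\<bar>" using that r by (intro mult_left_mono) auto
        also have "\<dots> = \<bar>(Y i - Y k) $ 1\<bar>"
          using r by (simp add: Y1 right_diff_distrib[symmetric] abs_mult)
        also have "\<dots> \<le> norm (Y i - Y k)" by (rule component_le_norm_cart)
        also have "\<dots> < r + r" using i(2) k dist_triangle_less_add[of "Y i" y r "Y k" r] by (simp add: dist_norm norm_minus_commute)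
        finally show False by simp
      qed
      then have "(\<Sum>k<N. indicator (ball (Y k) r) y :: real) = (\<Sum>k<N. if k = i then 1 else 0)"
        using i by (intro sum.cong) auto
      also have "\<dots> = 1" using i by simp
      finally show ?thesis by simp
    next
      case False
      then have "(\<Sum>i<N. indicator (ball (Y i) r) y :: real) = 0" by (intro sum.neutral) auto
      then show ?thesis by simp
    qed
    then have "(\<Sum>i<N. indicator (ball (Y i) r) y) * dens u y \<le> 1 * dens u y" by (intro mult_right_mono) auto
    then show "(\<Sum>i<N. indicator (ball (Y i) r) y * dens u y) \<le> dens u y" by (simp add: sum_distrib_right)
  qed
  finally show ?thesis by (simp add: mass_def)
qed

text \<open>The kernel sees only a ball of fixed radius about \<open>x\<close>, which far out
  carries at most a fraction 1 / N of the mass. The radius \<open>R\<close> depends on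
  \<open>j\<close>, \<open>m\<close> and \<open>e\<close> only, hence serves a whole bounded
  family.\<close>

lemma moll_radial_decay:
  assumes e: "e > 0"
  obtains R where "R > 0" "\<And>u x. u \<in> H1_rad \<Longrightarrow> mass u \<le> m \<Longrightarrow> R \<le> norm x \<Longrightarrow> norm (moll j u x) \<le> e"
proof -
  obtain \<rho> where \<rho>: "\<And>x. \<rho> < norm x \<Longrightarrow> eta_j j x = 0" using test_eta_j[of j] by (auto simp: test_function_alt)
  define r where "r = \<bar>\<rho>\<bar> + 1"
  have r: "r > 0" by (simp add: r_def)
  define E where "E = mass (eta_j j)"
  obtain N :: nat where N: "E * \<bar>m\<bar> / e\<^sup>2 < real N" using reals_Archimedean2 by blast
  have N0: "real N > 0"
  proof -
    have "0 \<le> E * \<bar>m\<bar> / e\<^sup>2" by (simp add: E_def)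
    then show ?thesis using N by linarith
  qed
  show ?thesis
  proof (rule that[of "2 * r * real N + 1"])
    show "2 * r * real N + 1 > 0" using r by (intro add_nonneg_pos) auto
    fix u :: "R3 \<Rightarrow> complex" and x :: R3 assume u: "u \<in> H1_rad" and m: "mass u \<le> m" and x: "2 * r * real N + 1 \<le> norm x"
    have uH: "u \<in> H1" using u by (simp add: H1_rad_def)
    note [measurable] = H1_measurable[OF uH] L2_measurable[OF test_function_integrable(3)[OF test_eta_j]]
    define w where "w y = indicator (ball x r) y *\<^sub>R u y" for y
    have [measurable]: "indicator (ball x r) \<in> borel_measurable (borel :: R3 measure)" by (intro borel_measurable_indicator) auto
    have wL: "L2_fun w"
      unfolding w_def[abs_def] by (rule L2_bound(1)[OF _ L2_integrable[OF H1_L2[OF uH]]]) (auto simp: indicator_def)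
    have "moll j u x = conv (eta_j j) w x"
      unfolding moll_def conv_def
    proof (intro Bochner_Integration.integral_cong refl)
      fix y
      show "eta_j j (x - y) *\<^sub>R u y = eta_j j (x - y) *\<^sub>R w y"
      proof (cases "y \<in> ball x r")
        case False
        then have "\<rho> < norm (x - y)" by (simp add: dist_norm r_def)
        then show ?thesis using \<rho> by simp
      qed (simp add: w_def)
    qed
    then have "norm (moll j u x) \<le> sqrt E * sqrt (mass w)"
      unfolding E_def using conv_sup(1)[OF test_function_integrable(3)[OF test_eta_j] wL] by simp
    also have "\<dots> = sqrt (E * mass w)" by (simp add: real_sqrt_mult)
    also have "\<dots> \<le> sqrt (e\<^sup>2)"
    proof (rule real_sqrt_le_mono)
      have "real N * mass w \<le> m"
        using radial_ball_mass[OF u r, of N x] x m unfolding w_def[abs_def] by simp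
      then have "mass w \<le> \<bar>m\<bar> / real N" using N0 by (simp add: field_simps)
      then have "E * mass w \<le> E * (\<bar>m\<bar> / real N)" by (intro mult_left_mono) (auto simp: E_def)
      also have "\<dots> \<le> e\<^sup>2"
      proof -
        have "E * \<bar>m\<bar> \<le> real N * e\<^sup>2" using N e by (simp add: pos_divide_less_eq)
        then show ?thesis using N0 by (simp add: field_simps)
      qed
      finally show "E * mass w \<le> e\<^sup>2" .
    qed
    also have "\<dots> = e" using e by simp
    finally show "norm (moll j u x) \<le> e" .
  qed
qed

lemma moll_lipschitz:
  assumes u: "u \<in> H1"
  shows "norm (moll j u (x + h) - moll j u x) \<le> norm h * (3 * (sqrt (mass (eta_j j)) * sqrt (kin u)))"
proof -
  note g = wgrad_weak_gradient[OF u]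
  let ?B = "norm h * (3 * (sqrt (mass (eta_j j)) * sqrt (kin u)))"
  have "ennreal (norm (moll j u (x + h) - moll j u x))
    \<le> (\<integral>\<^sup>+\<tau>. ennreal (norm (indicator {0..1} \<tau> *\<^sub>R (\<Sum>i\<in>UNIV. h $ i *\<^sub>R conv (eta_j j) (\<lambda>y. wgrad u y $ i) (x + \<tau> *\<^sub>R h)))) \<partial>lborel)"
    unfolding moll_def conv_translate_diff[OF g H1_L2[OF u] test_eta_j] by (rule norm_integral_le_nn_integral)
  also have "\<dots> \<le> (\<integral>\<^sup>+\<tau>. ennreal ?B * indicator {0..1::real} \<tau> \<partial>lborel)"
  proof (intro nn_integral_mono)
    fix \<tau> :: real
    have "norm (\<Sum>i\<in>UNIV. h $ i *\<^sub>R conv (eta_j j) (\<lambda>y. wgrad u y $ i) (x + \<tau> *\<^sub>R h))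
      \<le> (\<Sum>i\<in>(UNIV::3 set). norm h * (sqrt (mass (eta_j j)) * sqrt (kin u)))"
    proof (rule order_trans[OF norm_sum], rule sum_mono)
      fix i :: 3
      have "norm (conv (eta_j j) (\<lambda>y. wgrad u y $ i) (x + \<tau> *\<^sub>R h)) \<le> sqrt (mass (eta_j j)) * sqrt (mass (\<lambda>y. wgrad u y $ i))"
        by (rule conv_sup(1)[OF test_function_integrable(3)[OF test_eta_j] L2_component(1)[OF wgrad_L2[OF u]]])
      also have "\<dots> \<le> sqrt (mass (eta_j j)) * sqrt (kin u)"
        using L2_component(2)[OF wgrad_L2[OF u]] by (intro mult_left_mono) auto
      finally have b: "norm (conv (eta_j j) (\<lambda>y. wgrad u y $ i) (x + \<tau> *\<^sub>R h)) \<le> sqrt (mass (eta_j j)) * sqrt (kin u)" .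
      show "norm (h $ i *\<^sub>R conv (eta_j j) (\<lambda>y. wgrad u y $ i) (x + \<tau> *\<^sub>R h)) \<le> norm h * (sqrt (mass (eta_j j)) * sqrt (kin u))"
        unfolding norm_scaleR using b component_le_norm_cart[of h i] by (intro mult_mono) auto
    qed
    also have "\<dots> = ?B" by simp
    finally show "ennreal (norm (indicator {0..1} \<tau> *\<^sub>R (\<Sum>i\<in>UNIV. h $ i *\<^sub>R conv (eta_j j) (\<lambda>y. wgrad u y $ i) (x + \<tau> *\<^sub>R h))))
        \<le> ennreal ?B * indicator {0..1::real} \<tau>"
      by (auto simp: indicator_def intro!: ennreal_leI)
  qed
  also have "\<dots> = ennreal ?B" by (subst nn_integral_cmult_indicator) auto
  finally show ?thesis by (subst (asm) ennreal_le_iff) auto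
qed

text \<open>Arzela-Ascoli on a ball for each scale and radius, a diagonal argument over these pairs,
  and uniform decay outside a ball give a uniform Cauchy property on the whole space at every
  scale.\<close>

lemma radial_subsequence:
  fixes u :: "nat \<Rightarrow> R3 \<Rightarrow> complex"
  assumes u: "\<And>n. u n \<in> H1_rad" and m: "\<And>n. mass (u n) \<le> m" and K: "\<And>n. kin (u n) \<le> K"
  obtains r :: "nat \<Rightarrow> nat" where "strict_mono r"
    "\<And>j e. e > 0 \<Longrightarrow> \<exists>N. \<forall>n\<ge>N. \<forall>k\<ge>N. \<forall>x. norm (moll j (u (r n)) x - moll j (u (r k)) x) \<le> e"
proof -
  have uH: "u n \<in> H1" for n using u[of n] by (simp add: H1_rad_def)
  \<comment> \<open>The index i encodes a pair: the scale of mollification and the radius of the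
    ball.\<close>
  define P where "P i s \<longleftrightarrow> (\<exists>g. \<forall>e>0. \<exists>N. \<forall>n x. N \<le> n \<and> x \<in> cball (0::R3) (real (snd (prod_decode i))) \<longrightarrow>
      norm (moll (fst (prod_decode i)) (u (s n)) x - g x) < e)" for i :: nat and s :: "nat \<Rightarrow> nat"
  interpret subseqs P
  proof
    fix i :: nat and s :: "nat \<Rightarrow> nat" assume s: "strict_mono s"
    define j where "j = fst (prod_decode i)"
    define M where "M = real (snd (prod_decode i))"
    define E where "E = sqrt (mass (eta_j j))"
    have bd: "norm (moll j (u (s n)) x) \<le> E * sqrt \<bar>m\<bar>" for n x
    proof -
      have "norm (moll j (u (s n)) x) \<le> E * sqrt (mass (u (s n)))" unfolding moll_def E_def
        by (rule conv_sup(1)[OF test_function_integrable(3)[OF test_eta_j] H1_L2[OF uH]])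
      also have "\<dots> \<le> E * sqrt \<bar>m\<bar>" using m[of "s n"] by (intro mult_left_mono) (auto simp: E_def)
      finally show ?thesis .
    qed
    have lip: "norm (moll j (u (s n)) x - moll j (u (s n)) y) \<le> norm (x - y) * (3 * (E * sqrt \<bar>K\<bar>))" for n x y
    proof -
      have "norm (moll j (u (s n)) (y + (x - y)) - moll j (u (s n)) y) \<le> norm (x - y) * (3 * (E * sqrt (kin (u (s n)))))"
        unfolding E_def by (rule moll_lipschitz[OF uH])
      also have "\<dots> \<le> norm (x - y) * (3 * (E * sqrt \<bar>K\<bar>))"
        using K[of "s n"] by (intro mult_left_mono) (auto simp: E_def)
      finally show ?thesis by simp
    qed
    obtain g k where gk: "continuous_on (cball 0 M) g" "strict_mono (k :: nat \<Rightarrow> nat)"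
      "\<And>e. 0 < e \<Longrightarrow> \<exists>N. \<forall>n x. n \<ge> N \<and> x \<in> cball (0::R3) M \<longrightarrow> norm (moll j (u (s (k n))) x - g x) < e"
    proof (rule Arzela_Ascoli[of "cball (0::R3) M" "\<lambda>n. moll j (u (s n))" "E * sqrt \<bar>m\<bar>"])
      fix x :: R3 and e :: real assume "0 < e"
      define d where "d = e / (3 * (E * sqrt \<bar>K\<bar>) + 1)"
      have d1: "3 * (E * sqrt \<bar>K\<bar>) + 1 > 0" by (auto simp: E_def intro!: add_nonneg_pos)
      show "\<exists>d. 0 < d \<and> (\<forall>n y. y \<in> cball 0 M \<and> norm (x - y) < d \<longrightarrow> norm (moll j (u (s n)) x - moll j (u (s n)) y) < e)"
      proof (intro exI[of _ d] conjI allI impI)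
        show "0 < d" using \<open>0 < e\<close> d1 by (simp add: d_def)
        fix n y assume "y \<in> cball 0 M \<and> norm (x - y) < d"
        then have y: "norm (x - y) < d" by simp
        have "norm (moll j (u (s n)) x - moll j (u (s n)) y) \<le> norm (x - y) * (3 * (E * sqrt \<bar>K\<bar>))" by (rule lip)
        also have "\<dots> \<le> norm (x - y) * (3 * (E * sqrt \<bar>K\<bar>) + 1)" by (intro mult_left_mono) auto
        also have "\<dots> < d * (3 * (E * sqrt \<bar>K\<bar>) + 1)" using y d1 by (intro mult_strict_right_mono)
        also have "\<dots> = e" using d1 by (simp add: d_def)
        finally show "norm (moll j (u (s n)) x - moll j (u (s n)) y) < e" .
      qed
    qed (use bd in auto)
    then show "\<exists>r'. strict_mono r' \<and> P i (s \<circ> r')"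
      unfolding P_def j_def[symmetric] M_def[symmetric] o_def by blast
  qed
  have mono: "P i (s \<circ> r)" if r: "strict_mono r" and P: "P i s" for r s i
  proof -
    obtain g where g: "\<And>e. e > 0 \<Longrightarrow> \<exists>N. \<forall>n x. N \<le> n \<and> x \<in> cball (0::R3) (real (snd (prod_decode i))) \<longrightarrow>
      norm (moll (fst (prod_decode i)) (u (s n)) x - g x) < e" using P unfolding P_def by blast
    show ?thesis unfolding P_def
    proof (intro exI[of _ g] allI impI)
      fix e :: real assume "e > 0"
      then obtain N where N: "\<And>n x. N \<le> n \<and> x \<in> cball (0::R3) (real (snd (prod_decode i))) \<Longrightarrow>
        norm (moll (fst (prod_decode i)) (u (s n)) x - g x) < e" using g by blast
      show "\<exists>N. \<forall>n x. N \<le> n \<and> x \<in> cball 0 (real (snd (prod_decode i))) \<longrightarrow>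
        norm (moll (fst (prod_decode i)) (u ((s \<circ> r) n)) x - g x) < e"
      proof (intro exI[of _ N] allI impI)
        fix n x assume "N \<le> n \<and> x \<in> cball (0::R3) (real (snd (prod_decode i)))"
        then show "norm (moll (fst (prod_decode i)) (u ((s \<circ> r) n)) x - g x) < e"
          using N[of "r n" x] seq_suble[OF r, of n] by auto
      qed
    qed
  qed
  show ?thesis
  proof (rule that[OF subseq_diagseq])
    fix j and e :: real assume e: "e > 0"
    obtain R where R: "R > 0" "\<And>u x. u \<in> H1_rad \<Longrightarrow> mass u \<le> m \<Longrightarrow> R \<le> norm x \<Longrightarrow> norm (moll j u x) \<le> e / 2"
      by (rule moll_radial_decay[of "e / 2" m j]) (use e in auto)
    obtain M :: nat where M: "R \<le> real M" using real_arch_simple by blast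
    define i where "i = prod_encode (j, M)"
    \<comment> \<open>The diagonal sequence has property i only from index \<open>Suc i\<close> on,
      whence the shift in the threshold chosen below.\<close>
    have "P i (diagseq \<circ> (+) (Suc i))" by (rule diagseq_holds) (rule mono)
    then obtain g where "\<And>e. e > 0 \<Longrightarrow> \<exists>N. \<forall>n x. N \<le> n \<and> x \<in> cball (0::R3) (real M) \<longrightarrow>
      norm (moll j (u (diagseq (Suc i + n))) x - g x) < e" unfolding P_def i_def by auto
    from this[of "e / 2"] e obtain N where N: "\<And>n x. N \<le> n \<Longrightarrow> x \<in> cball (0::R3) (real M) \<Longrightarrow>
      norm (moll j (u (diagseq (Suc i + n))) x - g x) < e / 2" by auto
    show "\<exists>N. \<forall>n\<ge>N. \<forall>k\<ge>N. \<forall>x. norm (moll j (u (diagseq n)) x - moll j (u (diagseq k)) x) \<le> e"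
    proof (intro exI[of _ "Suc i + N"] allI impI)
      fix n k x assume n: "Suc i + N \<le> n" and k: "Suc i + N \<le> k"
      show "norm (moll j (u (diagseq n)) x - moll j (u (diagseq k)) x) \<le> e"
      proof (cases "R \<le> norm x")
        case True
        have "norm (moll j (u (diagseq n)) x - moll j (u (diagseq k)) x) \<le> norm (moll j (u (diagseq n)) x) + norm (moll j (u (diagseq k)) x)"
          by (rule norm_triangle_ineq4)
        also have "\<dots> \<le> e / 2 + e / 2" by (intro add_mono R u m True)
        finally show ?thesis by simp
      next
        case False
        then have x: "x \<in> cball 0 (real M)" using M by simp
        have "norm (moll j (u (diagseq n)) x - g x) < e / 2" "norm (moll j (u (diagseq k)) x - g x) < e / 2"
          using N[of "n - Suc i" x] N[of "k - Suc i" x] x n k by auto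
        then have "norm ((moll j (u (diagseq n)) x - g x) - (moll j (u (diagseq k)) x - g x)) < e / 2 + e / 2"
          using norm_triangle_ineq4[of "moll j (u (diagseq n)) x - g x" "moll j (u (diagseq k)) x - g x"] by linarith
        then show ?thesis by simp
      qed
    qed
  qed
qed

text \<open>First \<open>j\<close> is fixed so that the mollification error is small for all
  differences at once, which takes t < 6. At that scale the differences are uniformly small, and
  interpolation with the bounded mass takes t > 2.\<close>

lemma Lt_cauchy:
  fixes u :: "nat \<Rightarrow> R3 \<Rightarrow> complex"
  assumes u: "\<And>n. u n \<in> H1" and m: "\<And>n. mass (u n) \<le> m" and K: "\<And>n. kin (u n) \<le> K"
    and c: "\<And>j e. e > 0 \<Longrightarrow> \<exists>N. \<forall>n\<ge>N. \<forall>k\<ge>N. \<forall>x. norm (moll j (u n) x - moll j (u k) x) \<le> e"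
    and t: "2 < t" "t < 6" and e: "e > 0"
  shows "\<exists>N. \<forall>n\<ge>N. \<forall>k\<ge>N. pw t (\<lambda>x. u n x - u k x) \<le> e"
proof -
  obtain C where C: "C > 0"
    "\<And>u g j. is_weak_gradient u g \<Longrightarrow> L2_fun u \<Longrightarrow>
       integrable lborel (\<lambda>x. norm (moll j u x - u x) powr t) \<and>
       pw t (\<lambda>x. moll j u x - u x) \<le> C * 2 powr (- ((6 - t) / 2) * real j) * (mass g) powr (t / 2)"
    by (rule moll_error[OF less_imp_le[OF t(1)] t(2)]) blast
  have m0: "0 \<le> m" "0 \<le> K" using m[of 0] K[of 0] mass_nonneg[of "u 0"] mass_nonneg[of "wgrad (u 0)"] by linarith+
  define b where "b = (2::real) powr (- ((6 - t) / 2))"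
  have b: "0 < b" "b < 1" unfolding b_def using t by (auto simp: powr_less_one)
  define A where "A = C * (4 * K) powr (t / 2)"
  have "(\<lambda>j. 2 powr t * (A * b ^ j)) \<longlonglongrightarrow> 2 powr t * (A * 0)" using b by (intro tendsto_intros LIMSEQ_power_zero) auto
  then have "\<forall>\<^sub>F j in sequentially. 2 powr t * (A * b ^ j) < e / 2"
    using e by (intro order_tendstoD(2)[where y="2 powr t * (A * 0)"]) auto
  then obtain j where j: "2 powr t * (A * b ^ j) < e / 2" by (auto simp: eventually_sequentially)
  \<comment> \<open>Tuned so that the interpolated term, with mass at most 4 m for a difference and
    the factor 2^t of the quasi-triangle inequality, stays below e / 2.\<close>
  define d where "d = (e / 2 / (2 powr t * (4 * m + 1))) powr (1 / (t - 2))"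
  have d: "d > 0" using e m0 by (simp add: d_def)
  obtain N where N: "\<And>n k x. n \<ge> N \<Longrightarrow> k \<ge> N \<Longrightarrow> norm (moll j (u n) x - moll j (u k) x) \<le> d" using c[OF d, of j] by blast
  show ?thesis
  proof (intro exI[of _ N] allI impI)
    fix n k assume nk: "n \<ge> N" "k \<ge> N"
    define w where "w x = u n x - u k x" for x
    have wH: "w \<in> H1" unfolding w_def[abs_def] by (rule H1_diff(1)[OF u u])
    have mw: "mass w \<le> 4 * m" using mass_diff_le[OF H1_L2[OF u[of n]] H1_L2[OF u[of k]]] m[of n] m[of k] by (simp add: w_def[abs_def])
    have kw: "kin w \<le> 4 * K" unfolding w_def[abs_def] H1_diff(4)[OF u u]
      using mass_diff_le[OF wgrad_L2[OF u[of n]] wgrad_L2[OF u[of k]]] K[of n] K[of k] by simp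
    have mol: "moll j w x = moll j (u n) x - moll j (u k) x" for x
      unfolding moll_def w_def[abs_def] by (rule conv_diff_right[OF test_function_integrable(3)[OF test_eta_j] H1_L2[OF u] H1_L2[OF u]])
    have sup: "norm (moll j w x) \<le> d" for x unfolding mol by (rule N[OF nk])
    note L = moll_L2[OF H1_L2[OF wH], of j]
    note E = C(2)[OF wgrad_weak_gradient[OF wH] H1_L2[OF wH], of j]
    note S = pw_le_sup_mass[OF L(1) sup less_imp_le[OF t(1)]]
    note [measurable] = L2_measurable[OF L(1)] H1_measurable[OF wH]
    have "pw t (\<lambda>x. moll j w x - (moll j w x - w x)) \<le> 2 powr t * (pw t (moll j w) + pw t (\<lambda>x. moll j w x - w x))"
      using E t by (intro pw_integrable_diff(2) S(1)) auto
    also have "\<dots> \<le> 2 powr t * (d powr (t - 2) * (4 * m) + A * b ^ j)"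
    proof (intro mult_left_mono add_mono)
      show "pw t (moll j w) \<le> d powr (t - 2) * (4 * m)"
        using S(2) L(2) mw by (meson mult_left_mono order_trans powr_ge_zero)
      have "pw t (\<lambda>x. moll j w x - w x) \<le> C * 2 powr (- ((6 - t) / 2) * real j) * (kin w) powr (t / 2)" using E by simp
      also have "\<dots> \<le> C * 2 powr (- ((6 - t) / 2) * real j) * (4 * K) powr (t / 2)"
        using C(1) kw t by (intro mult_left_mono powr_mono2) auto
      also have "\<dots> = A * b ^ j" 
      proof -
        have "2 powr (- ((6 - t) / 2) * real j) = b powr real j" unfolding b_def powr_powr ..
        also have "\<dots> = b ^ j" using b by (simp add: powr_realpow)
        finally show ?thesis by (simp add: A_def)
      qed
      finally show "pw t (\<lambda>x. moll j w x - w x) \<le> A * b ^ j" .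
    qed simp
    also have "\<dots> = 2 powr t * (d powr (t - 2) * (4 * m)) + 2 powr t * (A * b ^ j)" by (simp add: distrib_left)
    also have "\<dots> \<le> e / 2 + e / 2"
    proof (rule add_mono)
      have "d powr (t - 2) = e / 2 / (2 powr t * (4 * m + 1))" using e m0 t by (simp add: d_def powr_powr)
      moreover have "X * (e / 2 / (X * Y) * Z) = e / 2 * (Z / Y)" if "X \<noteq> 0" for X Y Z :: real using that by simp
      ultimately have "2 powr t * (d powr (t - 2) * (4 * m)) = e / 2 * ((4 * m) / (4 * m + 1))" by simp
      also have "\<dots> \<le> e / 2 * 1" using e m0 by (intro mult_left_mono) (auto simp: divide_le_eq)
      finally show "2 powr t * (d powr (t - 2) * (4 * m)) \<le> e / 2" by simp
    qed (use j in simp)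
    finally show "pw t (\<lambda>x. u n x - u k x) \<le> e" by (simp add: w_def)
  qed
qed

section \<open>From Cauchy sequences in L^t to limits\<close>

lemma cauchy_AE_subsequence:
  fixes f :: "nat \<Rightarrow> R3 \<Rightarrow> 'a::euclidean_space"
  assumes m: "\<And>n. f n \<in> borel_measurable borel"
    and i: "\<And>n k. integrable lborel (\<lambda>x. norm (f n x - f k x) powr t)"
    and c: "\<And>e. e > 0 \<Longrightarrow> \<exists>N. \<forall>n\<ge>N. \<forall>k\<ge>N. pw t (\<lambda>x. f n x - f k x) \<le> e" and t: "0 < t"
  obtains r :: "nat \<Rightarrow> nat" and g where "strict_mono r" "g \<in> borel_measurable borel" "AE x in lborel. (\<lambda>n. f (r n) x) \<longlonglongrightarrow> g x"
proof -
  have "\<exists>N. \<forall>n\<ge>N. \<forall>k\<ge>N. pw t (\<lambda>x. f n x - f k x) \<le> (1/2) ^ i" for i by (rule c) simp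
  then obtain N where N: "\<And>i n k. n \<ge> N i \<Longrightarrow> k \<ge> N i \<Longrightarrow> pw t (\<lambda>x. f n x - f k x) \<le> (1/2) ^ i" by metis
  \<comment> \<open>Summing the thresholds, plus n, makes the index strictly increasing and at least
    each \<open>N i\<close>.\<close>
  define r where "r n = (\<Sum>i\<le>n. N i) + n" for n
  have r: "strict_mono r" unfolding strict_mono_Suc_iff r_def by simp
  have rN: "N i \<le> r i" for i
  proof -
    have "N i \<le> (\<Sum>k\<le>i. N k)" by (rule member_le_sum) auto
    then show ?thesis by (simp add: r_def)
  qed
  have rN2: "N i \<le> r (Suc i)" for i using rN[of i] strict_monoD[OF r, of i "Suc i"] by simp
  have conv: "AE x in lborel. convergent (\<lambda>n. f (r n) x)"
  proof (rule fast_cauchy_AE_convergent[where t=t and \<theta>="1/2" and B=1])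
    show "pw t (\<lambda>x. f (r (Suc n)) x - f (r n) x) \<le> 1 * (1 / 2) ^ n" for n using N[OF rN2 rN, of n] by simp
  qed (use m i t in auto)
  define g where "g x = lim (\<lambda>n. f (r n) x)" for x
  show ?thesis
  proof (rule that[OF r])
    note [measurable] = m
    show "g \<in> borel_measurable borel" unfolding g_def[abs_def] by measurable
    show "AE x in lborel. (\<lambda>n. f (r n) x) \<longlonglongrightarrow> g x"
      using conv by eventually_elim (simp add: g_def convergent_LIMSEQ_iff)
  qed
qed

lemma cauchy_limit_bound:
  fixes f :: "nat \<Rightarrow> R3 \<Rightarrow> 'a::euclidean_space"
  assumes m: "\<And>n. f n \<in> borel_measurable borel" and g: "g \<in> borel_measurable borel"
    and i: "\<And>n k. integrable lborel (\<lambda>x. norm (f n x - f k x) powr t)"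
    and r: "strict_mono (r :: nat \<Rightarrow> nat)" and l: "AE x in lborel. (\<lambda>n. f (r n) x) \<longlonglongrightarrow> g x" and t: "0 < t"
    and b: "\<And>k. k \<ge> N \<Longrightarrow> pw t (\<lambda>x. f n x - f k x) \<le> e"
  shows "integrable lborel (\<lambda>x. norm (f n x - g x) powr t)" "pw t (\<lambda>x. f n x - g x) \<le> e"
proof -
  note [measurable] = m g
  have rN: "N \<le> r (k + N)" for k using seq_suble[OF r, of "k + N"] by simp
  have l': "AE x in lborel. (\<lambda>k. norm (f n x - f (r (k + N)) x) powr t) \<longlonglongrightarrow> norm (f n x - g x) powr t"
    using l
  proof eventually_elim
    case (elim x)
    show ?case using LIMSEQ_ignore_initial_segment[OF elim, of N] t by (intro tendsto_powr' tendsto_intros) auto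
  qed
  show "integrable lborel (\<lambda>x. norm (f n x - g x) powr t)"
    by (rule fatou_bound(1)[OF l' i, where B=e]) (use b rN in \<open>auto simp: pw_def\<close>)
  show "pw t (\<lambda>x. f n x - g x) \<le> e"
    unfolding pw_def by (rule fatou_bound(2)[OF l' i]) (use b rN in \<open>auto simp: pw_def\<close>)
qed

text \<open>Fatou's lemma along the subsequence bounds the distance of each late member from
  \<open>g\<close>, so the convergence in L^t holds for the full sequence.\<close>

lemma cauchy_limit:
  fixes f :: "nat \<Rightarrow> R3 \<Rightarrow> 'a::euclidean_space"
  assumes m: "\<And>n. f n \<in> borel_measurable borel" and g: "g \<in> borel_measurable borel"
    and i: "\<And>n. integrable lborel (\<lambda>x. norm (f n x) powr t)"
    and r: "strict_mono (r :: nat \<Rightarrow> nat)" and l: "AE x in lborel. (\<lambda>n. f (r n) x) \<longlonglongrightarrow> g x" and t: "0 < t"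
    and c: "\<And>e. e > 0 \<Longrightarrow> \<exists>N. \<forall>n\<ge>N. \<forall>k\<ge>N. pw t (\<lambda>x. f n x - f k x) \<le> e"
  shows "integrable lborel (\<lambda>x. norm (g x) powr t)" "(\<lambda>n. pw t (\<lambda>x. f n x - g x)) \<longlonglongrightarrow> 0"
proof -
  have d: "integrable lborel (\<lambda>x. norm (f n x - f k x) powr t)" for n k
    by (rule pw_integrable_diff(1)[OF i i m m t])
  have b: "\<exists>N. \<forall>n\<ge>N. integrable lborel (\<lambda>x. norm (f n x - g x) powr t) \<and> pw t (\<lambda>x. f n x - g x) \<le> e" if e: "e > 0" for e
  proof -
    obtain N where N: "\<And>n k. n \<ge> N \<Longrightarrow> k \<ge> N \<Longrightarrow> pw t (\<lambda>x. f n x - f k x) \<le> e" using c[OF e] by blast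
    have "integrable lborel (\<lambda>x. norm (f n x - g x) powr t) \<and> pw t (\<lambda>x. f n x - g x) \<le> e" if "n \<ge> N" for n
      using cauchy_limit_bound[OF m g d r l t, of N n e] N[OF that] by blast
    then show ?thesis by blast
  qed
  obtain N where N: "\<And>n. n \<ge> N \<Longrightarrow> integrable lborel (\<lambda>x. norm (f n x - g x) powr t)" using b[of 1] by auto
  have "integrable lborel (\<lambda>x. norm (f N x - (f N x - g x)) powr t)"
    by (rule pw_integrable_diff(1)[OF i N[OF order_refl] m _ t]) (use m g in measurable)
  then show "integrable lborel (\<lambda>x. norm (g x) powr t)" by simp
  show "(\<lambda>n. pw t (\<lambda>x. f n x - g x)) \<longlonglongrightarrow> 0"
  proof (rule LIMSEQ_I)
    fix e :: real assume "0 < e"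
    then obtain N where "\<And>n. n \<ge> N \<Longrightarrow> pw t (\<lambda>x. f n x - g x) \<le> e / 2" using b[of "e/2"] by auto
    then show "\<exists>N. \<forall>n\<ge>N. norm (pw t (\<lambda>x. f n x - g x) - 0) < e"
      using \<open>0 < e\<close> by (intro exI[of _ N]) (fastforce intro: order.strict_trans1)
  qed
qed

text \<open>Pointwise s <= d + s^2 / d with s = |w|^2, integrated over the ball; the free parameter
  d plays the part of Hoelder's inequality.\<close>

lemma local_mass_le:
  fixes w :: "R3 \<Rightarrow> complex"
  assumes w: "L2_fun w" and i: "integrable lborel (\<lambda>x. norm (w x) powr 4)" and d: "d > 0"
  shows "mass (\<lambda>x. indicator (cball 0 R) x *\<^sub>R w x) \<le> d * measure lborel (cball (0::R3) R) + pw 4 w / d"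
proof -
  have ii: "integrable lborel (\<lambda>x. indicator (cball (0::R3) R) x * d + norm (w x) powr 4 / d)"
    using i emeasure_lborel_cball_finite[of "0::R3" R]
    by (intro Bochner_Integration.integrable_add integrable_mult_left integrable_divide) (auto intro!: integrable_real_indicator)
  have "(\<integral>x. indicator (cball 0 R) x * (norm (w x))\<^sup>2 \<partial>lborel)
      \<le> (\<integral>x. indicator (cball (0::R3) R) x * d + norm (w x) powr 4 / d \<partial>lborel)"
  proof (rule integral_mono[OF H1_cball_integrable(1)[OF w] ii])
    fix x
    have "(norm (w x))\<^sup>2 \<le> d + norm (w x) powr 4 / d"
    proof (cases "(norm (w x))\<^sup>2 \<le> d")
      case False
      then have "(norm (w x))\<^sup>2 * d \<le> (norm (w x))\<^sup>2 * (norm (w x))\<^sup>2" by (intro mult_left_mono) auto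
      then have "(norm (w x))\<^sup>2 \<le> norm (w x) powr 4 / d" using d by (simp add: norm_powr_4 power2_eq_square le_divide_eq)
      then show ?thesis using d by simp
    qed (use d in \<open>simp add: add_increasing2\<close>)
    then show "indicator (cball 0 R) x * (norm (w x))\<^sup>2 \<le> indicator (cball (0::R3) R) x * d + norm (w x) powr 4 / d"
      using d by (auto simp: indicator_def)
  qed
  also have "\<dots> = d * measure lborel (cball (0::R3) R) + pw 4 w / d"
    using i emeasure_lborel_cball_finite[of "0::R3" R]
    by (subst Bochner_Integration.integral_add) (auto intro!: integrable_real_indicator simp: pw_def)
  finally show ?thesis by (simp add: H1_cball_integrable(2)[OF w])
qed

lemma local_mass_tendsto:
  fixes w :: "nat \<Rightarrow> R3 \<Rightarrow> complex"
  assumes w: "\<And>n. L2_fun (w n)" and i: "\<And>n. integrable lborel (\<lambda>x. norm (w n x) powr 4)"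
    and l: "(\<lambda>n. pw 4 (w n)) \<longlonglongrightarrow> 0"
  shows "(\<lambda>n. mass (\<lambda>x. indicator (cball 0 R) x *\<^sub>R w n x)) \<longlonglongrightarrow> 0"
proof (rule LIMSEQ_I)
  fix e :: real assume e: "0 < e"
  define V where "V = measure lborel (cball (0::R3) R)"
  define d where "d = e / 2 / (V + 1)"
  have V: "V \<ge> 0" by (simp add: V_def)
  have d: "d > 0" "d * V \<le> e / 2" using e V by (auto simp: d_def field_simps)
  obtain N where N: "\<And>n. n \<ge> N \<Longrightarrow> pw 4 (w n) < d * (e / 2)"
    using order_tendstoD(2)[OF l, of "d * (e/2)"] e d by (auto simp: eventually_sequentially)
  show "\<exists>N. \<forall>n\<ge>N. norm (mass (\<lambda>x. indicator (cball 0 R) x *\<^sub>R w n x) - 0) < e"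
  proof (intro exI[of _ N] allI impI)
    fix n assume "n \<ge> N"
    from N[OF this] have small: "pw 4 (w n) / d < e / 2" using d by (simp add: divide_less_eq mult.commute)
    have "mass (\<lambda>x. indicator (cball 0 R) x *\<^sub>R w n x) \<le> d * V + pw 4 (w n) / d"
      unfolding V_def by (rule local_mass_le[OF w i d(1)])
    also have "\<dots> < e / 2 + e / 2" using d(2) small by (rule add_le_less_mono)
    finally show "norm (mass (\<lambda>x. indicator (cball 0 R) x *\<^sub>R w n x) - 0) < e" by simp
  qed
qed

lemma mass_tail_tendsto:
  fixes \<psi> :: "R3 \<Rightarrow> complex"
  assumes \<psi>: "L2_fun \<psi>"
  shows "(\<lambda>j. mass (\<lambda>x. indicator (- cball 0 (real j)) x *\<^sub>R \<psi> x)) \<longlonglongrightarrow> 0"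
proof -
  note [measurable] = L2_measurable[OF \<psi>]
  have "(\<lambda>j. \<integral>x. (norm (indicator (- cball 0 (real j)) x *\<^sub>R \<psi> x))\<^sup>2 \<partial>lborel) \<longlonglongrightarrow> (\<integral>x. 0 \<partial>(lborel :: R3 measure))"
  proof (rule integral_dominated_convergence[OF _ _ L2_integrable[OF \<psi>]])
    show "AE x in lborel. (\<lambda>j. (norm (indicator (- cball 0 (real j)) x *\<^sub>R \<psi> x))\<^sup>2) \<longlonglongrightarrow> 0"
    proof (intro AE_I2 tendsto_eventually)
      fix x :: R3
      show "\<forall>\<^sub>F j in sequentially. (norm (indicator (- cball 0 (real j)) x *\<^sub>R \<psi> x))\<^sup>2 = 0"
        using eventually_ge_at_top[of "nat \<lceil>norm x\<rceil>"] by eventually_elim (simp add: nat_ceiling_le_eq)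
    qed
    show "AE x in lborel. norm ((norm (indicator (- cball 0 (real j)) x *\<^sub>R \<psi> x))\<^sup>2) \<le> (norm (\<psi> x))\<^sup>2" for j
      by (intro AE_I2) (auto simp: indicator_def)
  qed measurable
  then show ?thesis by (simp add: mass_def)
qed

lemma L2_indicator:
  fixes \<psi> :: "R3 \<Rightarrow> complex"
  assumes \<psi>: "L2_fun \<psi>" and [measurable]: "A \<in> sets borel"
  shows "L2_fun (\<lambda>x. indicator A x *\<^sub>R \<psi> x)"
  using L2_measurable[OF \<psi>] by (intro L2_bound(1)[OF _ L2_integrable[OF \<psi>]]) (auto simp: indicator_def)

text \<open>Mass may escape to infinity, but against a fixed \<psi> the tail is harmless, and on a
  ball convergence in L^4 controls the L^2 norm.\<close>

lemma weak_L2_convergence: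
  fixes w :: "nat \<Rightarrow> R3 \<Rightarrow> complex" and \<psi> :: "R3 \<Rightarrow> complex"
  assumes w: "\<And>n. L2_fun (w n)" and i: "\<And>n. integrable lborel (\<lambda>x. norm (w n x) powr 4)"
    and l: "(\<lambda>n. pw 4 (w n)) \<longlonglongrightarrow> 0" and B: "\<And>n. mass (w n) \<le> B" and \<psi>: "L2_fun \<psi>"
  shows "(\<lambda>n. \<integral>x. norm (w n x) * norm (\<psi> x) \<partial>lborel) \<longlonglongrightarrow> 0"
proof (rule LIMSEQ_I)
  fix e :: real assume e: "0 < e"
  have "(\<lambda>j. sqrt B * sqrt (mass (\<lambda>x. indicator (- cball 0 (real j)) x *\<^sub>R \<psi> x))) \<longlonglongrightarrow> sqrt B * sqrt 0"
    by (intro tendsto_intros mass_tail_tendsto \<psi>)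
  from order_tendstoD(2)[OF this, of "e/2"] e
  obtain j where j: "sqrt B * sqrt (mass (\<lambda>x. indicator (- cball 0 (real j)) x *\<^sub>R \<psi> x)) < e / 2"
    by (auto simp: eventually_sequentially)
  have "(\<lambda>n. sqrt (mass (\<lambda>x. indicator (cball 0 (real j)) x *\<^sub>R w n x)) * sqrt (mass \<psi>)) \<longlonglongrightarrow> sqrt 0 * sqrt (mass \<psi>)"
    by (intro tendsto_intros local_mass_tendsto w i l)
  from order_tendstoD(2)[OF this, of "e/2"] e
  obtain N where N: "\<And>n. n \<ge> N \<Longrightarrow> sqrt (mass (\<lambda>x. indicator (cball 0 (real j)) x *\<^sub>R w n x)) * sqrt (mass \<psi>) < e / 2"
    by (auto simp: eventually_sequentially)
  show "\<exists>N. \<forall>n\<ge>N. norm ((\<integral>x. norm (w n x) * norm (\<psi> x) \<partial>lborel) - 0) < e"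
  proof (intro exI[of _ N] allI impI)
    fix n assume n: "n \<ge> N"
    let ?W = "\<lambda>x. indicator (cball 0 (real j)) x *\<^sub>R w n x" and ?P = "\<lambda>x. indicator (- cball 0 (real j)) x *\<^sub>R \<psi> x"
    have "L2_fun ?W" "L2_fun ?P" by (intro L2_indicator w \<psi>; simp)+
    note C = Cauchy_Schwarz_L2[OF this(1) \<psi>] and D = Cauchy_Schwarz_L2[OF w[of n] this(2)]
    have "norm (w n x) * norm (\<psi> x) = norm (?W x) * norm (\<psi> x) + norm (w n x) * norm (?P x)" for x
      by (simp add: indicator_def)
    then have "(\<integral>x. norm (w n x) * norm (\<psi> x) \<partial>lborel)
        = (\<integral>x. norm (?W x) * norm (\<psi> x) \<partial>lborel) + (\<integral>x. norm (w n x) * norm (?P x) \<partial>lborel)"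
      by (simp only: Bochner_Integration.integral_add[OF C(1) D(1)])
    also have "\<dots> \<le> sqrt (mass ?W) * sqrt (mass \<psi>) + sqrt (mass (w n)) * sqrt (mass ?P)" by (rule add_mono[OF C(2) D(2)])
    also have "\<dots> \<le> sqrt (mass ?W) * sqrt (mass \<psi>) + sqrt B * sqrt (mass ?P)"
      by (intro add_mono mult_right_mono) (use B in auto)
    also have "\<dots> < e" using N[OF n] j by linarith
    finally show "norm ((\<integral>x. norm (w n x) * norm (\<psi> x) \<partial>lborel) - 0) < e"
      by (simp add: abs_of_nonneg integral_nonneg_AE)
  qed
qed

text \<open>Multiplication by a bounded potential that vanishes at infinity restores compactness:
  the far part is small because of V, the near part because of local convergence.\<close>

lemma vanishing_potential_tendsto:
  fixes w :: "nat \<Rightarrow> R3 \<Rightarrow> complex" and V :: "R3 \<Rightarrow> real"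
  assumes w: "\<And>n. L2_fun (w n)" and i: "\<And>n. integrable lborel (\<lambda>x. norm (w n x) powr 4)"
    and l: "(\<lambda>n. pw 4 (w n)) \<longlonglongrightarrow> 0" and B: "\<And>n. mass (w n) \<le> B"
    and [measurable]: "V \<in> borel_measurable borel" and M: "\<And>x. \<bar>V x\<bar> \<le> M"
    and v: "\<And>e. e > 0 \<Longrightarrow> \<exists>R. \<forall>x. R \<le> norm x \<longrightarrow> \<bar>V x\<bar> \<le> e"
  shows "(\<lambda>n. mass (\<lambda>x. V x *\<^sub>R w n x)) \<longlonglongrightarrow> 0"
proof (rule LIMSEQ_I)
  fix e :: real assume e: "0 < e"
  have B0: "B \<ge> 0" using B[of 0] mass_nonneg[of "w 0"] by linarith
  define d where "d = sqrt (e / 2 / (B + 1))"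
  have d: "d > 0" "d\<^sup>2 * B \<le> e / 2" using e B0 by (auto simp: d_def field_simps)
  obtain R where R: "\<And>x. R \<le> norm x \<Longrightarrow> \<bar>V x\<bar> \<le> d" using v[OF d(1)] by blast
  have "(\<lambda>n. M\<^sup>2 * mass (\<lambda>x. indicator (cball 0 R) x *\<^sub>R w n x)) \<longlonglongrightarrow> M\<^sup>2 * 0"
    by (intro tendsto_intros local_mass_tendsto w i l)
  from order_tendstoD(2)[OF this, of "e/2"] e
  obtain N where N: "\<And>n. n \<ge> N \<Longrightarrow> M\<^sup>2 * mass (\<lambda>x. indicator (cball 0 R) x *\<^sub>R w n x) < e / 2"
    by (auto simp: eventually_sequentially)
  show "\<exists>N. \<forall>n\<ge>N. norm (mass (\<lambda>x. V x *\<^sub>R w n x) - 0) < e"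
  proof (intro exI[of _ N] allI impI)
    fix n assume n: "n \<ge> N"
    note H = H1_cball_integrable[OF w[of n], of R]
    note [measurable] = L2_measurable[OF w[of n]]
    have "mass (\<lambda>x. V x *\<^sub>R w n x) \<le> (\<integral>x. M\<^sup>2 * (indicator (cball 0 R) x * (norm (w n x))\<^sup>2) + d\<^sup>2 * (norm (w n x))\<^sup>2 \<partial>lborel)"
    proof (rule L2_bound(2))
      fix x
      show "(norm (V x *\<^sub>R w n x))\<^sup>2 \<le> M\<^sup>2 * (indicator (cball 0 R) x * (norm (w n x))\<^sup>2) + d\<^sup>2 * (norm (w n x))\<^sup>2"
      proof (cases "norm x \<le> R")
        case True
        have "\<bar>V x\<bar>\<^sup>2 \<le> M\<^sup>2" using M by (intro power_mono) auto
        then have "\<bar>V x\<bar>\<^sup>2 * (norm (w n x))\<^sup>2 \<le> M\<^sup>2 * (norm (w n x))\<^sup>2" by (rule mult_right_mono) simp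
        then show ?thesis using True d by (simp add: power_mult_distrib add_increasing2)
      next
        case False
        then have "\<bar>V x\<bar>\<^sup>2 \<le> d\<^sup>2" using R by (intro power_mono) auto
        then have "\<bar>V x\<bar>\<^sup>2 * (norm (w n x))\<^sup>2 \<le> d\<^sup>2 * (norm (w n x))\<^sup>2" by (rule mult_right_mono) simp
        then show ?thesis using False by (simp add: power_mult_distrib)
      qed
    next
      show "integrable lborel (\<lambda>x. M\<^sup>2 * (indicator (cball 0 R) x * (norm (w n x))\<^sup>2) + d\<^sup>2 * (norm (w n x))\<^sup>2)"
        by (rule Bochner_Integration.integrable_add[OF integrable_mult_right[OF H(1)] integrable_mult_right[OF L2_integrable[OF w]]])
    qed measurable
    also have "\<dots> = M\<^sup>2 * mass (\<lambda>x. indicator (cball 0 R) x *\<^sub>R w n x) + d\<^sup>2 * mass (w n)"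
      unfolding H(2) mass_def
      by (subst Bochner_Integration.integral_add[OF integrable_mult_right[OF H(1)] integrable_mult_right[OF L2_integrable[OF w]]]) simp
    also have "\<dots> \<le> M\<^sup>2 * mass (\<lambda>x. indicator (cball 0 R) x *\<^sub>R w n x) + d\<^sup>2 * B"
      by (intro add_left_mono mult_left_mono B) simp
    also have "\<dots> < e" using N[OF n] d(2) by linarith
    finally show "norm (mass (\<lambda>x. V x *\<^sub>R w n x) - 0) < e" by simp
  qed
qed

section \<open>Pointwise and integrated estimates for the power nonlinearity\<close>

lemma powr_mult_le:
  fixes x y :: real
  assumes "0 \<le> x" "0 \<le> y" "1 < t" "0 < \<delta>"
  shows "x powr (t - 1) * y \<le> \<delta> * x powr t + \<delta> powr (1 - t) * y powr t"
proof (cases "y \<le> \<delta> * x")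
  case True
  have "x powr (t - 1) * y \<le> x powr (t - 1) * (\<delta> * x)" by (rule mult_left_mono[OF True]) simp
  also have "\<dots> = \<delta> * x powr t" using assms by (cases "x = 0") (auto simp: powr_diff)
  finally show ?thesis by (simp add: add_increasing2)
next
  case False
  then have y: "y > 0" using assms by (smt (verit) mult_nonneg_nonneg)
  have "x \<le> y / \<delta>" using False assms by (simp add: field_simps)
  then have "x powr (t - 1) * y \<le> (y / \<delta>) powr (t - 1) * y" using assms by (intro mult_right_mono powr_mono2) auto
  also have "\<dots> = \<delta> powr (1 - t) * y powr t"
    using y assms by (simp add: powr_divide powr_diff)
  finally show ?thesis using assms by (simp add: add_increasing)
qed

text \<open>The difference is split into a change of argument at fixed modulus and a change of
  modulus; the latter is \<open>powr_diff_bound\<close> divided by the difference of the moduli. The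
  constant is 1 + 8.\<close>

lemma pow_nl_lipschitz:
  assumes p: "2 < p" "p < 6"
  shows "norm (pow_nl p z - pow_nl p w) \<le> 9 * (norm z powr (p - 2) + norm w powr (p - 2)) * norm (z - w)"
proof -
  define a b r S where "a = norm w" "b = norm z" "r = p - 2" "S = a powr r + b powr r"
  have ab: "\<bar>b - a\<bar> \<le> norm (z - w)" unfolding a_b_r_S_def(1,2) by (rule norm_triangle_ineq3)
  have pos: "0 \<le> a" "0 \<le> b" "0 \<le> S" "0 < r" "r < 4" using p by (auto simp: a_b_r_S_def)
  have L: "\<bar>b powr r - a powr r\<bar> * a \<le> 8 * S * \<bar>b - a\<bar>"
  proof (cases "b = a")
    case False
    have "(b powr r - a powr r) * (b\<^sup>2 - a\<^sup>2) \<le> 8 * S * (b - a)\<^sup>2"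
      unfolding a_b_r_S_def(4) by (rule powr_diff_bound) (use pos in auto)
    moreover have "0 \<le> (b powr r - a powr r) * (b - a)"
    proof (cases "b \<le> a")
      case True
      then show ?thesis using pos by (intro mult_nonpos_nonpos) (simp_all add: powr_mono2)
    next
      case False
      then show ?thesis using pos by (intro mult_nonneg_nonneg) (simp_all add: powr_mono2)
    qed
    then have "\<bar>b powr r - a powr r\<bar> * \<bar>b - a\<bar> = (b powr r - a powr r) * (b - a)" by (simp add: abs_mult[symmetric])
    then have "(b powr r - a powr r) * (b - a) * (a + b) = \<bar>b powr r - a powr r\<bar> * \<bar>b - a\<bar> * (a + b)" by simp
    then have "(b powr r - a powr r) * (b\<^sup>2 - a\<^sup>2) = \<bar>b powr r - a powr r\<bar> * (a + b) * \<bar>b - a\<bar>"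
      by (simp only: square_diff_square_factored power2_eq_square mult.assoc mult.commute[of "b - a"]) (simp only: mult_ac add_ac)
    ultimately have "\<bar>b powr r - a powr r\<bar> * (a + b) * \<bar>b - a\<bar> \<le> 8 * S * \<bar>b - a\<bar> * \<bar>b - a\<bar>"
      by (simp add: power2_eq_square)
    then have "\<bar>b powr r - a powr r\<bar> * (a + b) \<le> 8 * S * \<bar>b - a\<bar>" using False by simp
    moreover have "\<bar>b powr r - a powr r\<bar> * a \<le> \<bar>b powr r - a powr r\<bar> * (a + b)" using pos by (intro mult_left_mono) auto
    ultimately show ?thesis by linarith
  qed simp
  have "pow_nl p z - pow_nl p w = complex_of_real (b powr r) * (z - w) + complex_of_real (b powr r - a powr r) * w"
    by (simp add: pow_nl_def a_b_r_S_def(1-3) algebra_simps)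
  then have "norm (pow_nl p z - pow_nl p w) \<le> b powr r * norm (z - w) + \<bar>b powr r - a powr r\<bar> * a"
    using norm_triangle_ineq[of "complex_of_real (b powr r) * (z - w)" "complex_of_real (b powr r - a powr r) * w"]
    by (simp add: norm_mult a_b_r_S_def(1) flip: of_real_diff)
  also have "\<dots> \<le> S * norm (z - w) + 8 * S * norm (z - w)"
    using ab L pos by (intro add_mono mult_right_mono order_trans[OF L] mult_left_mono) (auto simp: a_b_r_S_def(4))
  finally show ?thesis by (simp add: a_b_r_S_def algebra_simps)
qed

lemma power_pairing_bound:
  fixes u w :: "R3 \<Rightarrow> complex"
  assumes u: "integrable lborel (\<lambda>x. norm (u x) powr t)" and w: "integrable lborel (\<lambda>x. norm (w x) powr t)"
    and [measurable]: "u \<in> borel_measurable borel" "w \<in> borel_measurable borel" and t: "2 < t" and d: "0 < \<delta>"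
  shows "\<bar>\<integral>x. norm (u x) powr (t - 2) * Re (u x * cnj (w x)) \<partial>lborel\<bar> \<le> \<delta> * pw t u + \<delta> powr (1 - t) * pw t w"
proof -
  let ?G = "\<lambda>x. \<delta> * norm (u x) powr t + \<delta> powr (1 - t) * norm (w x) powr t"
  have le: "\<bar>norm (u x) powr (t - 2) * Re (u x * cnj (w x))\<bar> \<le> ?G x" for x
  proof -
    have "\<bar>norm (u x) powr (t - 2) * Re (u x * cnj (w x))\<bar> \<le> norm (u x) powr (t - 2) * (norm (u x) * norm (w x))"
      unfolding abs_mult using Re_pairing_bound[of "u x" "w x"] by (intro mult_mono) auto
    also have "\<dots> = norm (u x) powr (t - 1) * norm (w x)"
      using t by (cases "u x = 0") (auto simp: powr_diff power2_eq_square)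
    also have "\<dots> \<le> ?G x" using t d by (intro powr_mult_le) auto
    finally show ?thesis .
  qed
  have G: "integrable lborel ?G" by (intro Bochner_Integration.integrable_add integrable_mult_right u w)
  have "integrable lborel (\<lambda>x. norm (u x) powr (t - 2) * Re (u x * cnj (w x)))"
    by (rule Bochner_Integration.integrable_bound[OF G], measurable) (auto intro!: AE_I2 order_trans[OF le abs_ge_self] simp del: times_complex.simps)
  then have "\<bar>\<integral>x. norm (u x) powr (t - 2) * Re (u x * cnj (w x)) \<partial>lborel\<bar> \<le> (\<integral>x. ?G x \<partial>lborel)"
    by (rule integral_abs_bound_integral[OF _ G le])
  also have "\<dots> = \<delta> * pw t u + \<delta> powr (1 - t) * pw t w"
    unfolding pw_def by (subst Bochner_Integration.integral_add) (auto intro!: u w)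
  finally show ?thesis .
qed

section \<open>Passage to the limit in the equation\<close>

locale solution_sequence =
  fixes p q m K lam0 :: real and \<mu> lam :: "nat \<Rightarrow> real" and u :: "nat \<Rightarrow> R3 \<Rightarrow> complex" and u0 :: "R3 \<Rightarrow> complex"
  assumes pq: "2 < p" "p < 6" "2 < q" "q < 6"
    and rad: "\<And>n. u n \<in> H1_rad"
    and sol: "\<And>n. weak_solution (comb_nl p q (\<mu> n)) (lam n) (u n)"
    and mass_u: "\<And>n. mass (u n) = m" and kin_u: "\<And>n. kin (u n) \<le> K"
    and mu: "\<mu> \<longlonglongrightarrow> 0" and lam: "lam \<longlonglongrightarrow> lam0" and lam0: "0 \<le> lam0"
    and cauchy: "\<And>t e. 2 < t \<Longrightarrow> t < 6 \<Longrightarrow> 0 < e \<Longrightarrow> \<exists>N. \<forall>n\<ge>N. \<forall>k\<ge>N. pw t (\<lambda>x. u n x - u k x) \<le> e"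
    and u0_measurable: "u0 \<in> borel_measurable borel" and AE_lim: "AE x in lborel. (\<lambda>n. u n x) \<longlonglongrightarrow> u0 x"
begin

lemma uH: "u n \<in> H1" using rad[of n] by (simp add: H1_rad_def)

lemma mpos: "0 \<le> m" using mass_u[of 0] mass_nonneg[of "u 0"] by simp

lemma pw_limit:
  assumes t: "2 < t" "t < 6"
  shows "integrable lborel (\<lambda>x. norm (u0 x) powr t)" "(\<lambda>n. pw t (\<lambda>x. u n x - u0 x)) \<longlonglongrightarrow> 0"
    "integrable lborel (\<lambda>x. norm (u n x - u0 x) powr t)"
proof -
  have i: "integrable lborel (\<lambda>x. norm (u n x) powr t)" for n using t by (intro H1_pw_integrable uH) auto
  note C = cauchy_limit[where f=u and g=u0 and r="\<lambda>n. n", OF H1_measurable[OF uH] u0_measurable i _ AE_lim _ cauchy[OF t]]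
  show "integrable lborel (\<lambda>x. norm (u0 x) powr t)" "(\<lambda>n. pw t (\<lambda>x. u n x - u0 x)) \<longlonglongrightarrow> 0"
    using C t by (auto simp: strict_mono_def)
  then show "integrable lborel (\<lambda>x. norm (u n x - u0 x) powr t)"
    using t by (intro pw_integrable_diff(1) i H1_measurable uH u0_measurable) auto
qed

text \<open>Fatou's lemma gives only an inequality for the mass; at this stage some of it may still
  be lost at infinity.\<close>

lemma L2_u0: "L2_fun u0" and mass_u0: "mass u0 \<le> m"
proof -
  have "AE x in lborel. (\<lambda>n. (norm (u n x))\<^sup>2) \<longlonglongrightarrow> (norm (u0 x))\<^sup>2"
    using AE_lim by eventually_elim (intro tendsto_intros)
  note F = fatou_bound[OF this L2_integrable[OF H1_L2[OF uH]], of m]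
  have "(\<integral>x. (norm (u n x))\<^sup>2 \<partial>lborel) \<le> m" for n using mass_u[of n] by (simp add: mass_def)
  note F = F[OF _ this]
  show "L2_fun u0" using F(1) u0_measurable by (intro L2_funI) auto
  show "mass u0 \<le> m" unfolding mass_def using F(2) u0_measurable by auto
qed

lemma L2_w: "L2_fun (\<lambda>x. u n x - u0 x)" by (rule L2_diff[OF H1_L2[OF uH] L2_u0])

lemma mass_w: "mass (\<lambda>x. u n x - u0 x) \<le> 4 * m"
  using mass_diff_le[OF H1_L2[OF uH[of n]] L2_u0] mass_u[of n] mass_u0 by simp

lemma w4: "integrable lborel (\<lambda>x. norm (u n x - u0 x) powr 4)" "(\<lambda>n. pw 4 (\<lambda>x. u n x - u0 x)) \<longlonglongrightarrow> 0"
  by (rule pw_limit; simp)+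

lemma weak_convergence:
  assumes "L2_fun \<psi>" shows "(\<lambda>n. \<integral>x. norm (u n x - u0 x) * norm ((\<psi> :: R3 \<Rightarrow> complex) x) \<partial>lborel) \<longlonglongrightarrow> 0"
  by (rule weak_L2_convergence[OF L2_w w4 mass_w assms])

lemma weak_convergence_pairing:
  fixes \<psi> :: "R3 \<Rightarrow> complex"
  assumes \<psi>: "L2_fun \<psi>"
  shows "(\<lambda>n. \<integral>x. u n x * \<psi> x \<partial>lborel) \<longlonglongrightarrow> (\<integral>x. u0 x * \<psi> x \<partial>lborel)"
proof -
  note [measurable] = L2_measurable[OF \<psi>] L2_measurable[OF L2_u0] H1_measurable[OF uH]
  have i: "integrable lborel (\<lambda>x. f x * \<psi> x)" if "L2_fun f" for f :: "R3 \<Rightarrow> complex"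
    using L2_measurable[OF that] by (intro L2_dominated_product(1)[OF that \<psi>, of _ 1]) (auto simp: norm_mult)
  have "(\<lambda>n. (\<integral>x. u n x * \<psi> x \<partial>lborel) - (\<integral>x. u0 x * \<psi> x \<partial>lborel)) \<longlonglongrightarrow> 0"
  proof (rule Lim_null_comparison[OF _ weak_convergence[OF \<psi>]], rule always_eventually, rule allI)
    fix n
    have "(\<integral>x. u n x * \<psi> x \<partial>lborel) - (\<integral>x. u0 x * \<psi> x \<partial>lborel) = (\<integral>x. (u n x - u0 x) * \<psi> x \<partial>lborel)"
      by (simp add: left_diff_distrib Bochner_Integration.integral_diff[OF i[OF H1_L2[OF uH]] i[OF L2_u0]])
    then show "norm ((\<integral>x. u n x * \<psi> x \<partial>lborel) - (\<integral>x. u0 x * \<psi> x \<partial>lborel)) \<le> (\<integral>x. norm (u n x - u0 x) * norm (\<psi> x) \<partial>lborel)"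
      using integral_norm_bound[of lborel "\<lambda>x. (u n x - u0 x) * \<psi> x"] by (simp add: norm_mult)
  qed
  then show ?thesis by (rule LIM_zero_cancel)
qed

section \<open>Convergence of the Coulomb potentials\<close>

lemma L12_u0: "L12 (dens u0)"
  using u0_measurable L2_u0 pw_limit(1)[of 4] by (intro L12_dens_iff) auto

text \<open>With c = |u_n - u0| the densities differ by at most c (c + 2 |u0|), so L^4 convergence
  of the functions gives L^2 convergence of the densities.\<close>

lemma dens_diff_tendsto: "(\<lambda>n. mass (\<lambda>x. dens (u n) x - dens u0 x)) \<longlonglongrightarrow> 0"
proof (rule Lim_null_comparison, rule always_eventually, rule allI)
  fix n
  let ?w = "\<lambda>x. u n x - u0 x"
  have W: "L12 (dens ?w)" using L2_w u0_measurable H1_measurable[OF uH] pw_limit(3)[of 4 n] by (intro L12_dens_iff) auto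
  have Lw: "L2_fun (dens ?w)" "L2_fun (dens u0)" using W L12_u0 by (auto simp: L12_def)
  note C = Cauchy_Schwarz_L2[OF Lw]
  have i4: "integrable lborel (\<lambda>x. ((norm (?w x))\<^sup>2)\<^sup>2)" using L2_integrable[OF Lw(1)] by simp
  have C1: "integrable lborel (\<lambda>x. (norm (?w x))\<^sup>2 * (norm (u0 x))\<^sup>2)" using C(1) by simp
  have "mass (\<lambda>x. dens (u n) x - dens u0 x) \<le> (\<integral>x. 2 * ((norm (?w x))\<^sup>2)\<^sup>2 + 8 * ((norm (?w x))\<^sup>2 * (norm (u0 x))\<^sup>2) \<partial>lborel)"
  proof (rule L2_bound(2))
    fix x
    define a b c where "a = norm (u n x)" "b = norm (u0 x)" "c = norm (?w x)"
    have "\<bar>a - b\<bar> \<le> c" unfolding a_b_c_def by (rule norm_triangle_ineq3)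
    moreover have "a + b \<le> c + 2 * b" using calculation by linarith
    ultimately have "\<bar>a - b\<bar> * (a + b) \<le> c * (c + 2 * b)" by (intro mult_mono) (auto simp: a_b_c_def)
    then have P: "(\<bar>a - b\<bar> * (a + b))\<^sup>2 \<le> (c * (c + 2 * b))\<^sup>2" by (intro power_mono) (auto simp: a_b_c_def)
    have Q: "(c + 2 * b)\<^sup>2 \<le> 2 * c\<^sup>2 + 8 * b\<^sup>2"
      using zero_le_power2[of "c - 2 * b"] by (simp add: power2_sum power2_diff power_mult_distrib)
    have "(a\<^sup>2 - b\<^sup>2)\<^sup>2 = (\<bar>a - b\<bar> * (a + b))\<^sup>2"
      by (simp add: power_mult_distrib square_diff_square_factored power2_eq_square[of a] power2_eq_square[of b])
    also note P
    also have "(c * (c + 2 * b))\<^sup>2 = c\<^sup>2 * (c + 2 * b)\<^sup>2" by (rule power_mult_distrib)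
    also have "\<dots> \<le> c\<^sup>2 * (2 * c\<^sup>2 + 8 * b\<^sup>2)" by (rule mult_left_mono[OF Q]) simp
    also have "\<dots> = 2 * (c\<^sup>2)\<^sup>2 + 8 * (c\<^sup>2 * b\<^sup>2)" by (simp add: distrib_left power2_eq_square[of "c\<^sup>2"])
    finally have "(a\<^sup>2 - b\<^sup>2)\<^sup>2 \<le> 2 * (c\<^sup>2)\<^sup>2 + 8 * (c\<^sup>2 * b\<^sup>2)" .
    then show "(norm (dens (u n) x - dens u0 x))\<^sup>2 \<le> 2 * ((norm (?w x))\<^sup>2)\<^sup>2 + 8 * ((norm (?w x))\<^sup>2 * (norm (u0 x))\<^sup>2)"
      unfolding a_b_c_def by (simp only: real_norm_def power2_abs)
  next
    show "integrable lborel (\<lambda>x. 2 * ((norm (?w x))\<^sup>2)\<^sup>2 + 8 * ((norm (?w x))\<^sup>2 * (norm (u0 x))\<^sup>2))"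
      by (intro Bochner_Integration.integrable_add integrable_mult_right i4 C1)
  next
    show "(\<lambda>x. dens (u n) x - dens u0 x) \<in> borel_measurable borel" using u0_measurable H1_measurable[OF uH] by measurable
  qed
  also have "\<dots> = 2 * mass (dens ?w) + 8 * (\<integral>x. (norm (?w x))\<^sup>2 * (norm (u0 x))\<^sup>2 \<partial>lborel)"
    by (subst Bochner_Integration.integral_add[OF integrable_mult_right[OF i4] integrable_mult_right[OF C1]]) (simp add: mass_def)
  also have "\<dots> \<le> 2 * pw 4 ?w + 8 * (sqrt (pw 4 ?w) * sqrt (pw 4 u0))"
    using C(2) unfolding dens_mass by simp
  finally show "norm (mass (\<lambda>x. dens (u n) x - dens u0 x)) \<le> 2 * pw 4 ?w + 8 * (sqrt (pw 4 ?w) * sqrt (pw 4 u0))" by simp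
next
  have "(\<lambda>n. 2 * pw 4 (\<lambda>x. u n x - u0 x) + 8 * (sqrt (pw 4 (\<lambda>x. u n x - u0 x)) * sqrt (pw 4 u0)))
      \<longlonglongrightarrow> 2 * 0 + 8 * (sqrt 0 * sqrt (pw 4 u0))"
    by (intro tendsto_intros pw_limit(2)) auto
  then show "(\<lambda>n. 2 * pw 4 (\<lambda>x. u n x - u0 x) + 8 * (sqrt (pw 4 (\<lambda>x. u n x - u0 x)) * sqrt (pw 4 u0))) \<longlonglongrightarrow> 0" by simp
qed

text \<open>The densities converge in L^2 but are merely bounded in L^1. The splitting radius \<rho>
  is therefore fixed first, large enough for the L^1 part, and then \<open>n\<close> is taken
  large.\<close>

lemma coulomb_uniform_limit:
  assumes e: "e > 0"
  shows "\<exists>N. \<forall>n\<ge>N. \<forall>x. \<bar>coulomb (u n) x - coulomb u0 x\<bar> \<le> e"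
proof -
  define \<rho> where "\<rho> = 4 * m / e + 1"
  have \<rho>: "\<rho> > 0" "2 * m / \<rho> \<le> e / 2"
  proof -
    show "\<rho> > 0" using e mpos by (simp add: \<rho>_def add_nonneg_pos)
    then show "2 * m / \<rho> \<le> e / 2" using e mpos by (simp add: \<rho>_def divide_le_eq field_simps)
  qed
  have "(\<lambda>n. sqrt (\<rho> * K2) * sqrt (mass (\<lambda>x. dens (u n) x - dens u0 x))) \<longlonglongrightarrow> sqrt (\<rho> * K2) * sqrt 0"
    by (intro tendsto_intros dens_diff_tendsto)
  from order_tendstoD(2)[OF this, of "e/2"] e
  obtain N where N: "\<And>n. n \<ge> N \<Longrightarrow> sqrt (\<rho> * K2) * sqrt (mass (\<lambda>x. dens (u n) x - dens u0 x)) < e / 2"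
    by (auto simp: eventually_sequentially)
  have "\<bar>coulomb (u n) x - coulomb u0 x\<bar> \<le> e" if n: "n \<ge> N" for n x
  proof -
    let ?g = "\<lambda>y. dens (u n) y - dens u0 y"
    have g: "L12 ?g" by (rule L12_diff[OF L12_dens[OF uH] L12_u0])
    have "\<bar>coulomb (u n) x - coulomb u0 x\<bar> = \<bar>newton ?g x\<bar>"
      unfolding coulomb_newton by (simp add: newton_diff[OF L12_dens[OF uH] L12_u0])
    also have "\<dots> \<le> newton (\<lambda>y. \<bar>?g y\<bar>) x" by (rule newton_abs_le)
    also have "\<dots> \<le> sqrt (\<rho> * K2) * sqrt (mass ?g) + (\<integral>y. \<bar>?g y\<bar> \<partial>lborel) / \<rho>" by (rule newton_sup[OF g \<rho>(1)])
    also have "(\<integral>y. \<bar>?g y\<bar> \<partial>lborel) \<le> (\<integral>y. dens (u n) y + dens u0 y \<partial>lborel)"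
      using L12_integrable[OF g] L12_integrable[OF L12_dens[OF uH]] L12_integrable[OF L12_u0]
      by (intro integral_mono) (auto intro!: Bochner_Integration.integrable_add integrable_abs abs_triangle_ineq4[THEN order_trans])
    also have "\<dots> = mass (u n) + mass u0"
      using L12_integrable[OF L12_dens[OF uH]] L12_integrable[OF L12_u0] by (simp add: mass_def)
    also have "\<dots> \<le> 2 * m" using mass_u[of n] mass_u0 by simp
    finally have "\<bar>coulomb (u n) x - coulomb u0 x\<bar> \<le> sqrt (\<rho> * K2) * sqrt (mass ?g) + 2 * m / \<rho>"
      using \<rho> by (simp add: divide_right_mono)
    also have "\<dots> \<le> e / 2 + e / 2" by (intro add_mono less_imp_le[OF N[OF n]] \<rho>(2))
    finally show ?thesis by simp
  qed
  then show ?thesis by blast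
qed

lemma coulomb_u0:
  obtains M where "M > 0" "\<And>x. \<bar>coulomb u0 x\<bar> \<le> M"
  using newton_bounded[OF L12_u0] unfolding coulomb_newton by metis

lemma coulomb_measurable: "coulomb u0 \<in> borel_measurable borel" "coulomb (u n) \<in> borel_measurable borel"
  unfolding coulomb_newton using u0_measurable H1_measurable[OF uH] by measurable

lemma coulomb_u0_vanishes: "e > 0 \<Longrightarrow> \<exists>R. \<forall>x. R \<le> norm x \<longrightarrow> \<bar>coulomb u0 x\<bar> \<le> e"
proof -
  assume "e > 0"
  then obtain R where "\<And>x. R \<le> norm x \<Longrightarrow> newton (\<lambda>y. \<bar>dens u0 y\<bar>) x \<le> e" using newton_vanishes[OF L12_u0] by metis
  then show ?thesis unfolding coulomb_newton by (intro exI[of _ R] allI impI order_trans[OF newton_abs_le])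
qed

lemma coulomb_w_tendsto: "(\<lambda>n. mass (\<lambda>x. coulomb u0 x *\<^sub>R (u n x - u0 x))) \<longlonglongrightarrow> 0"
proof -
  obtain M where "\<And>x. \<bar>coulomb u0 x\<bar> \<le> M" using coulomb_u0 by blast
  then show ?thesis
    by (intro vanishing_potential_tendsto[OF L2_w w4 mass_w coulomb_measurable(1) _ coulomb_u0_vanishes])
qed

lemma L2_coulomb_mult:
  assumes "L2_fun (\<psi> :: R3 \<Rightarrow> complex)" shows "L2_fun (\<lambda>x. coulomb u0 x *\<^sub>R \<psi> x)"
proof -
  obtain M where M: "\<And>x. \<bar>coulomb u0 x\<bar> \<le> M" using coulomb_u0 by blast
  note [measurable] = coulomb_measurable L2_measurable[OF assms]
  show ?thesis
  proof (rule L2_bound(1)[OF _ integrable_mult_right[OF L2_integrable[OF assms], of "M\<^sup>2"]])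
    show "(norm (coulomb u0 x *\<^sub>R \<psi> x))\<^sup>2 \<le> M\<^sup>2 * (norm (\<psi> x))\<^sup>2" for x
      using M[of x] power_mono[of "\<bar>coulomb u0 x\<bar>" M 2] by (auto simp: power_mult_distrib intro!: mult_right_mono)
  qed measurable
qed

text \<open>The moving potential is exchanged for the limit potential at the cost \<open>s\<close>.
  The limit potential vanishes at infinity and makes up for the missing L^2 compactness of
  \<open>w\<close>.\<close>

lemma coulomb_pairing_bound:
  assumes w: "w \<in> H1" and s: "\<And>x. \<bar>coulomb (u j) x - coulomb u0 x\<bar> \<le> s"
  shows "\<bar>\<integral>x. Re (u j x * cnj (w x)) * coulomb (u j) x \<partial>lborel\<bar>
    \<le> s * (sqrt m * sqrt (mass w)) + sqrt m * sqrt (mass (\<lambda>x. coulomb u0 x *\<^sub>R w x))"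
proof -
  note C = Cauchy_Schwarz_L2[OF H1_L2[OF uH[of j]] H1_L2[OF w]]
  note D = Cauchy_Schwarz_L2[OF H1_L2[OF uH[of j]] L2_coulomb_mult[OF H1_L2[OF w]]]
  let ?G = "\<lambda>x. s * (norm (u j x) * norm (w x)) + norm (u j x) * norm (coulomb u0 x *\<^sub>R w x)"
  have s0: "0 \<le> s" using s[of 0] by linarith
  note [measurable] = coulomb_measurable H1_measurable[OF w] H1_measurable[OF uH]
  have le: "\<bar>Re (u j x * cnj (w x)) * coulomb (u j) x\<bar> \<le> ?G x" for x
  proof -
    have "\<bar>Re (u j x * cnj (w x)) * coulomb (u j) x\<bar> \<le> (norm (u j x) * norm (w x)) * (s + \<bar>coulomb u0 x\<bar>)"
      unfolding abs_mult using s[of x] by (intro mult_mono Re_pairing_bound) auto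
    then show ?thesis by (simp add: algebra_simps)
  qed
  have G: "integrable lborel ?G" by (intro Bochner_Integration.integrable_add integrable_mult_right C(1) D(1))
  have "integrable lborel (\<lambda>x. Re (u j x * cnj (w x)) * coulomb (u j) x)"
    by (rule Bochner_Integration.integrable_bound[OF G], measurable) (intro AE_I2, unfold real_norm_def, rule order_trans[OF le abs_ge_self])
  then have "\<bar>\<integral>x. Re (u j x * cnj (w x)) * coulomb (u j) x \<partial>lborel\<bar> \<le> (\<integral>x. ?G x \<partial>lborel)"
    by (rule integral_abs_bound_integral[OF _ G le])
  also have "\<dots> = s * (\<integral>x. norm (u j x) * norm (w x) \<partial>lborel) + (\<integral>x. norm (u j x) * norm (coulomb u0 x *\<^sub>R w x) \<partial>lborel)"
    by (subst Bochner_Integration.integral_add[OF integrable_mult_right[OF C(1)] D(1)]) simp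
  also have "\<dots> \<le> s * (sqrt m * sqrt (mass w)) + sqrt m * sqrt (mass (\<lambda>x. coulomb u0 x *\<^sub>R w x))"
    using C(2) D(2) s0 unfolding mass_u by (intro add_mono mult_left_mono) auto
  finally show ?thesis .
qed


section \<open>The Cauchy estimate for the gradients\<close>

lemma pw_bounded:
  assumes t: "2 < t" "t < 6" obtains B where "B \<ge> 0" "\<And>n. pw t (u n) \<le> B"
proof -
  obtain C where C: "C > 0" "\<And>u. u \<in> H1 \<Longrightarrow> pw t u \<le> C * mass u powr ((6-t)/4) * kin u powr (3*(t-2)/4)" using GN[OF t] by blast
  show ?thesis
  proof (rule that[of "C * m powr ((6-t)/4) * K powr (3*(t-2)/4)"])
    fix n
    have "pw t (u n) \<le> C * m powr ((6-t)/4) * kin (u n) powr (3*(t-2)/4)" using C(2)[OF uH, of n] by (simp add: mass_u)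
    also have "\<dots> \<le> C * m powr ((6-t)/4) * K powr (3*(t-2)/4)" using C(1) t kin_u by (intro mult_left_mono powr_mono2) auto
    finally show "pw t (u n) \<le> C * m powr ((6-t)/4) * K powr (3*(t-2)/4)" .
  qed (use C in simp)
qed

text \<open>The parameter \<delta> is fixed by the uniform bound on the L^t norms; the Cauchy
  property then absorbs the large factor \<delta>^(1 - t). The threshold does not depend on
  \<open>j\<close>.\<close>

lemma power_pairing_small:
  assumes t: "2 < t" "t < 6" and e: "0 < e"
  shows "\<exists>N. \<forall>j. \<forall>n\<ge>N. \<forall>k\<ge>N. \<bar>\<integral>x. norm (u j x) powr (t - 2) * Re (u j x * cnj (u n x - u k x)) \<partial>lborel\<bar> \<le> e"
proof -
  obtain B where B: "B \<ge> 0" "\<And>n. pw t (u n) \<le> B" using pw_bounded[OF t] by blast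
  define \<delta> where "\<delta> = e / 2 / (B + 1)"
  have \<delta>: "\<delta> > 0" "\<delta> * B \<le> e / 2" using e B(1) by (auto simp: \<delta>_def field_simps)
  obtain N where N: "\<And>n k. n \<ge> N \<Longrightarrow> k \<ge> N \<Longrightarrow> pw t (\<lambda>x. u n x - u k x) \<le> e / 2 * \<delta> powr (t - 1)"
    using cauchy[OF t, of "e / 2 * \<delta> powr (t - 1)"] e \<delta> by auto
  have i: "integrable lborel (\<lambda>x. norm (v x) powr t)" if "v \<in> H1" for v using that t by (intro H1_pw_integrable) auto
  show ?thesis
  proof (intro exI[of _ N] allI impI)
    fix j n k assume nk: "n \<ge> N" "k \<ge> N"
    have w: "(\<lambda>x. u n x - u k x) \<in> H1" by (rule H1_diff(1)[OF uH uH])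
    have "\<bar>\<integral>x. norm (u j x) powr (t - 2) * Re (u j x * cnj (u n x - u k x)) \<partial>lborel\<bar>
        \<le> \<delta> * pw t (u j) + \<delta> powr (1 - t) * pw t (\<lambda>x. u n x - u k x)"
      by (rule power_pairing_bound[OF i[OF uH] i[OF w] H1_measurable[OF uH] H1_measurable[OF w] t(1) \<delta>(1)])
    also have "\<dots> \<le> \<delta> * B + \<delta> powr (1 - t) * (e / 2 * \<delta> powr (t - 1))"
      using \<delta>(1) by (intro add_mono mult_left_mono B N nk) auto
    also have "\<delta> powr (1 - t) * (e / 2 * \<delta> powr (t - 1)) = e / 2 * (\<delta> powr (1 - t) * \<delta> powr (t - 1))" by (simp only: mult_ac)
    also have "\<delta> powr (1 - t) * \<delta> powr (t - 1) = 1" using \<delta>(1) by (simp flip: powr_add)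
    also have "\<delta> * B + e / 2 * 1 \<le> e" using \<delta>(2) by simp
    finally show "\<bar>\<integral>x. norm (u j x) powr (t - 2) * Re (u j x * cnj (u n x - u k x)) \<partial>lborel\<bar> \<le> e" .
  qed
qed

lemma mass_diff: "mass (\<lambda>x. u n x - u k x) \<le> 4 * m"
  using mass_diff_le[OF H1_L2[OF uH[of n]] H1_L2[OF uH[of k]]] by (simp add: mass_u)

lemma coulomb_pairing_small:
  assumes e: "0 < e"
  shows "\<exists>N. \<forall>j\<ge>N. \<forall>n\<ge>N. \<forall>k\<ge>N. \<bar>\<integral>x. Re (u j x * cnj (u n x - u k x)) * coulomb (u j) x \<partial>lborel\<bar> \<le> e"
proof -
  define s where "s = e / 2 / (2 * m + 1)"
  define b where "b = e / 4 / (sqrt m + 1)"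
  have s: "s > 0" "s * (2 * m) \<le> e / 2" using e mpos by (auto simp: s_def field_simps)
  have sm: "sqrt m + 1 > 0" using mpos by (simp add: add_nonneg_pos)
  have b: "b > 0" "sqrt m * (2 * b) \<le> e / 2" using e sm mpos by (auto simp: b_def divide_le_eq field_simps)
  obtain N1 where N1: "\<And>j x. j \<ge> N1 \<Longrightarrow> \<bar>coulomb (u j) x - coulomb u0 x\<bar> \<le> s" using coulomb_uniform_limit[OF s(1)] by blast
  define A where "A n = mass (\<lambda>x. coulomb u0 x *\<^sub>R (u n x - u0 x))" for n
  obtain N2 where N2: "\<And>n. n \<ge> N2 \<Longrightarrow> A n < b\<^sup>2"
    using order_tendstoD(2)[OF coulomb_w_tendsto, of "b\<^sup>2"] b by (auto simp: eventually_sequentially A_def)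
  show ?thesis
  proof (intro exI[of _ "max N1 N2"] allI impI)
    fix j n k assume jnk: "max N1 N2 \<le> j" "max N1 N2 \<le> n" "max N1 N2 \<le> k"
    let ?w = "\<lambda>x. u n x - u k x"
    have w: "?w \<in> H1" by (rule H1_diff(1)[OF uH uH])
    have "mass (\<lambda>x. coulomb u0 x *\<^sub>R ?w x)
        = mass (\<lambda>x. coulomb u0 x *\<^sub>R (u n x - u0 x) - coulomb u0 x *\<^sub>R (u k x - u0 x))"
      by (simp add: scaleR_diff_right[symmetric])
    also have "\<dots> \<le> 2 * A n + 2 * A k" unfolding A_def by (rule mass_diff_le[OF L2_coulomb_mult[OF L2_w] L2_coulomb_mult[OF L2_w]])
    also have "\<dots> \<le> (2 * b)\<^sup>2" using N2[of n] N2[of k] jnk by (simp add: power_mult_distrib)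
    finally have sA: "sqrt (mass (\<lambda>x. coulomb u0 x *\<^sub>R ?w x)) \<le> 2 * b" using b by (intro real_le_lsqrt) auto
    have "sqrt (mass ?w) \<le> sqrt (4 * m)" using mass_diff by simp
    then have "sqrt m * sqrt (mass ?w) \<le> sqrt m * sqrt (4 * m)" using mpos by (intro mult_left_mono) auto
    also have "\<dots> = 2 * m" using mpos by (simp add: real_sqrt_mult)
    finally have sB: "sqrt m * sqrt (mass ?w) \<le> 2 * m" .
    have "\<bar>\<integral>x. Re (u j x * cnj (?w x)) * coulomb (u j) x \<partial>lborel\<bar>
        \<le> s * (sqrt m * sqrt (mass ?w)) + sqrt m * sqrt (mass (\<lambda>x. coulomb u0 x *\<^sub>R ?w x))"
      by (rule coulomb_pairing_bound[OF w N1]) (use jnk in auto)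
    also have "\<dots> \<le> s * (2 * m) + sqrt m * (2 * b)" using sA sB s mpos by (intro add_mono mult_left_mono) auto
    also have "\<dots> \<le> e" using s(2) b(2) by linarith
    finally show "\<bar>\<integral>x. Re (u j x * cnj (?w x)) * coulomb (u j) x \<partial>lborel\<bar> \<le> e" .
  qed
qed

text \<open>The equations for u_n and u_k are both tested with their difference and subtracted. The
  left side becomes the quadratic form, and eight terms remain, four for each index: two powers, the
  Coulomb pairing, and the deviation of the multiplier from \<open>lam0\<close>.\<close>

lemma kin_mass_cauchy:
  assumes e: "0 < e"
  shows "\<exists>N. \<forall>n\<ge>N. \<forall>k\<ge>N. kin (\<lambda>x. u n x - u k x) + lam0 * mass (\<lambda>x. u n x - u k x) \<le> e"
proof -
  have e8: "0 < e / 8" using e by simp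
  obtain N1 where N1: "\<And>j n k. n \<ge> N1 \<Longrightarrow> k \<ge> N1 \<Longrightarrow> \<bar>\<integral>x. norm (u j x) powr (p - 2) * Re (u j x * cnj (u n x - u k x)) \<partial>lborel\<bar> \<le> e / 8"
    using power_pairing_small[OF pq(1,2) e8] by blast
  obtain N2 where N2: "\<And>j n k. n \<ge> N2 \<Longrightarrow> k \<ge> N2 \<Longrightarrow> \<bar>\<integral>x. norm (u j x) powr (q - 2) * Re (u j x * cnj (u n x - u k x)) \<partial>lborel\<bar> \<le> e / 8"
    using power_pairing_small[OF pq(3,4) e8] by blast
  obtain N3 where N3: "\<And>j n k. j \<ge> N3 \<Longrightarrow> n \<ge> N3 \<Longrightarrow> k \<ge> N3 \<Longrightarrow> \<bar>\<integral>x. Re (u j x * cnj (u n x - u k x)) * coulomb (u j) x \<partial>lborel\<bar> \<le> e / 8"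
    using coulomb_pairing_small[OF e8] by blast
  define d where "d = e / 8 / (2 * m + 1)"
  have d: "d > 0" "d * (2 * m) \<le> e / 8" using e mpos by (auto simp: d_def field_simps)
  obtain N4 where N4: "\<And>n. n \<ge> N4 \<Longrightarrow> \<bar>lam n - lam0\<bar> \<le> d" using LIMSEQ_D[OF lam d(1)] by (auto intro: less_imp_le)
  obtain N5 where N5: "\<And>n. n \<ge> N5 \<Longrightarrow> \<bar>\<mu> n\<bar> \<le> 1" using LIMSEQ_D[OF mu, of 1] by (auto intro: less_imp_le)
  define N where "N = Max {N1, N2, N3, N4, N5}"
  have N: "N \<ge> N1" "N \<ge> N2" "N \<ge> N3" "N \<ge> N4" "N \<ge> N5" by (simp_all add: N_def)
  show ?thesis
  proof (intro exI[of _ N] allI impI)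
    fix n k assume nk: "N \<le> n" "N \<le> k"
    let ?w = "\<lambda>x. u n x - u k x"
    have w: "?w \<in> H1" by (rule H1_diff(1)[OF uH uH])
    define G U C P Q where "G j = (\<integral>x. wgrad (u j) x \<bullet> wgrad ?w x \<partial>lborel)" and "U j = (\<integral>x. u j x \<bullet> ?w x \<partial>lborel)"
      and "C j = (\<integral>x. Re (u j x * cnj (?w x)) * coulomb (u j) x \<partial>lborel)"
      and "P j = (\<integral>x. norm (u j x) powr (p - 2) * Re (u j x * cnj (?w x)) \<partial>lborel)"
      and "Q j = (\<integral>x. norm (u j x) powr (q - 2) * Re (u j x * cnj (?w x)) \<partial>lborel)" for j
    have eq: "G j + lam j * U j + C j = P j + \<mu> j * Q j" for j
      unfolding G_def U_def C_def P_def Q_def by (rule weak_solution_real[OF sol w pq])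
    have iG: "integrable lborel (\<lambda>x. wgrad (u j) x \<bullet> wgrad ?w x)" for j by (rule mass_add_eq(1)[OF wgrad_L2[OF uH] wgrad_L2[OF w]])
    have iU: "integrable lborel (\<lambda>x. u j x \<bullet> ?w x)" for j by (rule mass_add_eq(1)[OF H1_L2[OF uH] H1_L2[OF w]])
    have "G n - G k = (\<integral>x. (wgrad (u n) x - wgrad (u k) x) \<bullet> wgrad ?w x \<partial>lborel)"
      unfolding G_def by (simp add: inner_diff_left Bochner_Integration.integral_diff[OF iG iG])
    also have "\<dots> = kin ?w" unfolding mass_def
    proof (rule integral_cong_AE)
      note [measurable] = L2_measurable[OF wgrad_L2[OF w]] L2_measurable[OF wgrad_L2[OF uH]]
      show "(\<lambda>x. (wgrad (u n) x - wgrad (u k) x) \<bullet> wgrad ?w x) \<in> borel_measurable lborel" by measurable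
      show "(\<lambda>x. (norm (wgrad ?w x))\<^sup>2) \<in> borel_measurable lborel" by measurable
      show "AE x in lborel. (wgrad (u n) x - wgrad (u k) x) \<bullet> wgrad ?w x = (norm (wgrad ?w x))\<^sup>2"
        using H1_diff(3)[OF uH[of n] uH[of k]] by eventually_elim (simp add: power2_norm_eq_inner)
    qed
    finally have GG: "G n - G k = kin ?w" .
    have "U n - U k = (\<integral>x. ?w x \<bullet> ?w x \<partial>lborel)"
      unfolding U_def by (subst Bochner_Integration.integral_diff[OF iU iU, symmetric]) (simp only: inner_diff_left)
    then have UU: "U n - U k = mass ?w" unfolding mass_def power2_norm_eq_inner .
    have Ub: "\<bar>U j\<bar> \<le> 2 * m" for j
    proof -
      have "\<bar>U j\<bar> \<le> 1 * (sqrt (mass (u j)) * sqrt (mass ?w))"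
        unfolding U_def real_norm_def[symmetric]
        by (rule L2_dominated_product(2)[OF H1_L2[OF uH] H1_L2[OF w] borel_measurable_integrable[OF iU, simplified]])
          (auto simp: Cauchy_Schwarz_ineq2)
      also have "\<dots> \<le> 1 * (sqrt m * sqrt (4 * m))" unfolding mass_u using mass_diff mpos by (intro mult_left_mono) auto
      also have "\<dots> = 2 * m" using mpos by (simp add: real_sqrt_mult)
      finally show ?thesis .
    qed
    have L: "\<bar>(lam j - lam0) * U j\<bar> \<le> e / 8" if "N \<le> j" for j
    proof -
      have "\<bar>(lam j - lam0) * U j\<bar> \<le> d * (2 * m)" unfolding abs_mult using N4[of j] N that Ub[of j] d by (intro mult_mono) auto
      then show ?thesis using d(2) by linarith
    qed
    have M: "\<bar>\<mu> j * Q j\<bar> \<le> e / 8" if "N \<le> j" for j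
    proof -
      have "\<bar>\<mu> j * Q j\<bar> \<le> 1 * (e / 8)" unfolding abs_mult using N5[of j] N that N2[of n k j] nk
        by (intro mult_mono) (auto simp: Q_def simp del: times_complex.simps)
      then show ?thesis by simp
    qed
    have Cb: "\<bar>C j\<bar> \<le> e / 8" if "N \<le> j" for j unfolding C_def using N that nk by (intro N3) auto
    have Pb: "\<bar>P j\<bar> \<le> e / 8" for j unfolding P_def using N nk by (intro N1) auto
    have "kin ?w + lam0 * mass ?w = (G n - G k) + lam0 * (U n - U k)" by (simp only: GG UU)
    also have "\<dots> = (P n + \<mu> n * Q n - lam n * U n - C n) - (P k + \<mu> k * Q k - lam k * U k - C k) + lam0 * (U n - U k)"
      using eq[of n] eq[of k] by argo
    also have "\<dots> = P n - P k + \<mu> n * Q n - \<mu> k * Q k - (lam n - lam0) * U n + (lam k - lam0) * U k - C n + C k"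
      by (simp add: algebra_simps)
    also have "\<dots> \<le> \<bar>P n\<bar> + \<bar>P k\<bar> + \<bar>\<mu> n * Q n\<bar> + \<bar>\<mu> k * Q k\<bar> + \<bar>(lam n - lam0) * U n\<bar> + \<bar>(lam k - lam0) * U k\<bar> + \<bar>C n\<bar> + \<bar>C k\<bar>"
    proof -
      have "a - b + c - d - f + g - h + i \<le> \<bar>a\<bar> + \<bar>b\<bar> + \<bar>c\<bar> + \<bar>d\<bar> + \<bar>f\<bar> + \<bar>g\<bar> + \<bar>h\<bar> + \<bar>i\<bar>" for a b c d f g h i :: real by linarith
      then show ?thesis .
    qed
    also have "\<dots> \<le> e / 8 + e / 8 + e / 8 + e / 8 + e / 8 + e / 8 + e / 8 + e / 8"
      using nk by (intro add_mono L M Cb Pb)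
    finally show "kin ?w + lam0 * mass ?w \<le> e" by simp
  qed
qed

text \<open>The gradients converge strongly to some \<open>g\<close>, the functions only weakly in
  L^2; this suffices to pass to the limit in the defining identity of the weak gradient.\<close>

lemma gradient_limit:
  obtains g where "is_weak_gradient u0 g" "(\<lambda>n. mass (\<lambda>x. wgrad (u n) x - g x)) \<longlonglongrightarrow> 0"
proof -
  have i: "integrable lborel (\<lambda>x. norm (wgrad (u n) x) powr 2)" for n using L2_integrable[OF wgrad_L2[OF uH[of n]]] by simp
  have m: "wgrad (u n) \<in> borel_measurable borel" for n by (rule L2_measurable[OF wgrad_L2[OF uH]])
  have c: "\<exists>N. \<forall>n\<ge>N. \<forall>k\<ge>N. pw 2 (\<lambda>x. wgrad (u n) x - wgrad (u k) x) \<le> e" if "e > 0" for e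
  proof -
    have "pw 2 (\<lambda>x. wgrad (u n) x - wgrad (u k) x) \<le> kin (\<lambda>x. u n x - u k x) + lam0 * mass (\<lambda>x. u n x - u k x)" for n k
      unfolding pw_2 H1_diff(4)[OF uH uH] using lam0 by simp
    then show ?thesis using kin_mass_cauchy[OF that] by (meson order_trans)
  qed
  obtain r g where r: "strict_mono (r :: nat \<Rightarrow> nat)" and g: "g \<in> borel_measurable borel" and l: "AE x in lborel. (\<lambda>n. wgrad (u (r n)) x) \<longlonglongrightarrow> g x"
    using cauchy_AE_subsequence[OF m pw_integrable_diff(1)[OF i i m m] c] by (auto simp: )
  note L = cauchy_limit[OF m g i r l _ c]
  have gL: "L2_fun g" using L(1) g by (intro L2_funI) auto
  have conv: "(\<lambda>n. mass (\<lambda>x. wgrad (u n) x - g x)) \<longlonglongrightarrow> 0" using L(2) by (simp add: pw_2)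
  have "(\<integral>x. u0 x * complex_of_real (pderiv_R3 i \<phi> x) \<partial>lborel) = - (\<integral>x. g x $ i * complex_of_real (\<phi> x) \<partial>lborel)"
    if \<phi>: "test_function \<phi>" for \<phi> i
  proof (rule LIMSEQ_unique)
    have pd: "L2_fun (\<lambda>x. complex_of_real (pderiv_R3 i \<phi> x))" "L2_fun (\<lambda>x. complex_of_real (\<phi> x))"
      using pderiv_L2[OF \<phi>, of i] test_function_integrable(3)[OF \<phi>] by (auto simp: L2_fun_def)
    show "(\<lambda>n. \<integral>x. u n x * complex_of_real (pderiv_R3 i \<phi> x) \<partial>lborel) \<longlonglongrightarrow> (\<integral>x. u0 x * complex_of_real (pderiv_R3 i \<phi> x) \<partial>lborel)"
      by (rule weak_convergence_pairing[OF pd(1)])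
    have eq: "(\<integral>x. u n x * complex_of_real (pderiv_R3 i \<phi> x) \<partial>lborel) = - (\<integral>x. wgrad (u n) x $ i * complex_of_real (\<phi> x) \<partial>lborel)" for n
      using wgrad_weak_gradient[OF uH[of n]] \<phi> by (simp add: is_weak_gradient_def)
    have "(\<lambda>n. (\<integral>x. wgrad (u n) x $ i * complex_of_real (\<phi> x) \<partial>lborel) - (\<integral>x. g x $ i * complex_of_real (\<phi> x) \<partial>lborel)) \<longlonglongrightarrow> 0"
    proof (rule Lim_null_comparison, rule always_eventually, rule allI)
      fix n
      let ?d = "\<lambda>x. wgrad (u n) x - g x"
      have dL: "L2_fun ?d" by (rule L2_diff[OF wgrad_L2[OF uH] gL])
      note W = weak_gradient_pairings(2)[OF H1_L2[OF uH] _ \<phi>, of _ i]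
      have "(\<integral>x. wgrad (u n) x $ i * complex_of_real (\<phi> x) \<partial>lborel) - (\<integral>x. g x $ i * complex_of_real (\<phi> x) \<partial>lborel)
          = (\<integral>x. ?d x $ i * complex_of_real (\<phi> x) \<partial>lborel)"
        by (simp add: left_diff_distrib Bochner_Integration.integral_diff[OF W[OF wgrad_L2[OF uH]] W[OF gL]])
      moreover have "norm (wgrad (u n) x $ i - g x $ i) \<le> norm (?d x)" for x
        using Finite_Cartesian_Product.norm_nth_le[of "?d x" i] by simp
      then have "norm (\<integral>x. ?d x $ i * complex_of_real (\<phi> x) \<partial>lborel) \<le> 1 * (sqrt (mass ?d) * sqrt (mass (\<lambda>x. complex_of_real (\<phi> x))))"
        using borel_measurable_integrable[OF W[OF dL]]
        by (intro L2_dominated_product(2)[OF dL pd(2)]) (auto simp: norm_mult intro!: mult_right_mono)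
      ultimately show "norm ((\<integral>x. wgrad (u n) x $ i * complex_of_real (\<phi> x) \<partial>lborel) - (\<integral>x. g x $ i * complex_of_real (\<phi> x) \<partial>lborel))
          \<le> sqrt (mass ?d) * sqrt (mass (\<lambda>x. complex_of_real (\<phi> x)))" by simp
    next
      have "(\<lambda>n. sqrt (mass (\<lambda>x. wgrad (u n) x - g x)) * sqrt (mass (\<lambda>x. complex_of_real (\<phi> x)))) \<longlonglongrightarrow> sqrt 0 * sqrt (mass (\<lambda>x. complex_of_real (\<phi> x)))"
        by (intro tendsto_intros conv)
      then show "(\<lambda>n. sqrt (mass (\<lambda>x. wgrad (u n) x - g x)) * sqrt (mass (\<lambda>x. complex_of_real (\<phi> x)))) \<longlonglongrightarrow> 0" by simp
    qed
    from tendsto_minus[OF LIM_zero_cancel[OF this]]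
    show "(\<lambda>n. \<integral>x. u n x * complex_of_real (pderiv_R3 i \<phi> x) \<partial>lborel) \<longlonglongrightarrow> - (\<integral>x. g x $ i * complex_of_real (\<phi> x) \<partial>lborel)"
      by (simp only: eq)
  qed
  then have "is_weak_gradient u0 g" using gL by (simp add: is_weak_gradient_def)
  then show ?thesis using conv that by blast
qed

lemma u0_H1: "u0 \<in> H1" using gradient_limit H1_I[OF L2_u0] by metis

lemma kin_limit: "(\<lambda>n. kin (\<lambda>x. u n x - u0 x)) \<longlonglongrightarrow> 0"
proof -
  obtain g where g: "is_weak_gradient u0 g" "(\<lambda>n. mass (\<lambda>x. wgrad (u n) x - g x)) \<longlonglongrightarrow> 0" by (rule gradient_limit)
  have "kin (\<lambda>x. u n x - u0 x) = mass (\<lambda>x. wgrad (u n) x - g x)" for n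
    by (rule kin_eq[OF is_weak_gradient_diff[OF wgrad_weak_gradient[OF uH] g(1) H1_L2[OF uH] L2_u0]])
  then show ?thesis using g(2) by simp
qed


section \<open>Passage to the limit in each term of the tested equation\<close>

lemma gradient_pairing_tendsto:
  assumes \<phi>: "\<phi> \<in> H1"
  shows "(\<lambda>n. \<integral>x. (\<Sum>i\<in>UNIV. wgrad (u n) x $ i * cnj (wgrad \<phi> x $ i)) \<partial>lborel)
    \<longlonglongrightarrow> (\<integral>x. (\<Sum>i\<in>UNIV. wgrad u0 x $ i * cnj (wgrad \<phi> x $ i)) \<partial>lborel)"
proof (rule LIM_zero_cancel, rule Lim_null_comparison, rule always_eventually, rule allI)
  fix n
  let ?d = "\<lambda>x. wgrad (u n) x - wgrad u0 x"
  note I = gradient_pairing_integrable(1)[OF wgrad_L2 wgrad_L2[OF \<phi>]]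
  have "(\<integral>x. (\<Sum>i\<in>UNIV. wgrad (u n) x $ i * cnj (wgrad \<phi> x $ i)) \<partial>lborel) - (\<integral>x. (\<Sum>i\<in>UNIV. wgrad u0 x $ i * cnj (wgrad \<phi> x $ i)) \<partial>lborel)
      = (\<integral>x. (\<Sum>i\<in>UNIV. ?d x $ i * cnj (wgrad \<phi> x $ i)) \<partial>lborel)"
    by (simp add: left_diff_distrib sum_subtractf Bochner_Integration.integral_diff[OF I[OF uH] I[OF u0_H1]])
  then show "norm ((\<integral>x. (\<Sum>i\<in>UNIV. wgrad (u n) x $ i * cnj (wgrad \<phi> x $ i)) \<partial>lborel) - (\<integral>x. (\<Sum>i\<in>UNIV. wgrad u0 x $ i * cnj (wgrad \<phi> x $ i)) \<partial>lborel))
      \<le> 3 * (sqrt (kin (\<lambda>x. u n x - u0 x)) * sqrt (kin \<phi>))"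
    using gradient_pairing_integrable(3)[OF L2_diff(1)[OF wgrad_L2[OF uH] wgrad_L2[OF u0_H1]] wgrad_L2[OF \<phi>]]
    unfolding H1_diff(4)[OF uH u0_H1] by simp
next
  have "(\<lambda>n. 3 * (sqrt (kin (\<lambda>x. u n x - u0 x)) * sqrt (kin \<phi>))) \<longlonglongrightarrow> 3 * (sqrt 0 * sqrt (kin \<phi>))"
    by (intro tendsto_intros kin_limit)
  then show "(\<lambda>n. 3 * (sqrt (kin (\<lambda>x. u n x - u0 x)) * sqrt (kin \<phi>))) \<longlonglongrightarrow> 0" by simp
qed

text \<open>Uniform convergence of the potentials reduces the claim to the limit potential, which
  times the test function is a fixed L^2 function to be paired weakly.\<close>

lemma coulomb_pairing_tendsto:
  assumes \<phi>: "\<phi> \<in> H1"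
  shows "(\<lambda>n. \<integral>x. complex_of_real (coulomb (u n) x) * u n x * cnj (\<phi> x) \<partial>lborel)
    \<longlonglongrightarrow> (\<integral>x. complex_of_real (coulomb u0 x) * u0 x * cnj (\<phi> x) \<partial>lborel)"
proof -
  have cL: "L2_fun (\<lambda>x. cnj (\<phi> x))" using H1_L2[OF \<phi>] by (auto simp: L2_fun_def intro: measurable_compose[OF _ cnj_measurable])
  let ?\<psi> = "\<lambda>x. coulomb u0 x *\<^sub>R cnj (\<phi> x)"
  have \<psi>: "L2_fun ?\<psi>" by (rule L2_coulomb_mult[OF cL])
  note W = weak_convergence_pairing[OF \<psi>]
  note I = coulomb_pairing_integrable[OF _ H1_L2 H1_L2[OF \<phi>]]
  have "(\<lambda>n. (\<integral>x. complex_of_real (coulomb (u n) x) * u n x * cnj (\<phi> x) \<partial>lborel) - (\<integral>x. u n x * ?\<psi> x \<partial>lborel)) \<longlonglongrightarrow> 0"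
  proof (rule LIMSEQ_I)
    fix e :: real assume e: "0 < e"
    define S where "S = sqrt m * sqrt (mass \<phi>) + 1"
    have S: "S > 0" using mpos by (simp add: S_def add_nonneg_pos)
    have "e / 2 / S > 0" using e S by simp
    then obtain N where N: "\<And>n x. n \<ge> N \<Longrightarrow> \<bar>coulomb (u n) x - coulomb u0 x\<bar> \<le> e / 2 / S" using coulomb_uniform_limit by blast
    show "\<exists>N. \<forall>n\<ge>N. norm ((\<integral>x. complex_of_real (coulomb (u n) x) * u n x * cnj (\<phi> x) \<partial>lborel) - (\<integral>x. u n x * ?\<psi> x \<partial>lborel) - 0) < e"
    proof (intro exI[of _ N] allI impI)
      fix n assume n: "N \<le> n"
      let ?h = "\<lambda>x. complex_of_real (coulomb (u n) x) * u n x * cnj (\<phi> x)"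
      have i1: "integrable lborel ?h" by (rule I[OF L12_dens[OF uH] uH])
      have i2: "integrable lborel (\<lambda>x. u n x * ?\<psi> x)"
        using I[OF L12_u0 uH] by (simp add: scaleR_conv_of_real mult_ac)
      have "norm (?h x - u n x * ?\<psi> x) \<le> e / 2 / S * (norm (u n x) * norm (\<phi> x))" for x
      proof -
        have "?h x - u n x * ?\<psi> x = complex_of_real (coulomb (u n) x - coulomb u0 x) * (u n x * cnj (\<phi> x))"
          by (simp add: scaleR_conv_of_real algebra_simps)
        then show ?thesis using mult_right_mono[OF N[OF n, of x], of "norm (u n x) * norm (\<phi> x)"]
          by (simp add: norm_mult del: of_real_diff)
      qed
      then have "norm (\<integral>x. ?h x - u n x * ?\<psi> x \<partial>lborel) \<le> e / 2 / S * (sqrt (mass (u n)) * sqrt (mass \<phi>))"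
        using e S borel_measurable_integrable[OF Bochner_Integration.integrable_diff[OF i1 i2]]
        by (intro L2_dominated_product(2)[OF H1_L2[OF uH] H1_L2[OF \<phi>]]) auto
      also have "\<dots> \<le> e / 2 / S * S" using e S by (intro mult_left_mono) (auto simp: mass_u S_def)
      also have "\<dots> < e" using e S by simp
      finally show "norm ((\<integral>x. ?h x \<partial>lborel) - (\<integral>x. u n x * ?\<psi> x \<partial>lborel) - 0) < e"
        by (simp only: Bochner_Integration.integral_diff[OF i1 i2] diff_0_right)
    qed
  qed
  from tendsto_add[OF this W] show ?thesis by (simp add: scaleR_conv_of_real mult_ac)
qed

lemma power_pairing_tendsto:
  assumes \<phi>: "\<phi> \<in> H1" and t: "2 < t" "t < 6"
  shows "(\<lambda>n. \<integral>x. pow_nl t (u n x) * cnj (\<phi> x) \<partial>lborel) \<longlonglongrightarrow> (\<integral>x. pow_nl t (u0 x) * cnj (\<phi> x) \<partial>lborel)"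
proof (rule LIMSEQ_I)
  fix e :: real assume e: "0 < e"
  have i: "integrable lborel (\<lambda>x. norm (v x) powr t)" if "v \<in> H1" for v using that t by (intro H1_pw_integrable) auto
  have I: "integrable lborel (\<lambda>x. pow_nl t (v x) * cnj (\<phi> x))" if "v \<in> H1" for v
    using powr_pairing_integrable[OF i[OF that] i[OF \<phi>] H1_measurable[OF that] H1_measurable[OF \<phi>] t(1)] .
  obtain B where B: "B \<ge> 0" "\<And>n. pw t (u n) \<le> B" using pw_bounded[OF t] by blast
  define S where "S = B + pw t u0 + pw t \<phi> + 1"
  have S: "S > 0" using B(1) pw_nonneg[of t u0] pw_nonneg[of t \<phi>] unfolding S_def by linarith
  define \<delta> where "\<delta> = e / 2 / (18 * S)"
  have \<delta>: "\<delta> > 0" "18 * (\<delta> * S) = e / 2" using e S by (auto simp: \<delta>_def)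
  have "(\<lambda>n. 18 * (\<delta> powr (1 - t) * pw t (\<lambda>x. u n x - u0 x))) \<longlonglongrightarrow> 18 * (\<delta> powr (1 - t) * 0)"
    by (intro tendsto_intros pw_limit(2) t)
  from order_tendstoD(2)[OF this, of "e/2"] e
  obtain N where N: "\<And>n. n \<ge> N \<Longrightarrow> 18 * (\<delta> powr (1 - t) * pw t (\<lambda>x. u n x - u0 x)) < e / 2"
    by (auto simp: eventually_sequentially)
  show "\<exists>N. \<forall>n\<ge>N. norm ((\<integral>x. pow_nl t (u n x) * cnj (\<phi> x) \<partial>lborel) - (\<integral>x. pow_nl t (u0 x) * cnj (\<phi> x) \<partial>lborel)) < e"
  proof (intro exI[of _ N] allI impI)
    fix n assume n: "N \<le> n"
    let ?G = "\<lambda>x. 18 * (\<delta> * (norm (u n x) powr t + norm (u0 x) powr t + norm (\<phi> x) powr t) + \<delta> powr (1 - t) * norm (u n x - u0 x) powr t)"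
    have le: "norm (pow_nl t (u n x) * cnj (\<phi> x) - pow_nl t (u0 x) * cnj (\<phi> x)) \<le> ?G x" for x
    proof -
      define a b c d where "a = norm (u n x)" "b = norm (u0 x)" "c = norm (\<phi> x)" "d = norm (u n x - u0 x)"
      \<comment> \<open>A common bound for the three moduli lets all factors except the difference
        be collected into M^(t - 1), before \<delta> splits the product.\<close>
      define M where "M = max a (max b c)"
      have pos: "0 \<le> a" "0 \<le> b" "0 \<le> c" "0 \<le> d" "a \<le> M" "b \<le> M" "c \<le> M" "0 \<le> M" by (auto simp: a_b_c_d_def M_def le_max_iff_disj)
      have "norm (pow_nl t (u n x) * cnj (\<phi> x) - pow_nl t (u0 x) * cnj (\<phi> x)) = norm (pow_nl t (u n x) - pow_nl t (u0 x)) * c"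
        unfolding left_diff_distrib[symmetric] by (simp add: norm_mult a_b_c_d_def)
      also have "\<dots> \<le> 9 * (a powr (t - 2) + b powr (t - 2)) * d * c"
        unfolding a_b_c_d_def by (intro mult_right_mono pow_nl_lipschitz t) auto
      also have "\<dots> \<le> 9 * (M powr (t - 2) + M powr (t - 2)) * d * M"
        using pos t by (intro mult_mono add_mono powr_mono2) auto
      also have "\<dots> = 18 * (M powr (t - 1) * d)"
        using pos t by (cases "M = 0") (auto simp: powr_diff power2_eq_square)
      also have "\<dots> \<le> 18 * (\<delta> * M powr t + \<delta> powr (1 - t) * d powr t)"
        using pos t \<delta>(1) by (intro mult_left_mono powr_mult_le) auto
      also have "\<dots> \<le> 18 * (\<delta> * (a powr t + b powr t + c powr t) + \<delta> powr (1 - t) * d powr t)"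
      proof -
        have "M powr t \<le> a powr t + b powr t + c powr t" using powr_ge_zero[of a t] powr_ge_zero[of b t] powr_ge_zero[of c t]
          unfolding M_def max_def by (auto simp del: powr_ge_zero)
        then show ?thesis using \<delta>(1) by (intro mult_left_mono add_right_mono) auto
      qed
      finally show ?thesis by (simp only: a_b_c_d_def)
    qed
    note J = Bochner_Integration.integrable_add[OF Bochner_Integration.integrable_add[OF i[OF uH[of n]] i[OF u0_H1]] i[OF \<phi>]]
    have G: "integrable lborel ?G"
      by (intro integrable_mult_right Bochner_Integration.integrable_add pw_limit(3) t i uH u0_H1 \<phi>)
    have "norm ((\<integral>x. pow_nl t (u n x) * cnj (\<phi> x) \<partial>lborel) - (\<integral>x. pow_nl t (u0 x) * cnj (\<phi> x) \<partial>lborel))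
        = norm (\<integral>x. pow_nl t (u n x) * cnj (\<phi> x) - pow_nl t (u0 x) * cnj (\<phi> x) \<partial>lborel)"
      by (simp only: Bochner_Integration.integral_diff[OF I[OF uH] I[OF u0_H1]])
    also have "\<dots> \<le> (\<integral>x. ?G x \<partial>lborel)"
      by (rule Bochner_Integration.integral_norm_bound_integral[OF Bochner_Integration.integrable_diff[OF I[OF uH] I[OF u0_H1]] G le])
    also have "\<dots> = 18 * (\<delta> * (pw t (u n) + pw t u0 + pw t \<phi>) + \<delta> powr (1 - t) * pw t (\<lambda>x. u n x - u0 x))"
      unfolding pw_def integral_mult_right_zero
        Bochner_Integration.integral_add[OF integrable_mult_right[OF J] integrable_mult_right[OF pw_limit(3)[OF t]]]
        Bochner_Integration.integral_add[OF Bochner_Integration.integrable_add[OF i[OF uH[of n]] i[OF u0_H1]] i[OF \<phi>]]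
        Bochner_Integration.integral_add[OF i[OF uH[of n]] i[OF u0_H1]] ..
    also have "\<dots> \<le> 18 * (\<delta> * S + \<delta> powr (1 - t) * pw t (\<lambda>x. u n x - u0 x))"
      using B(2)[of n] \<delta>(1) by (intro mult_left_mono add_right_mono) (auto simp: S_def)
    also have "\<dots> = 18 * (\<delta> * S) + 18 * (\<delta> powr (1 - t) * pw t (\<lambda>x. u n x - u0 x))" by (rule distrib_left)
    also have "\<dots> < e / 2 + e / 2" by (rule add_le_less_mono[OF eq_refl[OF \<delta>(2)] N[OF n]])
    finally show "norm ((\<integral>x. pow_nl t (u n x) * cnj (\<phi> x) \<partial>lborel) - (\<integral>x. pow_nl t (u0 x) * cnj (\<phi> x) \<partial>lborel)) < e" by simp
  qed
qed

lemma limit_solution: "weak_solution (pow_nl p) lam0 u0"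
  unfolding weak_solution_def
proof (intro conjI ballI u0_H1)
  fix \<phi> assume \<phi>: "\<phi> \<in> H1"
  have cL: "L2_fun (\<lambda>x. cnj (\<phi> x))" using H1_L2[OF \<phi>] by (auto simp: L2_fun_def intro: measurable_compose[OF _ cnj_measurable])
  let ?L = "\<lambda>l v. (\<integral>x. (\<Sum>i\<in>UNIV. wgrad v x $ i * cnj (wgrad \<phi> x $ i)) \<partial>lborel)
     + complex_of_real l * (\<integral>x. v x * cnj (\<phi> x) \<partial>lborel)
     + (\<integral>x. complex_of_real (coulomb v x) * v x * cnj (\<phi> x) \<partial>lborel)"
  have "(\<lambda>n. ?L (lam n) (u n)) \<longlonglongrightarrow> ?L lam0 u0"
    by (intro tendsto_add gradient_pairing_tendsto coulomb_pairing_tendsto \<phi> tendsto_mult tendsto_of_real lam weak_convergence_pairing cL)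
  moreover have "?L (lam n) (u n) = (\<integral>x. pow_nl p (u n x) * cnj (\<phi> x) \<partial>lborel)
      + complex_of_real (\<mu> n) * (\<integral>x. pow_nl q (u n x) * cnj (\<phi> x) \<partial>lborel)" for n
    using sol[of n] \<phi> comb_nl_integrable(3)[OF uH \<phi> pq] by (simp add: weak_solution_def)
  moreover have "(\<lambda>n. (\<integral>x. pow_nl p (u n x) * cnj (\<phi> x) \<partial>lborel) + complex_of_real (\<mu> n) * (\<integral>x. pow_nl q (u n x) * cnj (\<phi> x) \<partial>lborel))
      \<longlonglongrightarrow> (\<integral>x. pow_nl p (u0 x) * cnj (\<phi> x) \<partial>lborel) + complex_of_real 0 * (\<integral>x. pow_nl q (u0 x) * cnj (\<phi> x) \<partial>lborel)"
    by (intro tendsto_add tendsto_mult tendsto_of_real mu power_pairing_tendsto \<phi> pq)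
  ultimately show "?L lam0 u0 = (\<integral>x. pow_nl p (u0 x) * cnj (\<phi> x) \<partial>lborel)"
    by (simp only: of_real_0 mult_zero_left add_0_right) (rule LIMSEQ_unique)
qed

lemma u0_rad: "u0 \<in> H1_rad"
proof -
  have "AE x in lborel. u0 (R x) = u0 x" if R: "orthogonal_transformation R" for R
  proof -
    have "AE x in lborel. u n (R x) = u n x" for n using rad[of n] R by (simp add: H1_rad_def)
    then have "AE x in lborel. \<forall>n. u n (R x) = u n x" by (simp add: AE_all_countable)
    moreover have "AE x in lborel. (\<lambda>n. u n (R x)) \<longlonglongrightarrow> u0 (R x)" by (rule AE_orthogonal[OF R AE_lim])
    ultimately show ?thesis using AE_lim by eventually_elim (auto intro: LIMSEQ_unique)
  qed
  then show ?thesis using u0_H1 by (simp add: H1_rad_def)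
qed

text \<open>A positive \<open>lam0\<close> brings the mass into the Cauchy estimate, which is what
  prevents a loss at infinity.\<close>

lemma mass_limit:
  assumes pos: "lam0 > 0"
  shows "(\<lambda>n. mass (\<lambda>x. u n x - u0 x)) \<longlonglongrightarrow> 0" "mass u0 = m"
proof -
  have i: "integrable lborel (\<lambda>x. norm (u n x) powr 2)" for n using L2_integrable[OF H1_L2[OF uH[of n]]] by simp
  have c: "\<exists>N. \<forall>n\<ge>N. \<forall>k\<ge>N. pw 2 (\<lambda>x. u n x - u k x) \<le> e" if "e > 0" for e
  proof -
    have *: "mass (\<lambda>x. u n x - u k x) \<le> e" if "kin (\<lambda>x. u n x - u k x) + lam0 * mass (\<lambda>x. u n x - u k x) \<le> lam0 * e" for n k
    proof -
      have "lam0 * mass (\<lambda>x. u n x - u k x) \<le> lam0 * e" using that mass_nonneg[of "wgrad (\<lambda>x. u n x - u k x)"] by linarith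
      then show ?thesis using pos by simp
    qed
    show ?thesis unfolding pw_2 using kin_mass_cauchy[of "lam0 * e"] pos that * by (meson mult_pos_pos)
  qed
  note L = cauchy_limit[where f=u and g=u0 and r="\<lambda>n. n", OF H1_measurable[OF uH] u0_measurable i _ AE_lim _ c]
  show lim: "(\<lambda>n. mass (\<lambda>x. u n x - u0 x)) \<longlonglongrightarrow> 0" using L(2) by (simp add: pw_2 strict_mono_def)
  have "sqrt m \<le> sqrt (mass (\<lambda>x. u n x - u0 x)) + sqrt (mass u0)" for n
    using l2_triangle[OF L2_w[of n] L2_u0] by (simp add: mass_u)
  moreover have "(\<lambda>n. sqrt (mass (\<lambda>x. u n x - u0 x)) + sqrt (mass u0)) \<longlonglongrightarrow> sqrt 0 + sqrt (mass u0)"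
    by (intro tendsto_intros lim)
  ultimately have "sqrt m \<le> sqrt 0 + sqrt (mass u0)" by (intro LIMSEQ_le_const) auto
  then show "mass u0 = m" using mass_u0 by simp
qed

text \<open>Strong convergence of the gradients carries the vanishing of the limit back to the
  sequence.\<close>

lemma kin_vanishes:
  assumes "AE x in lborel. u0 x = 0" shows "(\<lambda>n. kin (u n)) \<longlonglongrightarrow> 0"
proof -
  have "kin u0 = 0"
  proof -
    have "is_weak_gradient u0 (\<lambda>x. 0)"
      unfolding is_weak_gradient_def
    proof (intro conjI allI impI L2_zero)
      fix \<phi> i
      have "(\<integral>x. u0 x * complex_of_real (pderiv_R3 i \<phi> x) \<partial>lborel) = 0"
        by (rule integral_eq_zero_AE) (use assms in \<open>eventually_elim, simp\<close>)
      then show "(\<integral>x. u0 x * complex_of_real (pderiv_R3 i \<phi> x) \<partial>lborel) = - (\<integral>x. (0 :: complex ^ 3) $ i * complex_of_real (\<phi> x) \<partial>lborel)"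
        by simp
    qed
    from kin_eq[OF this] show ?thesis by (simp add: mass_def)
  qed
  have "kin (u n) \<le> 2 * kin (\<lambda>x. u n x - u0 x)" for n
    using mass_add_le[OF L2_diff(1)[OF wgrad_L2[OF uH[of n]] wgrad_L2[OF u0_H1]] wgrad_L2[OF u0_H1]]
    unfolding H1_diff(4)[OF uH u0_H1] by (simp add: \<open>kin u0 = 0\<close>)
  moreover have "(\<lambda>n. 2 * kin (\<lambda>x. u n x - u0 x)) \<longlonglongrightarrow> 2 * 0" by (intro tendsto_intros kin_limit)
  ultimately show ?thesis by (intro tendsto_sandwich[of "\<lambda>_. 0" "\<lambda>n. kin (u n)" sequentially "\<lambda>n. 2 * kin (\<lambda>x. u n x - u0 x)"]) auto
qed

end

theorem theorem1p11:
  fixes p q a a0_tilde :: real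
    and lam :: "real \<Rightarrow> real" and u :: "real \<Rightarrow> R3 \<Rightarrow> complex"
  assumes "2 < q" "q \<le> 12 / 5" "10 / 3 < p" "p < 6"
    and "limit_threshold p a0_tilde"
    and "0 < a" "a < a0_tilde"
    and "a < (3 / (4 * C_GN p powr p)) powr (1 / (2 * p * gam p + p - 6))
           * (4 / (4 * gam p - 1)) powr ((p * gam p - 1) / (2 * p * gam p + p - 6))
           * ((1 - gam p) / C_GN (12 / 5) powr (12 / 5))
               powr ((p * gam p - 2) / (2 * p * gam p + p - 6))"
    and "\<And>\<mu>. 0 < \<mu> \<Longrightarrow> a < a0_bar p q \<mu> \<Longrightarrow> mp_solution p q \<mu> a (lam \<mu>) (u \<mu>)"
  shows "\<forall>\<mu> :: nat \<Rightarrow> real. (\<forall>n. 0 < \<mu> n) \<and> \<mu> \<longlonglongrightarrow> 0 \<longrightarrow>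
    (\<exists>r lam0 u0. strict_mono r
       \<and> 0 < lam0 \<and> u0 \<in> H1_rad \<and> normalized_solution (pow_nl p) a lam0 u0
       \<and> (\<lambda>n. H1_norm (\<lambda>x. u (\<mu> (r n)) x - u0 x)) \<longlonglongrightarrow> 0
       \<and> (\<lambda>n. lam (\<mu> (r n))) \<longlonglongrightarrow> lam0)"
proof (intro allI impI, elim conjE)
  fix \<mu> :: "nat \<Rightarrow> real"
  assume pos: "\<forall>n. 0 < \<mu> n" and lim: "\<mu> \<longlonglongrightarrow> 0"
  note p = assms(3,4) and q = assms(1,2)
  have pq: "2 < p" "p < 6" "2 < q" "q < 6" using p q by auto
  \<comment> \<open>This function serves twice: as a nonzero element of \<open>H1\<close> that makes
    the constants \<open>C_GN\<close> positive, and as the profile dilated onto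
    \<open>P_minus_rad\<close>.\<close>
  obtain v lv where v: "v \<in> H1_rad" "normalized_solution (pow_nl p) a lv v"
    using assms(5-7) unfolding limit_threshold_def by meson
  have mv: "mass v = a\<^sup>2" by (rule normalized_mass[OF v(2)])
  have vH: "v \<in> H1" using v(1) by (simp add: H1_rad_def)
  have C: "C_GN p > 0" "C_GN q > 0" using C_GN_pos[OF _ _ vH] mv assms(6) pq by auto
  obtain \<mu>1 \<kappa> K \<Lambda> where \<mu>1: "\<mu>1 > 0" "\<kappa> > 0" and
    bounds: "\<And>\<mu> lam u. 0 < \<mu> \<Longrightarrow> \<mu> \<le> \<mu>1 \<Longrightarrow> mp_solution p q \<mu> a lam u \<Longrightarrow> \<kappa> \<le> kin u \<and> kin u \<le> K \<and> lam \<le> \<Lambda>"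
    using mp_solution_bounds[OF p q v(1) mv assms(6)] by blast
  have "filterlim \<mu> (at_right 0) sequentially"
    using lim pos by (auto simp: filterlim_at intro!: always_eventually) (metis less_irrefl)
  then have "\<forall>\<^sub>F n in sequentially. a < a0_bar p q (\<mu> n)"
    using a_less_a0_bar[OF p q C assms(6)] by (rule eventually_compose_filterlim[rotated])
  moreover have "\<forall>\<^sub>F n in sequentially. \<mu> n < \<mu>1" using order_tendstoD(2)[OF lim \<mu>1(1)] .
  \<comment> \<open>The hypothesis on the family applies to \<mu> n only from N on, so all sequences
    below are shifted by N.\<close>
  ultimately obtain N where N: "\<And>n. n \<ge> N \<Longrightarrow> a < a0_bar p q (\<mu> n) \<and> \<mu> n < \<mu>1"
    unfolding eventually_sequentially by (metis linorder_linear order_trans)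
  have mp: "mp_solution p q (\<mu> n) a (lam (\<mu> n)) (u (\<mu> n))" if "n \<ge> N" for n using assms(9) pos N[OF that] by blast
  have bd: "\<kappa> \<le> kin (u (\<mu> n)) \<and> kin (u (\<mu> n)) \<le> K \<and> lam (\<mu> n) \<le> \<Lambda>" if "n \<ge> N" for n
    using bounds[OF _ _ mp[OF that]] pos N[OF that] by (simp add: less_imp_le)
  have rad: "u (\<mu> n) \<in> H1_rad" and lpos: "0 < lam (\<mu> n)" and ns: "normalized_solution (comb_nl p q (\<mu> n)) a (lam (\<mu> n)) (u (\<mu> n))"
    if "n \<ge> N" for n using mp[OF that] by (auto simp: mp_solution_def)

  \<comment> \<open>Three nested extractions follow: convergence of the multipliers, the uniform
    Cauchy property at every mollification scale, and convergence almost everywhere.\<close>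
  have "\<forall>n. lam (\<mu> (n + N)) \<in> {0..\<Lambda>}" using bd lpos by (simp add: less_imp_le)
  with compact_imp_seq_compact[OF compact_Icc]
  obtain lam0 and r1 :: "nat \<Rightarrow> nat" where "lam0 \<in> {0..\<Lambda>}" and r1: "strict_mono r1" and "((\<lambda>n. lam (\<mu> (n + N))) \<circ> r1) \<longlonglongrightarrow> lam0"
    by (rule seq_compactE)
  then have lam0: "0 \<le> lam0" and l1: "(\<lambda>n. lam (\<mu> (r1 n + N))) \<longlonglongrightarrow> lam0" by (auto simp: o_def)
  let ?s1 = "\<lambda>n. r1 n + N"
  have m1: "mass (u (\<mu> (?s1 n))) \<le> a\<^sup>2" for n using normalized_mass[OF ns[of "?s1 n"]] by simp
  have k1: "kin (u (\<mu> (?s1 n))) \<le> K" for n using bd[of "?s1 n"] by simp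
  have "\<exists>r :: nat \<Rightarrow> nat. strict_mono r \<and> (\<forall>j e. e > 0 \<longrightarrow>
    (\<exists>M. \<forall>n\<ge>M. \<forall>k\<ge>M. \<forall>x. norm (moll j (u (\<mu> (?s1 (r n)))) x - moll j (u (\<mu> (?s1 (r k)))) x) \<le> e))"
    by (rule radial_subsequence[where u="\<lambda>n. u (\<mu> (?s1 n))", OF rad[OF le_add2] m1 k1]) blast
  then obtain r2 :: "nat \<Rightarrow> nat" where r2: "strict_mono r2" and unif:
    "\<And>j e. e > 0 \<Longrightarrow> \<exists>M. \<forall>n\<ge>M. \<forall>k\<ge>M. \<forall>x. norm (moll j (u (\<mu> (?s1 (r2 n)))) x - moll j (u (\<mu> (?s1 (r2 k)))) x) \<le> e"
    by blast
  let ?w = "\<lambda>n. u (\<mu> (?s1 (r2 n)))"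
  have wH: "?w n \<in> H1" for n using rad[of "?s1 (r2 n)"] by (simp add: H1_rad_def)
  have Lt: "\<exists>M. \<forall>n\<ge>M. \<forall>k\<ge>M. pw t (\<lambda>x. ?w n x - ?w k x) \<le> e" if "2 < t" "t < 6" "0 < e" for t e
    by (rule Lt_cauchy[where u="?w" and m="a\<^sup>2" and K=K, OF wH _ _ unif that]) (use m1 bd in auto)
  have "integrable lborel (\<lambda>x. norm (?w n x - ?w k x) powr 4)" for n k
    using H1_pw_integrable[OF H1_diff(1)[OF wH wH], of 4] by simp
  \<comment> \<open>The exponent 4 stands for any number strictly between 2 and 6.\<close>
  from cauchy_AE_subsequence[OF H1_measurable[OF wH] this Lt[of 4]]
  obtain r3 :: "nat \<Rightarrow> nat" and u0 where r3: "strict_mono r3" and u0: "u0 \<in> borel_measurable borel"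
    and ae: "AE x in lborel. (\<lambda>n. ?w (r3 n) x) \<longlonglongrightarrow> u0 x" by auto
  define r where "r n = r1 (r2 (r3 n)) + N" for n
  have r: "strict_mono r" using r1 r2 r3 by (simp add: r_def strict_mono_def)
  have rN: "r n \<ge> N" for n by (simp add: r_def)
  interpret solution_sequence p q "a\<^sup>2" K lam0 "\<lambda>n. \<mu> (r n)" "\<lambda>n. lam (\<mu> (r n))" "\<lambda>n. u (\<mu> (r n))" u0
  proof
    show "2 < p" "p < 6" "2 < q" "q < 6" by (fact pq)+
    show "u (\<mu> (r n)) \<in> H1_rad" "mass (u (\<mu> (r n))) = a\<^sup>2" "kin (u (\<mu> (r n))) \<le> K" for n
      using rad[OF rN] normalized_mass[OF ns[OF rN]] bd[OF rN] by auto
    show "weak_solution (comb_nl p q (\<mu> (r n))) (lam (\<mu> (r n))) (u (\<mu> (r n)))" for n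
      using ns[OF rN] by (simp add: normalized_solution_def)
    show "(\<lambda>n. \<mu> (r n)) \<longlonglongrightarrow> 0" using LIMSEQ_subseq_LIMSEQ[OF lim r] by (simp add: o_def)
    show "(\<lambda>n. lam (\<mu> (r n))) \<longlonglongrightarrow> lam0"
      using LIMSEQ_subseq_LIMSEQ[OF l1 strict_mono_o[OF r2 r3]] by (simp add: o_def r_def)
    show "0 \<le> lam0" "u0 \<in> borel_measurable borel" by fact+
    show "AE x in lborel. (\<lambda>n. u (\<mu> (r n)) x) \<longlonglongrightarrow> u0 x" using ae by (simp add: r_def)
    show "\<exists>M. \<forall>n\<ge>M. \<forall>k\<ge>M. pw t (\<lambda>x. u (\<mu> (r n)) x - u (\<mu> (r k)) x) \<le> e" if t: "2 < t" "t < 6" "0 < e" for t e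
    proof -
      obtain M where "\<forall>n\<ge>M. \<forall>k\<ge>M. pw t (\<lambda>x. ?w n x - ?w k x) \<le> e" using Lt[OF t] by blast
      then show ?thesis unfolding r_def using seq_suble[OF r3] by (meson order_trans)
    qed
  qed
  have "lam0 \<noteq> 0"
  proof
    assume z: "lam0 = 0"
    \<comment> \<open>Only mass u0 <= a^2 is known here; the nonexistence half of the threshold is
      stated for all L^2 norms up to it, so it applies to a limit that may have lost mass.\<close>
    have "Lnorm 2 u0 \<le> a" unfolding Lnorm_2 using mass_u0 assms(6) real_sqrt_le_mono[of "mass u0" "a\<^sup>2"] by simp
    then have "AE x in lborel. u0 x = 0"
      using assms(5,7) limit_solution z unfolding limit_threshold_def by (meson less_imp_le order_refl order_trans)
    then have "(\<lambda>n. kin (u (\<mu> (r n)))) \<longlonglongrightarrow> 0" by (rule kin_vanishes)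
    then have "\<kappa> \<le> 0" using bd[OF rN] by (intro LIMSEQ_le_const) auto
    then show False using \<mu>1(2) by simp
  qed
  then have l0: "0 < lam0" using lam0 by simp
  have "(\<lambda>n. sqrt (kin (\<lambda>x. u (\<mu> (r n)) x - u0 x) + mass (\<lambda>x. u (\<mu> (r n)) x - u0 x))) \<longlonglongrightarrow> sqrt (0 + 0)"
    by (intro tendsto_intros kin_limit mass_limit(1) l0)
  then have "(\<lambda>n. H1_norm (\<lambda>x. u (\<mu> (r n)) x - u0 x)) \<longlonglongrightarrow> 0" by (simp add: H1_norm_eq)
  moreover have "normalized_solution (pow_nl p) a lam0 u0"
    using limit_solution mass_limit(2)[OF l0] by (simp add: normalized_solution_def mass_def)
  ultimately show "\<exists>r lam0 u0. strict_mono r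
       \<and> 0 < lam0 \<and> u0 \<in> H1_rad \<and> normalized_solution (pow_nl p) a lam0 u0
       \<and> (\<lambda>n. H1_norm (\<lambda>x. u (\<mu> (r n)) x - u0 x)) \<longlonglongrightarrow> 0
       \<and> (\<lambda>n. lam (\<mu> (r n))) \<longlonglongrightarrow> lam0"
    using r l0 u0_rad lam by blast
qed

end
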